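(* Every tree and every forest having at least one edge is $\mathcal{N}$-matrix reconstructible.
   Context: All graphs are finite and simple. For graphs $G,F$, $\binom{G}{F}$ denotes the number of induced subgraphs of $G$ isomorphic to $F$. A graph is nonempty if it has at least one edge. Let $\Lambda(G)=\{\Lambda_1,\dots,\Lambda_I\}$ be the set of distinct isomorphism types of nonempty induced subgraphs of $G$ (including $G$ itself if it is nonempty). The matrix $\mathcal{N}(G)=(N_{ij})$ is the $I\times I$ matrix with $N_{ij}=\binom{\Lambda_i}{\Lambda_j}$. It is regarded as unlabelled: the graphs $\Lambda_i$ indexing its rows and columns are not given, so $\mathcal{N}(G)=\mathcal{N}(H)$ means that the two matrices have the same size and agree after applying one and the same permutation to the rows and columns of one of them. A graph $G$ with at least one edge is $\mathcal{N}$-matrix reconstructible if every graph $H$ with at least one edge (not assumed acyclic) and $\mathcal{N}(H)=\mathcal{N}(G)$ is isomorphic to $G$. *)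

theory Defs
  imports
    "Graph_Theory.Digraph_Isomorphism"
    "Jordan_Normal_Form.Matrix"
    "HOL-Combinatorics.Permutations"
begin

text \<open>
  Finite simple graphs are rendered by the locale predicate \<^const>\<open>graph\<close>: finite symmetric
  digraphs without loops and parallel arcs, so that an undirected edge is a pair of opposite arcs.
  In particular, a graph has at least one edge iff its arc set is nonempty.
\<close>

text \<open>
  The predicates \<^const>\<open>forest\<close> and \<^const>\<open>tree\<close> of the library are meant for digraphs: they
  count the closed walk \<open>u, v, u\<close> as a cycle, so no symmetric digraph with an arc satisfies them.
  A cycle of an undirected simple graph is a \<^const>\<open>pre_digraph.cycle\<close> of length at least 3.
\<close>

definition ugraph_forest :: "('a, 'b) pre_digraph \<Rightarrow> bool" where
  "ugraph_forest G \<longleftrightarrow>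
     graph G \<and> \<not> (\<exists>p. pre_digraph.cycle G p \<and> length p \<ge> 3)"

definition ugraph_tree :: "('a, 'b) pre_digraph \<Rightarrow> bool" where
  "ugraph_tree G \<longleftrightarrow> ugraph_forest G \<and> connected G"

definition num_induced :: "('a, 'b) pre_digraph \<Rightarrow> ('c, 'd) pre_digraph \<Rightarrow> nat" where
  "num_induced G F = card {K. induced_subgraph K G \<and> digraph_iso K F}"

text \<open>
  \<open>Ls\<close> lists, without repetition, the isomorphism types of nonempty induced subgraphs of \<open>G\<close>;
  each type is given by a representative among the induced subgraphs of \<open>G\<close>.
\<close>

definition enumerates_types ::
  "('a, 'b) pre_digraph \<Rightarrow> ('a, 'b) pre_digraph list \<Rightarrow> bool" where
  "enumerates_types G Ls \<longleftrightarrow>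
     (\<forall>L\<in>set Ls. induced_subgraph L G \<and> arcs L \<noteq> {}) \<and>
     (\<forall>K. induced_subgraph K G \<and> arcs K \<noteq> {} \<longrightarrow> (\<exists>L\<in>set Ls. digraph_iso K L)) \<and>
     (\<forall>i<length Ls. \<forall>j<length Ls. digraph_iso (Ls ! i) (Ls ! j) \<longrightarrow> i = j)"

definition count_matrix :: "('a, 'b) pre_digraph list \<Rightarrow> nat mat" where
  "count_matrix Ls =
     mat (length Ls) (length Ls) (\<lambda>(i, j). num_induced (Ls ! i) (Ls ! j))"

text \<open>
  The matrix of \<open>G\<close> depends on the order in which the isomorphism types are listed, so it is a
  relation; the possible matrices of \<open>G\<close> differ by simultaneous row and column permutations.
\<close>

definition is_N_matrix :: "('a, 'b) pre_digraph \<Rightarrow> nat mat \<Rightarrow> bool" where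
  "is_N_matrix G A \<longleftrightarrow> (\<exists>Ls. enumerates_types G Ls \<and> A = count_matrix Ls)"

definition perm_equal :: "nat mat \<Rightarrow> nat mat \<Rightarrow> bool" where
  "perm_equal A B \<longleftrightarrow>
     (\<exists>n p. A \<in> carrier_mat n n \<and> B \<in> carrier_mat n n \<and> p permutes {..<n} \<and>
        (\<forall>i<n. \<forall>j<n. B $$ (i, j) = A $$ (p i, p j)))"

text \<open>Equality of unlabelled matrices; the choice of \<open>A\<close> and \<open>B\<close> is immaterial.\<close>

definition same_N_matrix :: "('a, 'b) pre_digraph \<Rightarrow> ('c, 'd) pre_digraph \<Rightarrow> bool" where
  "same_N_matrix G H \<longleftrightarrow>
     (\<exists>A B. is_N_matrix G A \<and> is_N_matrix H B \<and> perm_equal A B)"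

text \<open>
  A definition cannot quantify over types, so the type of the competing graphs \<open>H\<close> is a parameter.
  Taking vertices in \<^typ>\<open>nat\<close> and arcs in \<^typ>\<open>nat \<times> nat\<close> already covers all finite simple
  graphs up to isomorphism.
\<close>

definition N_matrix_reconstructible ::
  "('c, 'd) pre_digraph itself \<Rightarrow> ('a, 'b) pre_digraph \<Rightarrow> bool" where
  "N_matrix_reconstructible (T :: ('c, 'd) pre_digraph itself) G \<longleftrightarrow>
     graph G \<and> arcs G \<noteq> {} \<and>
     (\<forall>H :: ('c, 'd) pre_digraph.
        graph H \<and> arcs H \<noteq> {} \<and> same_N_matrix H G \<longrightarrow> digraph_iso H G)"

end

theory Submission
  imports Defs
begin

text \<open>
  By induction on the size of the types, equality of the matrices yields a size preserving
  correspondence between the proper induced subgraphs of \<open>G\<close> and \<open>H\<close> that respects isomorphism; the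
  edgeless ones are added by counting. Numbers of vertices and edges then agree, which makes \<open>H\<close> a
  forest, connected iff \<open>G\<close> is, and in the disconnected case Kelly counting determines the components.

  A tree is rooted at its centre, after subdividing the central edge if the diameter is odd.
  Isomorphisms between subtrees of full diameter preserve the root. Counting the pairs of a path of
  radius length (a leg) in one branch and a subtree of full depth in another one determines the
  branches of full depth, and the remaining part is recovered by induction on rooted trees.
  This fails only if the root has two branches one of which is a leg; then the other branch is
  reconstructed from its own subtrees. If only one of the two trees is of this exceptional form,
  then each consists of a longest path and two more vertices, and they are compared directly. Paths
  and trees with a single vertex outside a longest path are treated separately.
\<close>

section \<open>Forests\<close>

text \<open>Matrix entries carry neither names nor sizes, so no type can be read off its own row.
  The induction works because every induced subgraph of a forest is again a forest: reconstruction
  from proper subgraphs is proved for two vertex sets and then applied to each type in turn, the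
  smaller types being identified already. The competing graph is not assumed acyclic, so forests are
  recognised by the edge counts of their vertex subsets. For trees the obstacle is that an unrooted
  subtree does not reveal its position. Only subtrees with a longest path do, as they contain the
  centre, so a subtree of one branch becomes visible only together with a piece of full length in
  another branch. A leg is the smallest such piece, but several branches may supply it and their
  total number of legs is unknown. Counting pairs thus gives products of a multiplicity and an
  unknown factor, which a monotonicity argument separates. All graphs are vertex sets in one ambient
  relation. Isomorphism is then an equivalence on sets of one type, and matchings of subgraphs are
  ordinary bijections.\<close>

locale sgraph =
  fixes E :: "'v \<Rightarrow> 'v \<Rightarrow> bool"
  assumes E_sym: "E x y \<Longrightarrow> E y x"
    and E_irrefl: "\<not> E x x"
begin

text \<open>Connectedness through cuts: it passes to unions and along isomorphisms without handling
  walks. The empty set is excluded.\<close>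

definition conn :: "'v set \<Rightarrow> bool" where
  "conn W \<longleftrightarrow> W \<noteq> {} \<and>
     (\<forall>Y. Y \<subseteq> W \<longrightarrow> Y \<noteq> {} \<longrightarrow> Y \<noteq> W \<longrightarrow> (\<exists>y\<in>Y. \<exists>z\<in>W - Y. E y z))"

text \<open>Acyclicity in the form that the proofs use: two neighbours of \<open>c\<close> in a
  connected set avoiding \<open>c\<close> would be joined by a path there and close a cycle through
  \<open>c\<close>.\<close>

definition forest_on :: "'v set \<Rightarrow> bool" where
  "forest_on V \<longleftrightarrow> finite V \<and>
     (\<forall>X c x y. X \<subseteq> V \<longrightarrow> conn X \<longrightarrow> c \<in> V - X \<longrightarrow> x \<in> X \<longrightarrow> y \<in> X \<longrightarrow> E c x \<longrightarrow> E c y \<longrightarrow> x = y)"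

definition path :: "'v list \<Rightarrow> bool" where
  "path xs \<longleftrightarrow> distinct xs \<and> successively E xs"

definition nbs :: "'v set \<Rightarrow> 'v \<Rightarrow> 'v set" where
  "nbs W x = {y \<in> W. E x y}"

text \<open>Ordered pairs, so each edge counts twice; the familiar bound of one edge less than
  vertices reads \<open>arc_count W + 2 \<le> 2 * card W\<close>.\<close>

definition arc_count :: "'v set \<Rightarrow> nat" where
  "arc_count W = card {(x, y). x \<in> W \<and> y \<in> W \<and> E x y}"

definition component :: "'v set \<Rightarrow> 'v \<Rightarrow> 'v set" where
  "component X x = \<Union>{Y. Y \<subseteq> X \<and> x \<in> Y \<and> conn Y}"

lemma connE:
  assumes "conn W" "Y \<subseteq> W" "Y \<noteq> {}" "Y \<noteq> W"
  obtains y z where "y \<in> Y" "z \<in> W" "z \<notin> Y" "E y z"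
  using assms unfolding conn_def by blast

lemma conn_nonempty: "conn W \<Longrightarrow> W \<noteq> {}"
  unfolding conn_def by blast

lemma conn_singleton: "conn {x}"
  unfolding conn_def by auto

lemma conn_Union:
  assumes "\<Y> \<noteq> {}" and "\<And>Y. Y \<in> \<Y> \<Longrightarrow> conn Y \<and> x \<in> Y"
  shows "conn (\<Union>\<Y>)"
  unfolding conn_def
proof (intro conjI allI impI)
  show "\<Union>\<Y> \<noteq> {}" using assms by blast
next
  fix Z assume Z: "Z \<subseteq> \<Union>\<Y>" "Z \<noteq> {}" "Z \<noteq> \<Union>\<Y>"
  \<comment> \<open>All members share \<open>x\<close>, so a member that meets the side of the cut
    without \<open>x\<close> is itself cut.\<close>
  have "\<exists>Y\<in>\<Y>. Y \<inter> Z \<noteq> {} \<and> Y \<inter> Z \<noteq> Y"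
  proof (cases "x \<in> Z")
    case True
    from Z obtain y Y where "Y \<in> \<Y>" "y \<in> Y" "y \<notin> Z" by blast
    then show ?thesis using True assms(2) by blast
  next
    case False
    from Z obtain y Y where "Y \<in> \<Y>" "y \<in> Y" "y \<in> Z" by blast
    then show ?thesis using False assms(2) by blast
  qed
  then obtain Y where Y: "Y \<in> \<Y>" "Y \<inter> Z \<noteq> {}" "Y \<inter> Z \<noteq> Y" by blast
  obtain y z where "y \<in> Y \<inter> Z" "z \<in> Y" "z \<notin> Y \<inter> Z" "E y z"
    using assms(2)[OF Y(1)] Y connE[of Y "Y \<inter> Z"] by blast
  then show "\<exists>y\<in>Z. \<exists>z\<in>\<Union>\<Y> - Z. E y z" using Y(1) by blast
qed

lemma conn_Un:
  assumes "conn A" "conn B" "A \<inter> B \<noteq> {}"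
  shows "conn (A \<union> B)"
proof -
  obtain x where "x \<in> A" "x \<in> B" using assms(3) by blast
  then show ?thesis using conn_Union[of "{A, B}" x] assms by auto
qed

lemma conn_edge: "E x y \<Longrightarrow> conn {x, y}"
  unfolding conn_def
proof (intro conjI allI impI)
  fix Y assume a: "E x y" "Y \<subseteq> {x, y}" "Y \<noteq> {}" "Y \<noteq> {x, y}"
  then have "Y = {x} \<and> x \<noteq> y \<or> Y = {y} \<and> x \<noteq> y" by blast
  then show "\<exists>y'\<in>Y. \<exists>z\<in>{x, y} - Y. E y' z" using a(1) E_sym by auto
qed simp

lemma conn_insert:
  assumes "conn X" "x \<in> X" "E x y"
  shows "conn (insert y X)"
proof -
  have "insert y X = X \<union> {x, y}" using assms(2) by blast
  then show ?thesis using conn_Un[OF assms(1) conn_edge[OF assms(3)]] assms(2) by auto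
qed

lemma conn_separated:
  assumes "conn X" "X \<subseteq> A \<union> B" "\<And>a b. a \<in> A \<Longrightarrow> b \<in> B \<Longrightarrow> \<not> E a b" "X \<inter> A \<noteq> {}"
  shows "X \<subseteq> A"
proof (rule ccontr)
  assume "\<not> X \<subseteq> A"
  then obtain y z where "y \<in> X \<inter> A" "z \<in> X" "z \<notin> X \<inter> A" "E y z"
    using connE[OF assms(1), of "X \<inter> A"] assms(4) by blast
  then show False using assms by blast
qed

section \<open>Paths\<close>

lemma path_Cons: "path (x # xs) \<longleftrightarrow> x \<notin> set xs \<and> path xs \<and> (xs = [] \<or> E x (hd xs))"
  unfolding path_def by (auto simp: successively_Cons)

lemma path_append: "path (xs @ ys) \<longleftrightarrow> path xs \<and> path ys \<and> set xs \<inter> set ys = {} \<and>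
    (xs = [] \<or> ys = [] \<or> E (last xs) (hd ys))"
  unfolding path_def by (auto simp: successively_append_iff)

lemma path_rev: "path (rev xs) \<longleftrightarrow> path xs"
proof -
  have "successively (\<lambda>x y. E y x) xs = successively E xs"
    by (metis E_sym successively_mono)
  then show ?thesis unfolding path_def by simp
qed

lemma path_take: "path xs \<Longrightarrow> path (take k xs)"
  by (metis append_take_drop_id path_append)

lemma path_drop: "path xs \<Longrightarrow> path (drop k xs)"
  by (metis append_take_drop_id path_append)

lemma path_nth: "path xs \<Longrightarrow> Suc i < length xs \<Longrightarrow> E (xs ! i) (xs ! Suc i)"
  unfolding path_def by (simp add: successively_nth)

lemma path_distinct: "path xs \<Longrightarrow> distinct xs"
  unfolding path_def by simp

lemma conn_path: "path xs \<Longrightarrow> xs \<noteq> [] \<Longrightarrow> conn (set xs)"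
proof (induction xs)
  case (Cons x xs)
  show ?case
  proof (cases "xs = []")
    case False
    then have "conn (set xs)" "hd xs \<in> set xs" "E (hd xs) x"
      using Cons by (auto simp: path_Cons intro: E_sym)
    then show ?thesis using conn_insert by auto
  qed (simp add: conn_singleton)
qed simp

text \<open>The vertices reachable from \<open>x\<close> by a path inside \<open>X\<close> cannot be
  left by an edge: such an edge prolongs the path, or its end lies on the path already and the path
  is cut off there.\<close>

lemma conn_ex_path:
  assumes "conn X" "x \<in> X" "y \<in> X"
  obtains xs where "path xs" "xs \<noteq> []" "hd xs = x" "last xs = y" "set xs \<subseteq> X"
proof -
  define R where "R = {z. \<exists>xs. path xs \<and> xs \<noteq> [] \<and> hd xs = x \<and> last xs = z \<and> set xs \<subseteq> X}"
  have "R \<subseteq> X" unfolding R_def by (auto dest: last_in_set)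
  have "x \<in> R" unfolding R_def using assms(2) by (auto simp: path_def intro!: exI[of _ "[x]"])
  have "R = X"
  proof (rule ccontr)
    assume "R \<noteq> X"
    then obtain a b where ab: "a \<in> R" "b \<in> X" "b \<notin> R" "E a b"
      using connE[OF assms(1) \<open>R \<subseteq> X\<close>] \<open>x \<in> R\<close> by blast
    then obtain xs where xs: "path xs" "xs \<noteq> []" "hd xs = x" "last xs = a" "set xs \<subseteq> X"
      unfolding R_def by blast
    show False
    proof (cases "b \<in> set xs")
      case True
      then obtain as bs where s: "xs = (as @ [b]) @ bs" by (auto dest: split_list)
      then have "path (as @ [b])" "set (as @ [b]) \<subseteq> X" using xs unfolding s path_append by auto
      moreover have "hd (as @ [b]) = x" using xs(3) s by (cases as) auto
      ultimately have "b \<in> R" unfolding R_def by (auto intro!: exI[of _ "as @ [b]"])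
      then show False using ab by blast
    next
      case False
      then have "path (xs @ [b])" using xs(1,4) ab(4) by (simp add: path_append path_Cons) (simp add: path_def)
      then have "b \<in> R" unfolding R_def using xs ab by (auto intro!: exI[of _ "xs @ [b]"])
      then show False using ab by blast
    qed
  qed
  then show thesis using assms(3) that unfolding R_def by blast
qed

section \<open>Connected components\<close>

lemma component_subset: "component X x \<subseteq> X"
  unfolding component_def by blast

lemma component_self: "x \<in> X \<Longrightarrow> x \<in> component X x"
  unfolding component_def using conn_singleton by blast

lemma conn_component:
  assumes "x \<in> X" shows "conn (component X x)"
  unfolding component_def by (rule conn_Union[of _ x]) (use assms conn_singleton in auto)

lemma component_maximal:
  assumes "conn Y" "Y \<subseteq> X" "y \<in> Y" "y \<in> component X x"
  shows "Y \<subseteq> component X x"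
proof -
  have "x \<in> X" using assms(4) unfolding component_def by blast
  then have "conn (Y \<union> component X x)" using conn_Un conn_component assms by blast
  moreover have "Y \<union> component X x \<subseteq> X" "x \<in> Y \<union> component X x"
    using assms component_subset component_self \<open>x \<in> X\<close> by auto
  ultimately show ?thesis unfolding component_def by blast
qed

lemma component_edge:
  assumes "y \<in> component X x" "z \<in> X" "E y z"
  shows "z \<in> component X x"
  using component_maximal[OF conn_edge[OF assms(3)], of X y x] assms component_subset by blast

lemma component_eq:
  assumes "y \<in> component X x" shows "component X y = component X x"
proof -
  have xX: "x \<in> X" and yX: "y \<in> X" using assms unfolding component_def by auto
  have "component X y \<subseteq> component X x"
    using component_maximal[OF conn_component[OF yX] component_subset component_self[OF yX] assms] .
  moreover have "component X x \<subseteq> component X y"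
    using component_maximal[OF conn_component[OF xX] component_subset assms component_self[OF yX]] .
  ultimately show ?thesis by blast
qed

lemma component_mono: "X \<subseteq> X' \<Longrightarrow> component X x \<subseteq> component X' x"
  unfolding component_def by blast

section \<open>Acyclicity and uniqueness of paths\<close>

lemma forest_finite: "forest_on V \<Longrightarrow> finite V"
  unfolding forest_on_def by blast

lemma forest_unique_nbs:
  assumes "forest_on V" "X \<subseteq> V" "conn X" "c \<in> V" "c \<notin> X" "x \<in> X" "y \<in> X" "E c x" "E c y"
  shows "x = y"
proof -
  have "c \<in> V - X" using assms by blast
  with assms show ?thesis unfolding forest_on_def by metis
qed

lemma forest_subset:
  assumes "forest_on V" "W \<subseteq> V" shows "forest_on W"
proof -
  have "finite W" using assms forest_finite finite_subset by blast
  moreover have "x = y" if "X \<subseteq> W" "conn X" "c \<in> W - X" "x \<in> X" "y \<in> X" "E c x" "E c y" for X c x y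
    using forest_unique_nbs[OF assms(1), of X c x y] that assms(2) by blast
  ultimately show ?thesis unfolding forest_on_def by blast
qed

text \<open>If the two tails met, their union would be a connected set avoiding \<open>x\<close>
  with two different neighbours of \<open>x\<close>, namely the two heads.\<close>

lemma path_fork_join:
  assumes "forest_on V" "path (x # xs)" "path (x # ys)" "set (x # xs) \<subseteq> V" "set (x # ys) \<subseteq> V"
    "xs \<noteq> [] \<Longrightarrow> ys \<noteq> [] \<Longrightarrow> hd xs \<noteq> hd ys"
  shows "path (rev xs @ x # ys)"
proof -
  have "set xs \<inter> set ys = {}"
  proof (rule ccontr)
    assume ne: "set xs \<inter> set ys \<noteq> {}"
    then have n: "xs \<noteq> []" "ys \<noteq> []" by auto
    have "conn (set xs \<union> set ys)"
      using assms(2,3) ne n conn_Un[OF conn_path conn_path, of xs ys] by (simp add: path_Cons)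
    then have "hd xs = hd ys"
      using forest_unique_nbs[OF assms(1), of "set xs \<union> set ys" x "hd xs" "hd ys"] assms n
      by (auto simp: path_Cons)
    then show False using assms(6) n by blast
  qed
  moreover have "path (rev xs)" using assms(2) by (simp add: path_rev path_Cons)
  moreover have "xs \<noteq> [] \<Longrightarrow> E (last (rev xs)) x"
    using assms(2) by (auto simp: path_Cons last_rev intro: E_sym)
  ultimately show ?thesis using assms(2,3) by (auto simp: path_append path_Cons)
qed

text \<open>At the first place where the paths differ, \<open>path_fork_join\<close> combines their
  remaining parts into one path, yet the common last vertex would occur on it twice.\<close>

lemma path_unique:
  assumes "forest_on V" "path xs" "path ys" "set xs \<subseteq> V" "set ys \<subseteq> V" "xs \<noteq> []" "ys \<noteq> []"
    "hd xs = hd ys" "last xs = last ys"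
  shows "xs = ys"
  using assms(2-)
proof (induction xs arbitrary: ys)
  case (Cons x xs)
  then obtain ys' where ys: "ys = x # ys'" by (cases ys) auto
  show ?case
  proof (cases "xs = [] \<or> ys' = []")
    case True
    then show ?thesis using Cons.prems ys by (auto simp: path_Cons split: if_splits)
  next
    case False
    have l: "last xs = last ys'" using Cons.prems ys False by auto
    have l': "last xs \<in> set xs" "last ys' \<in> set ys'" using False by auto
    have "hd xs = hd ys'"
    proof (rule ccontr)
      assume "hd xs \<noteq> hd ys'"
      then have "path (rev xs @ x # ys')"
        using path_fork_join[OF assms(1)] Cons.prems ys by auto
      then show False using l l' by (auto simp: path_append)
    qed
    then show ?thesis using Cons.IH[of ys'] Cons.prems ys False l by (auto simp: path_Cons)
  qed
qed simp

text \<open>Paths in a forest are induced. The entries before and after position \<open>k\<close>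
  form connected sets, each containing the adjacent entry and hence no second neighbour of
  \<open>xs ! k\<close>.\<close>

lemma path_nbs_card:
  assumes "forest_on V" "path xs" "set xs \<subseteq> V" "k < length xs"
  shows "nbs (set xs) (xs ! k) = {y. (\<exists>j. Suc j = k \<and> y = xs ! j) \<or> (Suc k < length xs \<and> y = xs ! Suc k)}"
proof -
  define x where "x = xs ! k"
  have s: "xs = take k xs @ x # drop (Suc k) xs" unfolding x_def using assms(4) by (rule id_take_nth_drop)
  have p: "path (take k xs)" "path (drop (Suc k) xs)" using assms path_take path_drop by auto
  have d: "x \<notin> set (take k xs)" "x \<notin> set (drop (Suc k) xs)"
    using path_distinct[OF assms(2)] s by (metis distinct_append disjoint_iff list.set_intros(1), metis distinct.simps(2) distinct_append s)
  have 1: "y = xs ! (k - 1) \<and> k > 0" if "y \<in> set (take k xs)" "E x y" for y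
  proof -
    have k: "k > 0" using that(1) by (cases k) auto
    have m: "xs ! (k - 1) \<in> set (take k xs)" using k assms(4)
      by (auto simp: in_set_conv_nth intro!: exI[of _ "k - 1"])
    have "E (xs ! (k - 1)) x" using path_nth[OF assms(2), of "k - 1"] k assms(4) x_def by auto
    then have "E x (xs ! (k - 1))" by (rule E_sym)
    moreover have "set (take k xs) \<subseteq> V" "take k xs \<noteq> []" "x \<in> V"
      using assms(3,4) k set_take_subset[of k xs] unfolding x_def by auto
    ultimately show ?thesis
      using forest_unique_nbs[OF assms(1) _ conn_path[OF p(1)] _ d(1) that(1) m that(2)] k by blast
  qed
  have 2: "y = xs ! Suc k \<and> Suc k < length xs" if "y \<in> set (drop (Suc k) xs)" "E x y" for y
  proof -
    have k: "Suc k < length xs" using that(1) by (metis drop_all empty_iff empty_set linorder_not_less)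
    have m: "xs ! Suc k \<in> set (drop (Suc k) xs)" using k
      by (metis Cons_nth_drop_Suc list.set_intros(1))
    have "E x (xs ! Suc k)" using path_nth[OF assms(2) k] x_def by auto
    moreover have "set (drop (Suc k) xs) \<subseteq> V" "drop (Suc k) xs \<noteq> []" "x \<in> V"
      using assms(3,4) k set_drop_subset[of "Suc k" xs] unfolding x_def by auto
    ultimately show ?thesis
      using forest_unique_nbs[OF assms(1) _ conn_path[OF p(2)] _ d(2) that(1) m that(2)] k by blast
  qed
  have "y \<in> set xs \<Longrightarrow> E x y \<Longrightarrow> y \<in> set (take k xs) \<or> y \<in> set (drop (Suc k) xs)" for y
    using E_irrefl by (metis Un_iff s set_ConsD set_append)
  then have "nbs (set xs) x \<subseteq> {y. (\<exists>j. Suc j = k \<and> y = xs ! j) \<or> (Suc k < length xs \<and> y = xs ! Suc k)}"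
    using 1 2 unfolding nbs_def by (fastforce simp: gr0_conv_Suc)
  moreover have "E x (xs ! j)" if "Suc j = k" for j
    using path_nth[OF assms(2), of j] that assms(4) E_sym unfolding x_def by blast
  moreover have "E x (xs ! Suc k)" if "Suc k < length xs"
    using path_nth[OF assms(2) that] unfolding x_def by blast
  ultimately show ?thesis using assms(4) unfolding nbs_def x_def[symmetric] by auto
qed

section \<open>Edge counts of forests and connected sets\<close>

lemma nbs_finite: "finite W \<Longrightarrow> finite (nbs W x)"
  unfolding nbs_def by simp

lemma nbs_mono: "W \<subseteq> V \<Longrightarrow> nbs W x \<subseteq> nbs V x"
  unfolding nbs_def by blast

lemma arc_count_finite: "finite W \<Longrightarrow> finite {(x, y). x \<in> W \<and> y \<in> W \<and> E x y}"
  by (rule finite_subset[of _ "W \<times> W"]) auto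

lemma arc_count_remove:
  assumes "finite W" "z \<in> W"
  shows "arc_count W = arc_count (W - {z}) + 2 * card (nbs W z)"
proof -
  let ?A = "{(x, y). x \<in> W - {z} \<and> y \<in> W - {z} \<and> E x y}"
  let ?B = "Pair z ` nbs W z" and ?C = "(\<lambda>x. (x, z)) ` nbs W z"
  have "{(x, y). x \<in> W \<and> y \<in> W \<and> E x y} = ?A \<union> (?B \<union> ?C)"
    using assms E_sym unfolding nbs_def by auto
  moreover have "card (?A \<union> (?B \<union> ?C)) = card ?A + card (?B \<union> ?C)"
    using assms by (intro card_Un_disjoint arc_count_finite) (auto simp: nbs_finite)
  moreover have "card (?B \<union> ?C) = card ?B + card ?C"
    using assms E_irrefl by (intro card_Un_disjoint) (auto simp: nbs_finite, auto simp: nbs_def)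
  moreover have "card ?B = card (nbs W z)" "card ?C = card (nbs W z)"
    by (auto intro!: card_image inj_onI)
  ultimately show ?thesis unfolding arc_count_def by simp
qed

text \<open>An end of a longest path is a leaf: its neighbours lie on the rest of the path, which is
  connected and so contains at most one of them.\<close>

lemma forest_leaf:
  assumes "forest_on W" "W \<noteq> {}"
  obtains x where "x \<in> W" "card (nbs W x) \<le> 1"
proof -
  let ?P = "\<lambda>xs. path xs \<and> set xs \<subseteq> W \<and> xs \<noteq> []"
  have fin: "finite W" using assms forest_finite by blast
  obtain w where "w \<in> W" using assms by blast
  then have "?P [w]" by (simp add: path_def)
  moreover have "\<forall>xs. ?P xs \<longrightarrow> length xs < Suc (card W)"
    using fin by (metis card_mono distinct_card le_imp_less_Suc path_distinct)
  ultimately obtain xs where xs: "?P xs" and mx: "\<And>ys. ?P ys \<Longrightarrow> length ys \<le> length xs"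
    using ex_has_greatest_nat[of ?P "[w]" length "Suc (card W)"] by (metis less_imp_le)
  then obtain x ys where x: "xs = x # ys" by (cases xs) auto
  have subtrees: "nbs W x \<subseteq> set ys"
  proof
    fix y assume y: "y \<in> nbs W x"
    show "y \<in> set ys"
    proof (rule ccontr)
      assume "y \<notin> set ys"
      then have "?P (y # xs)" using xs x y E_irrefl by (auto simp: nbs_def path_Cons intro: E_sym)
      then show False using mx by fastforce
    qed
  qed
  have "card (nbs W x) \<le> 1"
  proof (cases "ys = []")
    case False
    have "conn (set ys)" using xs x False by (auto simp: path_Cons intro: conn_path)
    then have "a = b" if "a \<in> nbs W x" "b \<in> nbs W x" for a b
      using forest_unique_nbs[OF assms(1), of "set ys" x a b] xs x that subtrees
      by (auto simp: nbs_def path_Cons)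
    then show ?thesis using fin by (simp add: card_le_Suc0_iff_eq nbs_finite)
  qed (use subtrees in simp)
  then show thesis using that xs x by auto
qed

lemma forest_arc_count:
  assumes "forest_on W" "W \<noteq> {}"
  shows "arc_count W + 2 \<le> 2 * card W"
proof -
  have "finite W" using assms forest_finite by blast
  then show ?thesis using assms
  proof (induction W rule: finite_psubset_induct)
    case (psubset W)
    obtain x where x: "x \<in> W" "card (nbs W x) \<le> 1" using forest_leaf psubset.prems by blast
    have c: "card W = Suc (card (W - {x}))" using x psubset.hyps by (metis card_Suc_Diff1)
    show ?case
    proof (cases "W - {x} = {}")
      case True
      then have "nbs W x = {}" using E_irrefl x unfolding nbs_def by blast
      moreover have "arc_count (W - {x}) = 0" unfolding True arc_count_def by simp
      ultimately show ?thesis using arc_count_remove[OF psubset.hyps x(1)] c by simp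
    next
      case False
      then have "arc_count (W - {x}) + 2 \<le> 2 * card (W - {x})"
        using psubset.IH[of "W - {x}"] psubset.prems x forest_subset[of W "W - {x}"] by blast
      then show ?thesis using arc_count_remove[OF psubset.hyps x(1)] c x(2) by linarith
    qed
  qed
qed

text \<open>A largest subset satisfying the bound is everything: an edge leaving it leads to a
  vertex whose addition raises \<open>arc_count\<close> by at least 2.\<close>

lemma conn_arc_count:
  assumes "finite X" "conn X"
  shows "2 * card X \<le> arc_count X + 2"
proof -
  let ?P = "\<lambda>Y. Y \<subseteq> X \<and> Y \<noteq> {} \<and> 2 * card Y \<le> arc_count Y + 2"
  obtain x where x: "x \<in> X" using assms conn_nonempty by blast
  then have "?P {x}" by simp
  moreover have "\<forall>Y. ?P Y \<longrightarrow> card Y < Suc (card X)" using assms(1) card_mono le_imp_less_Suc by blast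
  ultimately obtain Y where Y: "?P Y" and mx: "\<And>Z. ?P Z \<Longrightarrow> card Z \<le> card Y"
    using ex_has_greatest_nat[of ?P "{x}" card "Suc (card X)"] by (metis less_imp_le)
  have "Y = X"
  proof (rule ccontr)
    assume "Y \<noteq> X"
    then obtain y z where yz: "y \<in> Y" "z \<in> X" "z \<notin> Y" "E y z"
      using connE[OF assms(2)] Y by metis
    have fY: "finite Y" using Y assms finite_subset by blast
    have "nbs (insert z Y) z \<noteq> {}" using yz unfolding nbs_def by (auto intro: E_sym)
    then have "card (nbs (insert z Y) z) \<ge> 1" using fY by (simp add: nbs_finite card_gt_0_iff Suc_leI)
    then have "?P (insert z Y)" using Y yz fY arc_count_remove[of "insert z Y" z] by auto
    from mx[OF this] show False using fY yz by simp
  qed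
  then show ?thesis using Y by simp
qed

text \<open>A connected \<open>X\<close> already has the maximal edge count, so a vertex with two
  neighbours in \<open>X\<close> would exceed it. As edge counts are invariants, this recognises
  forests among sets not known to be acyclic.\<close>

lemma sparse_forest:
  assumes "finite V" "\<And>W. W \<subseteq> V \<Longrightarrow> W \<noteq> {} \<Longrightarrow> arc_count W + 2 \<le> 2 * card W"
  shows "forest_on V"
  unfolding forest_on_def
proof (intro conjI allI impI assms(1))
  fix X c x y
  assume a: "X \<subseteq> V" "conn X" "c \<in> V - X" "x \<in> X" "y \<in> X" "E c x" "E c y"
  have fX: "finite X" using a assms finite_subset by blast
  show "x = y"
  proof (rule ccontr)
    assume "x \<noteq> y"
    have "{x, y} \<subseteq> nbs (insert c X) c" using a unfolding nbs_def by auto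
    then have "2 \<le> card (nbs (insert c X) c)"
      using \<open>x \<noteq> y\<close> card_mono[of "nbs (insert c X) c" "{x, y}"] fX by (simp add: nbs_finite)
    moreover have "arc_count (insert c X) + 2 \<le> 2 * card (insert c X)" using a by (intro assms) auto
    moreover have "2 * card X \<le> arc_count X + 2" using conn_arc_count fX a by blast
    ultimately show False using arc_count_remove[of "insert c X" c] fX a by auto
  qed
qed

lemma arc_count_disjoint:
  assumes "finite V" "Y \<subseteq> V" "\<And>y z. y \<in> Y \<Longrightarrow> z \<in> V - Y \<Longrightarrow> \<not> E y z"
  shows "arc_count V = arc_count Y + arc_count (V - Y)"
proof -
  have "{(x, y). x \<in> V \<and> y \<in> V \<and> E x y} =
     {(x, y). x \<in> Y \<and> y \<in> Y \<and> E x y} \<union> {(x, y). x \<in> V - Y \<and> y \<in> V - Y \<and> E x y}"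
    using assms E_sym by blast
  then show ?thesis unfolding arc_count_def
    using assms finite_subset[OF assms(2)]
    by (simp only:, intro card_Un_disjoint arc_count_finite) auto
qed

text \<open>If no edge leaves a proper part \<open>Y\<close>, the forest bounds for \<open>Y\<close>
  and \<open>V - Y\<close> add up and keep the count of \<open>V\<close> below the maximum.\<close>

lemma forest_conn_iff:
  assumes "forest_on V" "V \<noteq> {}"
  shows "conn V \<longleftrightarrow> arc_count V + 2 = 2 * card V"
proof
  have fin: "finite V" using assms forest_finite by blast
  assume e: "arc_count V + 2 = 2 * card V"
  show "conn V" unfolding conn_def
  proof (intro conjI allI impI assms(2))
    fix Y assume Y: "Y \<subseteq> V" "Y \<noteq> {}" "Y \<noteq> V"
    show "\<exists>y\<in>Y. \<exists>z\<in>V - Y. E y z"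
    proof (rule ccontr)
      assume "\<not> ?thesis"
      then have "arc_count V = arc_count Y + arc_count (V - Y)" using arc_count_disjoint[OF fin Y(1)] by blast
      moreover have "arc_count Y + 2 \<le> 2 * card Y" "arc_count (V - Y) + 2 \<le> 2 * card (V - Y)"
        using Y assms(1) forest_subset[of V Y] forest_subset[of V "V - Y"]
          forest_arc_count[of Y] forest_arc_count[of "V - Y"] by blast+
      moreover have "card V = card Y + card (V - Y)"
        using Y fin by (metis card_Diff_subset card_mono finite_subset le_add_diff_inverse)
      ultimately show False using e by simp
    qed
  qed
qed (use forest_arc_count[OF assms] conn_arc_count forest_finite[OF assms(1)] in fastforce)

end

section \<open>Matchings of finite families and Kelly counting\<close>

text \<open>With an isomorphism relation for \<open>R\<close>, this is equality of two multisets of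
  isomorphism types.\<close>

definition matched :: "('a \<Rightarrow> 'b \<Rightarrow> bool) \<Rightarrow> 'a set \<Rightarrow> 'b set \<Rightarrow> bool" where
  "matched R A B \<longleftrightarrow> (\<exists>\<phi>. bij_betw \<phi> A B \<and> (\<forall>a\<in>A. R a (\<phi> a)))"

lemma matched_ex: "matched R A B \<Longrightarrow> a \<in> A \<Longrightarrow> \<exists>b\<in>B. R a b"
  unfolding matched_def by (blast dest: bij_betwE)

lemma matched_sym: "matched R A B \<Longrightarrow> matched (\<lambda>b a. R a b) B A"
  unfolding matched_def
proof (elim exE conjE)
  fix \<phi> assume p: "bij_betw \<phi> A B" "\<forall>a\<in>A. R a (\<phi> a)"
  have "\<forall>b\<in>B. R (inv_into A \<phi> b) b"
    using p by (metis bij_betw_imp_surj_on f_inv_into_f inv_into_into)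
  then show "\<exists>\<psi>. bij_betw \<psi> B A \<and> (\<forall>b\<in>B. R (\<psi> b) b)"
    using bij_betw_inv_into[OF p(1)] by blast
qed

lemma matched_restrict:
  assumes "matched R A B" "\<And>a b. a \<in> A \<Longrightarrow> b \<in> B \<Longrightarrow> R a b \<Longrightarrow> P a \<longleftrightarrow> Q b"
  shows "matched R {a \<in> A. P a} {b \<in> B. Q b}"
proof -
  obtain \<phi> where p: "bij_betw \<phi> A B" "\<And>a. a \<in> A \<Longrightarrow> R a (\<phi> a)" using assms(1) unfolding matched_def by blast
  have pq: "P a \<longleftrightarrow> Q (\<phi> a)" if "a \<in> A" for a using assms(2) p that bij_betwE by blast
  have "\<phi> ` {a \<in> A. P a} = {b \<in> B. Q b}"
    using p(1) pq unfolding bij_betw_def by blast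
  then have "bij_betw \<phi> {a \<in> A. P a} {b \<in> B. Q b}"
    using p(1) bij_betw_subset[of \<phi> A B "{a \<in> A. P a}"] by blast
  then show ?thesis unfolding matched_def using p(2) by blast
qed

lemma matched_card_eq: "matched R A B \<Longrightarrow> card A = card B"
  unfolding matched_def using bij_betw_same_card by blast

lemma matched_card:
  assumes "matched R A B" "\<And>a b. a \<in> A \<Longrightarrow> b \<in> B \<Longrightarrow> R a b \<Longrightarrow> P a \<longleftrightarrow> Q b"
  shows "card {a \<in> A. P a} = card {b \<in> B. Q b}"
  using matched_card_eq[OF matched_restrict[OF assms]] .

lemma matched_sum:
  assumes "matched R A B" "\<And>a b. a \<in> A \<Longrightarrow> b \<in> B \<Longrightarrow> R a b \<Longrightarrow> f a = g b"
  shows "sum f A = sum g B"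
proof -
  obtain \<phi> where p: "bij_betw \<phi> A B" "\<And>a. a \<in> A \<Longrightarrow> R a (\<phi> a)" using assms(1) unfolding matched_def by blast
  have "sum f A = (\<Sum>a\<in>A. g (\<phi> a))" using p assms(2) bij_betwE by (intro sum.cong) blast+
  then show ?thesis using sum.reindex_bij_betw[OF p(1)] by simp
qed

text \<open>Reindexes a matching on both sides; this serves, for instance, to pass from subtrees of
  a tree to subtrees of a part of it.\<close>

lemma matched_transfer:
  assumes "matched R A B" "bij_betw u C A" "bij_betw v D B"
    "\<And>c d. c \<in> C \<Longrightarrow> d \<in> D \<Longrightarrow> R (u c) (v d) \<Longrightarrow> S c d"
  shows "matched S C D"
proof -
  obtain \<phi> where p: "bij_betw \<phi> A B" "\<And>a. a \<in> A \<Longrightarrow> R a (\<phi> a)" using assms(1) unfolding matched_def by blast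
  let ?w = "inv_into D v \<circ> (\<phi> \<circ> u)"
  have b: "bij_betw ?w C D"
    using bij_betw_trans[OF bij_betw_trans[OF assms(2) p(1)] bij_betw_inv_into[OF assms(3)]] .
  moreover have "S c (?w c)" if "c \<in> C" for c
  proof -
    have "?w c \<in> D" using b that bij_betwE by blast
    have "u c \<in> A" using assms(2) that bij_betwE by blast
    then have "\<phi> (u c) \<in> B" "R (u c) (\<phi> (u c))" using p bij_betwE by blast+
    moreover have "v (?w c) = \<phi> (u c)" using calculation assms(3)
      by (simp add: bij_betw_inv_into_right)
    ultimately show ?thesis using assms(4)[OF that \<open>?w c \<in> D\<close>] by simp
  qed
  ultimately show ?thesis unfolding matched_def by blast
qed

lemma matched_mono:
  assumes "matched R A B" "\<And>a b. a \<in> A \<Longrightarrow> b \<in> B \<Longrightarrow> R a b \<Longrightarrow> S a b"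
  shows "matched S A B"
  using assms bij_betwE unfolding matched_def by blast

text \<open>Bijections chosen separately on the classes fit together, because the class of a point
  can be read off its image.\<close>

lemma matched_by_class_card:
  assumes "finite A" "finite B" "\<And>\<tau>. card {a \<in> A. s a = \<tau>} = card {b \<in> B. t b = \<tau>}"
  shows "matched (\<lambda>a b. s a = t b) A B"
proof -
  have "\<exists>g. bij_betw g {a \<in> A. s a = \<tau>} {b \<in> B. t b = \<tau>}" for \<tau>
    using assms by (intro finite_same_card_bij) auto
  then have "\<exists>g. \<forall>\<tau>. bij_betw (g \<tau>) {a \<in> A. s a = \<tau>} {b \<in> B. t b = \<tau>}" by (intro choice allI)
  then obtain g where g: "\<And>\<tau>. bij_betw (g \<tau>) {a \<in> A. s a = \<tau>} {b \<in> B. t b = \<tau>}" by blast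
  let ?h = "\<lambda>a. g (s a) a"
  have h: "?h a \<in> B \<and> t (?h a) = s a" if "a \<in> A" for a using bij_betwE[OF g[of "s a"]] that by blast
  have "inj_on ?h A"
  proof (rule inj_onI)
    fix x y assume xy: "x \<in> A" "y \<in> A" "?h x = ?h y"
    then have "s x = s y" using h by metis
    then show "x = y" using xy g[of "s x"] unfolding bij_betw_def inj_on_def by auto
  qed
  moreover have "?h ` A = B"
  proof
    show "B \<subseteq> ?h ` A"
    proof
      fix b assume "b \<in> B"
      then have "b \<in> g (t b) ` {a \<in> A. s a = t b}" using g[of "t b"] unfolding bij_betw_def by blast
      then show "b \<in> ?h ` A" by force
    qed
  qed (use h in blast)
  ultimately show ?thesis unfolding matched_def bij_betw_def using h by (intro exI[of _ ?h]) auto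
qed

text \<open>
  Kelly's counting argument: the system for the class totals is triangular with respect to the size.
\<close>

lemma weighted_class_totals:
  fixes tp :: "'o \<Rightarrow> 't" and N :: "'o \<Rightarrow> 'o \<Rightarrow> nat" and sz wA wB :: "'o \<Rightarrow> nat"
  assumes fin: "finite A" "finite B"
    and N_cong: "\<And>a a' t. a \<in> A \<union> B \<Longrightarrow> a' \<in> A \<union> B \<Longrightarrow> t \<in> A \<union> B \<Longrightarrow> tp a = tp a' \<Longrightarrow> N a t = N a' t"
    and N_self: "\<And>t. t \<in> A \<union> B \<Longrightarrow> N t t > 0"
    and N_size: "\<And>a t. a \<in> A \<union> B \<Longrightarrow> t \<in> A \<union> B \<Longrightarrow> N a t > 0 \<Longrightarrow> tp a = tp t \<or> sz t < sz a"
    and hyp: "\<And>t. t \<in> A \<union> B \<Longrightarrow> (\<Sum>a\<in>A. wA a * N a t) = (\<Sum>b\<in>B. wB b * N b t)"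
  shows "(\<Sum>a\<in>{a \<in> A. tp a = \<tau>}. wA a) = (\<Sum>b\<in>{b \<in> B. tp b = \<tau>}. wB b)"
proof (rule ccontr)
  assume neq: "\<not> ?thesis"
  define S where "S = A \<union> B"
  define D where "D \<sigma> = int (\<Sum>a\<in>{a \<in> A. tp a = \<sigma>}. wA a) - int (\<Sum>b\<in>{b \<in> B. tp b = \<sigma>}. wB b)" for \<sigma>
  have finS: "finite S" unfolding S_def using fin by simp
  have "\<exists>t\<in>S. tp t = \<tau>"
  proof (rule ccontr)
    assume "\<not> ?thesis"
    then have e: "{a \<in> A. tp a = \<tau>} = {}" "{b \<in> B. tp b = \<tau>} = {}" unfolding S_def by blast+
    show False using neq unfolding e by simp
  qed
  then obtain t0 where t0: "t0 \<in> S" "tp t0 = \<tau>" by blast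
  have t0': "D (tp t0) \<noteq> 0" using neq unfolding t0(2) D_def right_minus_eq of_nat_eq_iff .
  let ?P = "\<lambda>t. t \<in> S \<and> D (tp t) \<noteq> 0"
  have "\<forall>t. ?P t \<longrightarrow> sz t < Suc (Max (sz ` S))" using finS by (auto simp: le_imp_less_Suc)
  \<comment> \<open>Among the objects whose class totals differ, \<open>t\<close> has the largest
    size. A class of another type in which the pattern \<open>t\<close> occurs is represented by a
    larger object, so its totals agree and it drops out of the equation for
    \<open>t\<close>.\<close>
  then obtain t where t: "?P t" and mx: "\<And>u. ?P u \<Longrightarrow> sz u \<le> sz t"
    using ex_has_greatest_nat[of ?P t0 sz] t0(1) t0' by blast
  \<comment> \<open>One representative per type; by \<open>N_cong\<close> it may replace every
    object of its class.\<close>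
  define r where "r \<sigma> = (SOME a. a \<in> S \<and> tp a = \<sigma>)" for \<sigma>
  have r: "r (tp a) \<in> S \<and> tp (r (tp a)) = tp a" if "a \<in> S" for a
    unfolding r_def by (rule someI[of _ a]) (use that in blast)
  have grp: "int (\<Sum>a\<in>X. w a * N a t) = (\<Sum>\<sigma>\<in>tp ` S. int (\<Sum>a\<in>{a \<in> X. tp a = \<sigma>}. w a) * int (N (r \<sigma>) t))"
    if "X \<subseteq> S" for X and w :: "'o \<Rightarrow> nat"
  proof -
    have fX: "finite X" using that finS finite_subset by blast
    have "(\<Sum>a\<in>X. w a * N a t) = (\<Sum>\<sigma>\<in>tp ` S. \<Sum>a\<in>{a \<in> X. tp a = \<sigma>}. w a * N a t)"
      by (rule sum.group[symmetric]) (use fX finS that in auto)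
    also have "\<dots> = (\<Sum>\<sigma>\<in>tp ` S. \<Sum>a\<in>{a \<in> X. tp a = \<sigma>}. w a * N (r \<sigma>) t)"
    proof (intro sum.cong refl)
      fix \<sigma> a assume "\<sigma> \<in> tp ` S" "a \<in> {a \<in> X. tp a = \<sigma>}"
      then have "a \<in> S" "tp a = \<sigma>" using that by auto
      then have "N a t = N (r \<sigma>) t" using N_cong[of a "r \<sigma>" t] r[of a] t unfolding S_def by auto
      then show "w a * N a t = w a * N (r \<sigma>) t" by simp
    qed
    finally show ?thesis by (simp add: sum_distrib_right)
  qed
  have "0 = int (\<Sum>a\<in>A. wA a * N a t) - int (\<Sum>b\<in>B. wB b * N b t)"
    using hyp[of t] t unfolding S_def by simp
  also have "\<dots> = (\<Sum>\<sigma>\<in>tp ` S. D \<sigma> * int (N (r \<sigma>) t))"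
    using grp[of A wA] grp[of B wB] unfolding D_def S_def
    by (simp add: sum_subtractf left_diff_distrib)
  also have "\<dots> = (\<Sum>\<sigma>\<in>{tp t}. D \<sigma> * int (N (r \<sigma>) t))"
  proof (rule sum.mono_neutral_right)
    show "\<forall>\<sigma>\<in>tp ` S - {tp t}. D \<sigma> * int (N (r \<sigma>) t) = 0"
    proof
      fix \<sigma> assume s: "\<sigma> \<in> tp ` S - {tp t}"
      then have rs: "r \<sigma> \<in> S" "tp (r \<sigma>) = \<sigma>" using r by auto
      show "D \<sigma> * int (N (r \<sigma>) t) = 0"
      proof (rule ccontr)
        assume "\<not> ?thesis"
        then have n: "D \<sigma> \<noteq> 0" "N (r \<sigma>) t > 0" by auto
        then have "sz (r \<sigma>) \<le> sz t" using mx[of "r \<sigma>"] rs by auto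
        then show False using N_size[of "r \<sigma>" t] rs t n s unfolding S_def by auto
      qed
    qed
  qed (use finS t in auto)
  also have "\<dots> = D (tp t) * int (N t t)"
    using N_cong[of "r (tp t)" t t] r[of t] t unfolding S_def by simp
  finally show False using N_self[of t] t unfolding S_def by simp
qed

section \<open>Isomorphism of vertex sets\<close>

context sgraph begin

definition iso :: "('v \<Rightarrow> 'v) \<Rightarrow> 'v set \<Rightarrow> 'v set \<Rightarrow> bool" where
  "iso f W W' \<longleftrightarrow> bij_betw f W W' \<and> (\<forall>x\<in>W. \<forall>y\<in>W. E x y \<longleftrightarrow> E (f x) (f y))"

definition sim :: "'v set \<Rightarrow> 'v set \<Rightarrow> bool" where
  "sim W W' \<longleftrightarrow> (\<exists>f. iso f W W')"

definition rsim :: "'v set \<Rightarrow> 'v \<Rightarrow> 'v set \<Rightarrow> 'v \<Rightarrow> bool" where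
  "rsim W c W' c' \<longleftrightarrow> c \<in> W \<and> (\<exists>f. iso f W W' \<and> f c = c')"

lemma iso_id: "iso id W W"
  unfolding iso_def by simp

lemma iso_image: "iso f W W' \<Longrightarrow> f ` W = W'"
  unfolding iso_def bij_betw_def by simp

lemma iso_inj: "iso f W W' \<Longrightarrow> inj_on f W"
  unfolding iso_def bij_betw_def by simp

lemma iso_edge: "iso f W W' \<Longrightarrow> x \<in> W \<Longrightarrow> y \<in> W \<Longrightarrow> E (f x) (f y) \<longleftrightarrow> E x y"
  unfolding iso_def by simp

lemma iso_compose: "iso f U V \<Longrightarrow> iso g V W \<Longrightarrow> iso (g \<circ> f) U W"
  unfolding iso_def by (auto intro: bij_betw_trans) (metis bij_betwE)+

lemma iso_inv: "iso f W W' \<Longrightarrow> iso (inv_into W f) W' W"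
  unfolding iso_def
  by (auto simp: bij_betw_inv_into) (metis bij_betw_imp_surj_on f_inv_into_f inv_into_into)+

lemma iso_restrict: "iso f W W' \<Longrightarrow> X \<subseteq> W \<Longrightarrow> iso f X (f ` X)"
  unfolding iso_def bij_betw_def by (auto intro: inj_on_subset)

lemma sim_refl: "sim W W"
  unfolding sim_def using iso_id by blast

lemma sim_sym: "sim W W' \<Longrightarrow> sim W' W"
  unfolding sim_def using iso_inv by blast

lemma sim_trans: "sim U V \<Longrightarrow> sim V W \<Longrightarrow> sim U W"
  unfolding sim_def using iso_compose by blast

lemma rsim_mem: "rsim W c W' c' \<Longrightarrow> c \<in> W \<and> c' \<in> W'"
  unfolding rsim_def using iso_image by blast

lemma rsim_refl: "c \<in> W \<Longrightarrow> rsim W c W c"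
  unfolding rsim_def using iso_id by (auto intro: exI[of _ id])

lemma rsim_sym: "rsim W c W' c' \<Longrightarrow> rsim W' c' W c"
proof -
  assume a: "rsim W c W' c'"
  then obtain f where f: "c \<in> W" "iso f W W'" "f c = c'" unfolding rsim_def by blast
  have "inv_into W f c' = c" using f iso_inj inv_into_f_f by fastforce
  then show ?thesis unfolding rsim_def using rsim_mem[OF a] iso_inv[OF f(2)] by blast
qed

lemma rsim_trans: "rsim U u V v \<Longrightarrow> rsim V v W w \<Longrightarrow> rsim U u W w"
  unfolding rsim_def using iso_compose by fastforce

lemma rsim_sim: "rsim W c W' c' \<Longrightarrow> sim W W'"
  unfolding rsim_def sim_def by blast

lemma sim_card: "sim W W' \<Longrightarrow> card W = card W'"
  unfolding sim_def iso_def using bij_betw_same_card by blast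

lemma rsim_card: "rsim W c W' c' \<Longrightarrow> card W = card W'"
  using rsim_sim sim_card by blast

text \<open>Serves as a key: for roots inside their sets, equal keys mean rooted isomorphism, so
  classes of rooted sets can be counted through equations between keys.\<close>

definition rooted_type :: "'v set \<times> 'v \<Rightarrow> ('v set \<times> 'v) set" where
  "rooted_type A = {B. rsim (fst A) (snd A) (fst B) (snd B)}"

definition iso_type :: "'v set \<Rightarrow> 'v set set" where
  "iso_type W = {U. sim W U}"

lemma iso_type_eq: "iso_type W = iso_type U \<longleftrightarrow> sim W U"
  unfolding iso_type_def using sim_refl sim_sym sim_trans by blast

lemma rooted_type_eq: "c \<in> W \<Longrightarrow> u \<in> U \<Longrightarrow> rooted_type (W, c) = rooted_type (U, u) \<longleftrightarrow> rsim W c U u"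
proof
  assume "u \<in> U" "rooted_type (W, c) = rooted_type (U, u)"
  moreover have "(U, u) \<in> rooted_type (U, u)" if "u \<in> U" using rsim_refl that unfolding rooted_type_def by simp
  ultimately have "(U, u) \<in> rooted_type (W, c)" by simp
  then show "rsim W c U u" unfolding rooted_type_def by simp
next
  assume "rsim W c U u"
  then have "rsim W c V v \<longleftrightarrow> rsim U u V v" for V v by (meson rsim_sym rsim_trans)
  then show "rooted_type (W, c) = rooted_type (U, u)" unfolding rooted_type_def by simp
qed

section \<open>Transport of connectedness, paths and edge counts along isomorphisms\<close>

lemma iso_conn1:
  assumes "iso f W W'" "X \<subseteq> W" "conn X"
  shows "conn (f ` X)"
  unfolding conn_def
proof (intro conjI allI impI)
  show "f ` X \<noteq> {}" using assms conn_nonempty by blast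
  fix Y assume Y: "Y \<subseteq> f ` X" "Y \<noteq> {}" "Y \<noteq> f ` X"
  let ?Z = "{x \<in> X. f x \<in> Y}"
  have "?Z \<subseteq> X" "?Z \<noteq> {}" "?Z \<noteq> X" using Y by auto
  then obtain y z where yz: "y \<in> ?Z" "z \<in> X" "z \<notin> ?Z" "E y z" by (rule connE[OF assms(3)])
  then have "E (f y) (f z)" using iso_edge[OF assms(1)] assms(2) by blast
  then show "\<exists>y\<in>Y. \<exists>z\<in>f ` X - Y. E y z" using yz by blast
qed

lemma iso_conn:
  assumes "iso f W W'" "X \<subseteq> W"
  shows "conn (f ` X) \<longleftrightarrow> conn X"
proof
  assume c: "conn (f ` X)"
  have "inv_into X f ` f ` X = X"
    using iso_inj[OF assms(1)] assms(2) by (simp add: inj_on_subset inv_into_image_cancel)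
  then show "conn X"
    using iso_conn1[OF iso_inv[OF iso_restrict[OF assms]] order_refl c] by simp
qed (use iso_conn1 assms in blast)

lemma sim_conn: "sim W W' \<Longrightarrow> conn W \<longleftrightarrow> conn W'"
  unfolding sim_def using iso_conn iso_image by blast

lemma iso_path:
  assumes "iso f W W'" "set xs \<subseteq> W"
  shows "path (map f xs) \<longleftrightarrow> path xs"
  using assms(2)
proof (induction xs)
  case (Cons x xs)
  have "f x \<in> f ` set xs \<longleftrightarrow> x \<in> set xs"
    using inj_on_image_mem_iff[OF iso_inj[OF assms(1)], of x "set xs"] Cons.prems by simp
  moreover have "xs \<noteq> [] \<Longrightarrow> E (f x) (f (hd xs)) \<longleftrightarrow> E x (hd xs)"
    using iso_edge[OF assms(1), of x "hd xs"] Cons.prems by (cases xs) auto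
  ultimately show ?case using Cons by (auto simp: path_Cons hd_map)
qed (simp add: path_def)

lemma iso_nbs:
  assumes "iso f W W'" "X \<subseteq> W" "x \<in> W"
  shows "nbs (f ` X) (f x) = f ` nbs X x"
  unfolding nbs_def using iso_edge[OF assms(1) assms(3)] assms(2) by blast

lemma iso_nbs_card:
  assumes "iso f W W'" "x \<in> W"
  shows "card (nbs W' (f x)) = card (nbs W x)"
proof -
  have "nbs W' (f x) = f ` nbs W x" using iso_nbs[OF assms(1) order_refl assms(2)] iso_image[OF assms(1)] by simp
  moreover have "inj_on f (nbs W x)" using iso_inj[OF assms(1)] by (rule inj_on_subset) (simp add: nbs_def)
  ultimately show ?thesis by (simp add: card_image)
qed

lemma sim_arc_count:
  assumes "sim W W'" shows "arc_count W = arc_count W'"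
proof -
  obtain f where f: "iso f W W'" using assms sim_def by blast
  let ?S = "\<lambda>W. {(x, y). x \<in> W \<and> y \<in> W \<and> E x y}"
  have "map_prod f f ` ?S W = ?S W'"
  proof
    show "map_prod f f ` ?S W \<subseteq> ?S W'" using iso_image[OF f] iso_edge[OF f] by auto
    show "?S W' \<subseteq> map_prod f f ` ?S W"
    proof clarify
      fix x y assume xy: "x \<in> W'" "y \<in> W'" "E x y"
      then obtain a b where "a \<in> W" "b \<in> W" "x = f a" "y = f b" using iso_image[OF f] by blast
      then show "(x, y) \<in> map_prod f f ` ?S W" using iso_edge[OF f] xy(3) by (intro image_eqI[of _ _ "(a, b)"]) auto
    qed
  qed
  moreover have "inj_on (map_prod f f) (?S W)"
    using iso_inj[OF f] by (auto simp: inj_on_def)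
  ultimately show ?thesis unfolding arc_count_def using card_image by fastforce
qed

lemma iso_component:
  assumes "iso f W W'" "X \<subseteq> W" "x \<in> X"
  shows "component (f ` X) (f x) = f ` component X x"
proof
  have s: "component X x \<subseteq> W" using component_subset assms(2) by blast
  have "conn (f ` component X x)" using iso_conn[OF assms(1) s] conn_component assms(3) by blast
  then show "f ` component X x \<subseteq> component (f ` X) (f x)"
    using component_maximal[of _ "f ` X" "f x"] component_subset[of X x] component_self[OF assms(3)]
      component_self[of "f x" "f ` X"] assms(3) by (meson image_eqI image_mono)
  show "component (f ` X) (f x) \<subseteq> f ` component X x"
  proof
    fix y assume "y \<in> component (f ` X) (f x)"
    then obtain Y where Y: "Y \<subseteq> f ` X" "f x \<in> Y" "conn Y" "y \<in> Y" unfolding component_def by blast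
    let ?Z = "{z \<in> X. f z \<in> Y}"
    have "f ` ?Z = Y" using Y by blast
    then have "conn ?Z" using iso_conn[OF assms(1), of ?Z] Y assms(2) by auto
    moreover have "?Z \<subseteq> X" "x \<in> ?Z" using assms(3) Y by auto
    ultimately have "?Z \<subseteq> component X x" unfolding component_def by (intro Union_upper) simp
    then show "y \<in> f ` component X x" using Y by blast
  qed
qed

text \<open>By \<open>im\<close> the images meet only in the image of the overlap. On both sides no
  edge joins the two private parts, so every edge is decided by \<open>f\<close> or by
  \<open>g\<close> alone.\<close>

lemma iso_glue:
  assumes f: "iso f A A'" and g: "iso g B B'"
    and fg: "\<And>x. x \<in> A \<Longrightarrow> x \<in> B \<Longrightarrow> f x = g x" and im: "f ` (A \<inter> B) = A' \<inter> B'"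
    and sep: "\<And>x y. x \<in> A - B \<Longrightarrow> y \<in> B - A \<Longrightarrow> \<not> E x y"
    and sep': "\<And>x y. x \<in> A' - B' \<Longrightarrow> y \<in> B' - A' \<Longrightarrow> \<not> E x y"
  shows "iso (\<lambda>x. if x \<in> A then f x else g x) (A \<union> B) (A' \<union> B')"
proof -
  let ?h = "\<lambda>x. if x \<in> A then f x else g x"
  have hB: "?h x = g x" if "x \<in> B" for x using that fg by simp
  have img: "g ` (A \<inter> B) = A' \<inter> B'" using im fg by (metis IntE image_cong)
  have fA: "f x \<in> A' - B'" if "x \<in> A - B" for x
    using that im iso_image[OF f] iso_inj[OF f] unfolding inj_on_def by blast
  have gB: "g x \<in> B' - A'" if "x \<in> B - A" for x
    using that img iso_image[OF g] iso_inj[OF g] unfolding inj_on_def by blast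
  have inj: "inj_on ?h (A \<union> B)"
  proof (rule inj_onI)
    fix x y assume xy: "x \<in> A \<union> B" "y \<in> A \<union> B" "?h x = ?h y"
    consider "x \<in> A" "y \<in> A" | "x \<in> B" "y \<in> B" | "x \<in> A - B" "y \<in> B - A" | "x \<in> B - A" "y \<in> A - B"
      using xy by blast
    then show "x = y"
    proof cases
      case 1 then show ?thesis using xy iso_inj[OF f] by (simp add: inj_on_def)
    next
      case 2 then show ?thesis using xy hB iso_inj[OF g] by (metis inj_onD)
    next
      case 3 then show ?thesis using xy fA[of x] gB[of y] by auto
    next
      case 4 then show ?thesis using xy fA[of y] gB[of x] by auto
    qed
  qed
  have "?h ` (A \<union> B) = ?h ` A \<union> ?h ` B" by (rule image_Un)
  also have "?h ` A = A'" using iso_image[OF f] by simp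
  also have "?h ` B = g ` B" by (rule image_cong) (use hB in auto)
  also have "g ` B = B'" using iso_image[OF g] .
  finally have "bij_betw ?h (A \<union> B) (A' \<union> B')" unfolding bij_betw_def using inj by simp
  moreover have "E x y \<longleftrightarrow> E (?h x) (?h y)" if xy: "x \<in> A \<union> B" "y \<in> A \<union> B" for x y
  proof -
    consider "x \<in> A" "y \<in> A" | "x \<in> B" "y \<in> B" | "x \<in> A - B" "y \<in> B - A" | "x \<in> B - A" "y \<in> A - B"
      using xy by blast
    then show ?thesis
    proof cases
      case 1 then show ?thesis using iso_edge[OF f] by simp
    next
      case 2 then show ?thesis using hB iso_edge[OF g] by metis
    next
      case 3
      then have "\<not> E x y" "\<not> E (f x) (g y)" using sep sep' fA gB by blast+
      then show ?thesis using 3 by simp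
    next
      case 4
      then have "\<not> E x y" "\<not> E (g x) (f y)" using sep sep' fA gB E_sym by blast+
      then show ?thesis using 4 by simp
    qed
  qed
  ultimately show ?thesis unfolding iso_def by blast
qed

text \<open>The sets pairwise meet in a common core \<open>C\<close>, without edges between their
  private parts. The core is the root when branches are glued and empty when components are.\<close>

lemma iso_glue_family:
  assumes "finite \<P>" "matched (\<lambda>P P'. \<exists>f. iso f P P' \<and> (\<forall>x\<in>C. f x = f0 x)) \<P> \<P>'"
    and "iso f0 C C'"
    and "\<And>P. P \<in> \<P> \<Longrightarrow> C \<subseteq> P" "\<And>P. P \<in> \<P>' \<Longrightarrow> C' \<subseteq> P"
    and "\<And>P Q. P \<in> \<P> \<Longrightarrow> Q \<in> \<P> \<Longrightarrow> P \<noteq> Q \<Longrightarrow> P \<inter> Q \<subseteq> C"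
    and "\<And>P Q x y. P \<in> \<P> \<Longrightarrow> Q \<in> \<P> \<Longrightarrow> P \<noteq> Q \<Longrightarrow> x \<in> P - C \<Longrightarrow> y \<in> Q - C \<Longrightarrow> \<not> E x y"
    and "\<And>P Q. P \<in> \<P>' \<Longrightarrow> Q \<in> \<P>' \<Longrightarrow> P \<noteq> Q \<Longrightarrow> P \<inter> Q \<subseteq> C'"
    and "\<And>P Q x y. P \<in> \<P>' \<Longrightarrow> Q \<in> \<P>' \<Longrightarrow> P \<noteq> Q \<Longrightarrow> x \<in> P - C' \<Longrightarrow> y \<in> Q - C' \<Longrightarrow> \<not> E x y"
  shows "\<exists>f. iso f (C \<union> \<Union>\<P>) (C' \<union> \<Union>\<P>') \<and> (\<forall>x\<in>C. f x = f0 x)"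
  using assms
proof (induction \<P> arbitrary: \<P>' rule: finite_induct)
  case empty
  then have "\<P>' = {}" unfolding matched_def bij_betw_def by simp
  then show ?case using empty by auto
next
  case (insert P \<P>)
  obtain \<phi> where p: "bij_betw \<phi> (insert P \<P>) \<P>'"
    "\<And>Q. Q \<in> insert P \<P> \<Longrightarrow> \<exists>f. iso f Q (\<phi> Q) \<and> (\<forall>x\<in>C. f x = f0 x)"
    using insert.prems(1) unfolding matched_def by blast
  define \<P>'' where "\<P>'' = \<phi> ` \<P>"
  have P': "\<P>' = insert (\<phi> P) \<P>''" "\<phi> P \<notin> \<P>''"
    using p(1) insert.hyps(2) unfolding bij_betw_def \<P>''_def by auto
  have m: "matched (\<lambda>P P'. \<exists>f. iso f P P' \<and> (\<forall>x\<in>C. f x = f0 x)) \<P> \<P>''"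
    unfolding matched_def \<P>''_def using p by (intro exI[of _ \<phi>]) (auto simp: bij_betw_def)
  have "\<exists>f. iso f (C \<union> \<Union>\<P>) (C' \<union> \<Union>\<P>'') \<and> (\<forall>x\<in>C. f x = f0 x)"
  proof (rule insert.IH[OF m insert.prems(2)])
    show "\<And>P. P \<in> \<P> \<Longrightarrow> C \<subseteq> P" using insert.prems(3) by blast
    show "\<And>P. P \<in> \<P>'' \<Longrightarrow> C' \<subseteq> P" using insert.prems(4) P'(1) by blast
    show "\<And>P Q. P \<in> \<P> \<Longrightarrow> Q \<in> \<P> \<Longrightarrow> P \<noteq> Q \<Longrightarrow> P \<inter> Q \<subseteq> C" using insert.prems(5) by simp
    show "\<And>P Q x y. P \<in> \<P> \<Longrightarrow> Q \<in> \<P> \<Longrightarrow> P \<noteq> Q \<Longrightarrow> x \<in> P - C \<Longrightarrow> y \<in> Q - C \<Longrightarrow> \<not> E x y"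
      using insert.prems(6) by (meson insertCI)
    show "\<And>P Q. P \<in> \<P>'' \<Longrightarrow> Q \<in> \<P>'' \<Longrightarrow> P \<noteq> Q \<Longrightarrow> P \<inter> Q \<subseteq> C'" using insert.prems(7) P'(1) by simp
    show "\<And>P Q x y. P \<in> \<P>'' \<Longrightarrow> Q \<in> \<P>'' \<Longrightarrow> P \<noteq> Q \<Longrightarrow> x \<in> P - C' \<Longrightarrow> y \<in> Q - C' \<Longrightarrow> \<not> E x y"
      using insert.prems(8) P'(1) by (meson insertCI)
  qed
  then obtain g where g: "iso g (C \<union> \<Union>\<P>) (C' \<union> \<Union>\<P>'')" "\<And>x. x \<in> C \<Longrightarrow> g x = f0 x" by blast
  obtain f where f: "iso f P (\<phi> P)" "\<And>x. x \<in> C \<Longrightarrow> f x = f0 x" using p(2)[of P] by blast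
  have i: "P \<inter> (C \<union> \<Union>\<P>) = C" using insert.prems(3)[of P] insert.prems(5)[of P] insert.hyps(2) by blast
  have i': "\<phi> P \<inter> (C' \<union> \<Union>\<P>'') = C'"
    using insert.prems(4)[of "\<phi> P"] insert.prems(7)[of "\<phi> P"] P' by blast
  have s: "\<not> E x y" if xy: "x \<in> P - (C \<union> \<Union>\<P>)" "y \<in> (C \<union> \<Union>\<P>) - P" for x y
  proof -
    obtain Q where "Q \<in> \<P>" "y \<in> Q - C" using xy i by blast
    then show ?thesis using insert.prems(6)[of P Q x y] xy i insert.hyps(2) by blast
  qed
  have s': "\<not> E x y" if xy: "x \<in> \<phi> P - (C' \<union> \<Union>\<P>'')" "y \<in> (C' \<union> \<Union>\<P>'') - \<phi> P" for x y
  proof -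
    obtain Q where "Q \<in> \<P>''" "y \<in> Q - C'" using xy i' by blast
    then show ?thesis using insert.prems(8)[of "\<phi> P" Q x y] xy i' P' by blast
  qed
  have fi: "f ` C = C'" using iso_image[OF assms(3)] f(2) by (metis image_cong)
  have "iso (\<lambda>x. if x \<in> P then f x else g x) (P \<union> (C \<union> \<Union>\<P>)) (\<phi> P \<union> (C' \<union> \<Union>\<P>''))"
  proof (rule iso_glue[OF f(1) g(1)])
    fix x assume "x \<in> P" "x \<in> C \<union> \<Union>\<P>"
    then have "x \<in> C" using i by blast
    then show "f x = g x" using f g by simp
  qed (use i i' fi s s' in simp_all)
  moreover have "P \<union> (C \<union> \<Union>\<P>) = C \<union> \<Union>(insert P \<P>)" "\<phi> P \<union> (C' \<union> \<Union>\<P>'') = C' \<union> \<Union>\<P>'"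
    using P' by auto
  ultimately show ?case using f(2) g(2) by (intro exI[of _ "\<lambda>x. if x \<in> P then f x else g x"]) auto
qed

section \<open>Rooted trees\<close>

definition deep :: "nat \<Rightarrow> 'v set \<Rightarrow> 'v \<Rightarrow> bool" where
  "deep h W c \<longleftrightarrow> (\<exists>xs. path xs \<and> length xs = Suc h \<and> hd xs = c \<and> set xs \<subseteq> W)"

definition leg :: "nat \<Rightarrow> 'v set \<Rightarrow> 'v \<Rightarrow> bool" where
  "leg h L c \<longleftrightarrow> (\<exists>xs. path xs \<and> length xs = Suc h \<and> hd xs = c \<and> set xs = L)"

text \<open>The root belongs to each of its branches, which are thus trees with the same root and
  overlap only there.\<close>

definition branch :: "'v set \<Rightarrow> 'v \<Rightarrow> 'v \<Rightarrow> 'v set" where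
  "branch V c x = insert c (component (V - {c}) x)"

definition subtrees :: "'v set \<Rightarrow> 'v \<Rightarrow> 'v set set" where
  "subtrees V c = {W. W \<subseteq> V \<and> c \<in> W \<and> conn W}"

text \<open>Branches are represented by the neighbours of the root. With the centre as root and
  \<open>h\<close> the radius, these are the branches of full depth; for \<open>h = 1\<close> they
  are all branches.\<close>

definition radial :: "nat \<Rightarrow> 'v set \<Rightarrow> 'v \<Rightarrow> 'v set" where
  "radial h V c = {x \<in> nbs V c. deep h (branch V c x) c}"

definition radial_part :: "nat \<Rightarrow> 'v set \<Rightarrow> 'v \<Rightarrow> 'v set" where
  "radial_part h V c = insert c (\<Union>x\<in>radial h V c. branch V c x)"

text \<open>The known data of the rooted problem. For \<open>q = 1\<close> these are the proper
  subtrees of depth at least \<open>h\<close>; for \<open>q = 2\<close> they contain a path of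
  \<open>2 * h\<close> edges with the root in the middle, which makes the root recognisable.\<close>

definition proper_radial :: "nat \<Rightarrow> nat \<Rightarrow> 'v set \<Rightarrow> 'v \<Rightarrow> 'v set set" where
  "proper_radial q h V c = {W \<in> subtrees V c. q \<le> card (radial h W c) \<and> W \<noteq> V}"

definition rtree :: "'v set \<Rightarrow> 'v \<Rightarrow> bool" where
  "rtree V c \<longleftrightarrow> forest_on V \<and> conn V \<and> c \<in> V"

section \<open>Branches at the root\<close>

lemma rtree_finite: "rtree V c \<Longrightarrow> finite V"
  unfolding rtree_def using forest_finite by blast

lemma nbs_in: "x \<in> nbs V c \<Longrightarrow> x \<in> V \<and> x \<noteq> c \<and> x \<in> V - {c} \<and> E c x"
  unfolding nbs_def using E_irrefl by auto

text \<open>Branches that meet outside the root are the same component of \<open>V - {c}\<close>, a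
  connected set in which \<open>c\<close> has only one neighbour.\<close>

lemma branch_disjoint:
  assumes "rtree V c" "x \<in> nbs V c" "y \<in> nbs V c" "x \<noteq> y"
  shows "branch V c x \<inter> branch V c y = {c}"
proof -
  have "component (V - {c}) x \<inter> component (V - {c}) y = {}"
  proof (rule ccontr)
    assume "\<not> ?thesis"
    then obtain z where "z \<in> component (V - {c}) x" "z \<in> component (V - {c}) y" by blast
    then have e: "component (V - {c}) x = component (V - {c}) y" using component_eq by blast
    have f: "forest_on V" "c \<in> V" using assms(1) unfolding rtree_def by auto
    have x: "x \<in> V - {c}" "E c x" and y: "y \<in> V - {c}" "E c y" using nbs_in assms(2,3) by blast+
    have s: "component (V - {c}) x \<subseteq> V" "c \<notin> component (V - {c}) x" using component_subset by blast+
    have m: "x \<in> component (V - {c}) x" "y \<in> component (V - {c}) x" using component_self[OF x(1)] component_self[OF y(1)] e by auto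
    have "x = y" using forest_unique_nbs[OF f(1) s(1) conn_component[OF x(1)] f(2) s(2) m x(2) y(2)] .
    then show False using assms(4) by blast
  qed
  then show ?thesis unfolding branch_def by blast
qed

lemma branch_subset: "c \<in> V \<Longrightarrow> branch V c x \<subseteq> V"
  unfolding branch_def using component_subset by blast

lemma branch_self: "x \<in> nbs V c \<Longrightarrow> x \<in> branch V c x \<and> c \<in> branch V c x"
  unfolding branch_def using component_self nbs_in by blast

lemma branch_conn: "x \<in> nbs V c \<Longrightarrow> conn (branch V c x)"
  unfolding branch_def
  using conn_insert[OF conn_component[of x "V - {c}"] component_self[of x "V - {c}"], of c] nbs_in[of x V c] E_sym[of c x]
  by simp

lemma branch_in_subtrees: "c \<in> V \<Longrightarrow> x \<in> nbs V c \<Longrightarrow> branch V c x \<in> subtrees V c"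
  unfolding subtrees_def using branch_subset[of c V x] branch_self[of x V c] branch_conn[of x V c] by simp

text \<open>As \<open>V\<close> is connected, some edge leaves the component of a vertex in
  \<open>V - {c}\<close>, and it can only lead to \<open>c\<close>; its inner end is the neighbour
  sought.\<close>

lemma branch_cover:
  assumes "rtree V c"
  shows "V = insert c (\<Union>x\<in>nbs V c. branch V c x)"
proof
  have cV: "c \<in> V" using assms rtree_def by blast
  show "insert c (\<Union>x\<in>nbs V c. branch V c x) \<subseteq> V" using branch_subset[OF cV] cV by blast
  show "V \<subseteq> insert c (\<Union>x\<in>nbs V c. branch V c x)"
  proof
    fix y assume y: "y \<in> V"
    show "y \<in> insert c (\<Union>x\<in>nbs V c. branch V c x)"
    proof (cases "y = c")
      case False
      let ?Z = "component (V - {c}) y"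
      have Z: "?Z \<subseteq> V" "?Z \<noteq> {}" "?Z \<noteq> V" using component_subset[of "V - {c}" y] component_self[of y "V - {c}"] y False cV by auto
      have "conn V" using assms rtree_def by blast
      then obtain u w where uw: "u \<in> ?Z" "w \<in> V" "w \<notin> ?Z" "E u w" using Z by (rule connE)
      then have "w = c" using component_edge[of u "V - {c}" y w] by blast
      then have "u \<in> nbs V c" unfolding nbs_def using uw Z E_sym by blast
      moreover have "y \<in> branch V c u" unfolding branch_def using component_eq[OF uw(1)] component_self[of y "V - {c}"] y False by auto
      ultimately show ?thesis by blast
    qed simp
  qed
qed

lemma branch_no_edge:
  assumes "rtree V c" "x \<in> nbs V c" "y \<in> nbs V c" "x \<noteq> y" "u \<in> branch V c x - {c}" "w \<in> branch V c y - {c}"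
  shows "\<not> E u w"
proof
  assume "E u w"
  then have "w \<in> component (V - {c}) x"
    using component_edge[of u "V - {c}" x w] assms(5,6) component_subset[of "V - {c}" y] unfolding branch_def by blast
  then have "w \<in> branch V c x" unfolding branch_def by blast
  then show False using branch_disjoint[OF assms(1-4)] assms(6) by blast
qed

lemma subtrees_rtree: "rtree V c \<Longrightarrow> W \<in> subtrees V c \<Longrightarrow> rtree W c"
  unfolding rtree_def subtrees_def using forest_subset by blast

text \<open>Passing to a subtree only trims branches: a vertex of \<open>W\<close> lies in some
  branch of \<open>W\<close>, which is contained in a branch of \<open>V\<close>, and by
  disjointness the latter is unique.\<close>

lemma branch_subtrees:
  assumes "rtree V c" "W \<in> subtrees V c" "x \<in> nbs W c"
  shows "branch W c x = W \<inter> branch V c x"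
proof
  have WV: "W \<subseteq> V" "c \<in> W" using assms(2) unfolding subtrees_def by auto
  have m: "branch W c z \<subseteq> branch V c z" for z
    unfolding branch_def using component_mono[of "W - {c}" "V - {c}" z] WV by blast
  show "branch W c x \<subseteq> W \<inter> branch V c x" using m branch_subset WV by blast
  show "W \<inter> branch V c x \<subseteq> branch W c x"
  proof
    fix y assume y: "y \<in> W \<inter> branch V c x"
    show "y \<in> branch W c x"
    proof (cases "y = c")
      case False
      then obtain z where z: "z \<in> nbs W c" "y \<in> branch W c z"
        using branch_cover[OF subtrees_rtree[OF assms(1,2)]] y by blast
      then have "z \<in> nbs V c" "x \<in> nbs V c" "y \<in> branch V c z" using m nbs_mono[OF WV(1)] assms(3) by blast+
      then have "z = x" using branch_disjoint[OF assms(1), of z x] y False by blast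
      then show ?thesis using z by simp
    qed (simp add: branch_def)
  qed
qed

lemma branch_nbs:
  assumes "rtree V c" "x \<in> nbs V c"
  shows "nbs (branch V c x) c = {x}"
proof
  show "{x} \<subseteq> nbs (branch V c x) c" using branch_self[OF assms(2)] nbs_in[OF assms(2)] unfolding nbs_def by blast
  show "nbs (branch V c x) c \<subseteq> {x}"
  proof
    fix y assume y: "y \<in> nbs (branch V c x) c"
    have "c \<in> V" using assms(1) rtree_def by blast
    then have "y \<in> nbs V c" using y nbs_mono[OF branch_subset] by blast
    then have "y \<noteq> x \<Longrightarrow> False" using branch_disjoint[OF assms(1), of y x] assms(2) nbs_in[OF y] branch_self[of y V c] by blast
    then show "y \<in> {x}" by blast
  qed
qed

lemma branch_rtree: "rtree V c \<Longrightarrow> x \<in> nbs V c \<Longrightarrow> rtree (branch V c x) c"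
  using subtrees_rtree branch_in_subtrees rtree_def by blast

lemma branch_single: "rtree V c \<Longrightarrow> nbs V c = {x} \<Longrightarrow> branch V c x = V"
  using branch_cover[of V c] branch_self[of x V c] by auto

lemma nbs_nonempty:
  assumes "rtree V c" "V \<noteq> {c}" shows "nbs V c \<noteq> {}"
  using branch_cover[OF assms(1)] assms(2) by auto

lemma subtrees_branch:
  assumes "rtree V c" "x \<in> nbs V c" "B \<in> subtrees (branch V c x) c" "B \<noteq> {c}"
  shows "nbs B c = {x}" "branch B c x = B" "B \<in> subtrees V c"
proof -
  have r: "rtree B c" using subtrees_rtree[OF branch_rtree[OF assms(1,2)] assms(3)] .
  have "nbs B c \<subseteq> {x}" using nbs_mono[of B "branch V c x" c] branch_nbs[OF assms(1,2)] assms(3) unfolding subtrees_def by blast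
  then show n: "nbs B c = {x}" using nbs_nonempty[OF r assms(4)] by blast
  show "branch B c x = B" using branch_single[OF r n] .
  show "B \<in> subtrees V c" using assms(1,3) branch_subset unfolding subtrees_def rtree_def by blast
qed

lemma subtrees_trans: "W \<in> subtrees V c \<Longrightarrow> B \<in> subtrees W c \<Longrightarrow> B \<in> subtrees V c"
  unfolding subtrees_def by blast

lemma subtrees_Un: "A \<in> subtrees V c \<Longrightarrow> B \<in> subtrees V c \<Longrightarrow> A \<union> B \<in> subtrees V c"
  unfolding subtrees_def using conn_Un by blast

lemma subtrees_Union:
  assumes "c \<in> V" "\<And>P. P \<in> \<P> \<Longrightarrow> P \<in> subtrees V c"
  shows "insert c (\<Union>\<P>) \<in> subtrees V c"
proof -
  have "conn (\<Union>(insert {c} \<P>))"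
    by (rule conn_Union[of _ c]) (use assms conn_singleton in \<open>auto simp: subtrees_def\<close>)
  then show ?thesis using assms unfolding subtrees_def by auto
qed

lemma subtrees_single_nbs:
  assumes "rtree V c" "W \<in> subtrees V c" "nbs W c = {x}"
  shows "x \<in> nbs V c" "W \<in> subtrees (branch V c x) c"
proof -
  have W: "W \<subseteq> V" "c \<in> W" "conn W" using assms(2) unfolding subtrees_def by auto
  show x: "x \<in> nbs V c" using nbs_mono[OF W(1)] assms(3) by blast
  have "W = branch W c x" using branch_single[OF subtrees_rtree[OF assms(1,2)] assms(3)] by simp
  then have "W \<subseteq> branch V c x" using branch_subtrees[OF assms(1,2), of x] assms(3) by blast
  then show "W \<in> subtrees (branch V c x) c" unfolding subtrees_def using W by blast
qed

section \<open>Depth and legs\<close>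

lemma deep_mono: "deep h W c \<Longrightarrow> W \<subseteq> W' \<Longrightarrow> deep h W' c"
  unfolding deep_def by blast

lemma deep_le:
  assumes "deep h W c" "k \<le> h" shows "deep k W c"
proof -
  obtain xs where xs: "path xs" "length xs = Suc h" "hd xs = c" "set xs \<subseteq> W"
    using assms(1) unfolding deep_def by blast
  have "hd (take (Suc k) xs) = c" using xs by (cases xs) auto
  then show ?thesis unfolding deep_def using xs assms(2) path_take[OF xs(1), of "Suc k"] set_take_subset[of "Suc k" xs]
    by (intro exI[of _ "take (Suc k) xs"]) auto
qed

lemma deep_card:
  assumes "deep h W c" "finite W" shows "Suc h \<le> card W"
  using assms unfolding deep_def by (metis card_mono distinct_card path_distinct)

lemma leg_deep: "leg h L c \<Longrightarrow> deep h L c"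
  unfolding deep_def leg_def by blast

lemma leg_card: "leg h L c \<Longrightarrow> card L = Suc h"
  unfolding leg_def using distinct_card path_distinct by metis

lemma leg_finite: "leg h L c \<Longrightarrow> finite L"
  unfolding leg_def by auto

lemma leg_in_subtrees:
  assumes "leg h L c" "L \<subseteq> V" shows "L \<in> subtrees V c"
proof -
  obtain xs where xs: "path xs" "length xs = Suc h" "hd xs = c" "set xs = L" using assms(1) unfolding leg_def by blast
  then have "xs \<noteq> []" by auto
  then show ?thesis unfolding subtrees_def using xs assms(2) conn_path[OF xs(1)] hd_in_set by blast
qed

lemma deep_obtain_leg:
  assumes "deep h W c" obtains L where "leg h L c" "L \<subseteq> W"
  using assms unfolding deep_def leg_def by blast

lemma deep_branch:
  assumes "rtree V c" "1 \<le> h" "deep h V c"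
  obtains x where "x \<in> radial h V c"
proof -
  obtain xs where xs: "path xs" "length xs = Suc h" "hd xs = c" "set xs \<subseteq> V"
    using assms(3) unfolding deep_def by blast
  then obtain x ys where e: "xs = c # x # ys" using assms(2) by (cases xs; cases "tl xs") auto
  have x: "x \<in> nbs V c" using xs e unfolding nbs_def by (auto simp: path_Cons)
  have "set (x # ys) \<subseteq> component (V - {c}) x"
  proof (rule component_maximal[of _ _ x])
    show "conn (set (x # ys))" by (rule conn_path) (use xs e in \<open>auto simp: path_Cons\<close>)
    show "x \<in> component (V - {c}) x" by (rule component_self) (use nbs_in[OF x] in blast)
  qed (use xs e in \<open>auto simp: path_Cons\<close>)
  then have "set xs \<subseteq> branch V c x" unfolding branch_def e by auto
  then have "x \<in> radial h V c" unfolding radial_def deep_def using x xs by blast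
  then show thesis using that by blast
qed

lemma radial_deep: "c \<in> V \<Longrightarrow> x \<in> radial h V c \<Longrightarrow> deep h V c"
  unfolding radial_def using deep_mono branch_subset by blast

lemma radial_subtrees:
  assumes "rtree V c" "W \<in> subtrees V c" shows "radial h W c \<subseteq> radial h V c"
proof
  fix x assume "x \<in> radial h W c"
  then have x: "x \<in> nbs W c" "deep h (branch W c x) c" unfolding radial_def by auto
  then have "x \<in> nbs V c" using assms(2) nbs_mono unfolding subtrees_def by blast
  moreover have "branch W c x \<subseteq> branch V c x" using branch_subtrees[OF assms x(1)] by blast
  ultimately show "x \<in> radial h V c" unfolding radial_def using x(2) deep_mono by blast
qed

lemma radial_finite: "finite V \<Longrightarrow> finite (radial h V c)"
  unfolding radial_def using nbs_finite by simp

section \<open>Invariance under rooted isomorphism\<close>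

lemma iso_subtrees_matched:
  assumes "rsim A a A' a'"
  shows "matched (\<lambda>B B'. rsim B a B' a') (subtrees A a) (subtrees A' a')"
proof -
  obtain f where f: "iso f A A'" "f a = a'" "a \<in> A" using assms unfolding rsim_def by blast
  have b1: "bij_betw ((`) f) (Pow A) (Pow A')" using f(1) unfolding iso_def by (simp add: bij_betw_Pow)
  have b2: "(`) f ` subtrees A a = subtrees A' a'"
  proof
    show "(`) f ` subtrees A a \<subseteq> subtrees A' a'"
      unfolding subtrees_def using iso_conn[OF f(1)] iso_image[OF f(1)] f(2) by auto
    show "subtrees A' a' \<subseteq> (`) f ` subtrees A a"
    proof
      fix B' assume B': "B' \<in> subtrees A' a'"
      let ?B = "{b \<in> A. f b \<in> B'}"
      have i: "f ` ?B = B'" using iso_image[OF f(1)] B' unfolding subtrees_def by blast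
      then have "conn ?B" using iso_conn[OF f(1), of ?B] B' unfolding subtrees_def by auto
      then have "?B \<in> subtrees A a" using f B' unfolding subtrees_def by auto
      then show "B' \<in> (`) f ` subtrees A a" using i by blast
    qed
  qed
  have b3: "subtrees A a \<subseteq> Pow A" unfolding subtrees_def by blast
  have "bij_betw ((`) f) (subtrees A a) (subtrees A' a')" by (rule bij_betw_subset[OF b1 b3 b2])
  moreover have "rsim B a (f ` B) a'" if "B \<in> subtrees A a" for B
    unfolding rsim_def using that f iso_restrict[OF f(1)] unfolding subtrees_def by blast
  ultimately show ?thesis unfolding matched_def by blast
qed

lemma iso_deep1:
  assumes "iso f W W'" "f c = c'" "deep h W c" shows "deep h W' c'"
proof -
  obtain xs where xs: "path xs" "length xs = Suc h" "hd xs = c" "set xs \<subseteq> W"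
    using assms(3) unfolding deep_def by blast
  have "xs \<noteq> []" using xs by auto
  then show ?thesis unfolding deep_def
    using iso_path[OF assms(1) xs(4)] xs iso_image[OF assms(1)] assms(2)
    by (intro exI[of _ "map f xs"]) (auto simp: hd_map)
qed

lemma rsim_deep: "rsim W c W' c' \<Longrightarrow> deep h W c \<longleftrightarrow> deep h W' c'"
  using iso_deep1 rsim_sym unfolding rsim_def by metis

lemma iso_leg1:
  assumes "iso f W W'" "f c = c'" "L \<subseteq> W" "leg h L c" shows "leg h (f ` L) c'"
proof -
  obtain xs where xs: "path xs" "length xs = Suc h" "hd xs = c" "set xs = L"
    using assms(4) unfolding leg_def by blast
  have "xs \<noteq> []" using xs by auto
  then show ?thesis unfolding leg_def
    using iso_path[OF assms(1), of xs] xs assms(2,3)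
    by (intro exI[of _ "map f xs"]) (auto simp: hd_map)
qed

lemma rsim_leg: "rsim W c W' c' \<Longrightarrow> leg h W c \<longleftrightarrow> leg h W' c'"
  using iso_leg1[of _ W W' c c' W h] iso_leg1[of _ W' W c' c W' h] rsim_sym iso_image unfolding rsim_def
  by (metis order_refl)

lemma iso_branch:
  assumes "iso f W W'" "c \<in> W" "f c = c'" "x \<in> nbs W c"
  shows "branch W' c' (f x) = f ` branch W c x"
proof -
  have "f ` (W - {c}) = W' - {c'}"
    using inj_on_image_set_diff[OF iso_inj[OF assms(1)], of W "{c}"] iso_image[OF assms(1)] assms(2,3) by auto
  then show ?thesis unfolding branch_def
    using iso_component[OF assms(1), of "W - {c}" x] nbs_in[OF assms(4)] assms(3) by auto
qed

lemma iso_nbs_root: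
  assumes "iso f W W'" "c \<in> W" "f c = c'"
  shows "nbs W' c' = f ` nbs W c"
  using iso_nbs[OF assms(1) order_refl assms(2)] iso_image[OF assms(1)] assms(3) by simp

lemma iso_branch_rsim:
  assumes "iso f W W'" "c \<in> W" "f c = c'" "x \<in> nbs W c"
  shows "rsim (branch W c x) c (branch W' c' (f x)) c'"
  unfolding iso_branch[OF assms] rsim_def
  using iso_restrict[OF assms(1) branch_subset[OF assms(2)]] assms(3) branch_self[OF assms(4)] by blast

lemma iso_radial:
  assumes "iso f W W'" "c \<in> W" "f c = c'"
  shows "radial h W' c' = f ` radial h W c"
  unfolding radial_def iso_nbs_root[OF assms]
  using rsim_deep[OF iso_branch_rsim[OF assms]] by auto

lemma iso_radial_part:
  assumes "iso f W W'" "c \<in> W" "f c = c'"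
  shows "radial_part h W' c' = f ` radial_part h W c"
proof -
  have "(\<Union>x\<in>radial h W c. branch W' c' (f x)) = (\<Union>x\<in>radial h W c. f ` branch W c x)"
    using iso_branch[OF assms] unfolding radial_def by (intro SUP_cong) auto
  then show ?thesis unfolding radial_part_def iso_radial[OF assms] using assms(3) by (auto simp: image_UN)
qed

lemma iso_card: "iso f W W' \<Longrightarrow> X \<subseteq> W \<Longrightarrow> card (f ` X) = card X"
  using iso_inj card_image inj_on_subset by blast

lemma rsim_nbs_card: "rsim W c W' c' \<Longrightarrow> card (nbs W c) = card (nbs W' c')"
  unfolding rsim_def using iso_nbs_card by metis

lemma rsim_radial_card: "rsim W c W' c' \<Longrightarrow> card (radial h W c) = card (radial h W' c')"
proof -
  assume "rsim W c W' c'"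
  then obtain f where f: "iso f W W'" "c \<in> W" "f c = c'" unfolding rsim_def by blast
  have "radial h W c \<subseteq> W" unfolding radial_def nbs_def by blast
  then show ?thesis using iso_radial[OF f] iso_card[OF f(1)] by simp
qed

lemma radial_part_subtrees:
  assumes "rtree V c" shows "radial_part h V c \<in> subtrees V c"
  unfolding radial_part_def using subtrees_Union[of c V "branch V c ` radial h V c"] branch_in_subtrees assms
  unfolding radial_def rtree_def by blast

lemma rsim_radial_part_card: "rsim W c W' c' \<Longrightarrow> rtree W c \<Longrightarrow> card (radial_part h W c) = card (radial_part h W' c')"
  unfolding rsim_def using iso_radial_part iso_card radial_part_subtrees unfolding subtrees_def by (metis (no_types, lifting) mem_Collect_eq)

section \<open>Kelly counting for the deep branches\<close>

definition deep_count :: "nat \<Rightarrow> 'v set \<Rightarrow> 'v \<Rightarrow> 'v set \<Rightarrow> 'v \<Rightarrow> nat" where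
  "deep_count h A a T t = card {B \<in> subtrees A a. deep h B a \<and> rsim B a T t}"

lemma deep_count_cong:
  assumes "rsim A a A' a'" shows "deep_count h A a T t = deep_count h A' a' T t"
  unfolding deep_count_def
proof (rule matched_card[OF iso_subtrees_matched[OF assms]])
  fix B B' assume "rsim B a B' a'"
  then show "deep h B a \<and> rsim B a T t \<longleftrightarrow> deep h B' a' \<and> rsim B' a' T t"
    using rsim_deep rsim_sym rsim_trans by meson
qed

lemma subtrees_finite: "finite V \<Longrightarrow> finite (subtrees V c)"
  unfolding subtrees_def by simp

text \<open>An instance of \<open>weighted_class_totals\<close>: deep subtrees of a given rooted
  type are the patterns, and the number of vertices is the size. The weights stay free; they are 1
  for rooted trees, and later the numbers of legs in the other branches.\<close>

lemma branch_class_totals: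
  assumes V: "rtree V c" and V': "rtree V' c'"
    and hyp: "\<And>T t. (T, t) \<in> (\<lambda>x. (branch V c x, c)) ` radial h V c \<union> (\<lambda>x. (branch V' c' x, c')) ` radial h V' c' \<Longrightarrow>
      (\<Sum>x\<in>radial h V c. w x * deep_count h (branch V c x) c T t) = (\<Sum>x\<in>radial h V' c'. w' x * deep_count h (branch V' c' x) c' T t)"
  shows "(\<Sum>x\<in>{x \<in> radial h V c. rooted_type (branch V c x, c) = \<tau>}. w x) = (\<Sum>x\<in>{x \<in> radial h V' c'. rooted_type (branch V' c' x, c') = \<tau>}. w' x)"
proof -
  \<comment> \<open>The same vertex may be a neighbour of both roots, so tags record the tree to
    which a branch belongs.\<close>
  let ?A = "Inl ` radial h V c :: ('v + 'v) set" and ?B = "Inr ` radial h V' c' :: ('v + 'v) set"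
  define ob where "ob = case_sum (\<lambda>x. (branch V c x, c)) (\<lambda>x. (branch V' c' x, c'))"
  have obc: "\<exists>A a. ob i = (A, a) \<and> rtree A a \<and> deep h A a" if "i \<in> ?A \<union> ?B" for i
    using that branch_rtree[OF V] branch_rtree[OF V'] unfolding ob_def radial_def by auto
  have "(\<Sum>a\<in>{a \<in> ?A. rooted_type (ob a) = \<tau>}. case_sum w w' a) = (\<Sum>b\<in>{b \<in> ?B. rooted_type (ob b) = \<tau>}. case_sum w w' b)"
  proof (rule weighted_class_totals[where N = "\<lambda>i j. deep_count h (fst (ob i)) (snd (ob i)) (fst (ob j)) (snd (ob j))"
        and sz = "\<lambda>i. card (fst (ob i))"])
    show "finite ?A" "finite ?B" using radial_finite rtree_finite V V' by blast+
  next
    fix i i' t assume a: "i \<in> ?A \<union> ?B" "i' \<in> ?A \<union> ?B" "rooted_type (ob i) = rooted_type (ob i')"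
    obtain A b A' b' where "ob i = (A, b)" "ob i' = (A', b')" "rtree A b" "rtree A' b'" using obc a by meson
    then show "deep_count h (fst (ob i)) (snd (ob i)) (fst (ob t)) (snd (ob t)) = deep_count h (fst (ob i')) (snd (ob i')) (fst (ob t)) (snd (ob t))"
      using a(3) deep_count_cong rooted_type_eq by (simp add: rtree_def)
  next
    fix t assume "t \<in> ?A \<union> ?B"
    then obtain A b where o: "ob t = (A, b)" "rtree A b" "deep h A b" using obc by blast
    then have "A \<in> {B \<in> subtrees A b. deep h B b \<and> rsim B b A b}"
      unfolding subtrees_def rtree_def using rsim_refl by blast
    then show "0 < deep_count h (fst (ob t)) (snd (ob t)) (fst (ob t)) (snd (ob t))"
      unfolding deep_count_def using o subtrees_finite[OF rtree_finite[OF o(2)]] by (auto simp: card_gt_0_iff)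
  next
    fix i t assume a: "i \<in> ?A \<union> ?B" "t \<in> ?A \<union> ?B" "0 < deep_count h (fst (ob i)) (snd (ob i)) (fst (ob t)) (snd (ob t))"
    obtain A b T u where o: "ob i = (A, b)" "ob t = (T, u)" "rtree A b" "rtree T u" using obc a by meson
    then obtain B where B: "B \<in> subtrees A b" "rsim B b T u" using a(3) unfolding deep_count_def by (auto simp: card_gt_0_iff)
    have BA: "B \<subseteq> A" using B unfolding subtrees_def by blast
    show "rooted_type (ob i) = rooted_type (ob t) \<or> card (fst (ob t)) < card (fst (ob i))"
    proof (cases "B = A")
      case True
      then show ?thesis using B o rooted_type_eq by (simp add: rtree_def)
    next
      case False
      then have "card B < card A" using BA rtree_finite[OF o(3)] by (intro psubset_card_mono) auto
      then show ?thesis using rsim_card[OF B(2)] o by simp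
    qed
  next
    fix t assume "t \<in> ?A \<union> ?B"
    then have "ob t \<in> (\<lambda>x. (branch V c x, c)) ` radial h V c \<union> (\<lambda>x. (branch V' c' x, c')) ` radial h V' c'"
      unfolding ob_def by auto
    then show "(\<Sum>a\<in>?A. case_sum w w' a * deep_count h (fst (ob a)) (snd (ob a)) (fst (ob t)) (snd (ob t))) =
      (\<Sum>b\<in>?B. case_sum w w' b * deep_count h (fst (ob b)) (snd (ob b)) (fst (ob t)) (snd (ob t)))"
      using hyp[of "fst (ob t)" "snd (ob t)"] by (simp add: sum.reindex ob_def)
  qed
  moreover have "{a \<in> ?A. rooted_type (ob a) = \<tau>} = Inl ` {x \<in> radial h V c. rooted_type (branch V c x, c) = \<tau>}"
    "{a \<in> ?B. rooted_type (ob a) = \<tau>} = Inr ` {x \<in> radial h V' c'. rooted_type (branch V' c' x, c') = \<tau>}"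
    unfolding ob_def by auto
  ultimately show ?thesis by (simp add: sum.reindex)
qed

lemma radial_one:
  assumes "rtree V c" shows "radial 1 V c = nbs V c"
proof -
  have "deep 1 (branch V c x) c" if x: "x \<in> nbs V c" for x
    unfolding deep_def using nbs_in[OF x] branch_self[OF x]
    by (intro exI[of _ "[c, x]"]) (auto simp: path_def)
  then show ?thesis unfolding radial_def by auto
qed

section \<open>Splitting off the radial branches\<close>

definition rest :: "nat \<Rightarrow> 'v set \<Rightarrow> 'v \<Rightarrow> 'v set" where
  "rest h V c = insert c (V - radial_part h V c)"

lemma rest_subtrees:
  assumes "rtree V c" shows "rest h V c \<in> subtrees V c"
proof -
  have cV: "c \<in> V" using assms rtree_def by blast
  have "rest h V c = insert c (\<Union>(branch V c ` (nbs V c - radial h V c)))" (is "_ = ?R")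
  proof
    show "rest h V c \<subseteq> ?R"
    proof
      fix y assume y: "y \<in> rest h V c"
      show "y \<in> ?R"
      proof (cases "y = c")
        case False
        then have "y \<in> V" "y \<notin> radial_part h V c" using y unfolding rest_def by auto
        then obtain x where x: "x \<in> nbs V c" "y \<in> branch V c x" using branch_cover[OF assms] False by blast
        then have "x \<notin> radial h V c" using \<open>y \<notin> radial_part h V c\<close> unfolding radial_part_def by blast
        then show ?thesis using x by blast
      qed simp
    qed
    show "?R \<subseteq> rest h V c"
    proof
      fix y assume y: "y \<in> ?R"
      show "y \<in> rest h V c"
      proof (cases "y = c")
        case False
        then obtain x where x: "x \<in> nbs V c" "x \<notin> radial h V c" "y \<in> branch V c x" using y by blast
        have "y \<notin> branch V c z" if "z \<in> radial h V c" for z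
        proof -
          have "z \<in> nbs V c" "z \<noteq> x" using that x unfolding radial_def by auto
          then show ?thesis using branch_disjoint[OF assms, of z x] x False by blast
        qed
        then have "y \<notin> radial_part h V c" using False unfolding radial_part_def by blast
        moreover have "y \<in> V" using branch_subset[OF cV] x(3) by blast
        ultimately show ?thesis unfolding rest_def by blast
      qed (simp add: rest_def)
    qed
  qed
  then show ?thesis using subtrees_Union[OF cV, of "branch V c ` (nbs V c - radial h V c)"] branch_in_subtrees[OF cV] by auto
qed

lemma radial_part_rest:
  assumes "rtree V c"
  shows "radial_part h V c \<union> rest h V c = V" "radial_part h V c \<inter> rest h V c = {c}"
  using radial_part_subtrees[OF assms, of h] assms unfolding rest_def subtrees_def rtree_def by auto

lemma radial_part_rest_card:
  assumes "rtree V c"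
  shows "card (radial_part h V c) + card (rest h V c) = card V + 1"
proof -
  have "finite V" using rtree_finite assms by blast
  then have "finite (radial_part h V c)" "finite (rest h V c)"
    using radial_part_rest[OF assms, of h] by (metis finite_Un)+
  then show ?thesis using card_Un_Int[of "radial_part h V c" "rest h V c"] radial_part_rest[OF assms, of h] by simp
qed

lemma radial_part_rest_no_edge:
  assumes "rtree V c" "u \<in> radial_part h V c" "w \<in> rest h V c" "u \<noteq> c" "w \<noteq> c"
  shows "\<not> E u w"
proof -
  obtain x where x: "x \<in> radial h V c" "u \<in> branch V c x" using assms(2,4) unfolding radial_part_def by blast
  have "w \<in> V" using rest_subtrees[OF assms(1)] assms(3) unfolding subtrees_def by blast
  then obtain y where y: "y \<in> nbs V c" "w \<in> branch V c y" using branch_cover[OF assms(1)] assms(5) by blast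
  have "y \<noteq> x" using assms(3,5) x(1) y(2) unfolding rest_def radial_part_def by blast
  then show ?thesis using branch_no_edge[OF assms(1), of x y u w] x y assms unfolding radial_def by blast
qed

text \<open>Such a subtree keeps all radial branches of \<open>V\<close> intact, and it gains no
  others, since radial branches of a subtree come from radial branches of \<open>V\<close>.\<close>

lemma radial_restore:
  assumes "rtree V c" "W \<in> subtrees V c" "radial_part h V c \<subseteq> W"
  shows "radial h W c = radial h V c" "radial_part h W c = radial_part h V c"
proof -
  have b: "x \<in> nbs W c \<and> branch W c x = branch V c x" if x: "x \<in> radial h V c" for x
  proof -
    have "branch V c x \<subseteq> W" using x assms(3) unfolding radial_part_def by blast
    moreover have "x \<in> nbs V c" using x unfolding radial_def by blast
    ultimately have n: "x \<in> nbs W c" using branch_self[of x V c] unfolding nbs_def by blast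
    then show ?thesis using branch_subtrees[OF assms(1,2) n] \<open>branch V c x \<subseteq> W\<close> by blast
  qed
  have "radial h V c \<subseteq> radial h W c"
  proof
    fix x assume x: "x \<in> radial h V c"
    then have "deep h (branch V c x) c" unfolding radial_def by blast
    then show "x \<in> radial h W c" unfolding radial_def using b[OF x] by simp
  qed
  then show e: "radial h W c = radial h V c" using radial_subtrees[OF assms(1,2)] by blast
  show "radial_part h W c = radial_part h V c" unfolding radial_part_def e using b by auto
qed

lemma radial_part_mono:
  assumes "rtree V c" "W \<in> subtrees V c" shows "radial_part h W c \<subseteq> radial_part h V c"
proof -
  have "branch W c x \<subseteq> branch V c x" if "x \<in> radial h W c" for x
    using branch_subtrees[OF assms, of x] that unfolding radial_def by blast
  then show ?thesis using radial_subtrees[OF assms, of h] unfolding radial_part_def by blast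
qed

text \<open>
  Once the radial branches are known, the subtrees containing all of them show the proper subtrees
  of the remaining part.
\<close>

lemma rooted_finish:
  assumes V: "rtree V c" and V': "rtree V' c'" and card: "card V = card V'"
    and q: "q \<le> card (radial h V c)" "q \<le> card (radial h V' c')" and ne: "radial h V c \<noteq> {}"
    and m: "matched (\<lambda>W W'. rsim W c W' c') (proper_radial q h V c) (proper_radial q h V' c')"
    and cls: "\<And>\<tau>. card {x \<in> radial h V c. rooted_type (branch V c x, c) = \<tau>} = card {x \<in> radial h V' c'. rooted_type (branch V' c' x, c') = \<tau>}"
    and rec: "\<And>N N'. rtree N c \<Longrightarrow> rtree N' c' \<Longrightarrow> N \<subset> V \<Longrightarrow> card N = card N' \<Longrightarrow> N \<noteq> {c} \<Longrightarrow> N' \<noteq> {c'} \<Longrightarrow>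
      matched (\<lambda>W W'. rsim W c W' c') (proper_radial 1 1 N c) (proper_radial 1 1 N' c') \<Longrightarrow> rsim N c N' c'"
  shows "rsim V c V' c'"
proof -
  let ?R = "radial_part h V c" and ?R' = "radial_part h V' c'"
  let ?N = "rest h V c" and ?N' = "rest h V' c'"
  have finV: "finite V" "finite V'" using rtree_finite V V' by auto
  \<comment> \<open>The hypothesis counts neighbours, whereas branches are glued. Distinct
    neighbours have distinct branches, as a branch contains only one neighbour of the root.\<close>
  have P: "card {P \<in> branch V c ` radial h V c. rooted_type (P, c) = \<tau>} = card {x \<in> radial h V c. rooted_type (branch V c x, c) = \<tau>}"
    if V: "rtree V c" for V c and \<tau> :: "('v set \<times> 'v) set"
  proof -
    have "{P \<in> branch V c ` radial h V c. rooted_type (P, c) = \<tau>} = branch V c ` {x \<in> radial h V c. rooted_type (branch V c x, c) = \<tau>}" by blast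
    moreover have "inj_on (branch V c) {x \<in> radial h V c. rooted_type (branch V c x, c) = \<tau>}"
    proof (rule inj_onI)
      fix x y assume a: "x \<in> {x \<in> radial h V c. rooted_type (branch V c x, c) = \<tau>}" "y \<in> {x \<in> radial h V c. rooted_type (branch V c x, c) = \<tau>}"
        "branch V c x = branch V c y"
      then have "x \<in> nbs V c" "y \<in> nbs V c" unfolding radial_def by auto
      then have "{x} = {y}" using branch_nbs[OF V, of x] branch_nbs[OF V, of y] a(3) by metis
      then show "x = y" by simp
    qed
    ultimately show ?thesis by (simp add: card_image)
  qed
  have "matched (\<lambda>P P'. rooted_type (P, c) = rooted_type (P', c')) (branch V c ` radial h V c) (branch V' c' ` radial h V' c')"
    using P[OF V] P[OF V'] cls finV by (intro matched_by_class_card) (auto simp: radial_finite)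
  then have mP: "matched (\<lambda>P P'. \<exists>f. iso f P P' \<and> (\<forall>x\<in>{c}. f x = (\<lambda>_. c') x)) (branch V c ` radial h V c) (branch V' c' ` radial h V' c')"
  proof (rule matched_mono)
    fix P P' assume a: "P \<in> branch V c ` radial h V c" "P' \<in> branch V' c' ` radial h V' c'" "rooted_type (P, c) = rooted_type (P', c')"
    have "c \<in> P" "c' \<in> P'" using a unfolding branch_def by auto
    then have "rsim P c P' c'" using a(3) rooted_type_eq by blast
    then show "\<exists>f. iso f P P' \<and> (\<forall>x\<in>{c}. f x = (\<lambda>_. c') x)" unfolding rsim_def by auto
  qed
  have dj: "P \<inter> Q \<subseteq> {c}" "\<And>x y. x \<in> P - {c} \<Longrightarrow> y \<in> Q - {c} \<Longrightarrow> \<not> E x y"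
    if pq: "rtree V c" "P \<in> branch V c ` radial h V c" "Q \<in> branch V c ` radial h V c" "P \<noteq> Q" for V c P Q
  proof -
    obtain x where x: "x \<in> nbs V c" "P = branch V c x" using pq(2) unfolding radial_def by blast
    obtain y where y: "y \<in> nbs V c" "Q = branch V c y" using pq(3) unfolding radial_def by blast
    have "x \<noteq> y" using x(2) y(2) pq(4) by blast
    then show "P \<inter> Q \<subseteq> {c}" "\<And>x y. x \<in> P - {c} \<Longrightarrow> y \<in> Q - {c} \<Longrightarrow> \<not> E x y"
      using branch_disjoint[OF pq(1) x(1) y(1)] branch_no_edge[OF pq(1) x(1) y(1)] x(2) y(2) by auto
  qed
  have "\<exists>f. iso f ({c} \<union> \<Union>(branch V c ` radial h V c)) ({c'} \<union> \<Union>(branch V' c' ` radial h V' c')) \<and> (\<forall>x\<in>{c}. f x = (\<lambda>_. c') x)"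
  proof (rule iso_glue_family[OF _ mP])
    show "finite (branch V c ` radial h V c)" using finV radial_finite by blast
    show "iso (\<lambda>_. c') {c} {c'}" unfolding iso_def using E_irrefl by auto
    show "\<And>P. P \<in> branch V c ` radial h V c \<Longrightarrow> {c} \<subseteq> P" "\<And>P. P \<in> branch V' c' ` radial h V' c' \<Longrightarrow> {c'} \<subseteq> P"
      unfolding branch_def by auto
    show "\<And>P Q. P \<in> branch V c ` radial h V c \<Longrightarrow> Q \<in> branch V c ` radial h V c \<Longrightarrow> P \<noteq> Q \<Longrightarrow> P \<inter> Q \<subseteq> {c}"
      using dj(1)[OF V] .
    show "\<And>P Q. P \<in> branch V' c' ` radial h V' c' \<Longrightarrow> Q \<in> branch V' c' ` radial h V' c' \<Longrightarrow> P \<noteq> Q \<Longrightarrow> P \<inter> Q \<subseteq> {c'}"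
      using dj(1)[OF V'] .
    show "\<And>P Q x y. P \<in> branch V c ` radial h V c \<Longrightarrow> Q \<in> branch V c ` radial h V c \<Longrightarrow> P \<noteq> Q \<Longrightarrow> x \<in> P - {c} \<Longrightarrow> y \<in> Q - {c} \<Longrightarrow> \<not> E x y"
      using dj(2)[OF V] .
    show "\<And>P Q x y. P \<in> branch V' c' ` radial h V' c' \<Longrightarrow> Q \<in> branch V' c' ` radial h V' c' \<Longrightarrow> P \<noteq> Q \<Longrightarrow> x \<in> P - {c'} \<Longrightarrow> y \<in> Q - {c'} \<Longrightarrow> \<not> E x y"
      using dj(2)[OF V'] .
  qed
  then obtain f where f: "iso f ?R ?R'" "f c = c'" unfolding radial_part_def by auto
  have cR: "card ?R = card ?R'" using f(1) unfolding iso_def using bij_betw_same_card by blast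
  have cN: "card ?N = card ?N'" using radial_part_rest_card[OF V, of h] radial_part_rest_card[OF V', of h] cR card by linarith
  have N: "rtree ?N c" "rtree ?N' c'" using subtrees_rtree rest_subtrees V V' by blast+
  have glue: "rsim V c V' c'" if r: "rsim ?N c ?N' c'"
  proof -
    obtain g where g: "iso g ?N ?N'" "g c = c'" using r unfolding rsim_def by blast
    have "iso (\<lambda>x. if x \<in> ?R then f x else g x) (?R \<union> ?N) (?R' \<union> ?N')"
    proof (rule iso_glue[OF f(1) g(1)])
      show "f x = g x" if "x \<in> ?R" "x \<in> ?N" for x
      proof -
        have "x = c" using that radial_part_rest(2)[OF V, of h] by blast
        then show ?thesis using f(2) g(2) by simp
      qed
      show "f ` (?R \<inter> ?N) = ?R' \<inter> ?N'" using radial_part_rest[OF V, of h] radial_part_rest[OF V', of h] f by simp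
      show "\<not> E x y" if "x \<in> ?R - ?N" "y \<in> ?N - ?R" for x y
        using radial_part_rest_no_edge[OF V, of x h y] that unfolding rest_def radial_part_def by blast
      show "\<not> E x y" if "x \<in> ?R' - ?N'" "y \<in> ?N' - ?R'" for x y
        using radial_part_rest_no_edge[OF V', of x h y] that unfolding rest_def radial_part_def by blast
    qed
    then have i: "iso (\<lambda>x. if x \<in> ?R then f x else g x) V V'" using radial_part_rest(1)[OF V, of h] radial_part_rest(1)[OF V', of h] by simp
    have "c \<in> ?R" "c \<in> V" using V unfolding radial_part_def rtree_def by auto
    then show ?thesis unfolding rsim_def using i f(2) by (intro conjI exI[of _ "\<lambda>x. if x \<in> ?R then f x else g x"]) auto
  qed
  show ?thesis
  proof (cases "?N = {c}")
    case True
    then have "card ?N' = 1" using cN by simp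
    then have "?N' = {c'}" unfolding rest_def using card_1_singletonE by (metis insertI1 singletonD)
    moreover have "rsim {c} c {c'} c'" unfolding rsim_def iso_def
      by (intro conjI exI[of _ "\<lambda>_. c'"]) (auto simp: E_irrefl bij_betw_def)
    ultimately show ?thesis using True glue by simp
  next
    case False
    have "card ?N \<noteq> 1" using False unfolding rest_def by (metis card_1_singletonE insertI1 singletonD)
    then have N'c: "?N' \<noteq> {c'}" using cN by auto
    \<comment> \<open>Containing the whole radial part is recognised by the size of one's own radial
      part, an invariant of rooted isomorphism. The condition \<open>card W \<noteq> k\<close> drops
      the radial part itself, which would correspond to \<open>B = {c}\<close>.\<close>
    have bij: "bij_betw (\<lambda>B. radial_part h V c \<union> B) (proper_radial 1 1 (rest h V c) c)
       {W \<in> proper_radial q h V c. card (radial_part h W c) = k \<and> card W \<noteq> k}"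
      if V: "rtree V c" and q: "q \<le> card (radial h V c)" and k: "k = card (radial_part h V c)" for V c k
    proof (rule bij_betw_byWitness[where f' = "\<lambda>W. insert c (W - radial_part h V c)"])
      let ?R = "radial_part h V c" and ?N = "rest h V c"
      have fV: "finite V" using V rtree_finite by blast
      have RV: "?R \<in> subtrees V c" using radial_part_subtrees[OF V] .
      have fR: "finite ?R" using RV fV finite_subset unfolding subtrees_def by blast
      have cR: "c \<in> ?R" unfolding radial_part_def by blast
      have NV: "?N \<in> subtrees V c" using rest_subtrees[OF V] .
      have BR: "insert c ((?R \<union> B) - ?R) = B" if "B \<in> subtrees ?N c" for B
        using that radial_part_rest(2)[OF V, of h] unfolding subtrees_def by blast
      show "\<forall>B\<in>proper_radial 1 1 ?N c. insert c ((?R \<union> B) - ?R) = B" using BR unfolding proper_radial_def by blast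
      have WR: "?R \<subseteq> W" if "W \<in> proper_radial q h V c" "card (radial_part h W c) = k" for W
      proof -
        have W: "W \<in> subtrees V c" using that proper_radial_def by blast
        have "radial_part h W c = ?R" using radial_part_mono[OF V W, of h] that(2) k fR by (metis card_subset_eq)
        then show ?thesis using radial_part_subtrees[OF subtrees_rtree[OF V W], of h] unfolding subtrees_def by blast
      qed
      show "\<forall>W\<in>{W \<in> proper_radial q h V c. card (radial_part h W c) = k \<and> card W \<noteq> k}. ?R \<union> insert c (W - ?R) = W"
        using WR cR by blast
      show "(\<lambda>B. ?R \<union> B) ` proper_radial 1 1 ?N c \<subseteq> {W \<in> proper_radial q h V c. card (radial_part h W c) = k \<and> card W \<noteq> k}"
      proof
        fix W assume "W \<in> (\<lambda>B. ?R \<union> B) ` proper_radial 1 1 ?N c"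
        then obtain B where B: "B \<in> subtrees ?N c" "1 \<le> card (radial 1 B c)" "B \<noteq> ?N" "W = ?R \<union> B" unfolding proper_radial_def by blast
        have W: "W \<in> subtrees V c" using B subtrees_Un RV subtrees_trans[OF NV] by blast
        have r: "radial h W c = radial h V c" "radial_part h W c = ?R" using radial_restore[OF V W] B(4) by blast+
        have "W \<noteq> V" using B BR[OF B(1)] unfolding rest_def by blast
        moreover have "card W \<noteq> k"
        proof
          assume "card W = k"
          moreover have "finite W" using W fV finite_subset unfolding subtrees_def by blast
          ultimately have "W = ?R" using card_subset_eq[of W ?R] B(4) k by simp
          then have "B = {c}" using BR[OF B(1)] B(4) by blast
          then have "radial 1 B c = {}" unfolding radial_def nbs_def using E_irrefl by auto
          then show False using B(2) by simp
        qed
        ultimately show "W \<in> {W \<in> proper_radial q h V c. card (radial_part h W c) = k \<and> card W \<noteq> k}"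
          unfolding proper_radial_def using W r q k by simp
      qed
      show "(\<lambda>W. insert c (W - ?R)) ` {W \<in> proper_radial q h V c. card (radial_part h W c) = k \<and> card W \<noteq> k} \<subseteq> proper_radial 1 1 ?N c"
      proof
        fix B assume "B \<in> (\<lambda>W. insert c (W - ?R)) ` {W \<in> proper_radial q h V c. card (radial_part h W c) = k \<and> card W \<noteq> k}"
        then obtain W where W: "W \<in> proper_radial q h V c" "card (radial_part h W c) = k" "card W \<noteq> k" "B = insert c (W - ?R)" by blast
        have Ws: "W \<in> subtrees V c" "W \<noteq> V" using W(1) unfolding proper_radial_def by auto
        have RW: "?R \<subseteq> W" using WR W by blast
        have "radial_part h W c = ?R" using radial_restore[OF V Ws(1) RW] by blast
        then have "B = rest h W c" unfolding rest_def using W(4) by simp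
        then have "B \<in> subtrees W c" using rest_subtrees[OF subtrees_rtree[OF V Ws(1)]] by simp
        then have Bs: "B \<in> subtrees ?N c" using W(4) Ws(1) unfolding subtrees_def rest_def by blast
        have "W \<subseteq> V" using Ws unfolding subtrees_def by blast
        then have BN: "B \<noteq> ?N" using W(4) Ws(2) RW cR unfolding rest_def by auto
        have "W \<noteq> ?R" using W(3) k by blast
        then have Bc: "B \<noteq> {c}" using W(4) RW cR by blast
        have rB: "rtree B c" using subtrees_rtree[OF subtrees_rtree[OF V NV] Bs] .
        have "1 \<le> card (radial 1 B c)"
          unfolding radial_one[OF rB] using nbs_nonempty[OF rB Bc] nbs_finite[OF rtree_finite[OF rB]]
          by (simp add: Suc_leI card_gt_0_iff)
        then show "B \<in> proper_radial 1 1 ?N c" unfolding proper_radial_def using Bs BN by blast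
      qed
    qed
    have "matched (\<lambda>W W'. rsim W c W' c') {W \<in> proper_radial q h V c. card (radial_part h W c) = card ?R \<and> card W \<noteq> card ?R}
      {W \<in> proper_radial q h V' c'. card (radial_part h W c') = card ?R \<and> card W \<noteq> card ?R}"
    proof (rule matched_restrict[OF m])
      fix W W' assume a: "W \<in> proper_radial q h V c" "rsim W c W' c'"
      then have "rtree W c" using subtrees_rtree V unfolding proper_radial_def by blast
      then show "(card (radial_part h W c) = card ?R \<and> card W \<noteq> card ?R) = (card (radial_part h W' c') = card ?R \<and> card W' \<noteq> card ?R)"
        using rsim_radial_part_card[OF a(2)] rsim_card[OF a(2)] by simp
    qed
    then have "matched (\<lambda>W W'. rsim W c W' c') (proper_radial 1 1 ?N c) (proper_radial 1 1 ?N' c')"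
    proof (rule matched_transfer[OF _ bij[OF V q(1) refl] bij[OF V' q(2) cR]])
      fix B B' assume B: "B \<in> proper_radial 1 1 ?N c" "B' \<in> proper_radial 1 1 ?N' c'" "rsim (?R \<union> B) c (?R' \<union> B') c'"
      then obtain g where g: "iso g (?R \<union> B) (?R' \<union> B')" "g c = c'" unfolding rsim_def by blast
      have Bs: "B \<in> subtrees ?N c" "B' \<in> subtrees ?N' c'" using B unfolding proper_radial_def by auto
      have W: "?R \<union> B \<in> subtrees V c" "?R' \<union> B' \<in> subtrees V' c'"
        using subtrees_Un radial_part_subtrees V V' subtrees_trans rest_subtrees Bs by meson+
      \<comment> \<open>Both sets are the radial parts of the two subtrees matched by
        \<open>g\<close>, so \<open>g\<close> respects them and hence also the remainders.\<close>
      have "?R' = g ` ?R"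
        using iso_radial_part[OF g(1) _ g(2), of h] radial_restore(2)[OF V W(1)] radial_restore(2)[OF V' W(2)] Bs(1)
        unfolding subtrees_def by simp
      moreover have "B = insert c ((?R \<union> B) - ?R)" "B' = insert c' ((?R' \<union> B') - ?R')"
        using Bs radial_part_rest(2)[OF V, of h] radial_part_rest(2)[OF V', of h] unfolding subtrees_def by blast+
      ultimately have "g ` B = B'"
        using g iso_image[OF g(1)] inj_on_image_set_diff[OF iso_inj[OF g(1)], of "?R \<union> B" ?R]
        by (metis Un_upper1 image_insert Diff_subset)
      moreover have "iso g B (g ` B)" using iso_restrict[OF g(1)] by blast
      ultimately show "rsim B c B' c'" unfolding rsim_def using g(2) Bs(1) unfolding subtrees_def by auto
    qed
    moreover have "?N \<subseteq> V" using rest_subtrees[OF V] unfolding subtrees_def by blast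
    moreover have "?N \<noteq> V"
    proof -
      obtain x where x: "x \<in> radial h V c" using ne by blast
      then have "x \<in> nbs V c" unfolding radial_def by blast
      then have "x \<in> ?R" "x \<in> V" "x \<noteq> c" using x nbs_in[of x V c] branch_self[of x V c] unfolding radial_part_def by auto
      then show "?N \<noteq> V" unfolding rest_def by blast
    qed
    ultimately have "rsim ?N c ?N' c'" using rec[OF N _ cN False N'c] by blast
    then show ?thesis by (rule glue)
  qed
qed

text \<open>A subtree in which the root has one neighbour lies in a single branch, and it is proper
  since the root of \<open>V\<close> has at least two. So all deep subtrees of the branches are
  visible, and their counts are the sums that \<open>branch_class_totals\<close> asks for.\<close>

lemma single_branch_count:
  assumes V: "rtree V c" and h: "1 \<le> h" and d: "2 \<le> card (nbs V c)"
  shows "card {W \<in> proper_radial 1 h V c. card (nbs W c) = 1 \<and> rsim W c T t} = (\<Sum>x\<in>radial h V c. deep_count h (branch V c x) c T t)"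
proof -
  let ?S = "\<lambda>x. {B \<in> subtrees (branch V c x) c. deep h B c \<and> rsim B c T t}"
  have fV: "finite V" using V rtree_finite by blast
  have S: "nbs B c = {x} \<and> branch B c x = B \<and> B \<in> subtrees V c" if "x \<in> radial h V c" "B \<in> ?S x" for x B
  proof -
    have x: "x \<in> nbs V c" using that(1) unfolding radial_def by blast
    have "B \<subseteq> V" using that(2) V branch_subset unfolding subtrees_def rtree_def by blast
    then have "B \<noteq> {c}" using that(2) deep_card[of h B c] h fV finite_subset by fastforce
    then show ?thesis using subtrees_branch[OF V x, of B] that(2) by simp
  qed
  have "{W \<in> proper_radial 1 h V c. card (nbs W c) = 1 \<and> rsim W c T t} = (\<Union>x\<in>radial h V c. ?S x)"
  proof
    show "{W \<in> proper_radial 1 h V c. card (nbs W c) = 1 \<and> rsim W c T t} \<subseteq> (\<Union>x\<in>radial h V c. ?S x)"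
    proof
      fix W assume "W \<in> {W \<in> proper_radial 1 h V c. card (nbs W c) = 1 \<and> rsim W c T t}"
      then have W: "W \<in> subtrees V c" "radial h W c \<noteq> {}" "card (nbs W c) = 1" "rsim W c T t" unfolding proper_radial_def by auto
      obtain x where x: "nbs W c = {x}" using W(3) card_1_singletonE by blast
      have xr: "x \<in> radial h W c" using W(2) x unfolding radial_def by auto
      have "deep h W c" using radial_deep[OF _ xr] W(1) unfolding subtrees_def by blast
      moreover have "x \<in> radial h V c" using radial_subtrees[OF V W(1)] xr by blast
      ultimately show "W \<in> (\<Union>x\<in>radial h V c. ?S x)" using subtrees_single_nbs[OF V W(1) x] W(4) by blast
    qed
    show "(\<Union>x\<in>radial h V c. ?S x) \<subseteq> {W \<in> proper_radial 1 h V c. card (nbs W c) = 1 \<and> rsim W c T t}"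
    proof
      fix B assume "B \<in> (\<Union>x\<in>radial h V c. ?S x)"
      then obtain x where x: "x \<in> radial h V c" "B \<in> ?S x" by blast
      note s = S[OF x]
      have "B \<noteq> V" using s d by auto
      moreover have "radial h B c \<noteq> {}" using deep_branch[OF subtrees_rtree[OF V] h, of B] s x(2) by blast
      then have "1 \<le> card (radial h B c)" using radial_finite rtree_finite[OF subtrees_rtree[OF V]] s by (simp add: Suc_leI card_gt_0_iff)
      ultimately show "B \<in> {W \<in> proper_radial 1 h V c. card (nbs W c) = 1 \<and> rsim W c T t}"
        unfolding proper_radial_def using s x(2) by simp
    qed
  qed
  moreover have "card (\<Union>x\<in>radial h V c. ?S x) = (\<Sum>x\<in>radial h V c. card (?S x))"
  proof (rule card_UN_disjoint)
    show "finite (radial h V c)" using radial_finite fV by blast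
    show "\<forall>x\<in>radial h V c. finite (?S x)" using subtrees_finite fV finite_subset[OF branch_subset] V unfolding rtree_def by simp
    show "\<forall>x\<in>radial h V c. \<forall>y\<in>radial h V c. x \<noteq> y \<longrightarrow> ?S x \<inter> ?S y = {}" using S by blast
  qed
  ultimately show ?thesis unfolding deep_count_def by simp
qed

text \<open>A small member of the family shows a second neighbour of the root. For
  \<open>h = 1\<close> the edges at the root are counted; otherwise a leg together with one more
  neighbour has at most \<open>h + 2\<close> vertices and is proper by \<open>sz\<close>.\<close>

lemma root_degree_le:
  assumes V: "rtree V c" and V': "rtree V' c'" and card: "card V = card V'" and h: "1 \<le> h"
    and dp: "deep h V' c'" and sz: "h = 1 \<or> h + 3 \<le> card V"
    and m: "matched (\<lambda>W W'. rsim W c W' c') (proper_radial 1 h V c) (proper_radial 1 h V' c')"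
    and d: "card (nbs V c) = 1"
  shows "card (nbs V' c') \<le> 1"
proof (rule ccontr)
  assume "\<not> ?thesis"
  then have d': "2 \<le> card (nbs V' c')" by simp
  have fin: "finite V" "finite V'" using V V' rtree_finite by auto
  show False
  proof (cases "h = 1")
    case True
    \<comment> \<open>An edge at the root is a proper subtree unless it is the whole tree.\<close>
    have e: "{W \<in> proper_radial 1 1 V c. card W = 2} = (\<lambda>x. {c, x}) ` nbs V c" if V: "rtree V c" and "card V \<noteq> 2" for V c
    proof
      show "{W \<in> proper_radial 1 1 V c. card W = 2} \<subseteq> (\<lambda>x. {c, x}) ` nbs V c"
      proof
        fix W assume "W \<in> {W \<in> proper_radial 1 1 V c. card W = 2}"
        then have W: "W \<in> subtrees V c" "card W = 2" unfolding proper_radial_def by auto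
        then have rW: "rtree W c" using subtrees_rtree V by blast
        have "W \<noteq> {c}" using W(2) by auto
        then obtain x where x: "x \<in> nbs W c" using nbs_nonempty[OF rW] by blast
        have "{c, x} \<subseteq> W" "c \<noteq> x" using nbs_in[OF x] rW unfolding rtree_def by auto
        then have "{c, x} = W" using W(2) rtree_finite[OF rW] by (intro card_subset_eq) auto
        then show "W \<in> (\<lambda>x. {c, x}) ` nbs V c" using x nbs_mono[of W V c] W(1) unfolding subtrees_def by blast
      qed
      show "(\<lambda>x. {c, x}) ` nbs V c \<subseteq> {W \<in> proper_radial 1 1 V c. card W = 2}"
      proof
        fix W assume "W \<in> (\<lambda>x. {c, x}) ` nbs V c"
        then obtain x where x: "x \<in> nbs V c" "W = {c, x}" by blast
        have W: "W \<in> subtrees V c" "card W = 2" using x nbs_in[OF x(1)] conn_edge V unfolding subtrees_def rtree_def by auto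
        have rW: "rtree W c" using subtrees_rtree V W by blast
        have "W \<noteq> {c}" using W(2) by auto
        then have "radial 1 W c \<noteq> {}" unfolding radial_one[OF rW] using nbs_nonempty[OF rW] by simp
        then have "1 \<le> card (radial 1 W c)" using radial_finite[OF rtree_finite[OF rW]] by (simp add: Suc_leI card_gt_0_iff)
        moreover have "W \<noteq> V" using W(2) \<open>card V \<noteq> 2\<close> by blast
        ultimately show "W \<in> {W \<in> proper_radial 1 1 V c. card W = 2}" unfolding proper_radial_def using W by blast
      qed
    qed
    have "nbs V' c' \<subseteq> V' - {c'}" using nbs_in by blast
    then have "card (nbs V' c') \<le> card (V' - {c'})" using fin(2) by (simp add: card_mono)
    then have c3: "card V' \<noteq> 2" using d' V' fin unfolding rtree_def by (auto simp: card_Diff_singleton)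
    have i: "card ((\<lambda>x. {c, x}) ` nbs V c) = card (nbs V c)" for V c
      using nbs_in by (intro card_image inj_onI) (metis doubleton_eq_iff)
    have "card {W \<in> proper_radial 1 1 V c. card W = 2} = card {W \<in> proper_radial 1 1 V' c'. card W = 2}"
      by (rule matched_card[OF m[unfolded True]]) (auto dest: rsim_card)
    then show False using e[OF V] e[OF V' c3] c3 card i d d' by simp
  next
    case False
    obtain xs where xs: "path xs" "length xs = Suc h" "hd xs = c'" "set xs \<subseteq> V'"
      using dp unfolding deep_def by blast
    then obtain x ys where e: "xs = c' # x # ys" using h by (cases xs; cases "tl xs") auto
    have x: "x \<in> nbs V' c'" using xs e unfolding nbs_def by (auto simp: path_Cons)
    obtain y where y: "y \<in> nbs V' c'" "y \<noteq> x"
      using d' by (metis card_le_Suc0_iff_eq fin(2) nbs_finite not_less_eq_eq numeral_2_eq_2)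
    let ?W = "insert y (set xs)"
    have cx: "c' \<in> set xs" unfolding e by simp
    have cp: "conn (set xs)" using conn_path[OF xs(1)] e by simp
    have W: "?W \<in> subtrees V' c'" unfolding subtrees_def
      using conn_insert[OF cp cx] cx nbs_in[OF y(1)] xs(4) by auto
    have rW: "rtree ?W c'" using subtrees_rtree V' W by blast
    have "card ?W \<le> Suc (Suc h)" using card_insert_le_m1[of "Suc (Suc h)" "set xs" y] card_length[of xs] xs(2) by simp
    then have "?W \<noteq> V'" using False sz card by auto
    moreover have "radial h ?W c' \<noteq> {}"
    proof -
      have "deep h ?W c'" unfolding deep_def using xs by (intro exI[of _ xs]) auto
      then show ?thesis using deep_branch[OF rW h] by blast
    qed
    then have "1 \<le> card (radial h ?W c')" using radial_finite[OF rtree_finite[OF rW]] by (simp add: Suc_leI card_gt_0_iff)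
    ultimately have "?W \<in> proper_radial 1 h V' c'" unfolding proper_radial_def using W by simp
    then obtain W0 where W0: "W0 \<in> proper_radial 1 h V c" "rsim W0 c ?W c'"
      using matched_ex[OF matched_sym[OF m]] by blast
    have "{x, y} \<subseteq> nbs ?W c'" using x y e unfolding nbs_def by auto
    then have "2 \<le> card (nbs ?W c')"
      using card_mono[of "nbs ?W c'" "{x, y}"] y(2) nbs_finite[OF rtree_finite[OF rW]] by simp
    also have "card (nbs ?W c') = card (nbs W0 c)" using rsim_nbs_card[OF W0(2)] by simp
    also have "\<dots> \<le> card (nbs V c)"
      using W0(1) fin unfolding proper_radial_def subtrees_def by (intro card_mono nbs_mono) (auto simp: nbs_finite)
    finally show False using d by simp
  qed
qed

lemma proper_radial_one:
  assumes "rtree V c" "1 \<le> h"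
  shows "proper_radial 1 h V c = {W \<in> subtrees V c. deep h W c \<and> W \<noteq> V}"
proof -
  have "1 \<le> card (radial h W c) \<longleftrightarrow> deep h W c" if "W \<in> subtrees V c" for W
  proof -
    have r: "rtree W c" using subtrees_rtree assms(1) that by blast
    have "1 \<le> card (radial h W c) \<longleftrightarrow> radial h W c \<noteq> {}"
      using radial_finite[OF rtree_finite[OF r]] by (simp add: Suc_le_eq card_gt_0_iff)
    also have "\<dots> \<longleftrightarrow> deep h W c"
      using deep_branch[OF r assms(2)] radial_deep[of c W _ h] r unfolding rtree_def by blast
    finally show ?thesis .
  qed
  then show ?thesis unfolding proper_radial_def by auto
qed

lemma single_nbs_component:
  assumes "rtree V c" "nbs V c = {x}"
  shows "component (V - {c}) x = V - {c}" "rtree (V - {c}) x"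
proof -
  have "c \<notin> component (V - {c}) x" using component_subset by blast
  then show e: "component (V - {c}) x = V - {c}" using branch_single[OF assms] unfolding branch_def by blast
  have x: "x \<in> V - {c}" using assms(2) nbs_in by blast
  show "rtree (V - {c}) x" using conn_component[OF x] e x assms(1) forest_subset unfolding rtree_def by auto
qed

lemma deep_tl:
  assumes "rtree W c" "nbs W c = {x}" "deep (Suc h) W c"
  shows "deep h (W - {c}) x"
proof -
  obtain xs where xs: "path xs" "length xs = Suc (Suc h)" "hd xs = c" "set xs \<subseteq> W"
    using assms(3) unfolding deep_def by blast
  then obtain y ys where e: "xs = c # y # ys" by (cases xs; cases "tl xs") auto
  then have "y \<in> nbs W c" using xs unfolding nbs_def by (auto simp: path_Cons)
  then have "y = x" using assms(2) by blast
  then show ?thesis unfolding deep_def using xs e by (intro exI[of _ "y # ys"]) (auto simp: path_Cons)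
qed

lemma deep_Suc_insert:
  assumes "deep h W x" "E c x" "c \<notin> W"
  shows "deep (Suc h) (insert c W) c"
proof -
  obtain xs where xs: "path xs" "length xs = Suc h" "hd xs = x" "set xs \<subseteq> W"
    using assms(1) unfolding deep_def by blast
  then show ?thesis unfolding deep_def using assms(2,3)
    by (intro exI[of _ "c # xs"]) (auto simp: path_Cons)
qed

lemma deep_one:
  assumes "rtree W x" "W \<noteq> {x}" shows "deep 1 W x"
proof -
  obtain y where "y \<in> nbs W x" using nbs_nonempty assms by blast
  then have "y \<in> radial 1 W x" using radial_one[OF assms(1)] by simp
  then show ?thesis using radial_deep assms(1) unfolding rtree_def by blast
qed

text \<open>Moves the root from \<open>c\<close> to its only neighbour. The depth drops by one,
  except that \<open>h = 1\<close> stays: a subtree with at least 3 vertices still has depth 1 at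
  \<open>x\<close>. The bound \<open>3 \<le> card W\<close> removes the edge \<open>{c, x}\<close>,
  which would become the single vertex \<open>x\<close>.\<close>

lemma descend_bij:
  assumes V: "rtree V c" and x: "nbs V c = {x}" and h: "1 \<le> h"
    and h0: "h0 = (if h = 1 then 1 else h - 1)"
  shows "bij_betw (insert c) (proper_radial 1 h0 (V - {c}) x) {W \<in> proper_radial 1 h V c. 3 \<le> card W}"
proof (rule bij_betw_byWitness[where f' = "\<lambda>W. W - {c}"])
  let ?U = "V - {c}"
  have U: "rtree ?U x" using single_nbs_component[OF V x] by blast
  have h01: "1 \<le> h0" "h \<le> Suc h0" using h h0 by auto
  have cx: "E c x" "x \<noteq> c" "x \<in> V" using x nbs_in[of x V c] by auto
  have cV: "c \<in> V" using V rtree_def by blast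
  note aU = proper_radial_one[OF U h01(1)] and aV = proper_radial_one[OF V h]
  show "\<forall>W\<in>proper_radial 1 h0 ?U x. insert c W - {c} = W" unfolding aU subtrees_def by auto
  show "\<forall>W\<in>{W \<in> proper_radial 1 h V c. 3 \<le> card W}. insert c (W - {c}) = W" unfolding aV subtrees_def by auto
  show "insert c ` proper_radial 1 h0 ?U x \<subseteq> {W \<in> proper_radial 1 h V c. 3 \<le> card W}"
  proof
    fix W assume "W \<in> insert c ` proper_radial 1 h0 ?U x"
    then obtain B where B: "W = insert c B" "B \<subseteq> ?U" "x \<in> B" "conn B" "deep h0 B x" "B \<noteq> ?U"
      unfolding aU subtrees_def by blast
    have fB: "finite B" using B(2) rtree_finite[OF U] finite_subset by blast
    have "c \<notin> B" using B(2) by blast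
    then have "deep h W c" using deep_le[OF deep_Suc_insert[OF B(5) cx(1)] h01(2)] B(1) by blast
    moreover have "conn W" using conn_insert[OF B(4,3) E_sym[OF cx(1)]] B(1) by simp
    moreover have "W \<noteq> V" "W \<subseteq> V" using B \<open>c \<notin> B\<close> cV by auto
    moreover have "3 \<le> card W" using deep_card[OF B(5) fB] h01 fB \<open>c \<notin> B\<close> B(1) by simp
    ultimately show "W \<in> {W \<in> proper_radial 1 h V c. 3 \<le> card W}" unfolding aV subtrees_def using B(1) by blast
  qed
  show "(\<lambda>W. W - {c}) ` {W \<in> proper_radial 1 h V c. 3 \<le> card W} \<subseteq> proper_radial 1 h0 ?U x"
  proof
    fix B assume "B \<in> (\<lambda>W. W - {c}) ` {W \<in> proper_radial 1 h V c. 3 \<le> card W}"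
    then obtain W where W: "B = W - {c}" "W \<in> subtrees V c" "deep h W c" "W \<noteq> V" "3 \<le> card W"
      unfolding aV by blast
    have rW: "rtree W c" using subtrees_rtree V W(2) by blast
    have "W \<noteq> {c}" using W(5) by auto
    then have "nbs W c \<noteq> {}" using nbs_nonempty[OF rW] by blast
    moreover have "nbs W c \<subseteq> {x}" using nbs_mono[of W V c] x W(2) unfolding subtrees_def by simp
    ultimately have n: "nbs W c = {x}" by blast
    have rB: "rtree B x" using single_nbs_component(2)[OF rW n] W(1) by simp
    have "deep h0 B x"
    proof (cases "h = 1")
      case True
      have "card B = card W - 1" using W(1) rW rtree_finite[OF rW] unfolding rtree_def by simp
      then have "B \<noteq> {x}" using W(5) by auto
      then show ?thesis using deep_one[OF rB] True h0 by simp
    next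
      case False
      then obtain k where "h = Suc k" using h by (cases h) auto
      then show ?thesis using deep_tl[OF rW n, of k] W h0 False by simp
    qed
    moreover have "B \<noteq> ?U" "B \<subseteq> ?U" using W rW cV unfolding subtrees_def rtree_def by auto
    ultimately show "B \<in> proper_radial 1 h0 ?U x" unfolding aU subtrees_def using rB rtree_def by blast
  qed
qed

text \<open>Induction on the number of vertices. A root of degree 1 is deleted; otherwise Kelly
  counting finds the branches of depth \<open>h\<close>, and the rest is an instance with
  \<open>h = 1\<close>. The bound \<open>h + 3\<close> matters for \<open>h \<ge> 2\<close>: with
  \<open>h + 2\<close> vertices the family may consist of one leg and say nothing about the place of
  the last vertex.\<close>

theorem rooted_reconstruction:
  assumes "rtree V c" "rtree V' c'" "card V = card V'" "1 \<le> h" "deep h V c" "deep h V' c'"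
    "h = 1 \<or> h + 3 \<le> card V"
    "matched (\<lambda>W W'. rsim W c W' c') (proper_radial 1 h V c) (proper_radial 1 h V' c')"
  shows "rsim V c V' c'"
  using assms
proof (induction "card V" arbitrary: V V' c c' h rule: less_induct)
  case less
  note V = less.prems(1) and V' = less.prems(2) and card = less.prems(3) and h = less.prems(4)
    and d = less.prems(5) and d' = less.prems(6) and sz = less.prems(7) and m = less.prems(8)
  have fin: "finite V" "finite V'" using V V' rtree_finite by auto
  have rne: "radial h V c \<noteq> {}" "radial h V' c' \<noteq> {}"
    by (rule deep_branch[OF V h d], blast, rule deep_branch[OF V' h d'], blast)
  have n1: "1 \<le> card (nbs V c)" "1 \<le> card (nbs V' c')"
    using rne nbs_finite[OF fin(1), of c] nbs_finite[OF fin(2), of c'] unfolding radial_def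
    by (auto simp: Suc_le_eq card_gt_0_iff)
  have r1: "1 \<le> card (radial h V c)" "1 \<le> card (radial h V' c')"
    using rne radial_finite fin by (auto simp: Suc_le_eq card_gt_0_iff)
  show ?case
  proof (cases "card (nbs V c) = 1")
    case True
    have "card (nbs V' c') = 1" using root_degree_le[OF V V' card h d' sz m True] n1 by simp
    then obtain x x' where x: "nbs V c = {x}" and x': "nbs V' c' = {x'}" using True card_1_singletonE by metis
    let ?U = "V - {c}" and ?U' = "V' - {c'}"
    have U: "rtree ?U x" "rtree ?U' x'" using single_nbs_component V V' x x' by blast+
    have cV: "c \<in> V" "c' \<in> V'" using V V' rtree_def by auto
    have cx: "E c x" "x \<in> V" "x \<noteq> c" "E c' x'" "x' \<in> V'" "x' \<noteq> c'" using nbs_in[of x V c] nbs_in[of x' V' c'] x x' by auto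
    have cU: "card ?U = card ?U'" "card ?U < card V"
      using card cV fin card_Diff1_less[of V c] by auto
    have "rsim ?U x ?U' x'"
    proof (cases "?U = {x}")
      case True
      then have "card ?U' = 1" using cU by simp
      then obtain z where z: "?U' = {z}" using card_1_singletonE by blast
      have "x' \<in> ?U'" using cx by blast
      then have "?U' = {x'}" using z by simp
      then show ?thesis unfolding True rsim_def iso_def
        by (intro conjI exI[of _ "\<lambda>_. x'"]) (auto simp: E_irrefl bij_betw_def)
    next
      case False
      define h0 where "h0 = (if h = 1 then 1 else h - 1)"
      have U'x: "?U' \<noteq> {x'}"
      proof
        assume "?U' = {x'}"
        then have "card ?U = 1" using cU by simp
        then obtain z where z: "?U = {z}" using card_1_singletonE by blast
        have "x \<in> ?U" using cx by blast
        then show False using False z by simp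
      qed
      have dd: "deep h0 (W - {c}) x" if "rtree W c" "nbs W c = {x}" "deep h W c" "W - {c} \<noteq> {x}" for W c x
      proof (cases "h = 1")
        case True then show ?thesis using deep_one single_nbs_component(2) that h0_def by simp
      next
        case False
        then obtain k where "h = Suc k" using h by (cases h) auto
        then show ?thesis using deep_tl[OF that(1,2), of k] that(3) h0_def False by simp
      qed
      show ?thesis
      proof (rule less.hyps[OF cU(2) U cU(1)])
        show "1 \<le> h0" using h h0_def by auto
        show "deep h0 ?U x" "deep h0 ?U' x'" using dd V V' x x' d d' False U'x by blast+
        show "h0 = 1 \<or> h0 + 3 \<le> card ?U"
        proof (cases "h = 1")
          case False
          then have "Suc (card ?U) = card V" "h0 = h - 1" using cV fin h0_def by (auto simp: card_Suc_Diff1 simp del: card_Diff_insert card_Diff_singleton)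
          then show ?thesis using sz h False by linarith
        qed (simp add: h0_def)
        have "matched (\<lambda>W W'. rsim W c W' c') {W \<in> proper_radial 1 h V c. 3 \<le> card W} {W \<in> proper_radial 1 h V' c'. 3 \<le> card W}"
          by (rule matched_restrict[OF m]) (auto dest: rsim_card)
        then show "matched (\<lambda>W W'. rsim W x W' x') (proper_radial 1 h0 ?U x) (proper_radial 1 h0 ?U' x')"
        proof (rule matched_transfer[OF _ descend_bij[OF V x h h0_def] descend_bij[OF V' x' h h0_def]])
          fix B B' assume B: "B \<in> proper_radial 1 h0 ?U x" "B' \<in> proper_radial 1 h0 ?U' x'" "rsim (insert c B) c (insert c' B') c'"
          then obtain f where f: "iso f (insert c B) (insert c' B')" "f c = c'" unfolding rsim_def by blast
          have s: "B \<subseteq> ?U" "x \<in> B" "B' \<subseteq> ?U'" "x' \<in> B'" using B unfolding proper_radial_def subtrees_def by auto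
          have "f ` (insert c B - {c}) = insert c' B' - {c'}"
            using inj_on_image_set_diff[OF iso_inj[OF f(1)], of "insert c B" "{c}"] iso_image[OF f(1)] f(2) by auto
          moreover have "insert c B - {c} = B" "insert c' B' - {c'} = B'" using s by auto
          ultimately have fB: "f ` B = B'" by simp
          \<comment> \<open>The neighbour of the old root is unique, so an isomorphism respecting
            the old roots also respects the new ones.\<close>
          have "f x \<in> nbs V' c'" using iso_edge[OF f(1), of c x] f(2) s cx fB unfolding nbs_def by auto
          then have "f x = x'" using x' by blast
          then show "rsim B x B' x'" unfolding rsim_def using iso_restrict[OF f(1), of B] fB s by blast
        qed
      qed
    qed
    then obtain f where f: "iso f ?U ?U'" "f x = x'" unfolding rsim_def by blast
    have "iso (\<lambda>z. if z = c then c' else x') {c, x} {c', x'}"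
      unfolding iso_def bij_betw_def using cx E_irrefl E_sym by (auto simp: inj_on_def)
    then have "iso (\<lambda>z. if z \<in> {c, x} then (\<lambda>z. if z = c then c' else x') z else f z) ({c, x} \<union> ?U) ({c', x'} \<union> ?U')"
    proof (rule iso_glue[OF _ f(1)])
      show "(\<lambda>z. if z = c then c' else x') ` ({c, x} \<inter> ?U) = {c', x'} \<inter> ?U'" using cx by auto
      show "\<not> E u w" if "u \<in> {c, x} - ?U" "w \<in> ?U - {c, x}" for u w
        using that x cx unfolding nbs_def by auto
      show "\<not> E u w" if "u \<in> {c', x'} - ?U'" "w \<in> ?U' - {c', x'}" for u w
        using that x' cx unfolding nbs_def by auto
    qed (use f(2) in auto)
    moreover have "{c, x} \<union> ?U = V" "{c', x'} \<union> ?U' = V'" using cx cV by auto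
    ultimately have "iso (\<lambda>z. if z \<in> {c, x} then (\<lambda>z. if z = c then c' else x') z else f z) V V'" by simp
    then show ?thesis unfolding rsim_def using cV
      by (intro conjI exI[of _ "\<lambda>z. if z \<in> {c, x} then (\<lambda>z. if z = c then c' else x') z else f z"]) auto
  next
    case False
    then have n2: "2 \<le> card (nbs V c)" using n1 by linarith
    have "card (nbs V' c') \<noteq> 1"
    proof
      assume a: "card (nbs V' c') = 1"
      have "matched (\<lambda>W W'. rsim W c' W' c) (proper_radial 1 h V' c') (proper_radial 1 h V c)"
        by (rule matched_mono[OF matched_sym[OF m]]) (auto intro: rsim_sym)
      then show False using root_degree_le[OF V' V card[symmetric] h d _ _ a] sz card n2 by simp
    qed
    then have n2': "2 \<le> card (nbs V' c')" using n1 by linarith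
    have "card {W \<in> proper_radial 1 h V c. card (nbs W c) = 1 \<and> rsim W c T t} = card {W \<in> proper_radial 1 h V' c'. card (nbs W c') = 1 \<and> rsim W c' T t}" for T t
    proof (rule matched_card[OF m])
      fix W W' assume "rsim W c W' c'"
      then show "(card (nbs W c) = 1 \<and> rsim W c T t) = (card (nbs W' c') = 1 \<and> rsim W' c' T t)"
        using rsim_nbs_card rsim_sym rsim_trans by metis
    qed
    \<comment> \<open>Weight 1, so that the class totals are the multiplicities of the branch
      types.\<close>
    then have "(\<Sum>x\<in>radial h V c. 1 * deep_count h (branch V c x) c T t) = (\<Sum>x\<in>radial h V' c'. 1 * deep_count h (branch V' c' x) c' T t)" for T t
      using single_branch_count[OF V h n2] single_branch_count[OF V' h n2'] by simp
    then have "(\<Sum>x\<in>{x \<in> radial h V c. rooted_type (branch V c x, c) = \<tau>}. 1) = (\<Sum>x\<in>{x \<in> radial h V' c'. rooted_type (branch V' c' x, c') = \<tau>}. (1::nat))" for \<tau>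
      by (rule branch_class_totals[OF V V'])
    then have cls: "card {x \<in> radial h V c. rooted_type (branch V c x, c) = \<tau>} = card {x \<in> radial h V' c'. rooted_type (branch V' c' x, c') = \<tau>}" for \<tau>
      by simp
    show ?thesis
    proof (rule rooted_finish[OF V V' card r1 rne(1) m cls])
      fix N N' assume N: "rtree N c" "rtree N' c'" "N \<subset> V" "card N = card N'" "N \<noteq> {c}" "N' \<noteq> {c'}"
        "matched (\<lambda>W W'. rsim W c W' c') (proper_radial 1 1 N c) (proper_radial 1 1 N' c')"
      have "card N < card V" using N(3) fin by (simp add: psubset_card_mono)
      then show "rsim N c N' c'"
        using less.hyps[OF _ N(1,2,4) _ deep_one[OF N(1,5)] deep_one[OF N(2,6)]] N(7) by simp
    qed
  qed
qed

end

section \<open>Trees rooted at a bisecting vertex\<close>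

text \<open>In the application \<open>g \<tau>\<close> is the number of legs in a branch of type
  \<open>\<tau>\<close>, and \<open>P\<close>, \<open>Q\<close> are the total numbers of legs; pairs
  of a leg and another branch lead to the products in \<open>eq\<close>. With at least two branches,
  \<open>g \<tau> < Q\<close> for every type in \<open>B\<close>, so \<open>eq\<close> makes
  \<open>P - g \<tau>\<close> positive too, and the smaller factor forces the larger
  multiplicity.\<close>

lemma weighted_class_card_le:
  fixes g :: "'t \<Rightarrow> nat"
  assumes fin: "finite A" "finite B" and pos: "\<And>a. a \<in> A \<Longrightarrow> 0 < g (s a)" "\<And>b. b \<in> B \<Longrightarrow> 0 < g (t b)"
    and two: "2 \<le> card A" "2 \<le> card B"
    and P: "P = (\<Sum>a\<in>A. g (s a))" and Q: "Q = (\<Sum>b\<in>B. g (t b))"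
    and eq: "\<And>\<tau>. card {a \<in> A. s a = \<tau>} * (P - g \<tau>) = card {b \<in> B. t b = \<tau>} * (Q - g \<tau>)"
    and le: "P \<le> Q"
  shows "card {b \<in> B. t b = \<tau>} \<le> card {a \<in> A. s a = \<tau>}"
proof -
  have less: "g (s a) < (\<Sum>a\<in>A. g (s a))" if a: "a \<in> A" and "finite A" "2 \<le> card A" "\<And>a. a \<in> A \<Longrightarrow> 0 < g (s a)"
    for a and A :: "'x set" and s
  proof -
    have "card (A - {a}) \<noteq> 0" using that(2,3) a by simp
    then have "A - {a} \<noteq> {}" by (metis card.empty)
    then obtain b where b: "b \<in> A" "b \<noteq> a" by blast
    have "g (s a) < (\<Sum>a\<in>{a, b}. g (s a))" using b that(4) by simp
    also have "\<dots> \<le> (\<Sum>a\<in>A. g (s a))" using a b that(2) by (intro sum_mono2) auto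
    finally show ?thesis .
  qed
  show ?thesis
  proof (cases "{b \<in> B. t b = \<tau>} = {}")
    case False
    then obtain b where b: "b \<in> B" "t b = \<tau>" by blast
    have q: "g \<tau> < Q" using less[of b B t] b fin two pos Q by simp
    have "0 < card {b \<in> B. t b = \<tau>}" using False fin by (simp add: card_gt_0_iff)
    then have "0 < card {a \<in> A. s a = \<tau>} * (P - g \<tau>)" unfolding eq using q by simp
    then have p: "0 < P - g \<tau>" by (metis gr0I mult_0_right)
    have "card {b \<in> B. t b = \<tau>} * (P - g \<tau>) \<le> card {b \<in> B. t b = \<tau>} * (Q - g \<tau>)"
      using le by (intro mult_le_mono2 diff_le_mono)
    also have "\<dots> = card {a \<in> A. s a = \<tau>} * (P - g \<tau>)" using eq by simp
    finally show ?thesis using p by simp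
  next
    case True
    show ?thesis unfolding True by simp
  qed
qed

text \<open>
  The totals \<open>P\<close> and \<open>Q\<close> agree because increasing the total decreases every multiplicity.
\<close>

lemma weighted_class_card_eq:
  fixes g :: "'t \<Rightarrow> nat"
  assumes fin: "finite A" "finite B" and pos: "\<And>a. a \<in> A \<Longrightarrow> 0 < g (s a)" "\<And>b. b \<in> B \<Longrightarrow> 0 < g (t b)"
    and two: "2 \<le> card A" "2 \<le> card B"
    and P: "P = (\<Sum>a\<in>A. g (s a))" and Q: "Q = (\<Sum>b\<in>B. g (t b))"
    and eq: "\<And>\<tau>. card {a \<in> A. s a = \<tau>} * (P - g \<tau>) = card {b \<in> B. t b = \<tau>} * (Q - g \<tau>)"
  shows "card {a \<in> A. s a = \<tau>} = card {b \<in> B. t b = \<tau>}"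
proof -
  have grp: "(\<Sum>a\<in>X. g (u a)) = (\<Sum>\<tau>\<in>s ` A \<union> t ` B. card {a \<in> X. u a = \<tau>} * g \<tau>)"
    if "finite X" "u ` X \<subseteq> s ` A \<union> t ` B" for X :: "'z set" and u
  proof -
    have "(\<Sum>a\<in>X. g (u a)) = (\<Sum>\<tau>\<in>s ` A \<union> t ` B. \<Sum>a\<in>{a \<in> X. u a = \<tau>}. g (u a))"
      by (rule sum.group[symmetric]) (use fin that in auto)
    also have "\<dots> = (\<Sum>\<tau>\<in>s ` A \<union> t ` B. card {a \<in> X. u a = \<tau>} * g \<tau>)"
      by (intro sum.cong refl) simp
    finally show ?thesis .
  qed
  \<comment> \<open>Written over all types, \<open>P\<close> and \<open>Q\<close> are sums of
    multiplicities with the same coefficients \<open>g \<tau>\<close>, hence monotone in the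
    multiplicities.\<close>
  have PT: "P = (\<Sum>\<tau>\<in>s ` A \<union> t ` B. card {a \<in> A. s a = \<tau>} * g \<tau>)" unfolding P by (rule grp) (use fin in auto)
  have QT: "Q = (\<Sum>\<tau>\<in>s ` A \<union> t ` B. card {a \<in> B. t a = \<tau>} * g \<tau>)" unfolding Q by (rule grp) (use fin in auto)
  note le1 = weighted_class_card_le[where s = s and t = t, OF fin pos two P Q eq]
  note le2 = weighted_class_card_le[where s = t and t = s, OF fin(2,1) pos(2,1) two(2,1) Q P eq[symmetric]]
  have "P = Q"
  proof (cases "P \<le> Q")
    case True
    then have "Q \<le> P" unfolding PT QT using le1[OF _ _ True] by (intro sum_mono mult_le_mono1)
    then show ?thesis using True by simp
  next
    case False
    then have "Q \<le> P" by simp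
    then have "P \<le> Q" unfolding PT QT using le2[OF _ _ \<open>Q \<le> P\<close>] by (intro sum_mono mult_le_mono1)
    then show ?thesis using False by simp
  qed
  then show ?thesis using le1 le2 by (simp add: le_antisym)
qed

context sgraph begin

section \<open>Isomorphisms between paths\<close>

lemma path_edge_iff:
  assumes "forest_on V" "path xs" "set xs \<subseteq> V" "i < length xs" "j < length xs"
  shows "E (xs ! i) (xs ! j) \<longleftrightarrow> j = Suc i \<or> i = Suc j"
proof -
  have "E (xs ! i) (xs ! j) \<longleftrightarrow> xs ! j \<in> nbs (set xs) (xs ! i)" using assms(5) unfolding nbs_def by simp
  also have "\<dots> \<longleftrightarrow> j = Suc i \<or> i = Suc j"
    unfolding path_nbs_card[OF assms(1-4)]
    using nth_eq_iff_index_eq[OF path_distinct[OF assms(2)]] assms(4,5) by fastforce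
  finally show ?thesis .
qed

lemma path_iso:
  assumes "forest_on V" "forest_on V'" "path xs" "path ys" "set xs \<subseteq> V" "set ys \<subseteq> V'" "length xs = length ys"
  obtains f where "iso f (set xs) (set ys)" "\<And>i. i < length xs \<Longrightarrow> f (xs ! i) = ys ! i"
proof -
  have dx: "distinct xs" "distinct ys" using assms path_distinct by auto
  define f where "f = the \<circ> map_of (zip xs ys)"
  have f: "f (xs ! i) = ys ! i" if "i < length xs" for i
    using map_of_zip_nth[OF assms(7) dx(1), of i] that assms(7) unfolding f_def by simp
  have "map f xs = ys" using f assms(7) by (intro nth_equalityI) auto
  then have "f ` set xs = set ys" by (metis set_map)
  moreover have "inj_on f (set xs)"
  proof (rule inj_onI)
    fix x y assume a: "x \<in> set xs" "y \<in> set xs" "f x = f y"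
    then obtain i j where "i < length xs" "x = xs ! i" "j < length xs" "y = xs ! j" by (metis in_set_conv_nth)
    then show "x = y" using a f dx(2) assms(7) by (simp add: nth_eq_iff_index_eq)
  qed
  moreover have "E x y \<longleftrightarrow> E (f x) (f y)" if xy: "x \<in> set xs" "y \<in> set xs" for x y
  proof -
    obtain i where i: "i < length xs" "x = xs ! i" using xy(1) by (metis in_set_conv_nth)
    obtain j where j: "j < length xs" "y = xs ! j" using xy(2) by (metis in_set_conv_nth)
    show ?thesis using i j f path_edge_iff[OF assms(1,3,5)] path_edge_iff[OF assms(2,4,6)] assms(7) by simp
  qed
  ultimately have "iso f (set xs) (set ys)" unfolding iso_def bij_betw_def by blast
  then show thesis using that f by blast
qed

lemma leg_rsim:
  assumes "rtree V c" "rtree V' c'" "leg r L c" "leg r L' c'" "L \<subseteq> V" "L' \<subseteq> V'"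
  shows "rsim L c L' c'"
proof -
  obtain xs where xs: "path xs" "length xs = Suc r" "hd xs = c" "set xs = L" using assms(3) unfolding leg_def by blast
  obtain ys where ys: "path ys" "length ys = Suc r" "hd ys = c'" "set ys = L'" using assms(4) unfolding leg_def by blast
  have F: "forest_on V" "forest_on V'" using assms(1,2) unfolding rtree_def by auto
  obtain f where f: "iso f (set xs) (set ys)" "\<And>i. i < length xs \<Longrightarrow> f (xs ! i) = ys ! i"
    using path_iso[OF F xs(1) ys(1)] xs ys assms by metis
  have ne: "xs \<noteq> []" "ys \<noteq> []" using xs ys by auto
  then have "f (hd xs) = hd ys" using f(2)[of 0] by (simp add: hd_conv_nth)
  then show ?thesis unfolding rsim_def using f(1) xs ys ne hd_in_set[of xs] by auto
qed

text \<open>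
  The proper subtrees of the tree are informative except when the root has two branches and one of
  them is a leg: then no proper subtree contains a leg together with the whole other branch.
\<close>

definition exceptional :: "nat \<Rightarrow> 'v set \<Rightarrow> 'v \<Rightarrow> bool" where
  "exceptional r V c \<longleftrightarrow> (\<exists>x y. x \<noteq> y \<and> nbs V c = {x, y} \<and> leg r (branch V c x) c)"

definition legs :: "nat \<Rightarrow> 'v set \<Rightarrow> 'v \<Rightarrow> 'v set set" where
  "legs r A a = {L. L \<subseteq> A \<and> leg r L a}"

lemma legs_card: "rsim A a A' a' \<Longrightarrow> card (legs r A a) = card (legs r A' a')"
proof -
  assume r: "rsim A a A' a'"
  have e: "legs r A a = {L \<in> subtrees A a. leg r L a}" for A a
    unfolding legs_def using leg_in_subtrees unfolding subtrees_def by blast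
  show ?thesis unfolding e by (rule matched_card[OF iso_subtrees_matched[OF r]]) (rule rsim_leg)
qed

lemma legs_finite: "finite A \<Longrightarrow> finite (legs r A a)"
  unfolding legs_def by simp

text \<open>A deep subtree \<open>B\<close> of one branch alone does not show where the root is once
  roots are forgotten; together with a leg in another branch it does. Only the type of
  \<open>B\<close> is prescribed, as all legs of the same length are isomorphic.\<close>

definition legpairs :: "nat \<Rightarrow> 'v set \<Rightarrow> 'v \<Rightarrow> 'v set \<Rightarrow> 'v \<Rightarrow> ('v set \<times> 'v set) set" where
  "legpairs r V c T t = {(L, B). \<exists>x\<in>nbs V c. \<exists>y\<in>nbs V c. x \<noteq> y \<and> L \<in> legs r (branch V c x) c \<and>
     B \<in> subtrees (branch V c y) c \<and> deep r B c \<and> rsim B c T t}"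

lemma leg_not_singleton: "1 \<le> r \<Longrightarrow> deep r B c \<Longrightarrow> B \<noteq> {c}"
  using deep_card[of r B c] by auto

text \<open>Each of the two pieces becomes a full branch of the union, so the pair is recovered from
  the union and the choice of its two branches.\<close>

lemma legpair_structure:
  assumes V: "rtree V c" and r: "1 \<le> r" and x: "x \<in> nbs V c" and y: "y \<in> nbs V c" and xy: "x \<noteq> y"
    and L: "L \<in> legs r (branch V c x) c" and B: "B \<in> subtrees (branch V c y) c" "deep r B c"
  shows "L \<union> B \<in> subtrees V c" "nbs (L \<union> B) c = {x, y}" "branch (L \<union> B) c x = L" "branch (L \<union> B) c y = B"
    "radial r (L \<union> B) c = {x, y}"
proof -
  have L': "L \<in> subtrees (branch V c x) c" "deep r L c" using L leg_in_subtrees leg_deep unfolding legs_def by auto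
  note sL = subtrees_branch[OF V x L'(1) leg_not_singleton[OF r L'(2)]]
  note sB = subtrees_branch[OF V y B(1) leg_not_singleton[OF r B(2)]]
  show W: "L \<union> B \<in> subtrees V c" using subtrees_Un sL(3) sB(3) by blast
  show n: "nbs (L \<union> B) c = {x, y}" using sL(1) sB(1) unfolding nbs_def by blast
  have i: "branch V c x \<inter> branch V c y = {c}" using branch_disjoint[OF V x y xy] .
  have s: "L \<subseteq> branch V c x" "B \<subseteq> branch V c y" "c \<in> L" "c \<in> B" using L'(1) B(1) unfolding subtrees_def by auto
  show b: "branch (L \<union> B) c x = L" "branch (L \<union> B) c y = B"
    using branch_subtrees[OF V W, of x] branch_subtrees[OF V W, of y] n i s by auto
  show "radial r (L \<union> B) c = {x, y}" unfolding radial_def n using b L'(2) B(2) by auto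
qed

lemma legpairs_iso:
  assumes "iso f W W'" "c \<in> W" "f c = c'" "(L, B) \<in> legpairs r W c T t"
  shows "(f ` L, f ` B) \<in> legpairs r W' c' T t"
proof -
  obtain x y where xy: "x \<in> nbs W c" "y \<in> nbs W c" "x \<noteq> y" "L \<subseteq> branch W c x" "leg r L c" "B \<in> subtrees (branch W c y) c"
    "deep r B c" "rsim B c T t" using assms(4) unfolding legpairs_def legs_def by blast
  have BW: "B \<subseteq> W" "c \<in> B" "conn B" and LW: "L \<subseteq> W" using xy(4,6) branch_subset[OF assms(2)] unfolding subtrees_def by blast+
  have rB: "rsim B c (f ` B) c'" unfolding rsim_def using iso_restrict[OF assms(1) BW(1)] assms(3) BW by blast
  have "f x \<in> nbs W' c'" "f y \<in> nbs W' c'" using iso_nbs_root[OF assms(1-3)] xy by auto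
  moreover have "f x \<noteq> f y" using iso_inj[OF assms(1)] xy(1-3) nbs_in[of _ W c] by (metis inj_onD)
  moreover have "f ` L \<in> legs r (branch W' c' (f x)) c'"
    unfolding legs_def iso_branch[OF assms(1-3) xy(1)] using iso_leg1[OF assms(1,3) LW xy(5)] xy(4) by blast
  moreover have "f ` B \<in> subtrees (branch W' c' (f y)) c'"
    unfolding iso_branch[OF assms(1-3) xy(2)] subtrees_def
    using xy(6) iso_conn[OF assms(1) BW(1)] BW assms(3) unfolding subtrees_def by blast
  moreover have "deep r (f ` B) c'" using rsim_deep[OF rB] xy(7) by blast
  moreover have "rsim (f ` B) c' T t" using rsim_trans[OF rsim_sym[OF rB] xy(8)] .
  ultimately show ?thesis unfolding legpairs_def by blast
qed

text \<open>Applied in both directions, this makes the number of pairs covering a subtree an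
  invariant of its rooted type.\<close>

lemma legpairs_cover_le:
  assumes "rsim W c W' c'" "finite W'"
  shows "card {(L, B) \<in> legpairs r W c T t. L \<union> B = W} \<le> card {(L, B) \<in> legpairs r W' c' T t. L \<union> B = W'}"
proof -
  obtain f where f: "iso f W W'" "f c = c'" "c \<in> W" using assms(1) unfolding rsim_def by blast
  have c': "c' \<in> W'" using rsim_mem[OF assms(1)] by blast
  let ?g = "map_prod ((`) f) ((`) f)"
  have "inj_on ?g (Pow W \<times> Pow W)"
    by (intro map_prod_inj_on inj_on_image_Pow iso_inj[OF f(1)])
  moreover have "{(L, B) \<in> legpairs r W c T t. L \<union> B = W} \<subseteq> Pow W \<times> Pow W" by auto
  ultimately have "inj_on ?g {(L, B) \<in> legpairs r W c T t. L \<union> B = W}" by (rule inj_on_subset)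
  moreover have "?g ` {(L, B) \<in> legpairs r W c T t. L \<union> B = W} \<subseteq> {(L, B) \<in> legpairs r W' c' T t. L \<union> B = W'}"
    using legpairs_iso[OF f(1,3,2)] iso_image[OF f(1)] by auto
  moreover have "finite {(L, B) \<in> legpairs r W' c' T t. L \<union> B = W'}"
    by (rule finite_subset[of _ "Pow W' \<times> Pow W'"]) (use assms(2) in auto)
  ultimately show ?thesis by (rule card_inj_on_le)
qed

text \<open>Pairs are grouped by their union. The union is proper: \<open>L \<union> B = V\<close>
  would leave just two branches at the root, with the leg \<open>L\<close> as one of them.\<close>

lemma legpairs_card_sum:
  assumes V: "rtree V c" and r: "1 \<le> r" and ne: "\<not> exceptional r V c"
  shows "card (legpairs r V c T t) = (\<Sum>W\<in>proper_radial 2 r V c. card {(L, B) \<in> legpairs r W c T t. L \<union> B = W})"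
proof -
  have fV: "finite V" using V rtree_finite by blast
  let ?S = "\<lambda>W. {(L, B) \<in> legpairs r W c T t. L \<union> B = W}"
  have "legpairs r V c T t = (\<Union>W\<in>proper_radial 2 r V c. ?S W)"
  proof
    show "legpairs r V c T t \<subseteq> (\<Union>W\<in>proper_radial 2 r V c. ?S W)"
    proof clarify
      fix L B assume "(L, B) \<in> legpairs r V c T t"
      then obtain x y where xy: "x \<in> nbs V c" "y \<in> nbs V c" "x \<noteq> y" and L: "L \<in> legs r (branch V c x) c"
        and B: "B \<in> subtrees (branch V c y) c" "deep r B c" and rs: "rsim B c T t" unfolding legpairs_def by blast
      note s = legpair_structure[OF V r xy L B]
      have lL: "leg r L c" using L unfolding legs_def by blast
      have "L \<union> B \<noteq> V"
      proof
        assume e: "L \<union> B = V"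
        have "exceptional r V c" unfolding exceptional_def using s(2,3) lL xy(3) unfolding e by blast
        then show False using ne by blast
      qed
      then have "L \<union> B \<in> proper_radial 2 r V c" unfolding proper_radial_def using s(1,5) xy(3) by simp
      moreover have "(L, B) \<in> legpairs r (L \<union> B) c T t"
        unfolding legpairs_def legs_def using s xy(3) lL rs B by (auto simp: subtrees_def)
      ultimately show "(L, B) \<in> (\<Union>W\<in>proper_radial 2 r V c. ?S W)" by blast
    qed
    show "(\<Union>W\<in>proper_radial 2 r V c. ?S W) \<subseteq> legpairs r V c T t"
    proof clarify
      fix W L B assume W: "W \<in> proper_radial 2 r V c" and "(L, B) \<in> legpairs r W c T t"
      then obtain x y where xy: "x \<in> nbs W c" "y \<in> nbs W c" "x \<noteq> y" and L: "L \<in> legs r (branch W c x) c"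
        and B: "B \<in> subtrees (branch W c y) c" "deep r B c" and rs: "rsim B c T t" unfolding legpairs_def by blast
      have Ws: "W \<in> subtrees V c" using W unfolding proper_radial_def by blast
      have s: "branch W c z \<subseteq> branch V c z" "z \<in> nbs V c" if "z \<in> nbs W c" for z
        using branch_subtrees[OF V Ws that] that nbs_mono[of W V c] Ws unfolding subtrees_def by blast+
      show "(L, B) \<in> legpairs r V c T t"
        unfolding legpairs_def legs_def using s xy L B rs unfolding legs_def subtrees_def by blast
    qed
  qed
  moreover have "card (\<Union>W\<in>proper_radial 2 r V c. ?S W) = (\<Sum>W\<in>proper_radial 2 r V c. card (?S W))"
  proof (rule card_UN_disjoint)
    show "finite (proper_radial 2 r V c)" unfolding proper_radial_def using subtrees_finite[OF fV] by simp
    show "\<forall>W\<in>proper_radial 2 r V c. finite (?S W)"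
    proof
      fix W assume "W \<in> proper_radial 2 r V c"
      then have "finite W" using fV finite_subset unfolding proper_radial_def subtrees_def by blast
      moreover have "?S W \<subseteq> Pow W \<times> Pow W" by blast
      ultimately show "finite (?S W)" by (meson finite_Pow_iff finite_SigmaI finite_subset)
    qed
  qed auto
  ultimately show ?thesis by simp
qed

text \<open>Once the branch containing \<open>B\<close> is fixed, the leg ranges over all other
  branches, which gives the total number of legs minus those in this branch. The total is not known
  in advance, and this is why the weights are not simply given.\<close>

lemma legpairs_card_branches:
  assumes V: "rtree V c" and r: "1 \<le> r"
  shows "card (legpairs r V c T t) =
    (\<Sum>y\<in>radial r V c. ((\<Sum>x\<in>radial r V c. card (legs r (branch V c x) c)) - card (legs r (branch V c y) c)) * deep_count r (branch V c y) c T t)"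
proof -
  have fV: "finite V" using V rtree_finite by blast
  have cV: "c \<in> V" using V rtree_def by blast
  have fB: "finite (branch V c x)" for x using finite_subset[OF branch_subset[OF cV] fV] .
  let ?R = "radial r V c" and ?l = "\<lambda>x. legs r (branch V c x) c"
  let ?S = "\<lambda>y. {B \<in> subtrees (branch V c y) c. deep r B c \<and> rsim B c T t}"
  have fR: "finite ?R" using radial_finite[OF fV] .
  have Rn: "?R \<subseteq> nbs V c" unfolding radial_def by blast
  have inR: "x \<in> ?R" if "x \<in> nbs V c" "B \<in> subtrees (branch V c x) c" "deep r B c" for x B
    using that deep_mono unfolding radial_def subtrees_def by blast
  have leg: "L \<in> subtrees (branch V c x) c \<and> deep r L c" if "L \<in> ?l x" for L x
    using that leg_in_subtrees leg_deep unfolding legs_def by blast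
  have un: "x = y" if "x \<in> nbs V c" "y \<in> nbs V c" "B \<in> subtrees (branch V c x) c" "B \<in> subtrees (branch V c y) c" "deep r B c" for x y B
    using subtrees_branch(1)[OF V that(1,3) leg_not_singleton[OF r that(5)]]
      subtrees_branch(1)[OF V that(2,4) leg_not_singleton[OF r that(5)]] by simp
  have "legpairs r V c T t = (\<Union>y\<in>?R. (\<Union>x\<in>?R - {y}. ?l x) \<times> ?S y)"
  proof
    show "legpairs r V c T t \<subseteq> (\<Union>y\<in>?R. (\<Union>x\<in>?R - {y}. ?l x) \<times> ?S y)"
    proof clarify
      fix L B assume "(L, B) \<in> legpairs r V c T t"
      then obtain x y where xy: "x \<in> nbs V c" "y \<in> nbs V c" "x \<noteq> y" and L: "L \<in> ?l x"
        and B: "B \<in> subtrees (branch V c y) c" "deep r B c" and rs: "rsim B c T t" unfolding legpairs_def by blast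
      have "x \<in> ?R" "y \<in> ?R" using inR xy B leg[OF L] by blast+
      then show "(L, B) \<in> (\<Union>y\<in>?R. (\<Union>x\<in>?R - {y}. ?l x) \<times> ?S y)" using xy L B rs by blast
    qed
    show "(\<Union>y\<in>?R. (\<Union>x\<in>?R - {y}. ?l x) \<times> ?S y) \<subseteq> legpairs r V c T t"
      unfolding legpairs_def using Rn by blast
  qed
  moreover have "card (\<Union>y\<in>?R. (\<Union>x\<in>?R - {y}. ?l x) \<times> ?S y) = (\<Sum>y\<in>?R. card ((\<Union>x\<in>?R - {y}. ?l x) \<times> ?S y))"
  proof (rule card_UN_disjoint[OF fR])
    show "\<forall>y\<in>?R. finite ((\<Union>x\<in>?R - {y}. ?l x) \<times> ?S y)"
      using fR legs_finite[OF fB] subtrees_finite[OF fB] by simp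
    show "\<forall>i\<in>?R. \<forall>j\<in>?R. i \<noteq> j \<longrightarrow> ((\<Union>x\<in>?R - {i}. ?l x) \<times> ?S i) \<inter> ((\<Union>x\<in>?R - {j}. ?l x) \<times> ?S j) = {}"
      using un Rn by blast
  qed
  moreover have "card (\<Union>x\<in>?R - {y}. ?l x) = (\<Sum>x\<in>?R. card (?l x)) - card (?l y)" if y: "y \<in> ?R" for y
  proof -
    have "card (\<Union>x\<in>?R - {y}. ?l x) = (\<Sum>x\<in>?R - {y}. card (?l x))"
    proof (rule card_UN_disjoint)
      show "\<forall>i\<in>?R - {y}. \<forall>j\<in>?R - {y}. i \<noteq> j \<longrightarrow> ?l i \<inter> ?l j = {}" using leg un Rn by blast
    qed (use fR legs_finite[OF fB] in auto)
    also have "\<dots> = (\<Sum>x\<in>?R. card (?l x)) - card (?l y)" using sum_diff1_nat[of "\<lambda>x. card (?l x)" ?R y] y by simp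
    finally show ?thesis .
  qed
  ultimately show ?thesis unfolding deep_count_def by (simp add: card_cartesian_product)
qed

lemma biradial_nonexceptional:
  assumes V: "rtree V c" and V': "rtree V' c'" and card: "card V = card V'" and r: "1 \<le> r"
    and two: "2 \<le> card (radial r V c)" "2 \<le> card (radial r V' c')"
    and m: "matched (\<lambda>W W'. rsim W c W' c') (proper_radial 2 r V c) (proper_radial 2 r V' c')"
    and ne: "\<not> exceptional r V c" "\<not> exceptional r V' c'"
  shows "rsim V c V' c'"
proof -
  have fin: "finite V" "finite V'" using V V' rtree_finite by auto
  define s where "s = (\<lambda>x. rooted_type (branch V c x, c))"
  define s' where "s' = (\<lambda>x. rooted_type (branch V' c' x, c'))"
  define P where "P = (\<Sum>x\<in>radial r V c. card (legs r (branch V c x) c))"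
  define P' where "P' = (\<Sum>x\<in>radial r V' c'. card (legs r (branch V' c' x) c'))"
  \<comment> \<open>The number of legs depends on the rooted type only; it is read off an arbitrary
    representative.\<close>
  define g where "g \<tau> = card (legs r (fst (SOME R. R \<in> \<tau>)) (snd (SOME R. R \<in> \<tau>)))" for \<tau> :: "('v set \<times> 'v) set"
  have g: "g (rooted_type (A, a)) = card (legs r A a)" if "a \<in> A" for A a
  proof -
    have "(A, a) \<in> rooted_type (A, a)" unfolding rooted_type_def using rsim_refl that by simp
    then have "(SOME R. R \<in> rooted_type (A, a)) \<in> rooted_type (A, a)" by (rule someI)
    then show ?thesis unfolding g_def using legs_card[of A a] unfolding rooted_type_def by simp
  qed
  have gs: "g (s x) = card (legs r (branch V c x) c)" "g (s' x) = card (legs r (branch V' c' x) c')" for x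
    unfolding s_def s'_def using g unfolding branch_def by auto
  have pos: "0 < card (legs r (branch V c x) c)" if V: "rtree V c" and x: "x \<in> radial r V c" for V c x
  proof -
    have "deep r (branch V c x) c" using x unfolding radial_def by blast
    then obtain L where "leg r L c" "L \<subseteq> branch V c x" by (rule deep_obtain_leg)
    then have "L \<in> legs r (branch V c x) c" unfolding legs_def by blast
    moreover have "finite (branch V c x)" using finite_subset[OF branch_subset] rtree_finite V unfolding rtree_def by blast
    ultimately show ?thesis using legs_finite by (auto simp: card_gt_0_iff)
  qed
  have "card (legpairs r V c T t) = card (legpairs r V' c' T t)" for T t
    unfolding legpairs_card_sum[OF V r ne(1)] legpairs_card_sum[OF V' r ne(2)]
  proof (rule matched_sum[OF m])
    fix W W' assume a: "W \<in> proper_radial 2 r V c" "W' \<in> proper_radial 2 r V' c'" "rsim W c W' c'"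
    then have "finite W" "finite W'" using fin finite_subset unfolding proper_radial_def subtrees_def by blast+
    then show "card {(L, B) \<in> legpairs r W c T t. L \<union> B = W} = card {(L, B) \<in> legpairs r W' c' T t. L \<union> B = W'}"
      using legpairs_cover_le[OF a(3)] legpairs_cover_le[OF rsim_sym[OF a(3)]] by (simp add: le_antisym)
  qed
  then have tot: "(\<Sum>x\<in>radial r V c. (P - g (s x)) * deep_count r (branch V c x) c T t) = (\<Sum>x\<in>radial r V' c'. (P' - g (s' x)) * deep_count r (branch V' c' x) c' T t)" for T t
    unfolding legpairs_card_branches[OF V r] legpairs_card_branches[OF V' r] P_def[symmetric] P'_def[symmetric] gs .
  have "(\<Sum>x\<in>{x \<in> radial r V c. s x = \<tau>}. P - g (s x)) = (\<Sum>x\<in>{x \<in> radial r V' c'. s' x = \<tau>}. P' - g (s' x))" for \<tau>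
    using branch_class_totals[OF V V' tot, of \<tau>] unfolding s_def s'_def .
  moreover have "(\<Sum>x\<in>{x \<in> A. u x = \<tau>}. Q - g (u x)) = card {x \<in> A. u x = \<tau>} * (Q - g \<tau>)" for A :: "'v set" and u \<tau> Q
  proof -
    have "(\<Sum>x\<in>{x \<in> A. u x = \<tau>}. Q - g (u x)) = (\<Sum>x\<in>{x \<in> A. u x = \<tau>}. Q - g \<tau>)" by (rule sum.cong) auto
    then show ?thesis by simp
  qed
  ultimately have eq: "card {x \<in> radial r V c. s x = \<tau>} * (P - g \<tau>) = card {x \<in> radial r V' c'. s' x = \<tau>} * (P' - g \<tau>)" for \<tau>
    by simp
  have cls: "card {x \<in> radial r V c. s x = \<tau>} = card {x \<in> radial r V' c'. s' x = \<tau>}" for \<tau>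
    by (rule weighted_class_card_eq[where g = g and P = P and Q = P'])
      (use radial_finite fin two eq pos[OF V] pos[OF V'] in \<open>auto simp: gs P_def P'_def\<close>)
  have "radial r V c \<noteq> {}" using two by auto
  \<comment> \<open>The remaining branches are less deep than \<open>r\<close>, so they are
    reconstructed with \<open>h = 1\<close>.\<close>
  then show ?thesis
    using rooted_finish[OF V V' card two _ m cls[unfolded s_def s'_def]]
      rooted_reconstruction[where h = 1] deep_one by simp
qed

text \<open>A subtree with two branches of depth \<open>r\<close> must contain the whole leg
  \<open>L\<close>. Hence the family of \<open>V\<close> arises by adding \<open>L\<close> to the
  proper deep subtrees of the other branch \<open>T\<close>, and
  \<open>rooted_reconstruction\<close> applies to \<open>T\<close>, which has
  \<open>card V - r \<ge> r + 3\<close> vertices.\<close>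

lemma biradial_exceptional:
  assumes V: "rtree V c" and V': "rtree V' c'" and card: "card V = card V'" and r: "1 \<le> r"
    and two: "2 \<le> card (radial r V c)" "2 \<le> card (radial r V' c')"
    and m: "matched (\<lambda>W W'. rsim W c W' c') (proper_radial 2 r V c) (proper_radial 2 r V' c')"
    and ex: "exceptional r V c" "exceptional r V' c'" and big: "2 * r + 3 \<le> card V"
  shows "rsim V c V' c'"
proof -
  have str: "rtree T c \<and> deep r T c \<and> L \<union> T = V \<and> L \<inter> T = {c} \<and> radial r V c = {x, y} \<and> card T = card V - r \<and>
      bij_betw (\<lambda>B. L \<union> B) (proper_radial 1 r T c) (proper_radial 2 r V c) \<and>
      (\<forall>B\<in>proper_radial 1 r T c. nbs (L \<union> B) c = {x, y} \<and> branch (L \<union> B) c x = L \<and> branch (L \<union> B) c y = B)"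
    if V: "rtree V c" and two: "2 \<le> card (radial r V c)" and xy: "x \<noteq> y" "nbs V c = {x, y}" and lg: "leg r L c"
      and LT: "L = branch V c x" "T = branch V c y"
    for V c x y L T
  proof -
    have cV: "c \<in> V" using V rtree_def by blast
    have fV: "finite V" using V rtree_finite by blast
    have x: "x \<in> nbs V c" and y: "y \<in> nbs V c" using xy by auto
    have rT: "rtree T c" using branch_rtree[OF V y] LT by simp
    have LV: "L \<union> T = V" using branch_cover[OF V] xy(2) LT branch_self[OF x] by auto
    have i: "L \<inter> T = {c}" using branch_disjoint[OF V x y xy(1)] LT by simp
    have "radial r V c \<subseteq> {x, y}" unfolding radial_def using xy(2) by auto
    then have rd: "radial r V c = {x, y}" using two card_seteq[of "{x, y}" "radial r V c"] xy(1) by simp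
    then have dT: "deep r T c" unfolding radial_def LT by blast
    have "card V + card {c} = card L + card T"
      using card_Un_Int[of L T] LV i fV by (metis add.commute finite_Un)
    then have cT: "card T = card V - r" using leg_card[OF lg] by simp
    have lL: "L \<in> legs r (branch V c x) c" unfolding legs_def using lg LT by blast
    have T: "T \<in> subtrees V c" using branch_in_subtrees[OF cV y] LT by simp
    have st: "L \<union> B \<in> subtrees V c \<and> nbs (L \<union> B) c = {x, y} \<and> branch (L \<union> B) c x = L \<and> branch (L \<union> B) c y = B \<and> radial r (L \<union> B) c = {x, y}"
      if "B \<in> proper_radial 1 r T c" for B
    proof -
      have "B \<in> subtrees (branch V c y) c" "deep r B c" using that LT unfolding proper_radial_one[OF rT r] by auto
      then show ?thesis using legpair_structure[OF V r x y xy(1) lL] by blast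
    qed
    have "bij_betw (\<lambda>B. L \<union> B) (proper_radial 1 r T c) (proper_radial 2 r V c)"
    proof (rule bij_betw_byWitness[where f' = "\<lambda>W. W \<inter> T"])
      have sT: "(L \<union> B) \<inter> T = B" if "B \<in> proper_radial 1 r T c" for B
      proof -
        have B: "B \<subseteq> T" "c \<in> B" using that unfolding proper_radial_def subtrees_def by auto
        have "(L \<union> B) \<inter> T = (L \<inter> T) \<union> (B \<inter> T)" by blast
        also have "\<dots> = B" unfolding i using B by blast
        finally show ?thesis .
      qed
      then show "\<forall>B\<in>proper_radial 1 r T c. (L \<union> B) \<inter> T = B" by blast
      have W: "L \<subseteq> W \<and> branch W c y = W \<inter> T \<and> y \<in> radial r W c" if Wa: "W \<in> proper_radial 2 r V c" for W
      proof -
        have Ws: "W \<in> subtrees V c" "2 \<le> card (radial r W c)" using Wa unfolding proper_radial_def by auto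
        have "radial r W c \<subseteq> {x, y}" using radial_subtrees[OF V Ws(1)] rd by blast
        then have rW: "radial r W c = {x, y}" using Ws(2) card_seteq[of "{x, y}" "radial r W c"] xy(1) by simp
        then have n: "x \<in> nbs W c" "y \<in> nbs W c" "deep r (branch W c x) c" unfolding radial_def by auto
        have b: "branch W c x = W \<inter> L" "branch W c y = W \<inter> T" using branch_subtrees[OF V Ws(1)] n LT by auto
        have fL: "finite L" using leg_finite[OF lg] .
        have "Suc r \<le> card (W \<inter> L)" using deep_card[of r "W \<inter> L" c] n(3) b(1) fL by simp
        then have "W \<inter> L = L" using leg_card[OF lg] fL by (intro card_seteq) auto
        then show ?thesis using b rW by blast
      qed
      then show "\<forall>W\<in>proper_radial 2 r V c. L \<union> (W \<inter> T) = W" using LV unfolding proper_radial_def subtrees_def by blast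
      show "(\<lambda>B. L \<union> B) ` proper_radial 1 r T c \<subseteq> proper_radial 2 r V c"
      proof clarify
        fix B assume B: "B \<in> proper_radial 1 r T c"
        have "L \<union> B \<noteq> V" using sT[OF B] B LV unfolding proper_radial_def by blast
        then show "L \<union> B \<in> proper_radial 2 r V c" unfolding proper_radial_def using st[OF B] xy(1) by simp
      qed
      show "(\<lambda>W. W \<inter> T) ` proper_radial 2 r V c \<subseteq> proper_radial 1 r T c"
      proof clarify
        fix W assume Wa: "W \<in> proper_radial 2 r V c"
        then have Ws: "W \<in> subtrees V c" "W \<noteq> V" unfolding proper_radial_def by auto
        have y: "y \<in> nbs W c" "deep r (branch W c y) c" using W[OF Wa] unfolding radial_def by auto
        have "c \<in> W" using Ws unfolding subtrees_def by blast
        then have "W \<inter> T \<in> subtrees W c" using branch_in_subtrees[OF _ y(1)] W[OF Wa] by simp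
        then have "W \<inter> T \<in> subtrees T c" unfolding subtrees_def by blast
        moreover have "W \<inter> T \<noteq> T" using W[OF Wa] LV Ws unfolding subtrees_def by blast
        ultimately show "W \<inter> T \<in> proper_radial 1 r T c" unfolding proper_radial_one[OF rT r] using y(2) W[OF Wa] by simp
      qed
    qed
    then show ?thesis using rT dT LV i rd cT st by blast
  qed
  obtain x y where xy: "x \<noteq> y" "nbs V c = {x, y}" "leg r (branch V c x) c" using ex(1) unfolding exceptional_def by blast
  obtain x' y' where xy': "x' \<noteq> y'" "nbs V' c' = {x', y'}" "leg r (branch V' c' x') c'" using ex(2) unfolding exceptional_def by blast
  define L where "L = branch V c x"
  define T where "T = branch V c y"
  define L' where "L' = branch V' c' x'"
  define T' where "T' = branch V' c' y'"
  note S = str[OF V two(1) xy(1,2) xy(3)[folded L_def] L_def T_def]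
  note S' = str[OF V' two(2) xy'(1,2) xy'(3)[folded L'_def] L'_def T'_def]
  have legL: "leg r L c" "leg r L' c'" using xy xy' L_def L'_def by auto
  have LV: "L \<subseteq> V" "L' \<subseteq> V'" using S S' by auto
  have LL: "rsim L c L' c'" using leg_rsim[OF V V' legL LV] .
  have "matched (\<lambda>W W'. rsim W c W' c') (proper_radial 1 r T c) (proper_radial 1 r T' c')"
  proof (rule matched_transfer[OF m])
    show "bij_betw (\<lambda>B. L \<union> B) (proper_radial 1 r T c) (proper_radial 2 r V c)" "bij_betw (\<lambda>B. L' \<union> B) (proper_radial 1 r T' c') (proper_radial 2 r V' c')"
      using S S' by auto
    fix B B' assume B: "B \<in> proper_radial 1 r T c" "B' \<in> proper_radial 1 r T' c'" "rsim (L \<union> B) c (L' \<union> B') c'"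
    then obtain f where f: "iso f (L \<union> B) (L' \<union> B')" "c \<in> L \<union> B" "f c = c'" unfolding rsim_def by blast
    have b: "nbs (L \<union> B) c = {x, y}" "branch (L \<union> B) c x = L" "branch (L \<union> B) c y = B" using S B by auto
    have b': "nbs (L' \<union> B') c' = {x', y'}" "branch (L' \<union> B') c' x' = L'" "branch (L' \<union> B') c' y' = B'" using S' B by auto
    have n: "{x', y'} = {f x, f y}" using iso_nbs_root[OF f] b(1) b'(1) by simp
    note fx = iso_branch_rsim[OF f, of x] and fy = iso_branch_rsim[OF f, of y]
    show "rsim B c B' c'"
    proof (cases "f y = y'")
      case True
      then show ?thesis using fy b b' by simp
    next
      case False
      \<comment> \<open>An isomorphism may exchange the two branches. Then \<open>B\<close> and
        \<open>B'\<close> are both isomorphic to legs, hence to each other.\<close>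
      then have "f y = x'" "f x = y'" using n by (auto simp: doubleton_eq_iff)
      then have "rsim B c L' c'" "rsim L c B' c'" using fx fy b b' by auto
      then show ?thesis using LL rsim_sym rsim_trans by meson
    qed
  qed
  then have "rsim T c T' c'"
    using rooted_reconstruction[of T c T' c' r] S S' r big card by linarith
  then obtain f where f: "iso f T T'" "f c = c'" unfolding rsim_def by blast
  obtain g where g: "iso g L L'" "g c = c'" using LL unfolding rsim_def by blast
  have nx: "x \<in> nbs V c" "y \<in> nbs V c" "x' \<in> nbs V' c'" "y' \<in> nbs V' c'" using xy xy' by auto
  have "iso (\<lambda>x. if x \<in> L then g x else f x) (L \<union> T) (L' \<union> T')"
  proof (rule iso_glue[OF g(1) f(1)])
    show "g z = f z" if "z \<in> L" "z \<in> T" for z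
    proof -
      have "z = c" using that S by blast
      then show ?thesis using f(2) g(2) by simp
    qed
    show "g ` (L \<inter> T) = L' \<inter> T'" using S S' g(2) by simp
    show "\<not> E u w" if "u \<in> L - T" "w \<in> T - L" for u w
      using branch_no_edge[OF V nx(1,2) xy(1), of u w] that S unfolding L_def T_def by blast
    show "\<not> E u w" if "u \<in> L' - T'" "w \<in> T' - L'" for u w
      using branch_no_edge[OF V' nx(3,4) xy'(1), of u w] that S' unfolding L'_def T'_def by blast
  qed
  then have i: "iso (\<lambda>x. if x \<in> L then g x else f x) V V'" using S S' by simp
  have "c \<in> L" "c \<in> V" using V unfolding L_def branch_def rtree_def by auto
  then show ?thesis unfolding rsim_def using i g(2) by (intro conjI exI[of _ "\<lambda>x. if x \<in> L then g x else f x"]) auto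
qed

text \<open>Two legs of \<open>V\<close> with a third neighbour of the root, or with one more vertex
  in each branch, form subtrees that the exceptional \<open>V'\<close> cannot contain. So a third
  neighbour does not exist, and the second subtree is all of \<open>V\<close>; its additional
  vertices exist because neither branch of the nonexceptional \<open>V\<close> is a leg.\<close>

lemma biradial_mismatch:
  assumes V: "rtree V c" and V': "rtree V' c'" and card: "card V = card V'" and r: "1 \<le> r"
    and two: "2 \<le> card (radial r V c)"
    and m: "matched (\<lambda>W W'. rsim W c W' c') (proper_radial 2 r V c) (proper_radial 2 r V' c')"
    and ex: "\<not> exceptional r V c" "exceptional r V' c'" and big: "2 * r + 3 \<le> card V"
  obtains xs ys u w a b where "path (c # xs)" "path (c # ys)" "length xs = r" "length ys = r"
    "hd xs \<noteq> hd ys" "nbs V c = {hd xs, hd ys}" "a \<in> set xs" "b \<in> set ys" "E a u" "E b w"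
    "u \<notin> set (c # xs)" "w \<notin> set (c # ys)" "V = set (c # xs) \<union> set (c # ys) \<union> {u, w}" "card V = 2 * r + 3"
proof -
  have fin: "finite V" "finite V'" using V V' rtree_finite by auto
  have cV: "c \<in> V" using V rtree_def by blast
  obtain x' y' where xy': "x' \<noteq> y'" "nbs V' c' = {x', y'}" "leg r (branch V' c' x') c'" using ex(2) unfolding exceptional_def by blast
  obtain x y where xy: "x \<in> radial r V c" "y \<in> radial r V c" "x \<noteq> y"
    using two by (metis card_le_Suc0_iff_eq fin(1) not_less_eq_eq numeral_2_eq_2 radial_finite)
  have n: "x \<in> nbs V c" "y \<in> nbs V c" using xy unfolding radial_def by auto
  have lst: "\<exists>zs. path (c # zs) \<and> length zs = r \<and> set (c # zs) \<subseteq> branch V c x \<and> hd zs = x" if "x \<in> radial r V c" for x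
  proof -
    have "deep r (branch V c x) c" and x: "x \<in> nbs V c" using that unfolding radial_def by auto
    then obtain zs where zs: "path zs" "length zs = Suc r" "hd zs = c" "set zs \<subseteq> branch V c x" unfolding deep_def by blast
    then obtain z zs' where e: "zs = c # z # zs'" using r by (cases zs; cases "tl zs") auto
    then have "z \<in> nbs (branch V c x) c" using zs unfolding nbs_def by (auto simp: path_Cons)
    then have "z = x" using branch_nbs[OF V x] by blast
    then show ?thesis using zs e by (intro exI[of _ "z # zs'"]) auto
  qed
  obtain xs where xs: "path (c # xs)" "length xs = r" "set (c # xs) \<subseteq> branch V c x" "hd xs = x" using lst[OF xy(1)] by blast
  obtain ys where ys: "path (c # ys)" "length ys = r" "set (c # ys) \<subseteq> branch V c y" "hd ys = y" using lst[OF xy(2)] by blast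
  let ?X = "set (c # xs)" and ?Y = "set (c # ys)"
  have lX: "leg r ?X c" unfolding leg_def by (rule exI[of _ "c # xs"]) (use xs in simp)
  have lY: "leg r ?Y c" unfolding leg_def by (rule exI[of _ "c # ys"]) (use ys in simp)
  have i: "branch V c x \<inter> branch V c y = {c}" using branch_disjoint[OF V n xy(3)] .
  have Xs: "?X \<in> subtrees V c" "?Y \<in> subtrees V c"
    using leg_in_subtrees[OF lX order_trans[OF xs(3) branch_subset[OF cV]]]
      leg_in_subtrees[OF lY order_trans[OF ys(3) branch_subset[OF cV]]] by auto
  have cX: "card ?X = Suc r" "card ?Y = Suc r" using leg_card lX lY by auto
  have Q: "?X \<union> ?Y \<in> subtrees V c" using subtrees_Un Xs by blast
  have xin: "x \<in> set xs" "y \<in> set ys"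
  proof -
    have "xs \<noteq> []" "ys \<noteq> []" using xs(2) ys(2) r by auto
    then show "x \<in> set xs" "y \<in> set ys" using xs(4) ys(4) hd_in_set[of xs] hd_in_set[of ys] by auto
  qed
  have XY: "?X \<inter> ?Y = {c}" using i xs(3) ys(3) by auto
  have "card (?X \<union> ?Y) + 1 = Suc r + Suc r"
    using card_Un_Int[of ?X ?Y] unfolding cX XY by simp
  then have cQ: "card (?X \<union> ?Y) = 2 * r + 1" by simp
  have proper_radial: "W \<in> proper_radial 2 r V c" if W: "W \<in> subtrees V c" "?X \<union> ?Y \<subseteq> W" "W \<noteq> V" for W
  proof -
    have nW: "x \<in> nbs W c" "y \<in> nbs W c" using xin W(2) n unfolding nbs_def by auto
    have "?X \<subseteq> branch W c x" "?Y \<subseteq> branch W c y" using branch_subtrees[OF V W(1)] nW W(2) xs(3) ys(3) by blast+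
    then have "{x, y} \<subseteq> radial r W c" unfolding radial_def using nW leg_deep[OF lX] leg_deep[OF lY] deep_mono by blast
    moreover have "finite (radial r W c)" using radial_finite[OF rtree_finite[OF subtrees_rtree[OF V W(1)]]] .
    ultimately have "2 \<le> card (radial r W c)" using card_mono[of "radial r W c" "{x, y}"] xy(3) by simp
    then show ?thesis unfolding proper_radial_def using W by simp
  qed
  have nV: "nbs V c = {x, y}"
  proof (rule ccontr)
    assume "nbs V c \<noteq> {x, y}"
    then obtain z where z: "z \<in> nbs V c" "z \<noteq> x" "z \<noteq> y" using n by blast
    let ?W = "insert z (?X \<union> ?Y)"
    have "conn ?W" using conn_insert[of "?X \<union> ?Y" c z] Q nbs_in[OF z(1)] unfolding subtrees_def by auto
    then have W: "?W \<in> subtrees V c" using Q nbs_in[OF z(1)] unfolding subtrees_def by auto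
    \<comment> \<open>Here \<open>2 * r + 3 \<le> card V\<close> enters: the subtree is proper and
      must occur in \<open>V'\<close>, whose root has only two neighbours.\<close>
    have "card ?W \<le> 2 * r + 2" using card_insert_le_m1[of "2 * r + 2" "?X \<union> ?Y" z] cQ by simp
    then have "?W \<noteq> V" using big by auto
    then have "?W \<in> proper_radial 2 r V c" using proper_radial[OF W] by blast
    then obtain W' where W': "W' \<in> proper_radial 2 r V' c'" "rsim ?W c W' c'" using matched_ex[OF m] by blast
    have "card (nbs W' c') \<le> card {x', y'}"
      using W'(1) nbs_mono[of W' V' c'] xy'(2) unfolding proper_radial_def subtrees_def by (intro card_mono) auto
    moreover have "{x, y, z} \<subseteq> nbs ?W c" using n z xin unfolding nbs_def by auto
    then have "3 \<le> card (nbs ?W c)" using card_mono[of "nbs ?W c" "{x, y, z}"] xy(3) z by (simp add: nbs_finite)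
    ultimately show False using rsim_nbs_card[OF W'(2)] xy'(1) by simp
  qed
  \<comment> \<open>The new vertex is attached away from the root, since the root has only one
    neighbour in this branch and that one lies on the leg.\<close>
  have ext: "\<exists>a u. a \<in> set zs \<and> u \<in> branch V c z \<and> u \<notin> set (c # zs) \<and> E a u"
    if z: "z \<in> nbs V c" and zs: "path (c # zs)" "length zs = r" "set (c # zs) \<subseteq> branch V c z" "hd zs = z" and nl: "\<not> leg r (branch V c z) c" for z zs
  proof -
    have ne: "set (c # zs) \<noteq> branch V c z"
    proof
      assume "set (c # zs) = branch V c z"
      then have "leg r (branch V c z) c" unfolding leg_def using zs by (intro exI[of _ "c # zs"]) simp
      then show False using nl by blast
    qed
    obtain a u where au: "a \<in> set (c # zs)" "u \<in> branch V c z" "u \<notin> set (c # zs)" "E a u"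
      by (rule connE[OF branch_conn[OF z] zs(3) _ ne]) auto
    have "a \<noteq> c"
    proof
      assume "a = c"
      then have "u = z" using branch_nbs[OF V z] au unfolding nbs_def by blast
      then show False using au(3) zs r by (auto simp: Suc_le_eq)
    qed
    then show ?thesis using au by auto
  qed
  have "\<not> leg r (branch V c x) c" "\<not> leg r (branch V c y) c"
  proof -
    have "leg r (branch V c x) c \<Longrightarrow> exceptional r V c"
      unfolding exceptional_def using nV xy(3) by (intro exI[of _ x] exI[of _ y]) auto
    moreover have "leg r (branch V c y) c \<Longrightarrow> exceptional r V c"
      unfolding exceptional_def using nV xy(3) by (intro exI[of _ y] exI[of _ x]) auto
    ultimately show "\<not> leg r (branch V c x) c" "\<not> leg r (branch V c y) c" using ex(1) by blast+
  qed
  then obtain a u b w where au: "a \<in> set xs" "u \<in> branch V c x" "u \<notin> ?X" "E a u" and bw: "b \<in> set ys" "w \<in> branch V c y" "w \<notin> ?Y" "E b w"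
    using ext[OF n(1) xs] ext[OF n(2) ys] by blast
  let ?W = "insert w (insert u (?X \<union> ?Y))"
  have uV: "u \<in> V" "w \<in> V" using au bw branch_subset[OF cV] by blast+
  have "conn (insert u (?X \<union> ?Y))" using conn_insert[of "?X \<union> ?Y" a u] Q au unfolding subtrees_def by auto
  then have "conn ?W" using conn_insert[of "insert u (?X \<union> ?Y)" b w] bw by auto
  then have W: "?W \<in> subtrees V c" using Q uV unfolding subtrees_def by auto
  have uw: "u \<notin> branch V c y" "w \<notin> branch V c x" using i au bw by auto
  then have "u \<notin> ?X \<union> ?Y" "w \<notin> insert u (?X \<union> ?Y)" using au bw xs(3) ys(3) by auto
  then have cW: "card ?W = 2 * r + 3" using cQ by simp
  have "?W = V"
  proof (rule ccontr)
    assume "?W \<noteq> V"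
    then have "?W \<in> proper_radial 2 r V c" using proper_radial[OF W] by blast
    then obtain W' where W': "W' \<in> proper_radial 2 r V' c'" "rsim ?W c W' c'" using matched_ex[OF m] by blast
    obtain f where f: "iso f ?W W'" "c \<in> ?W" "f c = c'" using W'(2) unfolding rsim_def by blast
    have W's: "W' \<in> subtrees V' c'" using W'(1) unfolding proper_radial_def by blast
    have xW: "x \<in> nbs ?W c" "y \<in> nbs ?W c" using n xin unfolding nbs_def by auto
    have "nbs ?W c \<subseteq> {x, y}" using nbs_mono[of ?W V c] W nV unfolding subtrees_def by blast
    then have nW: "nbs ?W c = {x, y}" using xW by blast
    \<comment> \<open>Both branches of the subtree have \<open>r + 2\<close> vertices, whereas the
      branch of \<open>x'\<close> lies in a leg with \<open>r + 1\<close>.\<close>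
    have big: "card (branch ?W c z) = r + 2" if z: "z \<in> {x, y}" for z
    proof -
      have "?X \<inter> branch V c y \<subseteq> {c}" "?Y \<inter> branch V c x \<subseteq> {c}" using xs(3) ys(3) i by blast+
      then have "?W \<inter> branch V c x = insert u ?X" "?W \<inter> branch V c y = insert w ?Y"
        using au(2) bw(2) xs(3) ys(3) uw by auto
      then have "branch ?W c x = insert u ?X" "branch ?W c y = insert w ?Y"
        using branch_subtrees[OF V W xW(1)] branch_subtrees[OF V W xW(2)] by auto
      then show ?thesis using z cX au(3) bw(3) by auto
    qed
    have "card (radial r W' c') \<ge> 2" using W'(1) unfolding proper_radial_def by blast
    moreover have "radial r W' c' \<subseteq> {x', y'}" using radial_subtrees[OF V' W's] xy'(2) unfolding radial_def by auto
    ultimately have "radial r W' c' = {x', y'}" using card_seteq[of "{x', y'}" "radial r W' c'"] xy'(1) by simp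
    then have x'W: "x' \<in> nbs W' c'" unfolding radial_def by blast
    then obtain z where z: "z \<in> {x, y}" "x' = f z" using iso_nbs_root[OF f] nW by auto
    have "card (branch W' c' x') = r + 2" using rsim_card[OF iso_branch_rsim[OF f, of z]] big[OF z(1)] z nW by simp
    moreover have "branch W' c' x' \<subseteq> branch V' c' x'" using branch_subtrees[OF V' W's x'W] by blast
    then have "card (branch W' c' x') \<le> Suc r" using leg_card[OF xy'(3)] leg_finite[OF xy'(3)] card_mono by metis
    ultimately show False by simp
  qed
  then have "V = ?X \<union> ?Y \<union> {u, w}" by auto
  then show thesis using that[of xs ys a b u w] xs ys xy(3) nV au bw \<open>?W = V\<close> cW by auto
qed

section \<open>Trees of given diameter\<close>

text \<open>The families of all proper induced subgraphs agree up to isomorphism; all sizes and the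
  edgeless subgraphs are included.\<close>

definition hypomorphic :: "'v set \<Rightarrow> 'v set \<Rightarrow> bool" where
  "hypomorphic V V' \<longleftrightarrow> matched sim {W. W \<subset> V} {W. W \<subset> V'}"

definition has_path :: "nat \<Rightarrow> 'v set \<Rightarrow> bool" where
  "has_path k W \<longleftrightarrow> (\<exists>xs. path xs \<and> length xs = Suc k \<and> set xs \<subseteq> W)"

text \<open>The number of edges of a longest path. In a tree this is the diameter, as paths are
  determined by their ends.\<close>

definition diam :: "nat \<Rightarrow> 'v set \<Rightarrow> bool" where
  "diam d V \<longleftrightarrow> has_path d V \<and> \<not> has_path (Suc d) V"

section \<open>Invariants of the family of proper subgraphs\<close>

lemma hypomorphic_sym: "hypomorphic V V' \<Longrightarrow> hypomorphic V' V"
  unfolding hypomorphic_def by (drule matched_sym) (erule matched_mono, auto intro: sim_sym)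

lemma hypomorphic_ex:
  assumes "hypomorphic V V'" "W \<subset> V" obtains W' f where "W' \<subset> V'" "iso f W W'"
proof -
  obtain W' where "W' \<in> {W. W \<subset> V'}" "sim W W'"
    using matched_ex[OF assms(1)[unfolded hypomorphic_def], of W] assms(2) by blast
  then show thesis using that unfolding sim_def by blast
qed

lemma hypomorphic_points:
  assumes "hypomorphic V V'" "finite V" "finite V'" "card V = card V'"
  shows "matched (\<lambda>z z'. sim (V - {z}) (V' - {z'})) V V'"
proof -
  have m: "matched sim {W \<in> {W. W \<subset> V}. Suc (card W) = card V} {W \<in> {W. W \<subset> V'}. Suc (card W) = card V}"
    using assms(1) unfolding hypomorphic_def by (rule matched_restrict) (auto dest: sim_card)
  have b: "bij_betw (\<lambda>z. V - {z}) V {W \<in> {W. W \<subset> V}. Suc (card W) = card V}" if fV: "finite V" for V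
    unfolding bij_betw_def
  proof
    show "inj_on (\<lambda>z. V - {z}) V" by (rule inj_onI) blast
    show "(\<lambda>z. V - {z}) ` V = {W \<in> {W. W \<subset> V}. Suc (card W) = card V}"
    proof
      show "(\<lambda>z. V - {z}) ` V \<subseteq> {W \<in> {W. W \<subset> V}. Suc (card W) = card V}"
        using card_Suc_Diff1[OF fV] by auto
      show "{W \<in> {W. W \<subset> V}. Suc (card W) = card V} \<subseteq> (\<lambda>z. V - {z}) ` V"
      proof
        fix W assume "W \<in> {W \<in> {W. W \<subset> V}. Suc (card W) = card V}"
        then have W: "W \<subset> V" "Suc (card W) = card V" by auto
        then obtain z where z: "z \<in> V" "z \<notin> W" by blast
        have "card (V - {z}) = card W" using card_Suc_Diff1[OF fV z(1)] W(2) by simp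
        moreover have "W \<subseteq> V - {z}" using W z by blast
        ultimately have "W = V - {z}" using card_subset_eq[of "V - {z}" W] fV by simp
        then show "W \<in> (\<lambda>z. V - {z}) ` V" using z by blast
      qed
    qed
  qed
  show ?thesis
    by (rule matched_transfer[OF m b[OF assms(2)] b[OF assms(3), folded assms(4)]])
qed

text \<open>The degree of a vertex is half the loss of \<open>arc_count\<close> caused by its
  deletion.\<close>

lemma hypomorphic_degrees:
  assumes "hypomorphic V V'" "finite V" "finite V'" "card V = card V'" "arc_count V = arc_count V'"
  shows "matched (\<lambda>z z'. sim (V - {z}) (V' - {z'}) \<and> card (nbs V z) = card (nbs V' z')) V V'"
proof (rule matched_mono[OF hypomorphic_points[OF assms(1-4)]])
  fix z z' assume "z \<in> V" "z' \<in> V'" "sim (V - {z}) (V' - {z'})"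
  then show "sim (V - {z}) (V' - {z'}) \<and> card (nbs V z) = card (nbs V' z')"
    using arc_count_remove[OF assms(2), of z] arc_count_remove[OF assms(3), of z'] sim_arc_count assms(5) by fastforce
qed

lemma has_path_mono: "has_path k W \<Longrightarrow> W \<subseteq> V \<Longrightarrow> has_path k V"
  unfolding has_path_def by blast

lemma has_path_le:
  assumes "has_path k W" "j \<le> k" shows "has_path j W"
proof -
  obtain xs where "path xs" "length xs = Suc k" "set xs \<subseteq> W" using assms unfolding has_path_def by blast
  then show ?thesis unfolding has_path_def using assms(2) path_take[of xs "Suc j"] set_take_subset[of "Suc j" xs]
    by (intro exI[of _ "take (Suc j) xs"]) auto
qed

lemma has_path_card: "has_path k W \<Longrightarrow> finite W \<Longrightarrow> Suc k \<le> card W"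
  unfolding has_path_def by (metis card_mono distinct_card path_distinct)

lemma has_path_iso:
  assumes "iso f W W'" "has_path k W" shows "has_path k W'"
proof -
  obtain xs where "path xs" "length xs = Suc k" "set xs \<subseteq> W" using assms(2) unfolding has_path_def by blast
  then show ?thesis unfolding has_path_def using iso_path[OF assms(1)] iso_image[OF assms(1)]
    by (intro exI[of _ "map f xs"]) auto
qed

text \<open>A path that misses some vertex is a proper subset, so it occurs in \<open>V'\<close> as
  well.\<close>

lemma has_path_hypomorphic:
  assumes "hypomorphic V V'" "finite V" "has_path k V" "Suc k < card V"
  shows "has_path k V'"
proof -
  obtain xs where xs: "path xs" "length xs = Suc k" "set xs \<subseteq> V" using assms(3) unfolding has_path_def by blast
  have "card (set xs) = Suc k" using xs distinct_card path_distinct by metis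
  then have "set xs \<subset> V" using xs(3) assms(4) by auto
  then obtain W' f where "W' \<subset> V'" "iso f (set xs) W'" by (rule hypomorphic_ex[OF assms(1)])
  moreover have "has_path k (set xs)" unfolding has_path_def using xs by blast
  ultimately show ?thesis using has_path_iso has_path_mono by blast
qed

section \<open>Longest paths in trees\<close>

lemma diam_exists:
  assumes "finite V" "V \<noteq> {}" obtains d where "diam d V"
proof -
  obtain x where "x \<in> V" using assms(2) by blast
  then have "has_path 0 V" unfolding has_path_def by (intro exI[of _ "[x]"]) (simp add: path_def)
  moreover have "\<forall>k. has_path k V \<longrightarrow> k < card V" using has_path_card assms(1) Suc_le_eq by blast
  ultimately obtain d where d: "has_path d V" "\<And>k. has_path k V \<Longrightarrow> k \<le> d"
    using ex_has_greatest_nat[of "\<lambda>k. has_path k V" 0 "\<lambda>k. k" "card V"] less_imp_le by metis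
  have "\<not> has_path (Suc d) V"
  proof
    assume "has_path (Suc d) V"
    from d(2)[OF this] show False by simp
  qed
  then show thesis using d that unfolding diam_def by blast
qed

lemma diam_length:
  assumes "diam d V" "path xs" "set xs \<subseteq> V" shows "length xs \<le> Suc d"
proof (rule ccontr)
  assume "\<not> ?thesis"
  then obtain k where "length xs = Suc k" "Suc d \<le> k" by (cases "length xs") auto
  then have "has_path k V" unfolding has_path_def using assms by blast
  then show False using has_path_le[OF _ \<open>Suc d \<le> k\<close>] assms(1) unfolding diam_def by blast
qed

text \<open>A vertex attached to an end would prolong the longest path.\<close>

lemma diam_off_path:
  assumes "diam d V" "path xs" "set xs \<subseteq> V" "length xs = Suc d" "z \<in> V" "z \<notin> set xs" "E (xs ! i) z" "i \<le> d"
  shows "0 < i" "i < d"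
proof -
  have ne: "xs \<noteq> []" using assms(4) by auto
  show "0 < i"
  proof (rule ccontr)
    assume "\<not> 0 < i"
    then have "path (z # xs)" using assms ne E_sym by (simp add: path_Cons hd_conv_nth)
    then show False using diam_length[OF assms(1), of "z # xs"] assms(3-5) by simp
  qed
  show "i < d"
  proof (rule ccontr)
    assume "\<not> i < d"
    then have "i = d" using assms(8) by simp
    then have "last xs = xs ! i" using ne assms(4) by (simp add: last_conv_nth)
    then have "path (xs @ [z])" using assms(2,6,7) by (simp add: path_append path_Cons) (simp add: path_def)
    then show False using diam_length[OF assms(1), of "xs @ [z]"] assms(3-5) by simp
  qed
qed

lemma path_split:
  assumes "path xs" "i < length xs"
  shows "path (xs ! i # rev (take i xs))" "path (xs ! i # drop (Suc i) xs)"
proof -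
  have "rev (take (Suc i) xs) = xs ! i # rev (take i xs)" using assms(2) by (simp add: take_Suc_conv_app_nth)
  then show "path (xs ! i # rev (take i xs))" using path_rev[of "take (Suc i) xs"] path_take[OF assms(1)] by metis
  show "path (xs ! i # drop (Suc i) xs)" using path_drop[OF assms(1), of i] assms(2) by (simp add: Cons_nth_drop_Suc)
qed

text \<open>A path starting at an entry of \<open>xs\<close> takes its first step in at most one of
  the two directions along \<open>xs\<close>; it then continues the segment that arrives from the
  other direction.\<close>

lemma path_two_directions:
  assumes "forest_on V" "path xs" "set xs \<subseteq> V" "i < length xs" "path (xs ! i # ys)" "set ys \<subseteq> V"
  shows "path (take (Suc i) xs @ ys) \<or> path (rev ys @ drop i xs)"
proof (cases "ys = [] \<or> i = 0 \<or> hd ys \<noteq> hd (rev (take i xs))")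
  case True
  have "path (rev (rev (take i xs)) @ xs ! i # ys)"
  proof (rule path_fork_join[OF assms(1) path_split(1)[OF assms(2,4)] assms(5)])
    show "set (xs ! i # rev (take i xs)) \<subseteq> V" "set (xs ! i # ys) \<subseteq> V"
      using assms(3,4,6) set_take_subset[of i xs] by auto
  qed (use True in auto)
  moreover have "take (Suc i) xs @ ys = rev (rev (take i xs)) @ xs ! i # ys"
    using assms(4) by (simp add: take_Suc_conv_app_nth)
  ultimately show ?thesis by simp
next
  case False
  then have "rev (take i xs) \<noteq> []" "hd ys = hd (rev (take i xs))" using assms(4) by auto
  then have m: "hd ys \<in> set (take i xs)" using hd_in_set[of "rev (take i xs)"] by simp
  have "path (rev ys @ xs ! i # drop (Suc i) xs)"
  proof (rule path_fork_join[OF assms(1,5) path_split(2)[OF assms(2,4)]])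
    show "set (xs ! i # drop (Suc i) xs) \<subseteq> V" "set (xs ! i # ys) \<subseteq> V"
      using assms(3,4,6) set_drop_subset[of "Suc i" xs] by auto
    show "hd ys \<noteq> hd (drop (Suc i) xs)" if "drop (Suc i) xs \<noteq> []"
    proof -
      have "hd (drop (Suc i) xs) \<in> set (drop i xs)"
        using that by (metis Cons_nth_drop_Suc assms(4) hd_in_set list.set_intros(2))
      moreover have "set (take i xs) \<inter> set (drop i xs) = {}"
        using path_distinct[OF assms(2)] by (simp add: set_take_disj_set_drop_if_distinct)
      ultimately show ?thesis using m by (metis disjoint_iff)
    qed
  qed
  then show ?thesis using assms(4) by (simp add: Cons_nth_drop_Suc)
qed

text \<open>One of the two segments of the longest path that end in \<open>xs ! i\<close> can be
  prolonged by \<open>ys\<close>, and the result has at most \<open>d + 1\<close> vertices.\<close>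

lemma diam_eccentricity:
  assumes "forest_on V" "diam d V" "path xs" "set xs \<subseteq> V" "length xs = Suc d" "i \<le> d"
    "path (xs ! i # ys)" "set ys \<subseteq> V"
  shows "length ys \<le> max i (d - i)"
proof -
  have "path (take (Suc i) xs @ ys) \<or> path (rev ys @ drop i xs)"
    using path_two_directions[OF assms(1,3,4) _ assms(7,8)] assms(5,6) by simp
  moreover have "set (take (Suc i) xs @ ys) \<subseteq> V" "set (rev ys @ drop i xs) \<subseteq> V"
    using assms(4,8) set_take_subset[of "Suc i" xs] set_drop_subset[of i xs] by auto
  ultimately have "length (take (Suc i) xs @ ys) \<le> Suc d \<or> length (rev ys @ drop i xs) \<le> Suc d"
    using diam_length[OF assms(2)] by blast
  then show ?thesis using assms(5,6) by auto
qed

section \<open>Trees with at most one vertex off a longest path\<close>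

lemma path_degree_le_2:
  assumes "forest_on V" "path xs" "set xs \<subseteq> V" "x \<in> set xs"
  shows "card (nbs (set xs) x) \<le> 2"
proof -
  obtain k where k: "k < length xs" "x = xs ! k" using assms(4) by (metis in_set_conv_nth)
  have "nbs (set xs) x \<subseteq> {xs ! (k - 1), xs ! Suc k}" unfolding k(2) path_nbs_card[OF assms(1-3) k(1)] by auto
  then have "card (nbs (set xs) x) \<le> card {xs ! (k - 1), xs ! Suc k}" by (intro card_mono) auto
  also have "\<dots> \<le> 2" by (simp add: card_insert_if)
  finally show ?thesis .
qed

text \<open>A longest path is spanning: a vertex attached to it would hang at an inner entry, which
  then has degree at least 3.\<close>

lemma spanning_path_of_degrees:
  assumes "forest_on V" "conn V" "\<And>x. x \<in> V \<Longrightarrow> card (nbs V x) \<le> 2"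
  obtains xs where "path xs" "set xs = V"
proof -
  have fV: "finite V" using assms(1) forest_finite by blast
  obtain d where d: "diam d V" using diam_exists[OF fV conn_nonempty[OF assms(2)]] .
  then obtain xs where xs: "path xs" "length xs = Suc d" "set xs \<subseteq> V" unfolding diam_def has_path_def by blast
  have "set xs = V"
  proof (rule ccontr)
    assume ne: "set xs \<noteq> V"
    have "set xs \<noteq> {}" using xs(2) by auto
    then obtain y z where yz: "y \<in> set xs" "z \<in> V" "z \<notin> set xs" "E y z"
      using connE[OF assms(2) xs(3)] ne by metis
    obtain i where i: "i < length xs" "y = xs ! i" using yz(1) by (metis in_set_conv_nth)
    have i': "0 < i" "i < d" using diam_off_path[OF d xs(1,3,2) yz(2,3)] i yz(4) xs(2) by auto
    have "{xs ! (i - 1), xs ! Suc i, z} \<subseteq> nbs V y"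
      unfolding nbs_def using path_edge_iff[OF assms(1) xs(1,3), of i] i i' xs yz by auto
    then have "card {xs ! (i - 1), xs ! Suc i, z} \<le> card (nbs V y)" using fV by (intro card_mono) (auto simp: nbs_finite)
    moreover have "card {xs ! (i - 1), xs ! Suc i, z} = 3"
    proof -
      have "xs ! (i - 1) \<noteq> xs ! Suc i" using nth_eq_iff_index_eq[OF path_distinct[OF xs(1)]] i' xs(2) by auto
      moreover have "z \<noteq> xs ! (i - 1)" "z \<noteq> xs ! Suc i" using yz(3) i' xs(2) by auto
      ultimately show ?thesis by auto
    qed
    ultimately show False using assms(3)[of y] yz xs(3) by auto
  qed
  then show thesis using that xs by blast
qed

lemma path_reconstruction:
  assumes F: "forest_on V" "forest_on V'" and C: "conn V" "conn V'" and h: "hypomorphic V V'" and cd: "card V = card V'"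
    and xs: "path xs" "set xs = V"
  shows "sim V V'"
proof -
  have fin: "finite V" "finite V'" using F forest_finite by auto
  have ar: "arc_count V = arc_count V'" using forest_conn_iff[OF F(1)] forest_conn_iff[OF F(2)] C conn_nonempty cd by simp
  have "card (nbs V' x) \<le> 2" if xV: "x \<in> V'" for x
  proof -
    obtain z where "z \<in> V" "card (nbs V z) = card (nbs V' x)"
      using matched_ex[OF matched_sym[OF hypomorphic_degrees[OF h fin cd ar]] xV] by blast
    then show ?thesis using path_degree_le_2[OF F(1) xs(1), of z] xs(2) by simp
  qed
  then obtain ys where ys: "path ys" "set ys = V'" using spanning_path_of_degrees[OF F(2) C(2)] by blast
  have "length xs = length ys" using cd xs ys distinct_card path_distinct by metis
  then obtain f where "iso f (set xs) (set ys)"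
    using path_iso[OF F xs(1) ys(1)] xs ys by auto
  then show ?thesis unfolding sim_def using xs ys by blast
qed

lemma same_diam:
  assumes h: "hypomorphic V V'" and fin: "finite V" "finite V'"
    and d: "diam d V" "diam d' V'" and np: "Suc d < card V" "Suc d' < card V'"
  shows "d = d'"
proof -
  have le: "d \<le> d'" if h: "hypomorphic V V'" and "finite V" "diam d V" "diam d' V'" "Suc d < card V" for V V' d d'
  proof -
    have "has_path d V'" using has_path_hypomorphic[OF h] that unfolding diam_def by blast
    then show ?thesis using has_path_le[of d V' "Suc d'"] that(4) unfolding diam_def by (meson not_less_eq_eq)
  qed
  show ?thesis using le[OF h fin(1) d np(1)] le[OF hypomorphic_sym[OF h] fin(2) d(2,1) np(2)] by simp
qed

lemma off_path_unique:
  assumes "forest_on V" "path xs" "set xs \<subseteq> V" "z \<in> V" "z \<notin> set xs" "i < length xs" "j < length xs"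
    "E (xs ! i) z" "E (xs ! j) z"
  shows "i = j"
proof -
  have "xs \<noteq> []" using assms(6) by auto
  then have "xs ! i = xs ! j"
    using forest_unique_nbs[OF assms(1,3) conn_path[OF assms(2)] assms(4,5), of "xs ! i" "xs ! j"] assms E_sym by simp
  then show ?thesis using nth_eq_iff_index_eq[OF path_distinct[OF assms(2)]] assms by simp
qed

lemma off_path_degree:
  assumes "forest_on V" "path xs" "set xs \<subseteq> V" "z \<in> V" "z \<notin> set xs"
  shows "card (nbs V z) \<le> Suc (card (V - set xs - {z}))"
proof -
  have fV: "finite V" using assms(1) forest_finite by blast
  have "nbs V z \<subseteq> nbs (set xs) z \<union> (V - set xs - {z})" unfolding nbs_def using E_irrefl by auto
  then have "card (nbs V z) \<le> card (nbs (set xs) z \<union> (V - set xs - {z}))" using fV by (intro card_mono) (auto simp: nbs_finite)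
  also have "\<dots> \<le> card (nbs (set xs) z) + card (V - set xs - {z})" by (rule card_Un_le)
  also have "card (nbs (set xs) z) \<le> 1"
  proof -
    have "\<forall>x\<in>nbs (set xs) z. \<forall>y\<in>nbs (set xs) z. x = y"
      using off_path_unique[OF assms] unfolding nbs_def by (metis (mono_tags, lifting) E_sym in_set_conv_nth mem_Collect_eq)
    then show ?thesis by (simp add: card_le_Suc0_iff_eq nbs_finite)
  qed
  finally show ?thesis by simp
qed

lemma on_path_off_nbs:
  assumes "forest_on V" "path xs" "set xs \<subseteq> V" "k < length xs" "3 \<le> card (nbs V (xs ! k))"
  obtains z where "z \<in> V" "z \<notin> set xs" "E (xs ! k) z"
proof -
  have "\<not> nbs V (xs ! k) \<subseteq> nbs (set xs) (xs ! k)"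
  proof
    assume "nbs V (xs ! k) \<subseteq> nbs (set xs) (xs ! k)"
    then have "card (nbs V (xs ! k)) \<le> card (nbs (set xs) (xs ! k))" by (intro card_mono) (auto simp: nbs_finite)
    then show False using path_degree_le_2[OF assms(1-3), of "xs ! k"] assms(4,5) by simp
  qed
  then show thesis using that unfolding nbs_def by blast
qed

lemma branch_degree:
  assumes "forest_on V" "path xs" "set xs \<subseteq> V" "W \<subseteq> V" "0 < k" "Suc k < length xs"
    "xs ! (k - 1) \<in> W" "xs ! Suc k \<in> W" "z \<in> W" "z \<notin> set xs" "E (xs ! k) z"
  shows "3 \<le> card (nbs W (xs ! k))"
proof -
  have fW: "finite W" using assms(1,4) forest_finite finite_subset by blast
  have "{xs ! (k - 1), xs ! Suc k, z} \<subseteq> nbs W (xs ! k)"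
    unfolding nbs_def using path_edge_iff[OF assms(1-3), of k] assms(5-) by auto
  then have "card {xs ! (k - 1), xs ! Suc k, z} \<le> card (nbs W (xs ! k))" using fW by (intro card_mono) (auto simp: nbs_finite)
  moreover have "xs ! (k - 1) \<noteq> xs ! Suc k" using nth_eq_iff_index_eq[OF path_distinct[OF assms(2)]] assms(5,6) by auto
  moreover have "z \<noteq> xs ! (k - 1)" "z \<noteq> xs ! Suc k" using assms(5,6,10) by auto
  ultimately show ?thesis by simp
qed

text \<open>A path \<open>Q\<close> and one vertex \<open>w\<close> attached to its entry
  \<open>i\<close>. Reversing \<open>Q\<close> if necessary puts the index into the first half, so
  that it determines the tree.\<close>

definition spider :: "nat \<Rightarrow> 'v set \<Rightarrow> nat \<Rightarrow> 'v list \<Rightarrow> 'v \<Rightarrow> bool" where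
  "spider d V i Q w \<longleftrightarrow> path Q \<and> length Q = Suc d \<and> V = insert w (set Q) \<and> w \<notin> set Q \<and> E (Q ! i) w \<and> 0 < i \<and> 2 * i \<le> d"

lemma spider_exists:
  assumes F: "forest_on V" and C: "conn V" and d: "diam d V" and n: "card V = d + 2"
  obtains i Q w where "spider d V i Q w"
proof -
  have fV: "finite V" using F forest_finite by blast
  obtain Q where Q: "path Q" "length Q = Suc d" "set Q \<subseteq> V" using d unfolding diam_def has_path_def by blast
  have "card (set Q) = Suc d" using Q distinct_card path_distinct by metis
  then have "card (V - set Q) = 1" using n Q(3) fV by (simp add: card_Diff_subset)
  then obtain w where w: "V - set Q = {w}" using card_1_singletonE by blast
  have V: "V = insert w (set Q)" "w \<notin> set Q" using w Q(3) by auto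
  have "set Q \<noteq> {}" "set Q \<noteq> V" using Q(2) V by auto
  then obtain y z where yz: "y \<in> set Q" "z \<in> V" "z \<notin> set Q" "E y z" using connE[OF C Q(3)] by metis
  then have z: "z = w" using V by blast
  obtain i where i: "i < length Q" "y = Q ! i" using yz(1) by (metis in_set_conv_nth)
  have i': "0 < i" "i < d" using diam_off_path[OF d Q(1,3,2) yz(2,3)] i yz(4) Q(2) by auto
  show thesis
  proof (cases "2 * i \<le> d")
    case True
    then show thesis using that[of i Q w] Q V yz(4) i i' z unfolding spider_def by simp
  next
    case False
    have "rev Q ! (d - i) = Q ! i" using Q(2) i' by (simp add: rev_nth)
    then show thesis using that[of "d - i" "rev Q" w] Q V yz(4) i i' z False unfolding spider_def by (simp add: path_rev)
  qed
qed

text \<open>Deleting the only vertex of degree 3 leaves paths with \<open>i\<close>,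
  \<open>d - i\<close> and 1 vertices. In \<open>V'\<close> the matching deletion is recognised by
  the degree, and the largest pieces give \<open>d - i \<le> d - i'\<close>.\<close>

lemma spider_le:
  assumes F: "forest_on V" "forest_on V'" and C: "conn V" "conn V'" and h: "hypomorphic V V'" and cd: "card V = card V'"
    and s: "spider d V i Q w" and s': "spider d V' i' Q' w'"
  shows "i' \<le> i"
proof -
  have fin: "finite V" "finite V'" using F forest_finite by auto
  have ar: "arc_count V = arc_count V'" using forest_conn_iff[OF F(1)] forest_conn_iff[OF F(2)] C conn_nonempty cd by simp
  have Q: "path Q" "length Q = Suc d" "V = insert w (set Q)" "w \<notin> set Q" "E (Q ! i) w" "0 < i" "2 * i \<le> d" "set Q \<subseteq> V" "w \<in> V"
    using s unfolding spider_def by auto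
  have Q': "path Q'" "length Q' = Suc d" "V' = insert w' (set Q')" "w' \<notin> set Q'" "E (Q' ! i') w'" "0 < i'" "2 * i' \<le> d"
    "set Q' \<subseteq> V'" "w' \<in> V'"
    using s' unfolding spider_def by auto
  have "3 \<le> card (nbs V (Q ! i))" using branch_degree[OF F(1) Q(1,8) order_refl Q(6) _ _ _ Q(9,4,5)] Q by auto
  moreover have "Q ! i \<in> V" using Q by simp
  ultimately obtain z' where z': "z' \<in> V'" "sim (V - {Q ! i}) (V' - {z'})" "3 \<le> card (nbs V' z')"
    using matched_ex[OF hypomorphic_degrees[OF h fin cd ar]] by fastforce
  have "z' \<noteq> w'"
  proof
    assume "z' = w'"
    then have "card (nbs V' z') \<le> Suc (card (V' - set Q' - {w'}))" using off_path_degree[OF F(2) Q'(1,8,9,4)] by simp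
    also have "V' - set Q' - {w'} = {}" using Q'(3) by blast
    finally show False using z'(3) by simp
  qed
  then obtain k where k: "k < length Q'" "z' = Q' ! k" using z'(1) Q'(3) by (metis in_set_conv_nth insertE)
  obtain u where u: "u \<in> V'" "u \<notin> set Q'" "E (Q' ! k) u" using on_path_off_nbs[OF F(2) Q'(1,8) k(1)] z'(3) k(2) by metis
  then have "u = w'" using Q'(3) by blast
  then have ki: "k = i'" using off_path_unique[OF F(2) Q'(1,8,9,4) k(1), of i'] u(3) Q' by simp
  have "has_path (d - i - 1) (V - {Q ! i})"
  proof -
    have "Q ! i \<notin> set (drop (Suc i) Q)" using path_split(2)[OF Q(1), of i] Q by (simp add: path_Cons)
    then have "set (drop (Suc i) Q) \<subseteq> V - {Q ! i}" using Q(8) set_drop_subset[of "Suc i" Q] by blast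
    then show ?thesis unfolding has_path_def using path_drop[OF Q(1)] Q by (intro exI[of _ "drop (Suc i) Q"]) auto
  qed
  then have "has_path (d - i - 1) (V' - {Q' ! i'})" using z'(2) has_path_iso unfolding sim_def k ki by blast
  then obtain ys where ys: "path ys" "length ys = Suc (d - i - 1)" "set ys \<subseteq> V' - {Q' ! i'}" unfolding has_path_def by blast
  have "ys \<noteq> []" using ys(2) by auto
  then have cy: "conn (set ys)" using conn_path[OF ys(1)] by simp
  have cdy: "card (set ys) = d - i" using ys(2) distinct_card[OF path_distinct[OF ys(1)]] Q by simp
  let ?A = "set (take i' Q')" and ?B = "set (drop (Suc i') Q')"
  have dec: "set ys \<subseteq> ?A \<union> (?B \<union> {w'})"
  proof -
    have "i' < length Q'" using Q' by simp
    then have "set Q' = set (take i' Q' @ Q' ! i' # drop (Suc i') Q')" using id_take_nth_drop by metis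
    then have "set Q' = ?A \<union> insert (Q' ! i') ?B" by simp
    then show ?thesis using ys(3) Q'(3) by blast
  qed
  have wA: "\<not> E x w'" if "x \<in> set Q'" "x \<noteq> Q' ! i'" for x
  proof
    assume e: "E x w'"
    obtain m where m: "m < length Q'" "x = Q' ! m" using \<open>x \<in> set Q'\<close> by (metis in_set_conv_nth)
    then have "m = i'" using off_path_unique[OF F(2) Q'(1,8,9,4) m(1), of i'] e Q' by simp
    then show False using that(2) m(2) by simp
  qed
  have nA: "x \<noteq> Q' ! i'" if "x \<in> ?A \<union> ?B" for x
    using that path_split[OF Q'(1), of i'] Q' by (auto simp: path_Cons)
  have AB: "\<not> E x y" if x: "x \<in> ?A" and y: "y \<in> ?B" for x y
  proof -
    obtain a where a: "a < i'" "x = Q' ! a" using x Q' by (auto simp: in_set_conv_nth)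
    obtain b where "b < length (drop (Suc i') Q')" "y = drop (Suc i') Q' ! b" using y by (metis in_set_conv_nth)
    then have b: "Suc i' + b < length Q'" "y = Q' ! (Suc i' + b)" using Q' by auto
    show ?thesis using path_edge_iff[OF F(2) Q'(1,8), of a "Suc i' + b"] a b Q' by auto
  qed
  have cA: "card ?A \<le> i'" "card ?B \<le> d - i'" using card_length[of "take i' Q'"] card_length[of "drop (Suc i') Q'"] Q' by auto
  have Asub: "?A \<subseteq> set Q'" "?B \<subseteq> set Q'" by (auto dest: in_set_takeD in_set_dropD)
  \<comment> \<open>\<open>ys\<close> is connected and no edge joins two of the three pieces, so it
    lies in one of them.\<close>
  have "card (set ys) \<le> d - i'"
  proof (cases "set ys \<inter> ?A = {}")
    case False
    have "set ys \<subseteq> ?A"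
    proof (rule conn_separated[OF cy dec _ False])
      fix a b assume "a \<in> ?A" "b \<in> ?B \<union> {w'}"
      then show "\<not> E a b" using AB wA[of a] nA[of a] Asub by blast
    qed
    then have "card (set ys) \<le> i'" using cA(1) card_mono[of ?A "set ys"] by simp
    then show ?thesis using Q'(7) by simp
  next
    case True
    then have dec2: "set ys \<subseteq> ?B \<union> {w'}" using dec by blast
    show ?thesis
    proof (cases "set ys \<inter> ?B = {}")
      case False
      have "set ys \<subseteq> ?B"
      proof (rule conn_separated[OF cy dec2 _ False])
        fix a b assume "a \<in> ?B" "b \<in> {w'}"
        then show "\<not> E a b" using wA[of a] nA[of a] Asub by blast
      qed
      then show ?thesis using cA(2) card_mono[of ?B "set ys"] by simp
    next
      case True
      then have "set ys \<subseteq> {w'}" using dec2 by blast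
      then have "card (set ys) \<le> 1" using card_mono[of "{w'}" "set ys"] by simp
      then show ?thesis using Q' by simp
    qed
  qed
  then show ?thesis using cdy Q Q' by simp
qed

lemma spider_reconstruction:
  assumes F: "forest_on V" "forest_on V'" and C: "conn V" "conn V'" and h: "hypomorphic V V'" and cd: "card V = card V'"
    and d: "diam d V" "diam d V'" and n: "card V = d + 2"
  shows "sim V V'"
proof -
  obtain i Q w where s: "spider d V i Q w" using spider_exists[OF F(1) C(1) d(1) n] .
  obtain i' Q' w' where s': "spider d V' i' Q' w'" using spider_exists[OF F(2) C(2) d(2)] n cd by metis
  have ii: "i' = i" using spider_le[OF F C h cd s s'] spider_le[OF F(2,1) C(2,1) hypomorphic_sym[OF h] cd[symmetric] s' s] by simp
  have Q: "path Q" "length Q = Suc d" "V = insert w (set Q)" "w \<notin> set Q" "E (Q ! i) w" "2 * i \<le> d" "set Q \<subseteq> V" "w \<in> V"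
    using s unfolding spider_def by auto
  have Q': "path Q'" "length Q' = Suc d" "V' = insert w' (set Q')" "w' \<notin> set Q'" "E (Q' ! i) w'" "set Q' \<subseteq> V'" "w' \<in> V'"
    using s' ii unfolding spider_def by auto
  have len: "length Q = length Q'" using Q Q' by simp
  obtain f where f: "iso f (set Q) (set Q')" "\<And>k. k < length Q \<Longrightarrow> f (Q ! k) = Q' ! k"
    using path_iso[OF F Q(1) Q'(1) Q(7) Q'(6) len] by metis
  have iq: "Q ! i \<in> set Q" "Q' ! i \<in> set Q'" using Q Q' by auto
  let ?g = "\<lambda>x. if x = w then w' else Q' ! i"
  have ne: "Q ! i \<noteq> w" "Q' ! i \<noteq> w'" using iq Q Q' by auto
  have g: "iso ?g {Q ! i, w} {Q' ! i, w'}"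
    unfolding iso_def bij_betw_def using ne E_irrefl E_sym[OF Q(5)] E_sym[OF Q'(5)] Q(5) Q'(5) by (auto simp: inj_on_def)
  have u: "x = Q ! i" if xw: "x \<in> set Q" "E x w" for x
  proof -
    obtain m where m: "m < length Q" "x = Q ! m" using xw(1) by (metis in_set_conv_nth)
    then have "m = i" using off_path_unique[OF F(1) Q(1,7,8,4) m(1), of i] xw Q(2,5,6) by simp
    then show ?thesis using m by simp
  qed
  have u': "x = Q' ! i" if xw: "x \<in> set Q'" "E x w'" for x
  proof -
    obtain m where m: "m < length Q'" "x = Q' ! m" using xw(1) by (metis in_set_conv_nth)
    then have "m = i" using off_path_unique[OF F(2) Q'(1,6,7,4) m(1), of i] xw Q(6) Q'(2,5) by simp
    then show ?thesis using m by simp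
  qed
  have "iso (\<lambda>x. if x \<in> set Q then f x else ?g x) (set Q \<union> {Q ! i, w}) (set Q' \<union> {Q' ! i, w'})"
  proof (rule iso_glue[OF f(1) g])
    show "f x = ?g x" if "x \<in> set Q" "x \<in> {Q ! i, w}" for x using that Q f(2)[of i] by auto
    have "set Q \<inter> {Q ! i, w} = {Q ! i}" "set Q' \<inter> {Q' ! i, w'} = {Q' ! i}" using iq Q Q' by auto
    then show "f ` (set Q \<inter> {Q ! i, w}) = set Q' \<inter> {Q' ! i, w'}" using f(2)[of i] Q by simp
    show "\<not> E x y" if "x \<in> set Q - {Q ! i, w}" "y \<in> {Q ! i, w} - set Q" for x y using that u iq by auto
    show "\<not> E x y" if "x \<in> set Q' - {Q' ! i, w'}" "y \<in> {Q' ! i, w'} - set Q'" for x y using that u' iq by auto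
  qed
  moreover have "set Q \<union> {Q ! i, w} = V" "set Q' \<union> {Q' ! i, w'} = V'" using Q Q' iq by auto
  ultimately show ?thesis unfolding sim_def by auto
qed

lemma path_segment:
  assumes "path xs" "a \<le> b" "b < length xs"
  shows "path (take (Suc b - a) (drop a xs))" "hd (take (Suc b - a) (drop a xs)) = xs ! a"
    "last (take (Suc b - a) (drop a xs)) = xs ! b" "length (take (Suc b - a) (drop a xs)) = Suc b - a"
    "set (take (Suc b - a) (drop a xs)) = (!) xs ` {a..b}"
proof -
  let ?s = "take (Suc b - a) (drop a xs)"
  show "path ?s" using path_take[OF path_drop[OF assms(1)]] .
  show len: "length ?s = Suc b - a" using assms by simp
  have nth: "?s ! k = xs ! (a + k)" if "k < Suc b - a" for k using that assms by simp
  have ne: "?s \<noteq> []" using len assms(2) by auto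
  show "hd ?s = xs ! a" using nth[of 0] ne assms(2) by (simp add: hd_conv_nth)
  show "last ?s = xs ! b" using nth[of "b - a"] ne assms(2) len by (simp add: last_conv_nth)
  show "set ?s = (!) xs ` {a..b}"
  proof
    show "set ?s \<subseteq> (!) xs ` {a..b}"
    proof
      fix x assume "x \<in> set ?s"
      then obtain k where "k < length ?s" "x = ?s ! k" by (metis in_set_conv_nth)
      then show "x \<in> (!) xs ` {a..b}" using nth[of k] len assms(2) by (intro image_eqI[of _ _ "a + k"]) auto
    qed
    show "(!) xs ` {a..b} \<subseteq> set ?s"
    proof
      fix x assume "x \<in> (!) xs ` {a..b}"
      then obtain k where k: "a \<le> k" "k \<le> b" "x = xs ! k" by auto
      then have "x = ?s ! (k - a)" "k - a < length ?s" using nth[of "k - a"] len by auto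
      then show "x \<in> set ?s" by (metis nth_mem)
    qed
  qed
qed

text \<open>
  Such a tree \<open>V\<close> agrees with \<open>V'\<close> on all subtrees of full diameter. It is told apart by the distance of
  its two branch vertices.
\<close>

lemma opposite_pendants_contradiction:
  assumes F: "forest_on V" "forest_on V'" and C: "conn V" "conn V'" and h: "hypomorphic V V'" and cd: "card V = card V'"
    and d: "diam d V" "diam d V'" and n: "card V = d + 3"
    and Q: "path Q" "length Q = Suc d" "V = set Q \<union> {u, w}" "u \<notin> set Q" "w \<notin> set Q"
      "E (Q ! i) u" "E (Q ! j) w" "2 * i < d" "d < 2 * j" "j \<le> d"
    and Q': "path Q'" "length Q' = Suc d" "set Q' \<subseteq> V'" "\<And>k. 2 * k \<le> d \<Longrightarrow> card (nbs V' (Q' ! k)) \<le> 2"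
  shows False
proof -
  have fin: "finite V" "finite V'" using F forest_finite by auto
  have ar: "arc_count V = arc_count V'" using forest_conn_iff[OF F(1)] forest_conn_iff[OF F(2)] C conn_nonempty cd by simp
  have QV: "set Q \<subseteq> V" "u \<in> V" "w \<in> V" using Q(3) by auto
  have i: "0 < i" using diam_off_path(1)[OF d(1) Q(1) QV(1) Q(2) QV(2) Q(4,6)] Q(8) by simp
  have j: "j < d" using diam_off_path(2)[OF d(1) Q(1) QV(1) Q(2) QV(3) Q(5,7) Q(10)] .
  have di: "3 \<le> card (nbs V (Q ! i))" using branch_degree[OF F(1) Q(1) QV(1) order_refl i _ _ _ QV(2) Q(4,6)] Q QV i by simp
  have dj: "3 \<le> card (nbs V (Q ! j))" using branch_degree[OF F(1) Q(1) QV(1) order_refl _ _ _ _ QV(3) Q(5,7)] Q QV j by simp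
  \<comment> \<open>Only the two attachment points have degree at least 3: a vertex off
    \<open>Q\<close> has at most one neighbour on \<open>Q\<close> and at most one off it.\<close>
  have only: "z = Q ! i \<or> z = Q ! j" if z: "z \<in> V" "3 \<le> card (nbs V z)" for z
  proof -
    have "z \<in> set Q"
    proof (rule ccontr)
      assume zQ: "z \<notin> set Q"
      have "V - set Q - {z} \<subseteq> {u, w} - {z}" using Q(3) by blast
      then have "card (V - set Q - {z}) \<le> card ({u, w} - {z})" by (intro card_mono) auto
      also have "\<dots> \<le> 1" using zQ z(1) Q(3) by (auto simp: insert_Diff_if)
      finally show False using off_path_degree[OF F(1) Q(1) QV(1) z(1) zQ] z(2) by simp
    qed
    then obtain k where k: "k < length Q" "z = Q ! k" by (metis in_set_conv_nth)
    obtain y where y: "y \<in> V" "y \<notin> set Q" "E (Q ! k) y" using on_path_off_nbs[OF F(1) Q(1) QV(1) k(1)] z(2) k(2) by metis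
    then have "y = u \<or> y = w" using Q(3) by blast
    then have "k = i \<or> k = j"
      using off_path_unique[OF F(1) Q(1) QV(1) y(1,2) k(1), of i] off_path_unique[OF F(1) Q(1) QV(1) y(1,2) k(1), of j] y(3) Q i j by auto
    then show ?thesis using k(2) by blast
  qed
  have Qij: "Q ! i \<noteq> Q ! j" using nth_eq_iff_index_eq[OF path_distinct[OF Q(1)]] Q by auto
  have "{z \<in> V. 3 \<le> card (nbs V z)} = {Q ! i, Q ! j}" using only di dj QV(1) Q(2,8,10) by auto
  then have "card {z \<in> V'. 3 \<le> card (nbs V' z)} = 2"
    using matched_card[OF hypomorphic_degrees[OF h fin cd ar], of "\<lambda>z. 3 \<le> card (nbs V z)" "\<lambda>z. 3 \<le> card (nbs V' z)"] Qij by simp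
  then obtain a b where ab: "{z \<in> V'. 3 \<le> card (nbs V' z)} = {a, b}" "a \<noteq> b" by (auto simp: card_2_iff)
  have "card (V' - set Q') = 2" using n cd Q'(2,3) distinct_card[OF path_distinct[OF Q'(1)]] fin(2) by (simp add: card_Diff_subset)
  then have off: "card (V' - set Q' - {z}) = 1" if "z \<in> V'" "z \<notin> set Q'" for z using that fin(2) by simp
  \<comment> \<open>Both vertices of degree at least 3 in \<open>V'\<close> lie in the second half
    of \<open>Q'\<close>, because the entries of its first half have degree at most 2.\<close>
  have pos: "\<exists>k y. z = Q' ! k \<and> k < d \<and> 0 < k \<and> d < 2 * k \<and> y \<in> V' \<and> y \<notin> set Q' \<and> E (Q' ! k) y"
    if z: "z \<in> {a, b}" for z
  proof -
    have z': "z \<in> V'" "3 \<le> card (nbs V' z)" using z ab(1) by blast+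
    have "z \<in> set Q'" using off_path_degree[OF F(2) Q'(1,3) z'(1)] off[OF z'(1)] z'(2) by force
    then obtain k where k: "k < length Q'" "z = Q' ! k" by (metis in_set_conv_nth)
    obtain y where y: "y \<in> V'" "y \<notin> set Q'" "E (Q' ! k) y" using on_path_off_nbs[OF F(2) Q'(1,3) k(1)] z'(2) k(2) by metis
    have "0 < k" "k < d" using diam_off_path[OF d(2) Q'(1,3,2) y] k(1) Q'(2) by auto
    moreover have "d < 2 * k" using Q'(4)[of k] z'(2) k(2) by force
    ultimately show ?thesis using k y by blast
  qed
  obtain k y where k: "a = Q' ! k" "k < d" "0 < k" "d < 2 * k" "y \<in> V'" "y \<notin> set Q'" "E (Q' ! k) y" using pos[of a] by blast
  obtain l z where l: "b = Q' ! l" "l < d" "0 < l" "d < 2 * l" "z \<in> V'" "z \<notin> set Q'" "E (Q' ! l) z" using pos[of b] by blast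
  have "k \<noteq> l" using k(1) l(1) ab(2) by blast
  then obtain \<alpha> \<beta> p q where ab': "\<alpha> < \<beta>" "\<beta> < d" "0 < \<alpha>" "d < 2 * \<alpha>"
    "p \<in> V'" "p \<notin> set Q'" "E (Q' ! \<alpha>) p" "q \<in> V'" "q \<notin> set Q'" "E (Q' ! \<beta>) q"
    using k l by (metis linorder_neqE_nat)
  have up: "3 \<le> card (nbs V (f x))" if "iso f W' W" "W \<subset> V" "x \<in> W'" "3 \<le> card (nbs W' x)" for f W W' x
  proof -
    have "card (nbs W (f x)) \<le> card (nbs V (f x))" using that(2) nbs_mono fin(1) by (intro card_mono) (auto simp: nbs_finite)
    then show ?thesis using iso_nbs_card[OF that(1,3)] that(4) by simp
  qed
  \<comment> \<open>\<open>Q'\<close> with the vertex \<open>q\<close> attached to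
    \<open>Q' ! \<beta>\<close> is a proper subset and embeds into \<open>V\<close>. The image of
    \<open>Q' ! \<beta>\<close> is an attachment point at which a path with \<open>\<beta>\<close>
    edges starts, and the eccentricities of \<open>Q ! i\<close> and \<open>Q ! j\<close> are at
    most \<open>d - i\<close> and \<open>j\<close>.\<close>
  have far: "\<beta> \<le> d - i \<or> \<beta> \<le> j"
  proof -
    let ?W = "insert q (set Q')"
    have WV: "?W \<subseteq> V'" using ab'(8) Q'(3) by blast
    have "card ?W = d + 2" using ab'(9) Q'(2) distinct_card[OF path_distinct[OF Q'(1)]] by simp
    then have "?W \<subset> V'" using WV n cd by auto
    then obtain W f where W: "W \<subset> V" "iso f ?W W" by (rule hypomorphic_ex[OF hypomorphic_sym[OF h]])
    have bW: "Q' ! \<beta> \<in> ?W" using Q'(2) ab' by auto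
    have "3 \<le> card (nbs ?W (Q' ! \<beta>))" using branch_degree[OF F(2) Q'(1,3) WV _ _ _ _ _ ab'(9,10)] ab' Q'(2) by auto
    then have "3 \<le> card (nbs V (f (Q' ! \<beta>)))" using up[OF W(2,1) bW] by blast
    moreover have fV: "f ` ?W \<subseteq> V" using iso_image[OF W(2)] W(1) by blast
    ultimately have fb: "f (Q' ! \<beta>) = Q ! i \<or> f (Q' ! \<beta>) = Q ! j" using only bW by blast
    have "path (map f Q')" using iso_path[OF W(2)] Q'(1) by blast
    then have "path (map f Q' ! \<beta> # rev (take \<beta> (map f Q')))" using path_split(1)[of "map f Q'" \<beta>] Q'(2) ab' by simp
    then have p: "path (f (Q' ! \<beta>) # rev (take \<beta> (map f Q')))" using Q'(2) ab' by simp
    have s: "set (rev (take \<beta> (map f Q'))) \<subseteq> V" using fV set_take_subset[of \<beta> "map f Q'"] by auto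
    have len: "length (rev (take \<beta> (map f Q'))) = \<beta>" using Q'(2) ab' by simp
    from fb show ?thesis
    proof
      assume "f (Q' ! \<beta>) = Q ! i"
      then have "length (rev (take \<beta> (map f Q'))) \<le> max i (d - i)"
        using p Q(8) by (intro diam_eccentricity[OF F(1) d(1) Q(1) QV(1) Q(2) _ _ s]) auto
      then have "\<beta> \<le> max i (d - i)" unfolding len .
      then show ?thesis using Q(8) by auto
    next
      assume "f (Q' ! \<beta>) = Q ! j"
      then have "length (rev (take \<beta> (map f Q'))) \<le> max j (d - j)"
        using p j by (intro diam_eccentricity[OF F(1) d(1) Q(1) QV(1) Q(2) _ _ s]) auto
      then have "\<beta> \<le> max j (d - j)" unfolding len .
      then show ?thesis using Q(9) by auto
    qed
  qed
  \<comment> \<open>The segment between the two vertices, with one more entry at each end and with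
    \<open>p\<close> and \<open>q\<close>, is small enough to be proper and keeps both degrees at
    least 3. Its image in \<open>V\<close> joins \<open>Q ! i\<close> and \<open>Q ! j\<close>,
    where the path is unique.\<close>
  have dist: "\<beta> - \<alpha> = j - i"
  proof -
    let ?W = "(!) Q' ` {\<alpha> - 1..Suc \<beta>} \<union> {p, q}"
    have WV: "?W \<subseteq> V'" using ab' Q'(2,3) by auto
    have "card ?W \<le> card ((!) Q' ` {\<alpha> - 1..Suc \<beta>}) + card {p, q}" by (rule card_Un_le)
    also have "\<dots> \<le> card {\<alpha> - 1..Suc \<beta>} + 2" by (intro add_mono card_image_le) (auto simp: card_insert_if)
    also have "\<dots> < card V'" using n cd ab' i Q(8) by simp
    finally have "?W \<subset> V'" using WV by auto
    then obtain W f where W: "W \<subset> V" "iso f ?W W" by (rule hypomorphic_ex[OF hypomorphic_sym[OF h]])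
    have aW: "Q' ! \<alpha> \<in> ?W" "Q' ! \<beta> \<in> ?W" using ab' by auto
    have "3 \<le> card (nbs ?W (Q' ! \<alpha>))"
      using branch_degree[OF F(2) Q'(1,3) WV ab'(3) _ _ _ _ ab'(6,7)] ab' Q'(2) by auto
    then have fa: "f (Q' ! \<alpha>) = Q ! i \<or> f (Q' ! \<alpha>) = Q ! j" "f (Q' ! \<alpha>) \<in> V"
      using only up[OF W(2,1) aW(1)] iso_image[OF W(2)] W(1) aW(1) by blast+
    have "Q' ! (\<beta> - 1) \<in> ?W" by (intro UnI1 imageI) (use ab' in auto)
    then have "3 \<le> card (nbs ?W (Q' ! \<beta>))"
      using branch_degree[OF F(2) Q'(1,3) WV _ _ _ _ _ ab'(9,10)] ab' Q'(2) by auto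
    then have fb: "f (Q' ! \<beta>) = Q ! i \<or> f (Q' ! \<beta>) = Q ! j"
      using only up[OF W(2,1) aW(2)] iso_image[OF W(2)] W(1) aW(2) by blast
    have "Q' ! \<alpha> \<noteq> Q' ! \<beta>" using nth_eq_iff_index_eq[OF path_distinct[OF Q'(1)]] ab' Q'(2) by auto
    then have fab: "f (Q' ! \<alpha>) \<noteq> f (Q' ! \<beta>)" using iso_inj[OF W(2)] aW by (metis inj_onD)
    define S where "S = take (Suc \<beta> - \<alpha>) (drop \<alpha> Q')"
    have "\<alpha> \<le> \<beta>" "\<beta> < length Q'" using ab' Q'(2) by auto
    note S = path_segment[OF Q'(1) this, folded S_def]
    have SW: "set S \<subseteq> ?W" unfolding S(5) by auto
    have Sne: "S \<noteq> []" using S(4) ab'(1) by auto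
    have fS: "path (map f S)" "map f S \<noteq> []" "hd (map f S) = f (Q' ! \<alpha>)" "last (map f S) = f (Q' ! \<beta>)" "length (map f S) = Suc \<beta> - \<alpha>"
      using iso_path[OF W(2) SW] S Sne by (auto simp: hd_map last_map)
    have fSV: "set (map f S) \<subseteq> V" using SW iso_image[OF W(2)] W(1) by auto
    define T where "T = take (Suc j - i) (drop i Q)"
    have "i \<le> j" "j < length Q" using Q j by auto
    note T = path_segment[OF Q(1) this, folded T_def]
    have Tne: "T \<noteq> []" using T(4) Q by auto
    have TV: "set T \<subseteq> V" unfolding T_def using QV(1) by (meson in_set_dropD in_set_takeD subset_iff)
    have "map f S = T \<or> map f S = rev T"
    proof (cases "f (Q' ! \<alpha>) = Q ! i")
      case True
      then have "f (Q' ! \<beta>) = Q ! j" using fb fab by auto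
      then show ?thesis using path_unique[OF F(1) fS(1) T(1) fSV TV fS(2) Tne] fS(3,4) T(2,3) True by simp
    next
      case False
      then have "f (Q' ! \<alpha>) = Q ! j" "f (Q' ! \<beta>) = Q ! i" using fa fb fab by auto
      then show ?thesis using path_unique[OF F(1) fS(1), of "rev T"] fS fSV TV T Tne
        by (simp add: path_rev hd_rev last_rev)
    qed
    then have "length (map f S) = length T" by (metis length_rev)
    then show ?thesis using fS(5) T(4) ab'(1) Q by simp
  qed
  \<comment> \<open>Since \<open>\<beta> = \<alpha> + j - i\<close> with \<open>\<alpha>\<close> and
    \<open>j\<close> beyond the middle and \<open>i\<close> before it, both bounds are
    exceeded.\<close>
  from far show False
  proof
    assume "\<beta> \<le> d - i"
    then show False using dist ab' Q(8,9) by linarith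
  next
    assume "\<beta> \<le> j"
    then show False using dist ab' Q(8,9) by linarith
  qed
qed

section \<open>Radial branches and longest paths\<close>

lemma leg_radial:
  assumes "path (c # xs)" "xs \<noteq> []" "set (c # xs) \<subseteq> V"
  shows "hd xs \<in> radial (length xs) V c"
proof -
  have h: "hd xs \<in> set xs" using assms(2) by simp
  have n: "hd xs \<in> nbs V c" unfolding nbs_def using assms h by (auto simp: path_Cons)
  have "set xs \<subseteq> component (V - {c}) (hd xs)"
  proof (rule component_maximal[of _ _ "hd xs"])
    show "conn (set xs)" using conn_path[of xs] assms by (simp add: path_Cons)
    show "set xs \<subseteq> V - {c}" using assms by (auto simp: path_Cons)
    show "hd xs \<in> component (V - {c}) (hd xs)" by (rule component_self) (use nbs_in[OF n] in blast)
  qed (rule h)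
  then have "set (c # xs) \<subseteq> branch V c (hd xs)" unfolding branch_def by auto
  then have "deep (length xs) (branch V c (hd xs)) c" unfolding deep_def using assms(1) by (intro exI[of _ "c # xs"]) simp
  then show ?thesis unfolding radial_def using n by blast
qed

lemma radial_leg:
  assumes "rtree V c" "1 \<le> r" "x \<in> radial r V c"
  obtains xs where "path (c # xs)" "length xs = r" "hd xs = x" "set (c # xs) \<subseteq> branch V c x"
proof -
  have x: "x \<in> nbs V c" "deep r (branch V c x) c" using assms(3) unfolding radial_def by auto
  then obtain zs where zs: "path zs" "length zs = Suc r" "hd zs = c" "set zs \<subseteq> branch V c x" unfolding deep_def by blast
  then obtain z zs' where e: "zs = c # z # zs'" using assms(2) by (cases zs; cases "tl zs") auto
  then have "z \<in> nbs (branch V c x) c" using zs unfolding nbs_def by (auto simp: path_Cons)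
  then have "z = x" using branch_nbs[OF assms(1) x(1)] by blast
  then show thesis using that[of "z # zs'"] zs e by auto
qed

text \<open>With its converse \<open>path_biradial\<close>, having two branches of depth
  \<open>r\<close> means being the middle of a path with \<open>2 * r\<close> edges. This links the
  rooted families to subtrees of full diameter.\<close>

lemma biradial_path:
  assumes "rtree V c" "1 \<le> r" "2 \<le> card (radial r V c)"
  obtains xs ys where "path (rev xs @ c # ys)" "length xs = r" "length ys = r" "set (rev xs @ c # ys) \<subseteq> V"
proof -
  have fV: "finite V" and cV: "c \<in> V" using assms(1) rtree_finite rtree_def by auto
  obtain x y where xy: "x \<in> radial r V c" "y \<in> radial r V c" "x \<noteq> y"
    using assms(3) by (metis card_le_Suc0_iff_eq fV not_less_eq_eq numeral_2_eq_2 radial_finite)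
  obtain xs where xs: "path (c # xs)" "length xs = r" "hd xs = x" "set (c # xs) \<subseteq> branch V c x" by (rule radial_leg[OF assms(1,2) xy(1)])
  obtain ys where ys: "path (c # ys)" "length ys = r" "hd ys = y" "set (c # ys) \<subseteq> branch V c y" by (rule radial_leg[OF assms(1,2) xy(2)])
  have s: "set (c # xs) \<subseteq> V" "set (c # ys) \<subseteq> V" using xs(4) ys(4) branch_subset[OF cV] by blast+
  have "path (rev xs @ c # ys)"
    by (rule path_fork_join[of V]) (use assms(1) xs ys s xy(3) in \<open>auto simp: rtree_def\<close>)
  then show thesis using that[of xs ys] xs ys s by auto
qed

lemma path_biradial:
  assumes "finite V" "path (rev xs @ c # ys)" "length xs = r" "length ys = r" "set (rev xs @ c # ys) \<subseteq> V" "1 \<le> r"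
  shows "2 \<le> card (radial r V c)"
proof -
  have ne: "xs \<noteq> []" "ys \<noteq> []" using assms by auto
  have p: "path (c # xs)" "path (c # ys)"
    using assms(2) ne path_rev[of xs] by (auto simp: path_append path_Cons last_rev intro: E_sym)
  have "set xs \<inter> set ys = {}" using assms(2) by (auto simp: path_append)
  then have "hd xs \<noteq> hd ys" using hd_in_set[OF ne(1)] hd_in_set[OF ne(2)] by (metis disjoint_iff)
  moreover have "hd xs \<in> radial r V c" "hd ys \<in> radial r V c"
    using leg_radial[OF p(1) ne(1), of V] leg_radial[OF p(2) ne(2), of V] assms by auto
  ultimately show ?thesis
    using card_mono[OF radial_finite[OF assms(1), of r c], of "{hd xs, hd ys}"] by simp
qed

text \<open>The leg is taken as the half \<open>xs\<close>: apart from the root, whose degree is 2,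
  its vertices have no neighbours outside the leg.\<close>

lemma exceptional_path:
  assumes V: "rtree V c" and r: "1 \<le> r" and two: "2 \<le> card (radial r V c)" and ex: "exceptional r V c"
  obtains xs ys where "path (rev xs @ c # ys)" "length xs = r" "length ys = r" "set (rev xs @ c # ys) \<subseteq> V"
    "\<And>z. z \<in> set (c # xs) \<Longrightarrow> card (nbs V z) \<le> 2"
proof -
  have cV: "c \<in> V" and F: "forest_on V" using V rtree_def by auto
  obtain x y where xy: "x \<noteq> y" "nbs V c = {x, y}" "leg r (branch V c x) c" using ex unfolding exceptional_def by blast
  have "radial r V c \<subseteq> {x, y}" unfolding radial_def using xy by auto
  then have "radial r V c = {x, y}" using two card_seteq[of "{x, y}" "radial r V c"] xy(1) by simp
  then have rd: "x \<in> radial r V c" "y \<in> radial r V c" by auto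
  have x: "x \<in> nbs V c" using xy by blast
  obtain xs where xs: "path (c # xs)" "length xs = r" "hd xs = x" "set (c # xs) \<subseteq> branch V c x" by (rule radial_leg[OF V r rd(1)])
  obtain ys where ys: "path (c # ys)" "length ys = r" "hd ys = y" "set (c # ys) \<subseteq> branch V c y" by (rule radial_leg[OF V r rd(2)])
  have s: "set (c # xs) \<subseteq> V" "set (c # ys) \<subseteq> V" using xs(4) ys(4) branch_subset[OF cV] by blast+
  have "card (set (c # xs)) = card (branch V c x)" using leg_card[OF xy(3)] distinct_card[OF path_distinct[OF xs(1)]] xs(2) by simp
  then have e: "set (c # xs) = branch V c x" using card_subset_eq[OF leg_finite[OF xy(3)] xs(4)] by blast
  have p: "path (rev xs @ c # ys)"
    by (rule path_fork_join[of V]) (use F xs ys s xy(1) in auto)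
  have "card (nbs V z) \<le> 2" if z: "z \<in> set (c # xs)" for z
  proof (cases "z = c")
    case True then show ?thesis using xy by simp
  next
    case False
    have zc: "z \<in> component (V - {c}) x" using z False unfolding e branch_def by blast
    have "nbs V z \<subseteq> nbs (set (c # xs)) z"
    proof
      fix t assume t: "t \<in> nbs V z"
      then have "t \<in> V" "E z t" unfolding nbs_def by auto
      then have "t \<in> set (c # xs)" using component_edge[OF zc, of t] unfolding e branch_def by blast
      then show "t \<in> nbs (set (c # xs)) z" unfolding nbs_def using \<open>E z t\<close> by blast
    qed
    then have "card (nbs V z) \<le> card (nbs (set (c # xs)) z)" by (intro card_mono) (auto simp: nbs_finite)
    then show ?thesis using path_degree_le_2[OF F xs(1) s(1) z] by simp
  qed
  then show thesis using that[of xs ys] p xs ys s by auto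
qed

text \<open>The outcome of \<open>biradial_mismatch\<close> in terms of indices on one path. The
  vertices \<open>u\<close> and \<open>w\<close> are off the whole path, as otherwise there would be
  fewer than \<open>2 * r + 3\<close> vertices.\<close>

lemma biradial_mismatch_path:
  assumes V: "rtree V c" and V': "rtree V' c'" and card: "card V = card V'" and r: "1 \<le> r"
    and two: "2 \<le> card (radial r V c)"
    and m: "matched (\<lambda>W W'. rsim W c W' c') (proper_radial 2 r V c) (proper_radial 2 r V' c')"
    and ex: "\<not> exceptional r V c" "exceptional r V' c'" and big: "2 * r + 3 \<le> card V"
  obtains A B u w i j where "path (A @ c # B)" "length A = r" "length B = r" "V = set (A @ c # B) \<union> {u, w}"
    "u \<notin> set (A @ c # B)" "w \<notin> set (A @ c # B)" "i < r" "j < r" "E (A ! i) u" "E (B ! j) w" "card V = 2 * r + 3"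
proof -
  obtain xs ys u w a b where D: "path (c # xs)" "path (c # ys)" "length xs = r" "length ys = r"
    "hd xs \<noteq> hd ys" "nbs V c = {hd xs, hd ys}" "a \<in> set xs" "b \<in> set ys" "E a u" "E b w"
    "u \<notin> set (c # xs)" "w \<notin> set (c # ys)" "V = set (c # xs) \<union> set (c # ys) \<union> {u, w}" "card V = 2 * r + 3"
    by (rule biradial_mismatch[OF V V' card r two m ex big])
  define Q where "Q = rev xs @ c # ys"
  have Q: "path Q" unfolding Q_def by (rule path_fork_join[of V]) (use D V in \<open>auto simp: rtree_def\<close>)
  have VQ: "V = set Q \<union> {u, w}" unfolding Q_def using D(13) by auto
  have cQ: "card (set Q) = 2 * r + 1" using distinct_card[OF path_distinct[OF Q]] D(3,4) unfolding Q_def by simp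
  have uw: "u \<notin> set Q" "w \<notin> set Q"
  proof -
    have c: "card (insert z (set Q)) \<noteq> card V" for z unfolding D(14) using cQ by (simp add: card_insert_if)
    have "V = insert w (set Q)" if "u \<in> set Q" using VQ that by blast
    then show "u \<notin> set Q" using c by metis
    have "V = insert u (set Q)" if "w \<in> set Q" using VQ that by blast
    then show "w \<notin> set Q" using c by metis
  qed
  obtain i where i: "i < length (rev xs)" "rev xs ! i = a" using D(7) by (metis in_set_conv_nth set_rev)
  obtain j where j: "j < length ys" "ys ! j = b" using D(8) by (metis in_set_conv_nth)
  show thesis
    using that[of "rev xs" ys u w i j] Q VQ uw i j D unfolding Q_def by simp
qed

text \<open>Starting in the middle of \<open>Q\<close>, walking to a different middle of
  \<open>P\<close> and continuing along a suitable half of \<open>P\<close> would give a path with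
  more than \<open>r\<close> edges, but the eccentricity of the middle of \<open>Q\<close> is
  \<open>r\<close>.\<close>

lemma center_unique:
  assumes F: "forest_on V" and C: "conn V" and d: "diam (2 * r) V"
    and P: "path P" "length P = Suc (2 * r)" "set P \<subseteq> V" and Q: "path Q" "length Q = Suc (2 * r)" "set Q \<subseteq> V"
  shows "P ! r = Q ! r"
proof (rule ccontr)
  assume ne: "P ! r \<noteq> Q ! r"
  have "P ! r \<in> V" "Q ! r \<in> V" using P Q by auto
  then obtain zs where zs: "path zs" "zs \<noteq> []" "hd zs = P ! r" "last zs = Q ! r" "set zs \<subseteq> V" by (rule conn_ex_path[OF C])
  then obtain ys where ys: "zs = P ! r # ys" by (cases zs) auto
  have "ys \<noteq> []" using zs(4) ne ys by auto
  then have yn: "ys \<noteq> []" "last ys = Q ! r" using zs(4) ys by auto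
  have yV: "set ys \<subseteq> V" using zs ys by auto
  have "\<exists>ts. path (Q ! r # ts) \<and> Suc r \<le> length ts \<and> set ts \<subseteq> V"
  proof -
    have "path (take (Suc r) P @ ys) \<or> path (rev ys @ drop r P)"
      using path_two_directions[OF F P(1,3)] P(2) zs(1) ys yV by simp
    then obtain us where us: "path (rev ys @ us)" "Suc r = length us" "set us \<subseteq> V"
    proof
      assume a: "path (take (Suc r) P @ ys)"
      then have "path (rev ys @ rev (take (Suc r) P))" using path_rev by (metis rev_append)
      then show thesis using that[of "rev (take (Suc r) P)"] P set_take_subset[of "Suc r" P] by auto
    next
      assume "path (rev ys @ drop r P)"
      then show thesis using that[of "drop r P"] P set_drop_subset[of r P] by auto
    qed
    obtain a as where "rev ys = a # as" "a = Q ! r" using yn by (metis hd_rev list.collapse rev_is_Nil_conv)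
    moreover have "set (rev ys) \<subseteq> V" using yV by simp
    ultimately show ?thesis using us by (intro exI[of _ "as @ us"]) auto
  qed
  then obtain ts where "path (Q ! r # ts)" "Suc r \<le> length ts" "set ts \<subseteq> V" by blast
  then show False using diam_eccentricity[OF F d Q(1,3,2), of r ts] by simp
qed

text \<open>The root is the middle of a longest path. Every member of the family contains a path
  with \<open>2 * r\<close> edges around its root, and in the other tree the middle of such a path
  is unique; so the matching of unrooted subsets restricts to one of rooted subtrees.\<close>

lemma even_tree_reconstruction:
  assumes F: "forest_on V" "forest_on V'" and C: "conn V" "conn V'" and h: "hypomorphic V V'" and cd: "card V = card V'"
    and d: "diam (2 * r) V" "diam (2 * r) V'" and n: "2 * r + 3 \<le> card V" and r: "1 \<le> r"
  shows "sim V V'"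
proof -
  have mid: "\<exists>c. rtree V c \<and> 2 \<le> card (radial r V c) \<and> (\<exists>P. path P \<and> length P = Suc (2 * r) \<and> set P \<subseteq> V \<and> P ! r = c)"
    if H: "forest_on V" "conn V" "diam (2 * r) V" for V
  proof -
    obtain P where P: "path P" "length P = Suc (2 * r)" "set P \<subseteq> V" using H(3) unfolding diam_def has_path_def by blast
    have e: "rev (rev (take r P)) @ P ! r # drop (Suc r) P = P" using P(2) id_take_nth_drop[of r P] by simp
    have "2 \<le> card (radial r V (P ! r))"
      by (rule path_biradial[of V "rev (take r P)" "P ! r" "drop (Suc r) P"]) (use e P r H forest_finite in auto)
    moreover have "rtree V (P ! r)" unfolding rtree_def using H P by auto
    ultimately show ?thesis using P by blast
  qed
  obtain c P where c: "rtree V c" "2 \<le> card (radial r V c)" "path P" "length P = Suc (2 * r)" "set P \<subseteq> V" "P ! r = c"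
    using mid[OF F(1) C(1) d(1)] by blast
  obtain c' P' where c': "rtree V' c'" "2 \<le> card (radial r V' c')" "path P'" "length P' = Suc (2 * r)" "set P' \<subseteq> V'" "P' ! r = c'"
    using mid[OF F(2) C(2) d(2)] by blast
  have key: "rsim W c W' c' \<and> W' \<in> proper_radial 2 r V' c'"
    if W: "W \<in> proper_radial 2 r V c" and W': "W' \<subset> V'" and s: "sim W W'" and cc: "rtree V c"
      and cc': "conn V'" "forest_on V'" "diam (2 * r) V'" "path P'" "length P' = Suc (2 * r)" "set P' \<subseteq> V'" "P' ! r = c'"
    for V V' W W' c c' P'
  proof -
    obtain f where f: "iso f W W'" using s sim_def by blast
    have Ws: "W \<in> subtrees V c" "2 \<le> card (radial r W c)" using W unfolding proper_radial_def by auto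
    have rW: "rtree W c" using subtrees_rtree[OF cc Ws(1)] .
    obtain xs ys where xy: "path (rev xs @ c # ys)" "length xs = r" "length ys = r" "set (rev xs @ c # ys) \<subseteq> W"
      by (rule biradial_path[OF rW r Ws(2)])
    let ?R = "map f (rev xs @ c # ys)"
    have "path ?R" using iso_path[OF f xy(4)] xy(1) by simp
    moreover have "set ?R \<subseteq> V'" using xy(4) iso_image[OF f] W' by auto
    moreover have "length ?R = Suc (2 * r)" using xy by simp
    ultimately have "?R ! r = P' ! r" using center_unique[OF cc'(2,1,3), of ?R P'] cc' by simp
    moreover have "?R ! r = f c" using xy(2) by (simp add: nth_append)
    ultimately have "f c = c'" using cc' by simp
    then have rs: "rsim W c W' c'" unfolding rsim_def using f rW unfolding rtree_def by blast
    have "conn W'" using sim_conn[OF s] rW unfolding rtree_def by blast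
    then have "W' \<in> proper_radial 2 r V' c'" unfolding proper_radial_def subtrees_def
      using W' rsim_mem[OF rs] rsim_radial_card[OF rs] Ws(2) by auto
    then show ?thesis using rs by blast
  qed
  have inadm: "{W \<in> {W. W \<subset> V}. W \<in> proper_radial 2 r V c} = proper_radial 2 r V c" for V c unfolding proper_radial_def subtrees_def by blast
  have "matched sim {W \<in> {W. W \<subset> V}. W \<in> proper_radial 2 r V c} {W \<in> {W. W \<subset> V'}. W \<in> proper_radial 2 r V' c'}"
  proof (rule matched_restrict[OF h[unfolded hypomorphic_def]])
    fix W W' assume a: "W \<in> {W. W \<subset> V}" "W' \<in> {W. W \<subset> V'}" "sim W W'"
    show "W \<in> proper_radial 2 r V c \<longleftrightarrow> W' \<in> proper_radial 2 r V' c'"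
      using key[OF _ _ a(3) c(1) C(2) F(2) d(2) c'(3-6)] key[OF _ _ sim_sym[OF a(3)] c'(1) C(1) F(1) d(1) c(3-6)] a by blast
  qed
  then have m: "matched (\<lambda>W W'. rsim W c W' c') (proper_radial 2 r V c) (proper_radial 2 r V' c')"
    unfolding inadm
  proof (rule matched_mono)
    fix W W' assume a: "W \<in> proper_radial 2 r V c" "W' \<in> proper_radial 2 r V' c'" "sim W W'"
    then have "W' \<subset> V'" unfolding proper_radial_def subtrees_def by blast
    then show "rsim W c W' c'" using key[OF a(1) _ a(3) c(1) C(2) F(2) d(2) c'(3-6)] by blast
  qed
  have mism: False
    if H: "rtree V c" "rtree V' c'" "card V = card V'" "2 \<le> card (radial r V c)" "2 \<le> card (radial r V' c')" "hypomorphic V V'"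
      "matched (\<lambda>W W'. rsim W c W' c') (proper_radial 2 r V c) (proper_radial 2 r V' c')" "\<not> exceptional r V c" "exceptional r V' c'"
      "2 * r + 3 \<le> card V" "diam (2 * r) V" "diam (2 * r) V'" for V V' c c'
  proof -
    have FC: "forest_on V" "forest_on V'" "conn V" "conn V'" using H unfolding rtree_def by auto
    obtain A B u w i j where D: "path (A @ c # B)" "length A = r" "length B = r" "V = set (A @ c # B) \<union> {u, w}"
      "u \<notin> set (A @ c # B)" "w \<notin> set (A @ c # B)" "i < r" "j < r" "E (A ! i) u" "E (B ! j) w" "card V = 2 * r + 3"
      by (rule biradial_mismatch_path[OF H(1-3) r H(4,7-10)])
    obtain xs' ys' where D': "path (rev xs' @ c' # ys')" "length xs' = r" "length ys' = r" "set (rev xs' @ c' # ys') \<subseteq> V'"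
      "\<And>z. z \<in> set (c' # xs') \<Longrightarrow> card (nbs V' z) \<le> 2" by (rule exceptional_path[OF H(2) r H(5,9)]) blast
    define Q' where "Q' = rev xs' @ c' # ys'"
    \<comment> \<open>The entries up to and including the middle of \<open>Q'\<close> form the leg
      of the exceptional tree.\<close>
    have Q'k: "card (nbs V' (Q' ! k)) \<le> 2" if "2 * k \<le> 2 * r" for k
    proof (rule D'(5))
      show "Q' ! k \<in> set (c' # xs')"
      proof (cases "k = r")
        case True then show ?thesis unfolding Q'_def using D'(2) by (simp add: nth_append)
      next
        case False
        then have "Q' ! k = rev xs' ! k" "k < length (rev xs')" unfolding Q'_def using that D'(2) by (auto simp: nth_append)
        then show ?thesis by (metis in_set_conv_nth list.set_intros(2) set_rev)
      qed
    qed
    show False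
    proof (rule opposite_pendants_contradiction[OF FC H(6,3,11,12) _ D(1) _ D(4-6)])
      \<comment> \<open>The attachment points lie on different sides of the middle, at the indices
        \<open>i < r\<close> and \<open>Suc r + j\<close>.\<close>
      show "E ((A @ c # B) ! i) u" "E ((A @ c # B) ! (Suc r + j)) w" using D by (auto simp: nth_append)
      show "path Q'" "set Q' \<subseteq> V'" "length Q' = Suc (2 * r)" unfolding Q'_def using D' by auto
    qed (use D Q'k in auto)
  qed
  have "rsim V c V' c'"
  proof (cases "exceptional r V c"; cases "exceptional r V' c'")
    assume "exceptional r V c" "exceptional r V' c'"
    then show ?thesis using biradial_exceptional[OF c(1) c'(1) cd r c(2) c'(2) m] n by blast
  next
    assume "\<not> exceptional r V c" "\<not> exceptional r V' c'"
    then show ?thesis using biradial_nonexceptional[OF c(1) c'(1) cd r c(2) c'(2) m] by blast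
  next
    assume "\<not> exceptional r V c" "exceptional r V' c'"
    then show ?thesis using mism[OF c(1) c'(1) cd c(2) c'(2) h m] n d by blast
  next
    assume "exceptional r V c" "\<not> exceptional r V' c'"
    moreover have "matched (\<lambda>W W'. rsim W c' W' c) (proper_radial 2 r V' c') (proper_radial 2 r V c)"
      by (rule matched_mono[OF matched_sym[OF m]]) (rule rsim_sym)
    ultimately show ?thesis using mism[OF c'(1) c(1) cd[symmetric] c'(2) c(2) hypomorphic_sym[OF h]] n d cd by simp
  qed
  then show ?thesis by (rule rsim_sim)
qed

text \<open>Similar to \<open>center_unique\<close>: an end of the middle edge of \<open>Q\<close>
  that is not on the middle edge of \<open>P\<close> would start a path with more than
  \<open>r\<close> edges, whereas both ends have eccentricity at most \<open>r\<close>.\<close>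

lemma center_edge_unique:
  assumes F: "forest_on V" and C: "conn V" and d: "diam (2 * r - 1) V" and r: "1 \<le> r"
    and P: "path P" "length P = 2 * r" "set P \<subseteq> V" and Q: "path Q" "length Q = 2 * r" "set Q \<subseteq> V"
  shows "{P ! (r - 1), P ! r} = {Q ! (r - 1), Q ! r}"
proof -
  have in_P: "Q ! k \<in> {P ! (r - 1), P ! r}" if k: "k = r - 1 \<or> k = r" for k
  proof (rule ccontr)
    assume ne: "Q ! k \<notin> {P ! (r - 1), P ! r}"
    have "P ! (r - 1) \<in> V" "Q ! k \<in> V" using P Q r k by auto
    then obtain zs where zs: "path zs" "zs \<noteq> []" "hd zs = P ! (r - 1)" "last zs = Q ! k" "set zs \<subseteq> V" by (rule conn_ex_path[OF C])
    then obtain ys where ys: "zs = P ! (r - 1) # ys" by (cases zs) auto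
    have "ys \<noteq> []" using zs(4) ne ys by auto
    then have yn: "ys \<noteq> []" "last ys = Q ! k" using zs(4) ys by auto
    have yV: "set ys \<subseteq> V" using zs ys by auto
    have py: "path (P ! (r - 1) # ys)" using zs(1) ys by simp
    have l: "r - 1 < length P" using P(2) r by simp
    have rr: "Suc (r - 1) = r" using r by simp
    \<comment> \<open>The walk reaches entry \<open>r - 1\<close> of \<open>P\<close>. If it arrives
      from entry \<open>r\<close>, it has at least two edges and continues backwards over
      \<open>r - 1\<close> entries; otherwise it continues forwards over \<open>r\<close> entries.
      Either way there are \<open>r + 2\<close> vertices.\<close>
    obtain us where us: "path (rev ys @ us)" "set us \<subseteq> V" "r + 2 \<le> length (rev ys @ us)"
    proof (cases "hd ys = P ! r")
      case True
      have "path (rev ys @ P ! (r - 1) # rev (take (r - 1) P))"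
      proof (rule path_fork_join[OF F py path_split(1)[OF P(1) l]])
        show "set (P ! (r - 1) # ys) \<subseteq> V" "set (P ! (r - 1) # rev (take (r - 1) P)) \<subseteq> V"
          using zs(5) ys P(3) set_take_subset[of "r - 1" P] l by auto
        have "P ! r \<in> set (drop r P)" using P(2) r by (metis Cons_nth_drop_Suc l le_add2 linorder_not_le list.set_intros(1) mult_2 nle_le not_one_le_zero less_add_same_cancel1 zero_less_one_class.zero_less_one neq0_conv)
        moreover have "hd (rev (take (r - 1) P)) \<in> set (take r P)" if "rev (take (r - 1) P) \<noteq> []"
          using hd_in_set[OF that] set_take_subset_set_take[of "r - 1" r P] by auto
        moreover have "set (take r P) \<inter> set (drop r P) = {}" using set_take_disj_set_drop_if_distinct[OF path_distinct[OF P(1)]] by blast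
        ultimately show "hd ys \<noteq> hd (rev (take (r - 1) P))" if "rev (take (r - 1) P) \<noteq> []"
          using True that by (metis disjoint_iff)
      qed
      moreover have "2 \<le> length ys"
      proof (rule ccontr)
        assume "\<not> ?thesis"
        then have "ys = [hd ys]" using yn by (cases ys; cases "tl ys") auto
        then show False using yn(2) True ne by (metis insertCI last.simps)
      qed
      moreover have "set (P ! (r - 1) # rev (take (r - 1) P)) \<subseteq> V"
        using P(3) l set_take_subset[of "r - 1" P] nth_mem[OF l] by auto
      ultimately show thesis using that[of "P ! (r - 1) # rev (take (r - 1) P)"] P(2) r by auto
    next
      case False
      have dr: "drop (Suc (r - 1)) P = P ! r # drop (Suc r) P" using P(2) r by (simp add: Cons_nth_drop_Suc)
      have "path (rev ys @ P ! (r - 1) # drop (Suc (r - 1)) P)"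
      proof (rule path_fork_join[OF F py path_split(2)[OF P(1) l]])
        show "set (P ! (r - 1) # ys) \<subseteq> V" "set (P ! (r - 1) # drop (Suc (r - 1)) P) \<subseteq> V"
          using zs(5) ys P(3) set_drop_subset[of r P] l rr by auto
        show "hd ys \<noteq> hd (drop (Suc (r - 1)) P)" using False dr by simp
      qed
      moreover have "set (P ! (r - 1) # drop (Suc (r - 1)) P) \<subseteq> V" using P(3) set_drop_subset[of r P] l rr by auto
      moreover have "1 \<le> length ys" using yn by (cases ys) auto
      ultimately show thesis using that[of "P ! (r - 1) # drop (Suc (r - 1)) P"] P l r by auto
    qed
    obtain as where as: "rev ys = Q ! k # as" using yn by (metis hd_rev list.collapse rev_is_Nil_conv)
    have "set (as @ us) \<subseteq> V" using yV us(2) as by (metis (no_types, lifting) le_sup_iff set_append set_rev set_subset_Cons subset_trans)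
    then have "length (as @ us) \<le> max k (2 * r - 1 - k)"
      using us(1) as k r Q(2) by (intro diam_eccentricity[OF F d Q(1,3)]) auto
    then show False using us(3) as k r by auto
  qed
  have "Q ! (r - 1) \<noteq> Q ! r" using nth_eq_iff_index_eq[OF path_distinct[OF Q(1)]] Q(2) r by auto
  then show ?thesis using in_P[of "r - 1"] in_P[of r] by auto
qed

end

section \<open>Subdivision of the central edge\<close>

text \<open>Two relations on one vertex type: the rooted theory is applied to the subdivided trees,
  while hypomorphy speaks about the original ones.\<close>

locale two_graphs = G: sgraph E + H: sgraph E' for E E' :: "'v \<Rightarrow> 'v \<Rightarrow> bool"
begin

text \<open>On \<open>V\<close>, the graph \<open>E'\<close> is \<open>E\<close> with the edge \<open>uv\<close> subdivided by the new vertex \<open>w\<close>.\<close>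

definition subdivides :: "'v set \<Rightarrow> 'v \<Rightarrow> 'v \<Rightarrow> 'v \<Rightarrow> bool" where
  "subdivides V u v w \<longleftrightarrow> u \<in> V \<and> v \<in> V \<and> E u v \<and> w \<notin> V \<and>
     (\<forall>x\<in>V. \<forall>y\<in>V. E' x y \<longleftrightarrow> E x y \<and> {x, y} \<noteq> {u, v}) \<and> (\<forall>x\<in>V. E' w x \<longleftrightarrow> x = u \<or> x = v)"

lemma subdividesD:
  assumes "subdivides V u v w"
  shows "u \<in> V" "v \<in> V" "E u v" "E v u" "u \<noteq> v" "w \<notin> V" "E' w u" "E' w v" "E' u w" "E' v w"
    "\<And>x y. x \<in> V \<Longrightarrow> y \<in> V \<Longrightarrow> E' x y \<longleftrightarrow> E x y \<and> {x, y} \<noteq> {u, v}"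
    "\<And>x. x \<in> V \<Longrightarrow> E' w x \<longleftrightarrow> x = u \<or> x = v" "\<And>x. x \<in> V \<Longrightarrow> E' x w \<longleftrightarrow> x = u \<or> x = v"
proof -
  show a: "u \<in> V" "v \<in> V" "E u v" "w \<notin> V" "\<And>x y. x \<in> V \<Longrightarrow> y \<in> V \<Longrightarrow> E' x y \<longleftrightarrow> E x y \<and> {x, y} \<noteq> {u, v}"
    "\<And>x. x \<in> V \<Longrightarrow> E' w x \<longleftrightarrow> x = u \<or> x = v"
    using assms unfolding subdivides_def by auto
  show "E v u" "u \<noteq> v" using a(3) G.E_sym G.E_irrefl by blast+
  show b: "E' w u" "E' w v" using a by blast+
  show "E' u w" "E' v w" using b H.E_sym by blast+
  show "\<And>x. x \<in> V \<Longrightarrow> E' x w \<longleftrightarrow> x = u \<or> x = v" using a(6) H.E_sym by blast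
qed

lemma subdivides_conn:
  assumes S: "subdivides V u v w" and W: "W \<subseteq> V" "u \<in> W" "v \<in> W"
  shows "H.conn (insert w W) \<longleftrightarrow> G.conn W"
proof
  note D = subdividesD[OF S]
  have wW: "w \<notin> W" using D(6) W(1) by blast
  assume C: "G.conn W"
  show "H.conn (insert w W)" unfolding H.conn_def
  proof (intro conjI allI impI)
    fix Y assume Y: "Y \<subseteq> insert w W" "Y \<noteq> {}" "Y \<noteq> insert w W"
    show "\<exists>y\<in>Y. \<exists>z\<in>insert w W - Y. E' y z"
    proof (cases "Y \<inter> W = {} \<or> Y \<inter> W = W")
      case True
      then show ?thesis
      proof
        assume "Y \<inter> W = {}"
        then have "Y = {w}" using Y by blast
        then show ?thesis using D(7) W wW by blast
      next
        assume "Y \<inter> W = W"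
        then have "Y = W" using Y by blast
        then show ?thesis using D(9) W wW by blast
      qed
    next
      case False
      then obtain y z where yz: "y \<in> Y \<inter> W" "z \<in> W" "z \<notin> Y \<inter> W" "E y z"
        using G.connE[OF C, of "Y \<inter> W"] by blast
      show ?thesis
      proof (cases "{y, z} = {u, v}")
        case True
        then have "E' w z" "E' y w" using D(7-10) by (auto simp: doubleton_eq_iff)
        then show ?thesis using yz wW by (cases "w \<in> Y") blast+
      next
        case False
        then have "E' y z" using D(11)[of y z] yz W by blast
        then show ?thesis using yz by blast
      qed
    qed
  qed simp
next
  note D = subdividesD[OF S]
  have wW: "w \<notin> W" using D(6) W(1) by blast
  assume C: "H.conn (insert w W)"
  show "G.conn W" unfolding G.conn_def
  proof (intro conjI allI impI)
    show "W \<noteq> {}" using W by blast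
    fix Y assume Y: "Y \<subseteq> W" "Y \<noteq> {}" "Y \<noteq> W"
    \<comment> \<open>The new vertex is put on the side of \<open>u\<close>. If an edge at
      \<open>w\<close> crosses the enlarged cut, then \<open>u\<close> and \<open>v\<close> lie on
      different sides of the original one.\<close>
    define Y' where "Y' = (if u \<in> Y then insert w Y else Y)"
    have "Y' \<subseteq> insert w W" "Y' \<noteq> {}" "Y' \<noteq> insert w W" unfolding Y'_def using Y wW by (auto split: if_splits)
    then obtain y z where yz: "y \<in> Y'" "z \<in> insert w W" "z \<notin> Y'" "E' y z" using H.connE[OF C] by metis
    consider "y = w" | "z = w" | "y \<noteq> w" "z \<noteq> w" by blast
    then show "\<exists>y\<in>Y. \<exists>z\<in>W - Y. E y z"
    proof cases
      case 1
      then have uY: "u \<in> Y" using yz(1) Y wW unfolding Y'_def by (auto split: if_splits)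
      then have "z \<in> W" "z \<notin> Y" using yz Y'_def by auto
      moreover have "z = u \<or> z = v" using D(12)[of z] yz(4) 1 \<open>z \<in> W\<close> W by blast
      ultimately show ?thesis using uY D(3) by blast
    next
      case 2
      then have uY: "u \<notin> Y" "y \<in> Y" using yz unfolding Y'_def by (auto split: if_splits)
      then have "y = v" using D(13)[of y] yz(4) 2 Y W by blast
      then show ?thesis using uY D(4) W by blast
    next
      case 3
      then have "y \<in> Y" "z \<in> W" "z \<notin> Y" using yz unfolding Y'_def by (auto split: if_splits)
      then show ?thesis using D(11)[of y z] yz(4) Y W by blast
    qed
  qed
qed

text \<open>By edge counts: if both ends are present, one edge is replaced by two while one vertex
  is added; otherwise the new vertex has at most one neighbour.\<close>

lemma subdivides_forest:
  assumes S: "subdivides V u v w" and F: "G.forest_on V"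
  shows "H.forest_on (insert w V)"
proof (rule H.sparse_forest)
  note D = subdividesD[OF S]
  have fV: "finite V" using F G.forest_finite by blast
  then show "finite (insert w V)" by simp
  fix X assume X: "X \<subseteq> insert w V" "X \<noteq> {}"
  define W where "W = X - {w}"
  have W: "W \<subseteq> V" "finite W" unfolding W_def using X(1) fV finite_subset by auto
  let ?S = "{(x, y). x \<in> W \<and> y \<in> W \<and> E x y}" and ?S' = "{(x, y). x \<in> W \<and> y \<in> W \<and> E' x y}"
  have subtrees: "?S' \<subseteq> ?S" using D(11) W by blast
  have le: "H.arc_count W \<le> G.arc_count W" unfolding H.arc_count_def G.arc_count_def using subtrees G.arc_count_finite[OF W(2)] by (rule card_mono[rotated])
  have GW: "G.arc_count W + 2 \<le> 2 * card W" if "W \<noteq> {}" using G.forest_arc_count[OF G.forest_subset[OF F W(1)] that] .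
  show "H.arc_count X + 2 \<le> 2 * card X"
  proof (cases "w \<in> X")
    case False
    then have "W = X" unfolding W_def by blast
    then show ?thesis using le GW X by simp
  next
    case True
    have fX: "finite X" using X fV finite_subset by blast
    have HX: "H.arc_count X = H.arc_count W + 2 * card (H.nbs X w)" using H.arc_count_remove[OF fX True] W_def by simp
    have cX: "card X = Suc (card W)" unfolding W_def using card_Suc_Diff1[OF fX True] by simp
    have nbs: "H.nbs X w = {u, v} \<inter> W" unfolding H.nbs_def W_def using D(12) H.E_irrefl X(1) by blast
    show ?thesis
    proof (cases "u \<in> W \<and> v \<in> W")
      case True
      then have e1: "?S = ?S' \<union> {(u, v), (v, u)}" using D(3,4,11) W by (auto simp: doubleton_eq_iff)
      have e2: "?S' \<inter> {(u, v), (v, u)} = {}" using D(11) True W by blast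
      have "G.arc_count W = H.arc_count W + card {(u, v), (v, u)}"
        unfolding G.arc_count_def H.arc_count_def e1 by (rule card_Un_disjoint[OF H.arc_count_finite[OF W(2)] _ e2]) simp
      then have "G.arc_count W = H.arc_count W + 2" using D(5) by simp
      moreover have "card (H.nbs X w) = 2" unfolding nbs using True D(5) by simp
      moreover have "W \<noteq> {}" using True by blast
      ultimately show ?thesis using HX cX GW by simp
    next
      case False
      then have "card (H.nbs X w) \<le> 1" unfolding nbs by (auto simp: Int_insert_left)
      show ?thesis
      proof (cases "W = {}")
        case True
        then have "H.nbs X w = {}" "H.arc_count W = 0" unfolding nbs H.arc_count_def by auto
        then show ?thesis using HX cX by simp
      next
        case False
        then show ?thesis using HX cX GW le \<open>card (H.nbs X w) \<le> 1\<close> by auto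
      qed
    qed
  qed
qed

text \<open>The isomorphism carries the subdivided edge to the subdivided edge, possibly reversed,
  so the new vertices can be matched.\<close>

lemma subdivides_iso:
  assumes S: "subdivides V u v w" and S': "subdivides V' u' v' w'" and f: "G.iso f W W'" and W: "W \<subseteq> V" "W' \<subseteq> V'"
    and uv: "u \<in> W" "v \<in> W" "{f u, f v} = {u', v'}"
  shows "H.iso (f(w := w')) (insert w W) (insert w' W')"
proof -
  note D = subdividesD[OF S] and D' = subdividesD[OF S']
  have wW: "w \<notin> W" "w' \<notin> W'" using D(6) D'(6) W by auto
  have fW: "f x \<in> W'" if "x \<in> W" for x using G.iso_image[OF f] that by blast
  have b: "bij_betw f W W'" using f unfolding G.iso_def by blast
  have "bij_betw (f(w := w')) (insert w W) (insert w' W')"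
  proof -
    have "bij_betw (f(w := w')) W W'" using b wW(1) by (subst bij_betw_cong[of W _ f]) auto
    then show ?thesis using notIn_Un_bij_betw[of w W "f(w := w')" W'] wW by simp
  qed
  moreover have "E' x y \<longleftrightarrow> E' ((f(w := w')) x) ((f(w := w')) y)" if xy: "x \<in> insert w W" "y \<in> insert w W" for x y
  proof -
    have ends: "(f x = u' \<or> f x = v') \<longleftrightarrow> (x = u \<or> x = v)" if "x \<in> W" for x
    proof
      assume "f x = u' \<or> f x = v'"
      then have "f x = f u \<or> f x = f v" using uv(3) by auto
      then show "x = u \<or> x = v" using inj_onD[OF G.iso_inj[OF f]] that uv by blast
    qed (use uv(3) in auto)
    have set: "{f x, f y} = {u', v'} \<longleftrightarrow> {x, y} = {u, v}" if "x \<in> W" "y \<in> W" for x y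
    proof -
      have "f ` {x, y} = f ` {u, v} \<longleftrightarrow> {x, y} = {u, v}"
        by (rule inj_on_image_eq_iff[OF G.iso_inj[OF f]]) (use that uv in auto)
      then show ?thesis using uv(3) by simp
    qed
    consider "x = w" "y = w" | "x = w" "y \<in> W" | "x \<in> W" "y = w" | "x \<in> W" "y \<in> W" using xy by blast
    then show ?thesis
    proof cases
      case 1 then show ?thesis using H.E_irrefl by simp
    next
      case 2
      then have "y \<noteq> w" "y \<in> V" "f y \<in> V'" using wW fW W by auto
      then show ?thesis using 2 D(12)[of y] D'(12)[of "f y"] ends[of y] by simp
    next
      case 3
      then have "x \<noteq> w" "x \<in> V" "f x \<in> V'" using wW fW W by auto
      then show ?thesis using 3 D(13)[of x] D'(13)[of "f x"] ends[of x] by simp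
    next
      case 4
      then have n: "x \<noteq> w" "y \<noteq> w" using wW by auto
      have "E' x y \<longleftrightarrow> E x y \<and> {x, y} \<noteq> {u, v}" using D(11)[of x y] 4 W by blast
      also have "\<dots> \<longleftrightarrow> E (f x) (f y) \<and> {f x, f y} \<noteq> {u', v'}" using set[OF 4] G.iso_edge[OF f 4] by simp
      also have "\<dots> \<longleftrightarrow> E' (f x) (f y)" using D'(11)[of "f x" "f y"] fW[OF 4(1)] fW[OF 4(2)] W by blast
      finally show ?thesis using n by simp
    qed
  qed
  ultimately show ?thesis unfolding H.iso_def by blast
qed

lemma subdivides_iso_inverse:
  assumes S: "subdivides V u v w" and S': "subdivides V' u' v' w'" and f: "H.iso f (insert w V) (insert w' V')" "f w = w'"
  shows "G.iso f V V'"
proof -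
  note D = subdividesD[OF S] and D' = subdividesD[OF S']
  have "f ` (insert w V - {w}) = insert w' V' - {w'}"
    using inj_on_image_set_diff[OF H.iso_inj[OF f(1)], of "insert w V" "{w}"] H.iso_image[OF f(1)] f(2) by auto
  then have fV: "f ` V = V'" using D(6) D'(6) by simp
  have inj: "inj_on f V" using H.iso_inj[OF f(1)] by (rule inj_on_subset) blast
  have fx: "f x \<in> V'" if "x \<in> V" for x using fV that by blast
  have e: "f x = u' \<or> f x = v' \<longleftrightarrow> x = u \<or> x = v" if "x \<in> V" for x
    using H.iso_edge[OF f(1), of w x] f(2) D(12)[OF that] D'(12)[OF fx[OF that]] that by simp
  have set: "{f x, f y} = {u', v'} \<longleftrightarrow> {x, y} = {u, v}" if xy: "x \<in> V" "y \<in> V" for x y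
  proof -
    have "f u \<noteq> f v" using inj_onD[OF inj] D by blast
    then have "{f u, f v} = {u', v'}" using e[OF D(1)] e[OF D(2)] D'(5) by auto
    moreover have "f ` {x, y} = f ` {u, v} \<longleftrightarrow> {x, y} = {u, v}"
      by (rule inj_on_image_eq_iff[OF inj]) (use xy D in auto)
    ultimately show ?thesis by simp
  qed
  have "E x y \<longleftrightarrow> E (f x) (f y)" if xy: "x \<in> V" "y \<in> V" for x y
  proof (cases "{x, y} = {u, v}")
    case True
    then have "E x y" using D(3,4) by (auto simp: doubleton_eq_iff)
    moreover have "{f x, f y} = {u', v'}" using set[OF xy] True by simp
    then have "E (f x) (f y)" using D'(3,4) by (auto simp: doubleton_eq_iff)
    ultimately show ?thesis by simp
  next
    case False
    then have "E x y \<longleftrightarrow> E' x y" using D(11)[OF xy] by blast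
    also have "\<dots> \<longleftrightarrow> E' (f x) (f y)" using H.iso_edge[OF f(1), of x y] xy by simp
    also have "\<dots> \<longleftrightarrow> E (f x) (f y)" using D'(11)[OF fx fx, OF xy] set[OF xy] False by simp
    finally show ?thesis .
  qed
  then show ?thesis unfolding G.iso_def bij_betw_def using inj fV by blast
qed

section \<open>Paths and degrees in the subdivision\<close>

lemma subdivides_path_avoiding:
  assumes S: "subdivides V u v w" and "set A \<subseteq> V" "H.path A" shows "G.path A"
  using assms(2,3)
proof (induction A)
  case (Cons x A)
  have "E x (hd A)" if "A \<noteq> []"
  proof -
    have "x \<in> V" "hd A \<in> V" using Cons.prems(1) hd_in_set[OF that] by auto
    then show ?thesis using subdividesD(11)[OF S, of x "hd A"] Cons.prems(2) that by (simp add: H.path_Cons)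
  qed
  then show ?case using Cons by (auto simp: G.path_Cons H.path_Cons)
qed (simp add: G.path_def)

lemma subdivides_path:
  assumes S: "subdivides V u v w" and p: "H.path (A @ w # B)" and V: "set A \<subseteq> V" "set B \<subseteq> V" and ne: "A \<noteq> []" "B \<noteq> []"
  shows "G.path (A @ B)" "{last A, hd B} = {u, v}"
proof -
  note D = subdividesD[OF S]
  have a: "H.path A" "H.path B" "set A \<inter> set B = {}" "E' (last A) w" "E' w (hd B)"
    using p ne by (auto simp: H.path_append H.path_Cons)
  have "last A \<in> set A" "hd B \<in> set B" using ne by auto
  then have "last A = u \<or> last A = v" "hd B = u \<or> hd B = v" "last A \<noteq> hd B"
    using D(12,13) a V by auto
  then show "{last A, hd B} = {u, v}" by auto
  then have "E (last A) (hd B)" using D(3,4) by (auto simp: doubleton_eq_iff)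
  then show "G.path (A @ B)"
    using subdivides_path_avoiding[OF S V(1) a(1)] subdivides_path_avoiding[OF S V(2) a(2)] a(3) by (simp add: G.path_append)
qed

lemma subdivides_path_insert:
  assumes S: "subdivides V u v w" and p: "G.path (A @ B)" and V: "set A \<subseteq> V" "set B \<subseteq> V" and ne: "A \<noteq> []" "B \<noteq> []"
    and e: "{last A, hd B} = {u, v}"
  shows "H.path (A @ w # B)"
proof -
  note D = subdividesD[OF S]
  have a: "G.path A" "G.path B" "set A \<inter> set B = {}" using p by (auto simp: G.path_append)
  have l: "last A \<in> set A" "hd B \<in> set B" using ne by auto
  have one: "H.path X" if "G.path X" "set X \<subseteq> V" "\<not> {u, v} \<subseteq> set X" for X
    using that
  proof (induction X)
    case (Cons x X)
    have "E' x (hd X)" if "X \<noteq> []"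
    proof -
      have "{x, hd X} \<subseteq> set (x # X)" "x \<in> V" "hd X \<in> V" using that hd_in_set[OF that] Cons.prems by auto
      then have "{x, hd X} \<noteq> {u, v}" using Cons.prems(3) by metis
      then show ?thesis using D(11)[OF \<open>x \<in> V\<close> \<open>hd X \<in> V\<close>] Cons.prems(1) that by (simp add: G.path_Cons)
    qed
    then show ?case using Cons by (auto simp: G.path_Cons H.path_Cons)
  qed (simp add: H.path_def)
  have "\<not> {u, v} \<subseteq> set A" "\<not> {u, v} \<subseteq> set B" using e l a(3) by auto
  then have "H.path A" "H.path B" using one a V by blast+
  moreover have "E' (last A) w" "E' w (hd B)" using e D(7-10) by (auto simp: doubleton_eq_iff)
  moreover have "w \<notin> set A" "w \<notin> set B" using V D(6) by auto
  ultimately show ?thesis using a(3) by (simp add: H.path_append H.path_Cons)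
qed

text \<open>At an end of the subdivided edge the other end is exchanged for \<open>w\<close>;
  elsewhere the neighbours stay the same.\<close>

lemma subdivides_degree:
  assumes S: "subdivides V u v w" and z: "z \<in> V" and fV: "finite V"
  shows "card (H.nbs (insert w V) z) = card (G.nbs V z)"
proof -
  note D = subdividesD[OF S]
  have end': "card (H.nbs (insert w V) a) = card (G.nbs V a)" if S: "subdivides V a b w" for a b
  proof -
    note D = subdividesD[OF S]
    have b: "b \<in> G.nbs V a" unfolding G.nbs_def using D by blast
    have "H.nbs (insert w V) a = insert w (G.nbs V a - {b})"
      unfolding H.nbs_def G.nbs_def using D(1,5,9,11) by (auto simp: doubleton_eq_iff)
    moreover have "w \<notin> G.nbs V a" unfolding G.nbs_def using D(6) by blast
    ultimately show ?thesis using b G.nbs_finite[OF fV, of a] card_Suc_Diff1[of "G.nbs V a" b] by simp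
  qed
  consider "z = u" | "z = v" | "z \<noteq> u" "z \<noteq> v" by blast
  then show ?thesis
  proof cases
    case 1 then show ?thesis using end' S by blast
  next
    case 2
    have "subdivides V v u w" using S D(4) unfolding subdivides_def by (auto simp: insert_commute)
    then show ?thesis using end' 2 by blast
  next
    case 3
    then have "H.nbs (insert w V) z = G.nbs V z"
      unfolding H.nbs_def G.nbs_def using D(11,13) z by (auto simp: doubleton_eq_iff)
    then show ?thesis by simp
  qed
qed

text \<open>The new vertex is the middle of a path with \<open>2 * r\<close> edges, so the results
  on two branches of depth \<open>r\<close> apply to the subdivided trees. The members of their
  families contain the middle edge, which \<open>center_edge_unique\<close> identifies, so they are
  subsets of the original trees with \<open>w\<close> added.\<close>

lemma odd_tree_reconstruction_subdivided:
  assumes S: "subdivides V u v w" and S': "subdivides V' u' v' w'"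
    and F: "G.forest_on V" "G.forest_on V'" and C: "G.conn V" "G.conn V'" and h: "G.hypomorphic V V'" and cd: "card V = card V'"
    and d: "G.diam (2 * r - 1) V" "G.diam (2 * r - 1) V'" and n: "2 * r + 2 \<le> card V" and r: "1 \<le> r"
    and P: "G.path (A @ B)" "length A = r" "length B = r" "set A \<subseteq> V" "set B \<subseteq> V" "{last A, hd B} = {u, v}"
    and P': "G.path (A' @ B')" "length A' = r" "length B' = r" "set A' \<subseteq> V'" "set B' \<subseteq> V'" "{last A', hd B'} = {u', v'}"
  shows "G.sim V V'"
proof -
  let ?V = "insert w V" and ?V' = "insert w' V'"
  note D = subdividesD[OF S] and D' = subdividesD[OF S']
  have fin: "finite V" "finite V'" using F G.forest_finite by auto
  have cds: "card ?V = card ?V'" "2 * r + 3 \<le> card ?V" using fin D(6) D'(6) cd n by auto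
  have base: "H.rtree (insert w V) w \<and> 2 \<le> card (H.radial r (insert w V) w)"
    if S: "subdivides V u v w" and F: "G.forest_on V" and C: "G.conn V"
      and P: "G.path (A @ B)" "length A = r" "length B = r" "set A \<subseteq> V" "set B \<subseteq> V" "{last A, hd B} = {u, v}" for V u v w A B
  proof
    show "H.rtree (insert w V) w" unfolding H.rtree_def
      using subdivides_forest[OF S F] subdivides_conn[OF S order_refl] subdividesD(1,2)[OF S] C by simp
    have ne: "A \<noteq> []" "B \<noteq> []" using P(2,3) r by auto
    show "2 \<le> card (H.radial r (insert w V) w)"
      by (rule H.path_biradial[of _ "rev A" _ B])
        (use subdivides_path_insert[OF S P(1,4,5) ne P(6)] P G.forest_finite[OF F] r in auto)
  qed
  note b = base[OF S F(1) C(1) P] and b' = base[OF S' F(2) C(2) P']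
  have T: "H.rtree ?V w" "H.rtree ?V' w'" and two: "2 \<le> card (H.radial r ?V w)" "2 \<le> card (H.radial r ?V' w')" using b b' by auto
  have key: "H.rsim (insert w X) w (insert w' X') w' \<and> insert w' X' \<in> H.proper_radial 2 r (insert w' V') w'"
    if S: "subdivides V u v w" and S': "subdivides V' u' v' w'" and T: "H.rtree (insert w V) w"
      and V': "G.forest_on V'" "G.conn V'" "G.diam (2 * r - 1) V'"
      and P': "G.path (A' @ B')" "length A' = r" "length B' = r" "set A' \<subseteq> V'" "set B' \<subseteq> V'" "{last A', hd B'} = {u', v'}"
      and X: "X \<subset> V" "insert w X \<in> H.proper_radial 2 r (insert w V) w" and X': "X' \<subset> V'" and s: "G.sim X X'"
    for V V' u v w u' v' w' X X' A' B'
  proof -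
    note D = subdividesD[OF S] and D' = subdividesD[OF S']
    obtain f where f: "G.iso f X X'" using s G.sim_def by blast
    have Xs: "insert w X \<in> H.subtrees (insert w V) w" "2 \<le> card (H.radial r (insert w X) w)" using X(2) unfolding H.proper_radial_def by auto
    have rX: "H.rtree (insert w X) w" using H.subtrees_rtree[OF T Xs(1)] .
    obtain xs ys where xy: "H.path (rev xs @ w # ys)" "length xs = r" "length ys = r" "set (rev xs @ w # ys) \<subseteq> insert w X"
      by (rule H.biradial_path[OF rX r Xs(2)])
    have ne: "rev xs \<noteq> []" "ys \<noteq> []" using xy r by auto
    have sX: "set (rev xs) \<subseteq> X" "set ys \<subseteq> X" using xy(1,4) by (auto simp: H.path_append H.path_Cons)
    have sV: "set (rev xs) \<subseteq> V" "set ys \<subseteq> V" using sX X(1) by auto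
    note p = subdivides_path[OF S xy(1) sV ne]
    have l: "last (rev xs) \<in> X" "hd ys \<in> X" using sX ne last_in_set hd_in_set by blast+
    have uvX: "u \<in> X" "v \<in> X" using p(2) l by (auto simp: doubleton_eq_iff)
    let ?R = "map f (rev xs @ ys)"
    have R: "G.path ?R" "length ?R = 2 * r" "set ?R \<subseteq> V'"
      using G.iso_path[OF f, of "rev xs @ ys"] p(1) sX xy(2,3) G.iso_image[OF f] X' by auto
    have mid: "(As @ Bs) ! (r - 1) = last As \<and> (As @ Bs) ! r = hd Bs" if "length As = r" "length Bs = r" for As Bs :: "'v list"
    proof -
      have "As \<noteq> []" "Bs \<noteq> []" using that r by auto
      then show ?thesis using that r by (simp add: nth_append last_conv_nth hd_conv_nth)
    qed
    have "{?R ! (r - 1), ?R ! r} = {(A' @ B') ! (r - 1), (A' @ B') ! r}"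
      using G.center_edge_unique[OF V' r R P'(1)] P' by simp
    moreover have "?R ! (r - 1) = f (last (rev xs))" "?R ! r = f (hd ys)"
      using mid[of "map f (rev xs)" "map f ys"] xy(2,3) ne by (auto simp: last_map hd_map)
    ultimately have "f ` {last (rev xs), hd ys} = {u', v'}" using mid[OF P'(2,3)] P'(6) by simp
    then have fuv: "{f u, f v} = {u', v'}" unfolding p(2) by simp
    have i: "H.iso (f(w := w')) (insert w X) (insert w' X')"
      using subdivides_iso[OF S S' f _ _ uvX fuv] X X' by blast
    have rs: "H.rsim (insert w X) w (insert w' X') w'" unfolding H.rsim_def using i by (intro conjI exI[of _ "f(w := w')"]) auto
    have "H.conn (insert w' X')" using H.sim_conn[OF H.rsim_sim[OF rs]] rX unfolding H.rtree_def by blast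
    moreover have "insert w' X' \<subseteq> insert w' V'" "insert w' X' \<noteq> insert w' V'" using X' D'(6) by auto
    ultimately have "insert w' X' \<in> H.proper_radial 2 r (insert w' V') w'"
      unfolding H.proper_radial_def H.subtrees_def using H.rsim_radial_card[OF rs] Xs(2) by auto
    then show ?thesis using rs by blast
  qed
  have bij: "bij_betw (\<lambda>X. X - {w}) (H.proper_radial 2 r (insert w V) w) {X \<in> {X. X \<subset> V}. insert w X \<in> H.proper_radial 2 r (insert w V) w}"
    if "w \<notin> V" for V w
  proof (rule bij_betw_byWitness[where f' = "insert w"])
    show "\<forall>X\<in>H.proper_radial 2 r (insert w V) w. insert w (X - {w}) = X" unfolding H.proper_radial_def H.subtrees_def by auto
    show "\<forall>X\<in>{X \<in> {X. X \<subset> V}. insert w X \<in> H.proper_radial 2 r (insert w V) w}. insert w X - {w} = X" using that by auto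
    show "insert w ` {X \<in> {X. X \<subset> V}. insert w X \<in> H.proper_radial 2 r (insert w V) w} \<subseteq> H.proper_radial 2 r (insert w V) w" by auto
    show "(\<lambda>X. X - {w}) ` H.proper_radial 2 r (insert w V) w \<subseteq> {X \<in> {X. X \<subset> V}. insert w X \<in> H.proper_radial 2 r (insert w V) w}"
    proof
      fix Y assume "Y \<in> (\<lambda>X. X - {w}) ` H.proper_radial 2 r (insert w V) w"
      then obtain X where X: "X \<in> H.proper_radial 2 r (insert w V) w" "Y = X - {w}" by blast
      then have "X \<subseteq> insert w V" "w \<in> X" "X \<noteq> insert w V" unfolding H.proper_radial_def H.subtrees_def by auto
      moreover from this have "insert w Y = X" "Y \<subset> V" unfolding X(2) by auto
      ultimately show "Y \<in> {X \<in> {X. X \<subset> V}. insert w X \<in> H.proper_radial 2 r (insert w V) w}" using X by simp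
    qed
  qed
  have "matched G.sim {X \<in> {X. X \<subset> V}. insert w X \<in> H.proper_radial 2 r ?V w} {X \<in> {X. X \<subset> V'}. insert w' X \<in> H.proper_radial 2 r ?V' w'}"
  proof (rule matched_restrict[OF h[unfolded G.hypomorphic_def]])
    fix X X' assume a: "X \<in> {W. W \<subset> V}" "X' \<in> {W. W \<subset> V'}" "G.sim X X'"
    show "insert w X \<in> H.proper_radial 2 r ?V w \<longleftrightarrow> insert w' X' \<in> H.proper_radial 2 r ?V' w'"
      using key[OF S S' T(1) F(2) C(2) d(2) P' _ _ _ a(3)] key[OF S' S T(2) F(1) C(1) d(1) P _ _ _ G.sim_sym[OF a(3)]] a by blast
  qed
  then have "matched (\<lambda>X X'. G.sim X X' \<and> X \<subset> V \<and> X' \<subset> V' \<and> insert w X \<in> H.proper_radial 2 r ?V w)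
      {X \<in> {X. X \<subset> V}. insert w X \<in> H.proper_radial 2 r ?V w} {X \<in> {X. X \<subset> V'}. insert w' X \<in> H.proper_radial 2 r ?V' w'}"
    by (rule matched_mono) auto
  then have m: "matched (\<lambda>W W'. H.rsim W w W' w') (H.proper_radial 2 r ?V w) (H.proper_radial 2 r ?V' w')"
  proof (rule matched_transfer[OF _ bij[OF D(6)] bij[OF D'(6)]])
    fix W W' assume W: "W \<in> H.proper_radial 2 r ?V w" "W' \<in> H.proper_radial 2 r ?V' w'"
      "G.sim (W - {w}) (W' - {w'}) \<and> W - {w} \<subset> V \<and> W' - {w'} \<subset> V' \<and> insert w (W - {w}) \<in> H.proper_radial 2 r ?V w"
    have "insert w (W - {w}) = W" "insert w' (W' - {w'}) = W'" using W(1,2) unfolding H.proper_radial_def H.subtrees_def by auto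
    then show "H.rsim W w W' w'" using key[OF S S' T(1) F(2) C(2) d(2) P', of "W - {w}" "W' - {w'}"] W(3) by simp
  qed
  \<comment> \<open>The comparison takes place before subdivision, with diameter
    \<open>2 * r - 1\<close>: removing the new vertices joins the two halves to longest paths of the
    original trees.\<close>
  have mism: False
    if S: "subdivides V u v w" and S': "subdivides V' u' v' w'"
      and F: "G.forest_on V" "G.forest_on V'" and C: "G.conn V" "G.conn V'" and h: "G.hypomorphic V V'" and cd: "card V = card V'"
      and d: "G.diam (2 * r - 1) V" "G.diam (2 * r - 1) V'"
      and T: "H.rtree (insert w V) w" "H.rtree (insert w' V') w'"
      and two: "2 \<le> card (H.radial r (insert w V) w)" "2 \<le> card (H.radial r (insert w' V') w')"
      and m: "matched (\<lambda>W W'. H.rsim W w W' w') (H.proper_radial 2 r (insert w V) w) (H.proper_radial 2 r (insert w' V') w')"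
      and ex: "\<not> H.exceptional r (insert w V) w" "H.exceptional r (insert w' V') w'" and n: "2 * r + 3 \<le> card (insert w V)"
    for V V' u v w u' v' w'
  proof -
    note D = subdividesD[OF S] and D' = subdividesD[OF S']
    have fin: "finite V" "finite V'" using F G.forest_finite by auto
    have cds: "card (insert w V) = card (insert w' V')" using fin D(6) D'(6) cd by auto
    obtain A B p q i j where L: "H.path (A @ w # B)" "length A = r" "length B = r" "insert w V = set (A @ w # B) \<union> {p, q}"
      "p \<notin> set (A @ w # B)" "q \<notin> set (A @ w # B)" "i < r" "j < r" "E' (A ! i) p" "E' (B ! j) q" "card (insert w V) = 2 * r + 3"
      by (rule H.biradial_mismatch_path[OF T cds r two(1) m ex n])
    obtain xs' B' where L': "H.path (rev xs' @ w' # B')" "length xs' = r" "length B' = r" "set (rev xs' @ w' # B') \<subseteq> insert w' V'"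
      "\<And>z. z \<in> set (w' # xs') \<Longrightarrow> card (H.nbs (insert w' V') z) \<le> 2" by (rule H.exceptional_path[OF T(2) r two(2) ex(2)]) blast
    define A' where "A' = rev xs'"
    have wn: "w \<notin> set A" "w \<notin> set B" using L(1) by (auto simp: H.path_append H.path_Cons)
    have wn': "w' \<notin> set A'" "w' \<notin> set B'" using L'(1) unfolding A'_def by (auto simp: H.path_append H.path_Cons)
    have AV: "set A \<subseteq> V" "set B \<subseteq> V" using L(4) wn by auto
    have AV': "set A' \<subseteq> V'" "set B' \<subseteq> V'" using L'(4) wn' unfolding A'_def by auto
    have ne: "A \<noteq> []" "B \<noteq> []" "A' \<noteq> []" "B' \<noteq> []" using L L' r unfolding A'_def by auto
    have pq: "p \<in> V" "q \<in> V" using L(4,5,6) by auto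
    have VQ: "V = set (A @ B) \<union> {p, q}"
    proof -
      have "V = insert w V - {w}" using D(6) by simp
      also have "\<dots> = (set (A @ w # B) \<union> {p, q}) - {w}" using L(4) by simp
      also have "\<dots> = set (A @ B) \<union> {p, q}" using wn L(5,6) by auto
      finally show ?thesis .
    qed
    have "A ! i \<in> V" "B ! j \<in> V" using L(2,3,7,8) AV nth_mem[of i A] nth_mem[of j B] by auto
    then have e: "E (A ! i) p" "E (B ! j) q"
      using L AV pq D(11)[of "A ! i" p] D(11)[of "B ! j" q] nth_mem[of i A] nth_mem[of j B] by auto
    \<comment> \<open>For \<open>d = 2 * r - 1\<close> the bound \<open>2 * k \<le> d\<close> means
      \<open>k < r\<close>, so only the half \<open>A'\<close> is concerned; subdivision does not
      change its degrees.\<close>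
    have Q': "card (G.nbs V' ((A' @ B') ! k)) \<le> 2" if "2 * k \<le> 2 * r - 1" for k
    proof -
      have "k < length A'" using that L'(2) r unfolding A'_def by simp
      then have "(A' @ B') ! k \<in> set A'" by (simp add: nth_append)
      then show ?thesis using L'(5)[of "(A' @ B') ! k"] subdivides_degree[OF S' _ fin(2), of "(A' @ B') ! k"] AV'(1)
        unfolding A'_def by auto
    qed
    show False
    proof (rule G.opposite_pendants_contradiction[OF F C h cd d])
      show "card V = 2 * r - 1 + 3" using L(11) D(6) fin r by simp
      show "G.path (A @ B)" using subdivides_path(1)[OF S L(1) AV ne(1,2)] .
      show "G.path (A' @ B')" using subdivides_path(1)[OF S' L'(1)[folded A'_def] AV' ne(3,4)] .
      show "V = set (A @ B) \<union> {p, q}" by (rule VQ)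
      show "E ((A @ B) ! i) p" using e L by (simp add: nth_append)
      show "E ((A @ B) ! (r + j)) q" using e L by (simp add: nth_append)
      show "p \<notin> set (A @ B)" "q \<notin> set (A @ B)" using L by auto
      show "set (A' @ B') \<subseteq> V'" using AV' by simp
    qed (use L L' r Q' in \<open>auto simp: A'_def\<close>)
  qed
  have "H.rsim ?V w ?V' w'"
  proof (cases "H.exceptional r ?V w"; cases "H.exceptional r ?V' w'")
    assume "H.exceptional r ?V w" "H.exceptional r ?V' w'"
    then show ?thesis using H.biradial_exceptional[OF T cds(1) r two m] cds by blast
  next
    assume "\<not> H.exceptional r ?V w" "\<not> H.exceptional r ?V' w'"
    then show ?thesis using H.biradial_nonexceptional[OF T cds(1) r two m] by blast
  next
    assume "\<not> H.exceptional r ?V w" "H.exceptional r ?V' w'"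
    then show ?thesis using mism[OF S S' F C h cd d T two m] cds by blast
  next
    assume "H.exceptional r ?V w" "\<not> H.exceptional r ?V' w'"
    moreover have "matched (\<lambda>W W'. H.rsim W w' W' w) (H.proper_radial 2 r ?V' w') (H.proper_radial 2 r ?V w)"
      by (rule matched_mono[OF matched_sym[OF m]]) (rule H.rsim_sym)
    ultimately show ?thesis
      using mism[OF S' S F(2,1) C(2,1) G.hypomorphic_sym[OF h] cd[symmetric] d(2,1) T(2,1) two(2,1)] cds by simp
  qed
  then obtain f where "H.iso f ?V ?V'" "f w = w'" unfolding H.rsim_def by blast
  then show ?thesis unfolding G.sim_def using subdivides_iso_inverse[OF S S'] by blast
qed

end

context sgraph begin

text \<open>A single relation subdivides both central edges. Disjointness of \<open>V\<close> and
  \<open>V'\<close> keeps the two changes from interfering, and infinitely many vertices supply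
  \<open>w\<close> and \<open>w'\<close>.\<close>

lemma odd_tree_reconstruction:
  assumes inf: "infinite (UNIV :: 'v set)" and dj: "V \<inter> V' = {}"
    and F: "forest_on V" "forest_on V'" and C: "conn V" "conn V'" and h: "hypomorphic V V'" and cd: "card V = card V'"
    and d: "diam (2 * r - 1) V" "diam (2 * r - 1) V'" and n: "2 * r + 2 \<le> card V" and r: "1 \<le> r"
  shows "sim V V'"
proof -
  have fin: "finite V" "finite V'" using F forest_finite by auto
  have mid: "\<exists>A B. path (A @ B) \<and> length A = r \<and> length B = r \<and> set A \<subseteq> V \<and> set B \<subseteq> V \<and> last A \<in> V \<and> hd B \<in> V \<and> E (last A) (hd B)"
    if dV: "diam (2 * r - 1) V" for V
  proof -
    obtain P where P: "path P" "length P = 2 * r" "set P \<subseteq> V" using dV r unfolding diam_def has_path_def by auto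
    define A B where "A = take r P" and "B = drop r P"
    have AB: "path (A @ B)" "length A = r" "length B = r" "set A \<subseteq> V" "set B \<subseteq> V"
      unfolding A_def B_def using P set_take_subset[of r P] set_drop_subset[of r P] by auto
    have ne: "A \<noteq> []" "B \<noteq> []" using AB r by auto
    have "last A \<in> V" "hd B \<in> V" using AB(4,5) ne last_in_set hd_in_set by blast+
    moreover have "E (last A) (hd B)" using AB(1) ne by (simp add: path_append)
    ultimately show ?thesis using AB by blast
  qed
  obtain A B where P: "path (A @ B)" "length A = r" "length B = r" "set A \<subseteq> V" "set B \<subseteq> V" "last A \<in> V" "hd B \<in> V" "E (last A) (hd B)"
    using mid[OF d(1)] by blast
  obtain A' B' where P': "path (A' @ B')" "length A' = r" "length B' = r" "set A' \<subseteq> V'" "set B' \<subseteq> V'" "last A' \<in> V'" "hd B' \<in> V'" "E (last A') (hd B')"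
    using mid[OF d(2)] by blast
  obtain w where w: "w \<notin> V \<union> V'" using ex_new_if_finite[OF inf, of "V \<union> V'"] fin by blast
  obtain w' where w': "w' \<notin> insert w (V \<union> V')" using ex_new_if_finite[OF inf, of "insert w (V \<union> V')"] fin by blast
  define u v u' v' where "u = last A" and "v = hd B" and "u' = last A'" and "v' = hd B'"
  define ed where "ed a b x y \<longleftrightarrow> x = a \<and> y = b \<or> x = b \<and> y = a" for a b x y :: 'v
  \<comment> \<open>Edges of \<open>E\<close> that leave \<open>V \<union> V'\<close> are dropped,
    so that the new vertices are adjacent only to the ends of the subdivided edges.\<close>
  define E' where "E' x y \<longleftrightarrow> E x y \<and> \<not> ed u v x y \<and> \<not> ed u' v' x y \<and> x \<in> V \<union> V' \<and> y \<in> V \<union> V' \<or>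
    ed w u x y \<or> ed w v x y \<or> ed w' u' x y \<or> ed w' v' x y" for x y
  have m: "u \<in> V" "v \<in> V" "u' \<in> V'" "v' \<in> V'" "E u v" "E u' v'" using P P' unfolding u_def v_def u'_def v'_def by auto
  have nV: "x \<noteq> w \<and> x \<noteq> w' \<and> x \<noteq> u' \<and> x \<noteq> v'" if "x \<in> V" for x using that m w w' dj by auto
  have nV': "x \<noteq> w \<and> x \<noteq> w' \<and> x \<noteq> u \<and> x \<noteq> v" if "x \<in> V'" for x using that m w w' dj by auto
  have ww: "w \<noteq> w'" using w' by auto
  interpret two_graphs E E'
  proof unfold_locales
    have ed_sym: "ed a b y x = ed a b x y" for a b x y unfolding ed_def by blast
    show "E' y x" if "E' x y" for x y using that E_sym[of x y] ed_sym unfolding E'_def by simp blast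
    show "\<not> E' x x" for x unfolding E'_def ed_def using E_irrefl[of x] nV[OF m(1)] nV[OF m(2)] nV'[OF m(3)] nV'[OF m(4)] by blast
  qed
  have S: "subdivides V u v w"
    unfolding subdivides_def
  proof (intro conjI ballI)
    fix x y assume xy: "x \<in> V" "y \<in> V"
    show "E' x y = (E x y \<and> {x, y} \<noteq> {u, v})"
      unfolding E'_def ed_def doubleton_eq_iff using nV[OF xy(1)] nV[OF xy(2)] xy by blast
  next
    fix x assume x: "x \<in> V"
    show "E' w x \<longleftrightarrow> x = u \<or> x = v" unfolding E'_def ed_def using nV[OF x] nV[OF m(1)] nV[OF m(2)] x w ww by blast
  qed (use m w in auto)
  have S': "subdivides V' u' v' w'"
    unfolding subdivides_def
  proof (intro conjI ballI)
    fix x y assume xy: "x \<in> V'" "y \<in> V'"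
    show "E' x y = (E x y \<and> {x, y} \<noteq> {u', v'})"
      unfolding E'_def ed_def doubleton_eq_iff using nV'[OF xy(1)] nV'[OF xy(2)] xy by blast
  next
    fix x assume x: "x \<in> V'"
    show "E' w' x \<longleftrightarrow> x = u' \<or> x = v'" unfolding E'_def ed_def using nV'[OF x] nV'[OF m(3)] nV'[OF m(4)] x w' ww by blast
  qed (use m w' in auto)
  show ?thesis
    by (rule odd_tree_reconstruction_subdivided[OF S S' F C h cd d n r P(1-5) _ P'(1-5)])
      (simp_all add: u_def v_def u'_def v'_def)
qed

text \<open>The number of vertices off a longest path decides. From two such vertices on,
  \<open>d + 3 \<le> card V\<close> holds, the bound under which the argument at the centre
  works.\<close>

theorem tree_reconstruction:
  assumes inf: "infinite (UNIV :: 'v set)" and dj: "V \<inter> V' = {}"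
    and F: "forest_on V" "forest_on V'" and C: "conn V" "conn V'" and h: "hypomorphic V V'" and cd: "card V = card V'"
    and n: "3 \<le> card V"
  shows "sim V V'"
proof -
  have fin: "finite V" "finite V'" using F forest_finite by auto
  obtain d where d: "diam d V" using diam_exists[OF fin(1) conn_nonempty[OF C(1)]] .
  obtain d' where d': "diam d' V'" using diam_exists[OF fin(2) conn_nonempty[OF C(2)]] .
  have le: "Suc d \<le> card V" "Suc d' \<le> card V'" using d d' has_path_card fin unfolding diam_def by auto
  have spanning: "sim V V'"
    if "forest_on V" "forest_on V'" "conn V" "conn V'" "hypomorphic V V'" "card V = card V'" "diam d V" "Suc d = card V" for V V' d
  proof -
    obtain xs where xs: "path xs" "length xs = Suc d" "set xs \<subseteq> V" using \<open>diam d V\<close> unfolding diam_def has_path_def by blast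
    have "set xs = V"
      using card_subset_eq[OF _ xs(3)] distinct_card[OF path_distinct[OF xs(1)]] xs(2) that(8) forest_finite[OF that(1)] by simp
    then show ?thesis using path_reconstruction[OF that(1-6) xs(1)] by blast
  qed
  show ?thesis
  proof (cases "Suc d = card V \<or> Suc d' = card V'")
    case True
    then show ?thesis
      using spanning[OF F C h cd d] spanning[OF F(2,1) C(2,1) hypomorphic_sym[OF h] cd[symmetric] d'] sim_sym by blast
  next
    case False
    then have "d' = d" using same_diam[OF h fin d d'] le by simp
    then have d': "diam d V'" using d' by simp
    show ?thesis
    proof (cases "card V = d + 2")
      case True
      then show ?thesis using spider_reconstruction[OF F C h cd d d'] by blast
    next
      case ne: False
      then have n3: "d + 3 \<le> card V" using le False by linarith
      have d1: "1 \<le> d"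
      proof (rule ccontr)
        assume "\<not> 1 \<le> d"
        obtain x where x: "x \<in> V" using conn_nonempty[OF C(1)] by blast
        have "{x} \<noteq> V" using n by auto
        then obtain y where "y \<in> V" "y \<notin> {x}" "E x y" using connE[OF C(1), of "{x}"] x by auto
        then have "has_path 1 V" unfolding has_path_def using x by (intro exI[of _ "[x, y]"]) (auto simp: path_def)
        moreover have "d = 0" using \<open>\<not> 1 \<le> d\<close> by simp
        ultimately show False using d unfolding diam_def by simp
      qed
      show ?thesis
      proof (cases "even d")
        case True
        then obtain r where "d = 2 * r" by blast
        then show ?thesis using even_tree_reconstruction[OF F C h cd, of r] d d' n3 d1 by simp
      next
        case False
        then obtain k where k: "d = 2 * k + 1" by (rule oddE)
        then have "d = 2 * Suc k - 1" by simp
        then show ?thesis using odd_tree_reconstruction[OF inf dj F C h cd, of "Suc k"] d d' n3 k by simp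
      qed
    qed
  qed
qed

end

section \<open>Disconnected forests\<close>

lemma matched_Un:
  assumes "matched R A B" "matched R A' B'" "A \<inter> A' = {}" "B \<inter> B' = {}"
  shows "matched R (A \<union> A') (B \<union> B')"
proof -
  obtain \<phi> \<psi> where p: "bij_betw \<phi> A B" "\<forall>a\<in>A. R a (\<phi> a)" "bij_betw \<psi> A' B'" "\<forall>a\<in>A'. R a (\<psi> a)"
    using assms(1,2) unfolding matched_def by blast
  let ?h = "\<lambda>a. if a \<in> A then \<phi> a else \<psi> a"
  have "bij_betw ?h A B" using p(1) by (subst bij_betw_cong[of A _ \<phi>]) auto
  moreover have "bij_betw ?h A' B'" using p(3) assms(3) by (subst bij_betw_cong[of A' _ \<psi>]) auto
  ultimately have "bij_betw ?h (A \<union> A') (B \<union> B')" using bij_betw_combine assms(4) by blast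
  then show ?thesis unfolding matched_def using p(2,4) by (intro exI[of _ ?h]) auto
qed

context sgraph begin

lemma component_eq_or_disjoint: "component V x \<inter> component V y = {} \<or> component V x = component V y"
  using component_eq by blast

text \<open>Every connected subset is proper here, so the number of copies of each connected pattern
  is known, and it is the sum over the components. Kelly counting then yields the multiplicities of
  the component types.\<close>

lemma disconnected_reconstruction:
  assumes fin: "finite V" "finite V'" and ncon: "\<not> conn V" "\<not> conn V'" and h: "hypomorphic V V'"
  shows "sim V V'"
proof -
  let ?C = "component V ` V" and ?C' = "component V' ` V'"
  define N where "N A t = card {W. W \<subseteq> A \<and> conn W \<and> sim W t}" for A t
  have total: "(\<Sum>P\<in>component V ` V. N P t) = card {W \<in> {W. W \<subset> V}. conn W \<and> sim W t}" if "finite V" "\<not> conn V" for V t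
  proof -
    have e: "{W \<in> {W. W \<subset> V}. conn W \<and> sim W t} = (\<Union>P\<in>component V ` V. {W. W \<subseteq> P \<and> conn W \<and> sim W t})"
    proof
      show "{W \<in> {W. W \<subset> V}. conn W \<and> sim W t} \<subseteq> (\<Union>P\<in>component V ` V. {W. W \<subseteq> P \<and> conn W \<and> sim W t})"
      proof
        fix W assume W: "W \<in> {W \<in> {W. W \<subset> V}. conn W \<and> sim W t}"
        then obtain x where x: "x \<in> W" "x \<in> V" using conn_nonempty by blast
        have "W \<subseteq> component V x" using component_maximal[of W V x x] W x component_self[OF x(2)] by blast
        then show "W \<in> (\<Union>P\<in>component V ` V. {W. W \<subseteq> P \<and> conn W \<and> sim W t})" using W x by blast
      qed
      show "(\<Union>P\<in>component V ` V. {W. W \<subseteq> P \<and> conn W \<and> sim W t}) \<subseteq> {W \<in> {W. W \<subset> V}. conn W \<and> sim W t}"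
      proof
        fix W assume "W \<in> (\<Union>P\<in>component V ` V. {W. W \<subseteq> P \<and> conn W \<and> sim W t})"
        then obtain x where W: "W \<subseteq> component V x" "conn W" "sim W t" by blast
        then have "W \<subseteq> V" using component_subset by blast
        then show "W \<in> {W \<in> {W. W \<subset> V}. conn W \<and> sim W t}" using W(2,3) that(2) by auto
      qed
    qed
    have "card (\<Union>P\<in>component V ` V. {W. W \<subseteq> P \<and> conn W \<and> sim W t}) = (\<Sum>P\<in>component V ` V. card {W. W \<subseteq> P \<and> conn W \<and> sim W t})"
    proof (rule card_UN_disjoint)
      show "finite (component V ` V)" using that by simp
      show "\<forall>P\<in>component V ` V. finite {W. W \<subseteq> P \<and> conn W \<and> sim W t}"
        using finite_subset[OF component_subset that(1)] by auto
      show "\<forall>P\<in>component V ` V. \<forall>Q\<in>component V ` V. P \<noteq> Q \<longrightarrow> {W. W \<subseteq> P \<and> conn W \<and> sim W t} \<inter> {W. W \<subseteq> Q \<and> conn W \<and> sim W t} = {}"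
      proof (intro ballI impI)
        fix P Q assume "P \<in> component V ` V" "Q \<in> component V ` V" "P \<noteq> Q"
        then have "P \<inter> Q = {}" using component_eq_or_disjoint by blast
        then show "{W. W \<subseteq> P \<and> conn W \<and> sim W t} \<inter> {W. W \<subseteq> Q \<and> conn W \<and> sim W t} = {}"
          using conn_nonempty by blast
      qed
    qed
    then show ?thesis unfolding e N_def by simp
  qed
  have Ccon: "conn P" "finite P" if P: "P \<in> ?C \<union> ?C'" for P
    using P conn_component finite_subset[OF component_subset fin(1)] finite_subset[OF component_subset fin(2)] by auto
  have tot: "(\<Sum>a\<in>{a \<in> ?C. iso_type a = \<tau>}. 1) = (\<Sum>b\<in>{b \<in> ?C'. iso_type b = \<tau>}. (1::nat))" for \<tau>
  proof (rule weighted_class_totals[where N = N and sz = card])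
    show "finite ?C" "finite ?C'" using fin by auto
  next
    fix a a' t assume "iso_type a = iso_type a'"
    then have "sim a a'" using iso_type_eq by blast
    then obtain f where f: "iso f a a'" unfolding sim_def by blast
    have le: "N a t \<le> N a' t" if f: "iso f a a'" and "finite a'" for a a' f t
    proof -
      have "inj_on ((`) f) {W. W \<subseteq> a \<and> conn W \<and> sim W t}"
        using inj_on_image_Pow[OF iso_inj[OF f]] by (rule inj_on_subset) auto
      moreover have "(`) f ` {W. W \<subseteq> a \<and> conn W \<and> sim W t} \<subseteq> {W. W \<subseteq> a' \<and> conn W \<and> sim W t}"
      proof clarify
        fix W assume W: "W \<subseteq> a" "conn W" "sim W t"
        have "sim (f ` W) W" using iso_restrict[OF f W(1)] sim_sym unfolding sim_def by blast
        then show "f ` W \<subseteq> a' \<and> conn (f ` W) \<and> sim (f ` W) t"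
          using W iso_conn[OF f W(1)] iso_image[OF f] sim_trans by blast
      qed
      ultimately show ?thesis unfolding N_def using that(2) by (intro card_inj_on_le) auto
    qed
    assume "a \<in> ?C \<union> ?C'" "a' \<in> ?C \<union> ?C'"
    then show "N a t = N a' t" using le[OF f] le[OF iso_inv[OF f]] Ccon(2) by (simp add: le_antisym)
  next
    fix t assume t: "t \<in> ?C \<union> ?C'"
    then have "t \<in> {W. W \<subseteq> t \<and> conn W \<and> sim W t}" using Ccon sim_refl by blast
    moreover have "finite {W. W \<subseteq> t \<and> conn W \<and> sim W t}" using Ccon(2)[OF t] by simp
    ultimately show "0 < N t t" unfolding N_def by (auto simp: card_gt_0_iff)
  next
    fix a t assume a: "a \<in> ?C \<union> ?C'" "0 < N a t"
    then obtain W where W: "W \<subseteq> a" "sim W t" unfolding N_def by (auto simp: card_gt_0_iff)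
    show "iso_type a = iso_type t \<or> card t < card a"
    proof (cases "W = a")
      case True
      then show ?thesis using W iso_type_eq by blast
    next
      case False
      then show ?thesis using psubset_card_mono[OF Ccon(2)[OF a(1)], of W] W sim_card by auto
    qed
  next
    fix t
    have "card {W \<in> {W. W \<subset> V}. conn W \<and> sim W t} = card {W \<in> {W. W \<subset> V'}. conn W \<and> sim W t}"
      by (rule matched_card[OF h[unfolded hypomorphic_def]]) (meson sim_conn sim_sym sim_trans)
    then show "(\<Sum>a\<in>?C. 1 * N a t) = (\<Sum>b\<in>?C'. 1 * N b t)" using total[OF fin(1) ncon(1)] total[OF fin(2) ncon(2)] by simp
  qed
  have "matched (\<lambda>P P'. iso_type P = iso_type P') ?C ?C'"
    by (rule matched_by_class_card) (use fin tot in auto)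
  then have m: "matched (\<lambda>P P'. \<exists>f. iso f P P' \<and> (\<forall>x\<in>{}. f x = id x)) ?C ?C'"
    by (rule matched_mono) (use iso_type_eq in \<open>auto simp: sim_def\<close>)
  have dj: "P \<inter> Q \<subseteq> {}" "\<And>x y. x \<in> P - {} \<Longrightarrow> y \<in> Q - {} \<Longrightarrow> \<not> E x y"
    if PQ: "P \<in> component V ` V" "Q \<in> component V ` V" "P \<noteq> Q" for V P Q
  proof -
    show e: "P \<inter> Q \<subseteq> {}" using component_eq_or_disjoint PQ by blast
    obtain a b where ab: "P = component V a" "Q = component V b" using PQ by blast
    fix x y assume xy: "x \<in> P - {}" "y \<in> Q - {}"
    show "\<not> E x y"
    proof
      assume "E x y"
      moreover have "y \<in> V" using xy(2) ab component_subset by blast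
      ultimately have "y \<in> P" using component_edge[of x V a y] xy(1) ab by simp
      then show False using e xy(2) by blast
    qed
  qed
  have "\<exists>f. iso f ({} \<union> \<Union>?C) ({} \<union> \<Union>?C') \<and> (\<forall>x\<in>{}. f x = id x)"
  proof (rule iso_glue_family[OF _ m])
    show "finite ?C" using fin by simp
    show "iso id {} {}" by (rule iso_id)
    show "\<And>P Q. P \<in> ?C \<Longrightarrow> Q \<in> ?C \<Longrightarrow> P \<noteq> Q \<Longrightarrow> P \<inter> Q \<subseteq> {}" using dj(1) .
    show "\<And>P Q. P \<in> ?C' \<Longrightarrow> Q \<in> ?C' \<Longrightarrow> P \<noteq> Q \<Longrightarrow> P \<inter> Q \<subseteq> {}" using dj(1) .
    show "\<And>P Q x y. P \<in> ?C \<Longrightarrow> Q \<in> ?C \<Longrightarrow> P \<noteq> Q \<Longrightarrow> x \<in> P - {} \<Longrightarrow> y \<in> Q - {} \<Longrightarrow> \<not> E x y" using dj(2) .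
    show "\<And>P Q x y. P \<in> ?C' \<Longrightarrow> Q \<in> ?C' \<Longrightarrow> P \<noteq> Q \<Longrightarrow> x \<in> P - {} \<Longrightarrow> y \<in> Q - {} \<Longrightarrow> \<not> E x y" using dj(2) .
  qed auto
  moreover have "\<Union>(component V ` V) = V" for V using component_self component_subset[of V] by (auto; blast)
  ultimately show ?thesis unfolding sim_def by auto
qed

section \<open>Edge numbers and acyclicity of the other graph\<close>

lemma finite_proper_subsets: "finite V \<Longrightarrow> finite {W. W \<subset> V \<and> P W}"
  by (rule finite_subset[of _ "Pow V"]) auto

text \<open>With at least 3 vertices all pairs of vertices are proper subsets, so the number of
  edges is part of the data.\<close>

lemma arc_count_as_sum:
  assumes "finite V" "3 \<le> card V"
  shows "arc_count V = (\<Sum>W\<in>{W \<in> {W. W \<subset> V}. card W = 2}. arc_count W)"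
proof -
  let ?S = "\<lambda>V. {(x, y). x \<in> V \<and> y \<in> V \<and> E x y}"
  let ?T = "{W \<in> {W. W \<subset> V}. card W = 2}"
  have "(\<Sum>W\<in>?T. \<Sum>e\<in>{e \<in> ?S V. (\<lambda>(x, y). {x, y}) e = W}. 1) = (\<Sum>e\<in>?S V. (1::nat))"
  proof (rule sum.group)
    show "finite (?S V)" using arc_count_finite[OF assms(1)] .
    show "finite ?T" using finite_proper_subsets[OF assms(1)] by simp
    show "(\<lambda>(x, y). {x, y}) ` ?S V \<subseteq> ?T"
    proof (rule image_subsetI)
      fix e assume "e \<in> ?S V"
      then obtain x y where xy: "e = (x, y)" "x \<in> V" "y \<in> V" "E x y" by auto
      have "x \<noteq> y" using xy(4) E_irrefl by blast
      then have "card {x, y} = 2" by simp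
      moreover have "{x, y} \<noteq> V"
      proof
        assume "{x, y} = V"
        then show False using \<open>card {x, y} = 2\<close> assms(2) by simp
      qed
      ultimately show "(\<lambda>(x, y). {x, y}) e \<in> ?T" using xy by auto
    qed
  qed
  moreover have "{e \<in> ?S V. (\<lambda>(x, y). {x, y}) e = W} = ?S W" if W: "W \<in> ?T" for W
  proof
    show "{e \<in> ?S V. (\<lambda>(x, y). {x, y}) e = W} \<subseteq> ?S W" by auto
    show "?S W \<subseteq> {e \<in> ?S V. (\<lambda>(x, y). {x, y}) e = W}"
    proof
      fix e assume "e \<in> ?S W"
      then obtain x y where xy: "e = (x, y)" "x \<in> W" "y \<in> W" "E x y" by auto
      have "x \<noteq> y" using xy(4) E_irrefl by blast
      then have "card {x, y} = 2" by simp
      moreover have "finite W" using W assms(1) finite_subset by blast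
      ultimately have "{x, y} = W" using xy W by (intro card_subset_eq) auto
      then show "e \<in> {e \<in> ?S V. (\<lambda>(x, y). {x, y}) e = W}" using xy W by auto
    qed
  qed
  ultimately show ?thesis unfolding arc_count_def by simp
qed

lemma hypomorphic_arc_count:
  assumes "hypomorphic V V'" "finite V" "finite V'" "card V = card V'" "3 \<le> card V"
  shows "arc_count V = arc_count V'"
proof -
  have "matched sim {W \<in> {W. W \<subset> V}. card W = 2} {W \<in> {W. W \<subset> V'}. card W = 2}"
    by (rule matched_restrict[OF assms(1)[unfolded hypomorphic_def]]) (auto dest: sim_card)
  then show ?thesis using arc_count_as_sum assms by (simp add: matched_sum[OF _ sim_arc_count])
qed

text \<open>Acyclicity of \<open>V'\<close> follows from \<open>sparse_forest\<close>: its proper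
  subsets occur in \<open>V\<close>, and \<open>V'\<close> itself has the same numbers of vertices
  and edges as \<open>V\<close>. These two numbers also decide connectedness.\<close>

theorem forest_reconstruction:
  assumes inf: "infinite (UNIV :: 'v set)" and dj: "V \<inter> V' = {}"
    and F: "forest_on V" and fin: "finite V'" and h: "hypomorphic V V'" and cd: "card V = card V'" and n: "3 \<le> card V"
  shows "sim V V'"
proof -
  have fV: "finite V" using F forest_finite by blast
  have ar: "arc_count V = arc_count V'" using hypomorphic_arc_count[OF h fV fin cd n] .
  have ne: "V \<noteq> {}" "V' \<noteq> {}" using n cd by auto
  have F': "forest_on V'"
  proof (rule sparse_forest[OF fin])
    fix W assume W: "W \<subseteq> V'" "W \<noteq> {}"
    have "\<exists>U. U \<subseteq> V \<and> arc_count U = arc_count W \<and> card U = card W"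
    proof (cases "W = V'")
      case False
      then have "W \<subset> V'" using W by blast
      then obtain U f where "U \<subset> V" "iso f W U" by (rule hypomorphic_ex[OF hypomorphic_sym[OF h]])
      then have "U \<subseteq> V" "sim U W" using sim_sym unfolding sim_def by blast+
      then show ?thesis using sim_arc_count[of U W] sim_card[of U W] by blast
    qed (use ar cd in auto)
    then obtain U where U: "U \<subseteq> V" "arc_count U = arc_count W" "card U = card W" by blast
    have "finite W" using W fin finite_subset by blast
    then have "U \<noteq> {}" using U(3) W(2) by auto
    then show "arc_count W + 2 \<le> 2 * card W" using forest_arc_count[OF forest_subset[OF F U(1)]] U by simp
  qed
  have "conn V \<longleftrightarrow> conn V'" using forest_conn_iff[OF F ne(1)] forest_conn_iff[OF F' ne(2)] ar cd by simp
  then show ?thesis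
    using tree_reconstruction[OF inf dj F F' _ _ h cd n] disconnected_reconstruction[OF fV fin _ _ h] by blast
qed

section \<open>From the matrix to the family of proper subgraphs\<close>

lemma arc_count_zero: "finite W \<Longrightarrow> arc_count W = 0 \<longleftrightarrow> (\<forall>x\<in>W. \<forall>y\<in>W. \<not> E x y)"
  unfolding arc_count_def using arc_count_finite[of W] by auto

lemma sim_arcless:
  assumes "finite W" "finite W'" "arc_count W = 0" "arc_count W' = 0" "card W = card W'"
  shows "sim W W'"
proof -
  obtain f where f: "bij_betw f W W'" using finite_same_card_bij assms by blast
  then have "iso f W W'" unfolding iso_def using assms arc_count_zero bij_betwE[OF f] by blast
  then show ?thesis unfolding sim_def by blast
qed

lemma arc_count_pos_card_ge_2:
  assumes "finite W" "arc_count W \<noteq> 0" shows "2 \<le> card W"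
proof -
  obtain x y where xy: "x \<in> W" "y \<in> W" "E x y" using assms arc_count_zero[OF assms(1)] by auto
  then have "x \<noteq> y" using E_irrefl by blast
  then show ?thesis using card_mono[OF assms(1), of "{x, y}"] xy by simp
qed

lemma sim_single_edges:
  assumes "finite W" "finite W'" "arc_count W \<noteq> 0" "arc_count W' \<noteq> 0" "card W = 2" "card W' = 2"
  shows "sim W W'"
proof -
  have ed: "\<exists>x y. x \<noteq> y \<and> E x y \<and> W = {x, y}" if W: "finite W" "arc_count W \<noteq> 0" "card W = 2" for W
  proof -
    obtain x y where xy: "x \<in> W" "y \<in> W" "E x y" using W(2) arc_count_zero[OF W(1)] by auto
    then have "x \<noteq> y" using E_irrefl by blast
    then have "{x, y} = W" using xy W by (intro card_subset_eq) auto
    then show ?thesis using xy \<open>x \<noteq> y\<close> by blast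
  qed
  obtain x y where xy: "x \<noteq> y" "E x y" "W = {x, y}" using ed[of W] assms by blast
  obtain a b where ab: "a \<noteq> b" "E a b" "W' = {a, b}" using ed[of W'] assms by blast
  have "iso (\<lambda>z. if z = x then a else b) W W'"
    unfolding iso_def bij_betw_def xy(3) ab(3) using xy ab E_irrefl E_sym[OF xy(2)] E_sym[OF ab(2)] by (auto simp: inj_on_def)
  then show ?thesis unfolding sim_def by blast
qed

lemma arc_count_remove_vertex:
  assumes "finite W" "arc_count W \<noteq> 0" "3 \<le> card W"
  obtains z where "z \<in> W" "arc_count (W - {z}) \<noteq> 0"
proof -
  obtain x y where xy: "x \<in> W" "y \<in> W" "E x y" using assms arc_count_zero[OF assms(1)] by auto
  have "card {x, y} < card W" using assms(3) by (simp add: card_insert_if)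
  then have "\<not> W \<subseteq> {x, y}" using card_mono[of "{x, y}" W] by auto
  then obtain z where "z \<in> W" "z \<noteq> x" "z \<noteq> y" by blast
  then show thesis using that[of z] xy arc_count_zero[of "W - {z}"] assms(1) by blast
qed

text \<open>An entry of the matrix, in terms of vertex sets.\<close>

definition copies :: "'v set \<Rightarrow> 'v set \<Rightarrow> nat" where
  "copies A T = card {W. W \<subseteq> A \<and> sim W T}"

lemma copies_pos: "finite A \<Longrightarrow> 0 < copies A T \<longleftrightarrow> (\<exists>W\<subseteq>A. sim W T)"
  unfolding copies_def by (auto simp: card_gt_0_iff)

text \<open>
  The empty induced subgraphs do not occur in the matrix; their number follows from the binomial
  coefficients.
\<close>

lemma hypomorphic_if_nonempty_matched:
  assumes fin: "finite A" "finite B" and cd: "card A = card B"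
    and m: "matched sim {W. W \<subset> A \<and> arc_count W \<noteq> 0} {W. W \<subset> B \<and> arc_count W \<noteq> 0}"
  shows "hypomorphic A B"
proof -
  have cnt: "card {W \<in> {W. W \<subset> A \<and> arc_count W = 0}. card W = k} = (if k < card A then card A choose k else 0) - card {W \<in> {W. W \<subset> A \<and> arc_count W \<noteq> 0}. card W = k}"
    if "finite A" for A k
  proof (cases "k < card A")
    case True
    have "{W. W \<subseteq> A \<and> card W = k} = {W \<in> {W. W \<subset> A \<and> arc_count W = 0}. card W = k} \<union> {W \<in> {W. W \<subset> A \<and> arc_count W \<noteq> 0}. card W = k}"
      using True by auto
    then have "card A choose k = card ({W \<in> {W. W \<subset> A \<and> arc_count W = 0}. card W = k} \<union> {W \<in> {W. W \<subset> A \<and> arc_count W \<noteq> 0}. card W = k})"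
      using n_subsets[OF that, of k] by simp
    also have "\<dots> = card {W \<in> {W. W \<subset> A \<and> arc_count W = 0}. card W = k} + card {W \<in> {W. W \<subset> A \<and> arc_count W \<noteq> 0}. card W = k}"
      by (rule card_Un_disjoint) (auto intro: finite_proper_subsets[OF that])
    finally show ?thesis using True by simp
  next
    case False
    then have "{W \<in> {W. W \<subset> A \<and> arc_count W = 0}. card W = k} = {}" using psubset_card_mono[OF that] by auto
    then have "card {W \<in> {W. W \<subset> A \<and> arc_count W = 0}. card W = k} = 0" by (simp only: card.empty)
    then show ?thesis using False by simp
  qed
  have "card {W \<in> {W. W \<subset> A \<and> arc_count W = 0}. card W = k} = card {W \<in> {W. W \<subset> B \<and> arc_count W = 0}. card W = k}" for k
    unfolding cnt[OF fin(1)] cnt[OF fin(2)] using matched_card[OF m, of "\<lambda>W. card W = k" "\<lambda>W. card W = k"] sim_card cd by auto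
  then have "matched (\<lambda>W W'. card W = card W') {W. W \<subset> A \<and> arc_count W = 0} {W. W \<subset> B \<and> arc_count W = 0}"
    by (intro matched_by_class_card finite_proper_subsets fin)
  then have "matched sim {W. W \<subset> A \<and> arc_count W = 0} {W. W \<subset> B \<and> arc_count W = 0}"
  proof (rule matched_mono)
    fix W W' assume a: "W \<in> {W. W \<subset> A \<and> arc_count W = 0}" "W' \<in> {W. W \<subset> B \<and> arc_count W = 0}" "card W = card W'"
    then have "finite W" "finite W'" using fin finite_subset by blast+
    then show "sim W W'" using sim_arcless a by blast
  qed
  then have "matched sim ({W. W \<subset> A \<and> arc_count W \<noteq> 0} \<union> {W. W \<subset> A \<and> arc_count W = 0}) ({W. W \<subset> B \<and> arc_count W \<noteq> 0} \<union> {W. W \<subset> B \<and> arc_count W = 0})"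
    by (intro matched_Un m) auto
  moreover have "{W. W \<subset> A \<and> arc_count W \<noteq> 0} \<union> {W. W \<subset> A \<and> arc_count W = 0} = {W. W \<subset> A}" for A by auto
  ultimately show ?thesis unfolding hypomorphic_def by simp
qed

text \<open>The types \<open>L i\<close> and \<open>M i\<close> turn out isomorphic for every
  \<open>i\<close>. Their numbers of vertices are not given: a type with at least 3 vertices
  contains a type with an edge and exactly one vertex less, and positive entries carry this over to
  the other side.\<close>

theorem reconstruction_from_copies:
  assumes inf: "infinite (UNIV :: 'v set)" and dj: "V \<inter> V' = {}" and F: "forest_on V" and fin': "finite V'"
    and ne: "arc_count V \<noteq> 0" "arc_count V' \<noteq> 0"
    and L: "\<And>i. i < (m :: nat) \<Longrightarrow> L i \<subseteq> V \<and> arc_count (L i) \<noteq> 0" "\<And>W. W \<subseteq> V \<Longrightarrow> arc_count W \<noteq> 0 \<Longrightarrow> \<exists>i<m. sim W (L i)"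
      "\<And>i j. i < m \<Longrightarrow> j < m \<Longrightarrow> sim (L i) (L j) \<Longrightarrow> i = j"
    and M: "\<And>i. i < m \<Longrightarrow> M i \<subseteq> V' \<and> arc_count (M i) \<noteq> 0" "\<And>W. W \<subseteq> V' \<Longrightarrow> arc_count W \<noteq> 0 \<Longrightarrow> \<exists>i<m. sim W (M i)"
      "\<And>i j. i < m \<Longrightarrow> j < m \<Longrightarrow> sim (M i) (M j) \<Longrightarrow> i = j"
    and eq: "\<And>i j. i < m \<Longrightarrow> j < m \<Longrightarrow> copies (L i) (L j) = copies (M i) (M j)"
  shows "sim V V'"
proof -
  have fin: "finite V" using F forest_finite by blast
  note subs = finite_subset[OF _ fin] finite_subset[OF _ fin']
  have fL: "finite (L i)" "finite (M i)" if "i < m" for i using L(1)[OF that] M(1)[OF that] subs by auto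
  have smaller: "card (K j) < card (K i)"
    if H: "0 < copies (K i) (K j)" "i \<noteq> j" "i < m" "j < m" "finite (K i)" "\<And>i j. i < m \<Longrightarrow> j < m \<Longrightarrow> sim (K i) (K j) \<Longrightarrow> i = j"
    for K :: "nat \<Rightarrow> 'v set" and i j
  proof -
    obtain W where W: "W \<subseteq> K i" "sim W (K j)" using H(1) copies_pos[OF H(5)] by blast
    then have "W \<noteq> K i" using H(2-4,6) by blast
    then have "card W < card (K i)" using W(1) H(5) by (intro psubset_card_mono) auto
    then show ?thesis using sim_card[OF W(2)] by simp
  qed
  \<comment> \<open>The deleted vertex lies off some edge, which therefore remains.\<close>
  have below: "\<exists>j<m. j \<noteq> i \<and> 0 < copies (K i) (K j) \<and> Suc (card (K j)) = card (K i)"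
    if i: "i < m" and K: "K i \<subseteq> U" "finite (K i)" "arc_count (K i) \<noteq> 0" "3 \<le> card (K i)"
      and all: "\<And>W. W \<subseteq> U \<Longrightarrow> arc_count W \<noteq> 0 \<Longrightarrow> \<exists>i<m. sim W (K i)" for K :: "nat \<Rightarrow> 'v set" and i U
  proof -
    obtain z where z: "z \<in> K i" "arc_count (K i - {z}) \<noteq> 0" using arc_count_remove_vertex K by blast
    then obtain j where j: "j < m" "sim (K i - {z}) (K j)" using all[of "K i - {z}"] K(1) by blast
    have c: "Suc (card (K j)) = card (K i)" using sim_card[OF j(2)] card_Suc_Diff1[OF K(2) z(1)] by simp
    moreover have "0 < copies (K i) (K j)" using copies_pos[OF K(2)] j(2) by blast
    ultimately show ?thesis using j(1) by auto
  qed
  have main: "sim (L i) (M i)" if "i < m" for i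
    using that
  proof (induction "card (L i)" arbitrary: i rule: less_induct)
    case less
    let ?A = "L i" and ?B = "M i"
    note i = less.prems
    have IH: "sim (L j) (M j)" if "j < m" "card (L j) < card ?A" for j using less.hyps that by blast
    have fA: "finite ?A" "finite ?B" using fL i by auto
    have "card ?A \<le> card ?B"
    proof (cases "3 \<le> card ?A")
      case True
      obtain j where j: "j < m" "j \<noteq> i" "0 < copies ?A (L j)" "Suc (card (L j)) = card ?A"
        using below[OF i _ fA(1) _ True L(2)] L(1)[OF i] by blast
      have "0 < copies ?B (M j)" using eq[OF i j(1)] j(3) by simp
      then have "card (M j) < card ?B" using smaller[of M i j] j i fA(2) M(3) by metis
      moreover have "card (M j) = card (L j)" using IH[OF j(1)] j(4) sim_card by auto
      ultimately show ?thesis using j(4) by simp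
    next
      case False
      then show ?thesis using arc_count_pos_card_ge_2[OF fA(2)] M(1)[OF i] by simp
    qed
    \<comment> \<open>The induction hypothesis needs a small \<open>L j\<close>, whereas here
      \<open>M j\<close> is found; the positive entry transferred to \<open>L\<close> bounds the
      size of \<open>L j\<close>.\<close>
    moreover have "card ?B \<le> card ?A"
    proof (rule ccontr)
      assume gt: "\<not> ?thesis"
      then have "3 \<le> card ?B" using arc_count_pos_card_ge_2[OF fA(1)] L(1)[OF i] by simp
      then obtain j where j: "j < m" "j \<noteq> i" "0 < copies ?B (M j)" "Suc (card (M j)) = card ?B"
        using below[OF i _ fA(2) _ _ M(2)] M(1)[OF i] by blast
      have "0 < copies ?A (L j)" using eq[OF i j(1)] j(3) by simp
      then have lt: "card (L j) < card ?A" using smaller[of L i j] j i fA(1) L(3) by metis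
      then have "card (M j) = card (L j)" using IH[OF j(1)] sim_card by auto
      then show False using lt gt j(4) by simp
    qed
    ultimately have cd: "card ?A = card ?B" by simp
    show ?case
    proof (cases "3 \<le> card ?A")
      case False
      then have "card ?A = 2" using arc_count_pos_card_ge_2[OF fA(1)] L(1)[OF i] by simp
      then show ?thesis using sim_single_edges[OF fA] L(1)[OF i] M(1)[OF i] cd by simp
    next
      case True
      \<comment> \<open>Copies of a type with fewer vertices than \<open>L i\<close> are
        automatically proper and have an edge, so on both sides the entry counts the whole class of
        this type.\<close>
      have same: "card {W \<in> {W. W \<subset> ?A \<and> arc_count W \<noteq> 0}. iso_type W = \<tau>} = card {W \<in> {W. W \<subset> ?B \<and> arc_count W \<noteq> 0}. iso_type W = \<tau>}"
        if j: "j < m" "card (L j) < card ?A" and \<tau>: "\<tau> = iso_type (L j)" for j \<tau>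
      proof -
        have jj: "sim (L j) (M j)" using IH[OF j] .
        have e: "{W \<in> {W. W \<subset> C \<and> arc_count W \<noteq> 0}. iso_type W = \<tau>} = {W. W \<subseteq> C \<and> sim W T}"
          if T: "sim (L j) T" and C: "card C = card ?A" for C T
        proof
          show "{W \<in> {W. W \<subset> C \<and> arc_count W \<noteq> 0}. iso_type W = \<tau>} \<subseteq> {W. W \<subseteq> C \<and> sim W T}"
            unfolding \<tau> iso_type_eq using T sim_trans by blast
          show "{W. W \<subseteq> C \<and> sim W T} \<subseteq> {W \<in> {W. W \<subset> C \<and> arc_count W \<noteq> 0}. iso_type W = \<tau>}"
          proof
            fix W assume "W \<in> {W. W \<subseteq> C \<and> sim W T}"
            then have W: "W \<subseteq> C" "sim W (L j)" using T sim_sym sim_trans by blast+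
            then have "W \<noteq> C" using sim_card[OF W(2)] C j(2) by auto
            then show "W \<in> {W \<in> {W. W \<subset> C \<and> arc_count W \<noteq> 0}. iso_type W = \<tau>}"
              unfolding \<tau> iso_type_eq using W sim_arc_count[OF W(2)] L(1)[OF j(1)] by auto
          qed
        qed
        show ?thesis using eq[OF i j(1)] unfolding copies_def e[OF sim_refl refl] e[OF jj cd[symmetric]] .
      qed
      have "matched (\<lambda>W W'. iso_type W = iso_type W') {W. W \<subset> ?A \<and> arc_count W \<noteq> 0} {W. W \<subset> ?B \<and> arc_count W \<noteq> 0}"
      proof (rule matched_by_class_card)
        show "finite {W. W \<subset> ?A \<and> arc_count W \<noteq> 0}" "finite {W. W \<subset> ?B \<and> arc_count W \<noteq> 0}" using finite_proper_subsets fA by auto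
        fix \<tau>
        show "card {W \<in> {W. W \<subset> ?A \<and> arc_count W \<noteq> 0}. iso_type W = \<tau>} = card {W \<in> {W. W \<subset> ?B \<and> arc_count W \<noteq> 0}. iso_type W = \<tau>}"
        proof (cases "{W \<in> {W. W \<subset> ?A \<and> arc_count W \<noteq> 0}. iso_type W = \<tau>} = {}")
          case False
          then obtain W where W: "W \<subset> ?A" "arc_count W \<noteq> 0" "iso_type W = \<tau>" by blast
          then obtain j where j: "j < m" "sim W (L j)" using L(2)[of W] L(1)[OF i] by blast
          have "card (L j) < card ?A" using psubset_card_mono[OF fA(1) W(1)] sim_card[OF j(2)] by simp
          then show ?thesis using same[OF j(1)] j(2) W(3) iso_type_eq by blast
        next
          case e: True
          show ?thesis
          proof (cases "{W \<in> {W. W \<subset> ?B \<and> arc_count W \<noteq> 0}. iso_type W = \<tau>} = {}")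
            case False
            then obtain W where W: "W \<subset> ?B" "arc_count W \<noteq> 0" "iso_type W = \<tau>" by blast
            then obtain j where j: "j < m" "sim W (M j)" using M(2)[of W] M(1)[OF i] by blast
            have "card (M j) < card ?B" using psubset_card_mono[OF fA(2) W(1)] sim_card[OF j(2)] by simp
            then have ij: "i \<noteq> j" by auto
            \<comment> \<open>A type inside \<open>M i\<close> has its counterpart inside
              \<open>L i\<close>, as the entries agree; being smaller than \<open>L i\<close>, it is
              identified by the induction hypothesis.\<close>
            have "0 < copies ?B (M j)" using copies_pos[OF fA(2)] W(1) j(2) by blast
            then have "0 < copies ?A (L j)" using eq[OF i j(1)] by simp
            then have lt: "card (L j) < card ?A" using smaller[of L i j] ij j i fA(1) L(3) by metis
            have "sim W (L j)" using sim_trans[OF j(2) sim_sym[OF IH[OF j(1) lt]]] .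
            then show ?thesis using same[OF j(1) lt] W(3) iso_type_eq by blast
          qed (simp only: e)
        qed
      qed
      then have "matched sim {W. W \<subset> ?A \<and> arc_count W \<noteq> 0} {W. W \<subset> ?B \<and> arc_count W \<noteq> 0}"
        by (rule matched_mono) (simp add: iso_type_eq)
      then have "hypomorphic ?A ?B" using hypomorphic_if_nonempty_matched[OF fA cd] by blast
      moreover have "?A \<inter> ?B = {}" using L(1)[OF i] M(1)[OF i] dj by blast
      moreover have "forest_on ?A" using forest_subset[OF F] L(1)[OF i] by blast
      ultimately show ?thesis using forest_reconstruction[OF inf _ _ fA(2) _ cd True] by blast
    qed
  qed
  \<comment> \<open>\<open>V\<close> is its own type \<open>L i\<close>. Since \<open>L k\<close>
    occurs in \<open>V\<close>, the type \<open>M k\<close> of \<open>V'\<close> occurs in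
    \<open>M i\<close>, and by size this leaves only \<open>M i = V'\<close>.\<close>
  obtain i where i: "i < m" "sim V (L i)" using L(2)[OF order_refl ne(1)] by blast
  obtain k where k: "k < m" "sim V' (M k)" using M(2)[OF order_refl ne(2)] by blast
  have "L i = V"
    using L(1)[OF i(1)] sim_card[OF i(2)] fin by (intro card_subset_eq) auto
  then have "0 < copies (L i) (L k)" using copies_pos[OF fin] L(1)[OF k(1)] sim_refl by blast
  then have "0 < copies (M i) (M k)" using eq[OF i(1) k(1)] by simp
  then obtain W where W: "W \<subseteq> M i" "sim W (M k)" using copies_pos[OF fL(2)[OF i(1)]] by blast
  have "card V' = card W" using sim_card[OF W(2)] sim_card[OF k(2)] by simp
  moreover have "W \<subseteq> V'" using W(1) M(1)[OF i(1)] by blast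
  ultimately have "W = V'" using fin' card_subset_eq by metis
  then have "M i = V'" using W(1) M(1)[OF i(1)] by blast
  then show ?thesis using main[OF i(1)] \<open>L i = V\<close> by simp
qed

end

section \<open>Induced subgraphs as vertex sets\<close>

definition ends_iso :: "('a, 'b) pre_digraph \<Rightarrow> ('c, 'd) pre_digraph \<Rightarrow> bool" where
  "ends_iso G H \<longleftrightarrow> (\<exists>g. bij_betw g (verts G) (verts H) \<and>
     (\<forall>x\<in>verts G. \<forall>y\<in>verts G. (x, y) \<in> arcs_ends G \<longleftrightarrow> (g x, g y) \<in> arcs_ends H))"

text \<open>Without parallel arcs an arc is determined by its ends, so a vertex bijection respecting
  adjacency extends to the arcs.\<close>

lemma digraph_iso_iff_ends_iso:
  fixes G :: "('a, 'b) pre_digraph" and H :: "('c, 'd) pre_digraph"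
  assumes "wf_digraph G" "nomulti_digraph G" "wf_digraph H" "nomulti_digraph H"
  shows "digraph_iso G H \<longleftrightarrow> ends_iso G H"
proof
  interpret G: nomulti_digraph G by fact
  interpret H: nomulti_digraph H by fact
  assume "digraph_iso G H"
  then obtain f where f: "pre_digraph.digraph_isomorphism G f" "H = app_iso f G" unfolding digraph_iso_def by blast
  have inj: "inj_on (iso_verts f) (verts G)" using f(1) G.digraph_isomorphism_inj_on_verts by blast
  have "(x, y) \<in> arcs_ends G \<longleftrightarrow> (iso_verts f x, iso_verts f y) \<in> arcs_ends H" if xy: "x \<in> verts G" "y \<in> verts G" for x y
  proof
    assume "(iso_verts f x, iso_verts f y) \<in> arcs_ends H"
    then obtain a b where ab: "(a, b) \<in> arcs_ends G" "iso_verts f x = iso_verts f a" "iso_verts f y = iso_verts f b"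
      unfolding f(2) G.arcs_ends_app_iso_eq[OF f(1)] by auto
    then have "a \<in> verts G" "b \<in> verts G" using G.adj_in_verts by auto
    then have "x = a" "y = b" using ab xy inj by (auto dest: inj_onD)
    then show "(x, y) \<in> arcs_ends G" using ab by simp
  qed (auto simp: f(2) G.arcs_ends_app_iso_eq[OF f(1)])
  moreover have "bij_betw (iso_verts f) (verts G) (verts H)" unfolding bij_betw_def f(2) using inj by simp
  ultimately show "ends_iso G H" unfolding ends_iso_def by blast
next
  interpret G: nomulti_digraph G by fact
  interpret H: nomulti_digraph H by fact
  assume "ends_iso G H"
  then obtain g where g: "bij_betw g (verts G) (verts H)"
    "\<And>x y. x \<in> verts G \<Longrightarrow> y \<in> verts G \<Longrightarrow> (x, y) \<in> arcs_ends G \<longleftrightarrow> (g x, g y) \<in> arcs_ends H"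
    unfolding ends_iso_def by blast
  have inj: "inj_on g (verts G)" and im: "g ` verts G = verts H" using g(1) unfolding bij_betw_def by auto
  define k where "k a = (SOME b. b \<in> arcs H \<and> tail H b = g (tail G a) \<and> head H b = g (head G a))" for a
  have k: "k a \<in> arcs H \<and> tail H (k a) = g (tail G a) \<and> head H (k a) = g (head G a)" if a: "a \<in> arcs G" for a
  proof -
    have "(tail G a, head G a) \<in> arcs_ends G" unfolding arcs_ends_conv using a by blast
    then have "(g (tail G a), g (head G a)) \<in> arcs_ends H" using g(2) a by simp
    then obtain b where "b \<in> arcs H \<and> tail H b = g (tail G a) \<and> head H b = g (head G a)"
      unfolding arcs_ends_conv by auto
    then show ?thesis unfolding k_def by (rule someI)
  qed
  have kinj: "inj_on k (arcs G)"
  proof (rule inj_onI)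
    fix a b assume ab: "a \<in> arcs G" "b \<in> arcs G" "k a = k b"
    then have "g (tail G a) = g (tail G b)" "g (head G a) = g (head G b)" using k by metis+
    then have "tail G a = tail G b" "head G a = head G b" using ab inj by (auto dest: inj_onD)
    then show "a = b" using G.no_multi_arcs[OF ab(1,2)] by (simp add: arc_to_ends_def)
  qed
  have kim: "k ` arcs G = arcs H"
  proof
    show "arcs H \<subseteq> k ` arcs G"
    proof
      fix b assume b: "b \<in> arcs H"
      then have "tail H b \<in> g ` verts G" "head H b \<in> g ` verts G" unfolding im by auto
      then obtain x y where xy: "x \<in> verts G" "y \<in> verts G" "tail H b = g x" "head H b = g y" by blast
      have "(g x, g y) \<in> arcs_ends H" unfolding arcs_ends_conv using b xy by (auto intro!: image_eqI[of _ _ b])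
      then have "(x, y) \<in> arcs_ends G" using g(2) xy by blast
      then obtain a where a: "a \<in> arcs G" "tail G a = x" "head G a = y" unfolding arcs_ends_conv by auto
      have "k a = b" using k[OF a(1)] H.no_multi_arcs[of "k a" b] b xy a by (simp add: arc_to_ends_def)
      then show "b \<in> k ` arcs G" using a by blast
    qed
  qed (use k in auto)
  \<comment> \<open>Tail and head are those of \<open>H\<close> as functions, so that applying the
    isomorphism yields \<open>H\<close> itself and not merely a graph agreeing with it on its
    arcs.\<close>
  define f where "f = \<lparr>iso_verts = g, iso_arcs = k, iso_head = head H, iso_tail = tail H\<rparr>"
  have "pre_digraph.digraph_isomorphism G f"
    unfolding pre_digraph.digraph_isomorphism_def f_def using assms(1) inj kinj k by simp
  moreover have "H = app_iso f G" unfolding app_iso_def f_def using im kim by simp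
  ultimately show "digraph_iso G H" unfolding digraph_iso_def by blast
qed

lemma induced_subgraphD:
  assumes "induced_subgraph K G"
  shows "wf_digraph K" "verts K \<subseteq> verts G" "tail K = tail G" "head K = head G"
    "arcs K = {e \<in> arcs G. tail G e \<in> verts K \<and> head G e \<in> verts K}"
    "\<And>x y. x \<in> verts K \<Longrightarrow> y \<in> verts K \<Longrightarrow> (x, y) \<in> arcs_ends K \<longleftrightarrow> (x, y) \<in> arcs_ends G"
proof -
  show b: "wf_digraph K" "verts K \<subseteq> verts G" "tail K = tail G" "head K = head G"
    "arcs K = {e \<in> arcs G. tail G e \<in> verts K \<and> head G e \<in> verts K}"
    using assms unfolding induced_subgraph_def subgraph_def compatible_def by auto
  show "(x, y) \<in> arcs_ends K \<longleftrightarrow> (x, y) \<in> arcs_ends G" if "x \<in> verts K" "y \<in> verts K" for x y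
    unfolding arcs_ends_conv b(3,4) using that by (auto simp: b(5))
qed

lemma induced_subgraph_nomulti:
  assumes "induced_subgraph K G" "nomulti_digraph G" shows "nomulti_digraph K"
proof -
  note D = induced_subgraphD[OF assms(1)]
  interpret K: wf_digraph K by (rule D(1))
  interpret G: nomulti_digraph G by fact
  show ?thesis
  proof
    fix a b assume "a \<in> arcs K" "b \<in> arcs K" "arc_to_ends K a = arc_to_ends K b"
    then show "a = b" using G.no_multi_arcs[of a b] D(3-5) by (simp add: arc_to_ends_def)
  qed
qed

text \<open>Tail and head are inherited from \<open>G\<close> as whole functions, so the vertex set
  determines the record. The cardinality in \<open>num_induced\<close> is thus a number of vertex
  sets.\<close>

lemma induced_subgraph_cong:
  assumes "induced_subgraph K G" "induced_subgraph K' G" "verts K = verts K'" shows "K = K'"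
  using induced_subgraphD[OF assms(1)] induced_subgraphD[OF assms(2)] assms(3)
  by (intro pre_digraph.equality) auto

lemma induced_subgraph_transitive:
  assumes "induced_subgraph K L" "induced_subgraph L G" shows "induced_subgraph K G"
  using assms unfolding induced_subgraph_def subgraph_def compatible_def by auto

lemma induced_subgraph_of_larger:
  assumes "induced_subgraph K G" "induced_subgraph L G" "verts K \<subseteq> verts L" shows "induced_subgraph K L"
  using assms unfolding induced_subgraph_def subgraph_def compatible_def by auto

text \<open>Both graphs are encoded in a common relation, so that isomorphism relates vertex sets of one graph.\<close>

locale graph_encoding = sgraph E for E :: "'v \<Rightarrow> 'v \<Rightarrow> bool" +
  fixes e :: "'a \<Rightarrow> 'v" and G :: "('a, 'b) pre_digraph"
  assumes graph: "graph G" and inj: "inj_on e (verts G)"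
    and enc: "\<And>x y. x \<in> verts G \<Longrightarrow> y \<in> verts G \<Longrightarrow> E (e x) (e y) \<longleftrightarrow> (x, y) \<in> arcs_ends G"
begin

sublocale G: graph G by (rule graph)

definition vs :: "('a, 'b) pre_digraph \<Rightarrow> 'v set" where
  "vs K = e ` verts K"

lemma vs_finite: "induced_subgraph K G \<Longrightarrow> finite (vs K)"
  unfolding vs_def using finite_subset[OF induced_subgraphD(2) G.finite_verts] by (rule finite_imageI)

lemma vs_subset: "induced_subgraph K G \<Longrightarrow> vs K \<subseteq> vs G"
  unfolding vs_def using induced_subgraphD(2) by blast

lemma induced_self: "induced_subgraph G G"
  unfolding induced_subgraph_def subgraph_def compatible_def using G.wf_digraph by auto

lemma vs_edge:
  assumes "induced_subgraph K G" "x \<in> verts K" "y \<in> verts K"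
  shows "E (e x) (e y) \<longleftrightarrow> (x, y) \<in> arcs_ends K"
proof -
  have "x \<in> verts G" "y \<in> verts G" using induced_subgraphD(2)[OF assms(1)] assms(2,3) by auto
  then show ?thesis using enc induced_subgraphD(6)[OF assms] by simp
qed

lemma vs_arc_count:
  assumes K: "induced_subgraph K G" shows "arc_count (vs K) \<noteq> 0 \<longleftrightarrow> arcs K \<noteq> {}"
proof -
  interpret K: wf_digraph K by (rule induced_subgraphD(1)[OF K])
  have "arc_count (vs K) \<noteq> 0 \<longleftrightarrow> (\<exists>x\<in>verts K. \<exists>y\<in>verts K. (x, y) \<in> arcs_ends K)"
    unfolding arc_count_zero[OF vs_finite[OF K]] using vs_edge[OF K] unfolding vs_def by auto
  also have "\<dots> \<longleftrightarrow> arcs K \<noteq> {}"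
  proof
    assume "arcs K \<noteq> {}"
    then obtain a where a: "a \<in> arcs K" by blast
    then have "(tail K a, head K a) \<in> arcs_ends K" unfolding arcs_ends_conv by simp
    then show "\<exists>x\<in>verts K. \<exists>y\<in>verts K. (x, y) \<in> arcs_ends K"
      using K.tail_in_verts[OF a] K.head_in_verts[OF a] by (intro bexI)
  qed (unfold arcs_ends_conv, blast)
  finally show ?thesis .
qed

lemma induced_of_subset:
  assumes "W \<subseteq> vs G" obtains K where "induced_subgraph K G" "vs K = W"
proof -
  let ?S = "{x \<in> verts G. e x \<in> W}"
  have "induced_subgraph (G \<restriction> ?S) G" by (rule G.induced_induce) auto
  moreover have "vs (G \<restriction> ?S) = W" unfolding vs_def using assms by (auto simp: vs_def)
  ultimately show thesis using that by blast
qed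

lemma vs_inj: "induced_subgraph K G \<Longrightarrow> induced_subgraph K' G \<Longrightarrow> vs K = vs K' \<Longrightarrow> K = K'"
  unfolding vs_def using inj_on_image_eq_iff[OF inj] induced_subgraphD(2) induced_subgraph_cong by metis

lemma vs_subset_iff:
  assumes "induced_subgraph K G" "induced_subgraph L G"
  shows "vs K \<subseteq> vs L \<longleftrightarrow> verts K \<subseteq> verts L"
proof
  assume s: "vs K \<subseteq> vs L"
  show "verts K \<subseteq> verts L"
  proof
    fix x assume "x \<in> verts K"
    then have "x \<in> verts G" "e x \<in> e ` verts L"
      using s induced_subgraphD(2)[OF assms(1)] unfolding vs_def by auto
    then show "x \<in> verts L" using inj_on_image_mem_iff[OF inj _ induced_subgraphD(2)[OF assms(2)]] by simp
  qed
qed (unfold vs_def, rule image_mono)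

end

text \<open>Conjugation with the two encodings. As both use the same relation \<open>E\<close>,
  subgraphs of different graphs are compared by the one relation \<open>sim\<close>.\<close>

lemma ends_iso_iff_sim:
  assumes "graph_encoding E e G" "graph_encoding E e' G'" and K: "induced_subgraph K G" and K': "induced_subgraph K' G'"
  shows "digraph_iso K K' \<longleftrightarrow> sgraph.sim E (graph_encoding.vs e K) (graph_encoding.vs e' K')"
proof -
  interpret A: graph_encoding E e G by fact
  interpret B: graph_encoding E e' G' by fact
  have nm: "nomulti_digraph K" "nomulti_digraph K'"
    using induced_subgraph_nomulti[OF K A.G.nomulti_digraph_axioms]
      induced_subgraph_nomulti[OF K' B.G.nomulti_digraph_axioms] .
  have i: "inj_on e (verts K)" "inj_on e' (verts K')"
    using inj_on_subset[OF A.inj induced_subgraphD(2)[OF K]] inj_on_subset[OF B.inj induced_subgraphD(2)[OF K']] .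
  have "digraph_iso K K' \<longleftrightarrow> ends_iso K K'"
    by (rule digraph_iso_iff_ends_iso) (fact nm induced_subgraphD(1)[OF K] induced_subgraphD(1)[OF K'])+
  also have "\<dots> \<longleftrightarrow> A.sim (A.vs K) (B.vs K')"
  proof
    assume "ends_iso K K'"
    then obtain g where g: "bij_betw g (verts K) (verts K')"
      "\<And>x y. x \<in> verts K \<Longrightarrow> y \<in> verts K \<Longrightarrow> (x, y) \<in> arcs_ends K \<longleftrightarrow> (g x, g y) \<in> arcs_ends K'"
      unfolding ends_iso_def by blast
    let ?f = "e' \<circ> g \<circ> the_inv_into (verts K) e"
    have inv: "the_inv_into (verts K) e (e x) = x" if "x \<in> verts K" for x using the_inv_into_f_f[OF i(1) that] .
    have "bij_betw (the_inv_into (verts K) e) (A.vs K) (verts K)" unfolding A.vs_def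
      using i(1) by (simp add: bij_betw_the_inv_into inj_on_imp_bij_betw)
    moreover have "bij_betw e' (verts K') (B.vs K')" unfolding B.vs_def using i(2) by (rule inj_on_imp_bij_betw)
    ultimately have "bij_betw ?f (A.vs K) (B.vs K')" using g(1) by (meson bij_betw_trans)
    moreover have "E u v \<longleftrightarrow> E (?f u) (?f v)" if uv: "u \<in> A.vs K" "v \<in> A.vs K" for u v
    proof -
      obtain x y where xy: "x \<in> verts K" "y \<in> verts K" "u = e x" "v = e y" using uv unfolding A.vs_def by blast
      have "g x \<in> verts K'" "g y \<in> verts K'" using g(1) xy bij_betwE by blast+
      then show ?thesis using A.vs_edge[OF K xy(1,2)] B.vs_edge[OF K', of "g x" "g y"] g(2)[OF xy(1,2)] xy inv by simp
    qed
    ultimately show "A.sim (A.vs K) (B.vs K')" unfolding A.sim_def A.iso_def by blast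
  next
    assume "A.sim (A.vs K) (B.vs K')"
    then obtain f where f: "A.iso f (A.vs K) (B.vs K')" unfolding A.sim_def by blast
    let ?g = "the_inv_into (verts K') e' \<circ> f \<circ> e"
    have fe: "f (e x) \<in> e' ` verts K'" if "x \<in> verts K" for x
      using A.iso_image[OF f] that unfolding A.vs_def B.vs_def by blast
    have inv: "e' (?g x) = f (e x)" if "x \<in> verts K" for x using f_the_inv_into_f[OF i(2) fe[OF that]] by simp
    have "bij_betw (the_inv_into (verts K') e') (B.vs K') (verts K')" unfolding B.vs_def
      using i(2) by (simp add: bij_betw_the_inv_into inj_on_imp_bij_betw)
    moreover have "bij_betw e (verts K) (A.vs K)" unfolding A.vs_def using i(1) by (rule inj_on_imp_bij_betw)
    moreover have "bij_betw f (A.vs K) (B.vs K')" using f unfolding A.iso_def by blast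
    ultimately have b: "bij_betw ?g (verts K) (verts K')" by (meson bij_betw_trans)
    moreover have "(x, y) \<in> arcs_ends K \<longleftrightarrow> (?g x, ?g y) \<in> arcs_ends K'" if xy: "x \<in> verts K" "y \<in> verts K" for x y
    proof -
      have "?g x \<in> verts K'" "?g y \<in> verts K'" using b xy bij_betwE by blast+
      then have "(?g x, ?g y) \<in> arcs_ends K' \<longleftrightarrow> E (f (e x)) (f (e y))"
        using B.vs_edge[OF K', of "?g x" "?g y"] inv xy by metis
      also have "\<dots> \<longleftrightarrow> E (e x) (e y)" using A.iso_edge[OF f] xy unfolding A.vs_def by blast
      finally show ?thesis using A.vs_edge[OF K xy] by simp
    qed
    ultimately show "ends_iso K K'" unfolding ends_iso_def by blast
  qed
  finally show ?thesis .
qed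

section \<open>Matrix entries and acyclicity in the encoding\<close>

context graph_encoding begin

lemma num_induced_copies:
  assumes K: "induced_subgraph K G" and T: "induced_subgraph T G"
  shows "num_induced K T = copies (vs K) (vs T)"
proof -
  have ge: "graph_encoding E e G" by unfold_locales
  have "bij_betw vs {L. induced_subgraph L K \<and> digraph_iso L T} {W. W \<subseteq> vs K \<and> sim W (vs T)}"
    unfolding bij_betw_def
  proof
    show "inj_on vs {L. induced_subgraph L K \<and> digraph_iso L T}"
      by (rule inj_onI) (use vs_inj induced_subgraph_transitive K in blast)
    show "vs ` {L. induced_subgraph L K \<and> digraph_iso L T} = {W. W \<subseteq> vs K \<and> sim W (vs T)}"
    proof
      show "vs ` {L. induced_subgraph L K \<and> digraph_iso L T} \<subseteq> {W. W \<subseteq> vs K \<and> sim W (vs T)}"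
      proof (rule image_subsetI)
        fix L assume L: "L \<in> {L. induced_subgraph L K \<and> digraph_iso L T}"
        then have LG: "induced_subgraph L G" using induced_subgraph_transitive K by blast
        have "vs L \<subseteq> vs K" using vs_subset_iff[OF LG K] induced_subgraphD(2)[of L K] L by blast
        then show "vs L \<in> {W. W \<subseteq> vs K \<and> sim W (vs T)}" using ends_iso_iff_sim[OF ge ge LG T] L by blast
      qed
      show "{W. W \<subseteq> vs K \<and> sim W (vs T)} \<subseteq> vs ` {L. induced_subgraph L K \<and> digraph_iso L T}"
      proof
        fix W assume W: "W \<in> {W. W \<subseteq> vs K \<and> sim W (vs T)}"
        then have "W \<subseteq> vs G" using vs_subset[OF K] by blast
        then obtain L where L: "induced_subgraph L G" "vs L = W" by (rule induced_of_subset)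
        have "induced_subgraph L K" using induced_subgraph_of_larger[OF L(1) K] vs_subset_iff[OF L(1) K] L(2) W by blast
        moreover have "digraph_iso L T" using ends_iso_iff_sim[OF ge ge L(1) T] L(2) W by blast
        ultimately show "W \<in> vs ` {L. induced_subgraph L K \<and> digraph_iso L T}" using L(2) by blast
      qed
    qed
  qed
  then show ?thesis unfolding num_induced_def copies_def by (rule bij_betw_same_card)
qed

text \<open>Cycles of the library are lists of arcs, so a list of successively adjacent vertices has
  to be turned into a walk of arcs.\<close>

lemma ex_awalk:
  assumes "xs \<noteq> []" "set xs \<subseteq> verts G" "successively (\<lambda>x y. (x, y) \<in> arcs_ends G) xs"
  shows "\<exists>p. G.awalk (hd xs) p (last xs) \<and> G.awalk_verts (hd xs) p = xs"
  using assms
proof (induction xs)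
  case (Cons x xs)
  show ?case
  proof (cases "xs = []")
    case True
    then show ?thesis using Cons.prems by (intro exI[of _ "[]"]) (auto simp: G.awalk_def)
  next
    case False
    then obtain p where p: "G.awalk (hd xs) p (last xs)" "G.awalk_verts (hd xs) p = xs"
      using Cons by (auto simp: successively_Cons)
    have "(x, hd xs) \<in> arcs_ends G" using Cons.prems False by (auto simp: successively_Cons)
    then obtain a where a: "a \<in> arcs G" "tail G a = x" "head G a = hd xs" unfolding arcs_ends_conv by auto
    then show ?thesis using p False Cons.prems by (intro exI[of _ "a # p"]) (auto simp: G.awalk_def)
  qed
qed simp

text \<open>A path in \<open>X\<close> between two neighbours of \<open>c\<close> is closed by
  \<open>c\<close> to a cycle. Its ends differ, so it has at least two vertices and the cycle has
  length at least 3.\<close>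

lemma forest_on_if_ugraph_forest:
  assumes "ugraph_forest G" shows "forest_on (vs G)"
  unfolding forest_on_def
proof (intro conjI allI impI)
  show "finite (vs G)" using vs_finite[OF induced_self] .
  fix X c x y
  assume X: "X \<subseteq> vs G" "conn X" "c \<in> vs G - X" and xy: "x \<in> X" "y \<in> X" "E c x" "E c y"
  show "x = y"
  proof (rule ccontr)
    assume ne: "x \<noteq> y"
    obtain xs where xs: "path xs" "xs \<noteq> []" "hd xs = x" "last xs = y" "set xs \<subseteq> X"
      using conn_ex_path[OF X(2) xy(1,2)] by blast
    define i where "i = the_inv_into (verts G) e"
    have i: "e (i u) = u" "i u \<in> verts G" if "u \<in> vs G" for u
      using that f_the_inv_into_f[OF inj] the_inv_into_into[OF inj] unfolding vs_def i_def by auto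
    have iE: "(i u, i v) \<in> arcs_ends G" if "E u v" "u \<in> vs G" "v \<in> vs G" for u v
      using that enc i by metis
    let ?zs = "c # xs @ [c]"
    have zV: "set ?zs \<subseteq> vs G" using X xs by auto
    have sE: "successively E ?zs"
      using xs xy E_sym[OF xy(4)] by (auto simp: successively_Cons successively_append_iff path_def)
    have "successively (\<lambda>u v. (i u, i v) \<in> arcs_ends G) ?zs"
      by (rule successively_mono[OF sE]) (use iE zV in blast)
    then have "successively (\<lambda>x y. (x, y) \<in> arcs_ends G) (map i ?zs)" by (simp only: successively_map)
    moreover have "set (map i ?zs) \<subseteq> verts G" using zV i(2) by auto
    ultimately obtain p where p: "G.awalk (i c) p (i c)" "G.awalk_verts (i c) p = map i ?zs"
      using ex_awalk[of "map i ?zs"] by auto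
    have injz: "inj_on i (set (xs @ [c]))" by (rule inj_on_inverseI[of _ e]) (use i zV in auto)
    have "distinct (xs @ [c])" using xs(1,5) X(3) path_distinct by auto
    then have "distinct (map i (xs @ [c]))" using injz by (simp only: distinct_map)
    then have "distinct (tl (G.awalk_verts (i c) p))" unfolding p(2) by simp
    moreover have "length xs \<ge> 2" using xs ne by (cases xs; cases "tl xs") auto
    moreover have "length p + 1 = length (map i ?zs)" using G.length_awalk_verts[of "i c" p] p(2) by simp
    ultimately have "G.cycle p \<and> length p \<ge> 3" unfolding G.cycle_def using p(1) by auto
    then show False using assms unfolding ugraph_forest_def by blast
  qed
qed

end

text \<open>Vertices of \<open>G\<close> become even numbers and those of \<open>H\<close> odd ones.
  The infinite type leaves room for the new vertices of the subdivision.\<close>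

lemma disjoint_encodings_exist:
  fixes G :: "('a, 'b) pre_digraph" and H :: "('c, 'd) pre_digraph"
  assumes "graph G" "graph H"
  obtains E :: "nat \<Rightarrow> nat \<Rightarrow> bool" and e e' where "graph_encoding E e G" "graph_encoding E e' H" "e ` verts G \<inter> e' ` verts H = {}"
proof -
  interpret G: graph G by fact
  interpret H: graph H by fact
  obtain f :: "'a \<Rightarrow> nat" where f: "inj_on f (verts G)" using finite_imp_inj_to_nat_seg[OF G.finite_verts] by blast
  obtain f' :: "'c \<Rightarrow> nat" where f': "inj_on f' (verts H)" using finite_imp_inj_to_nat_seg[OF H.finite_verts] by blast
  define e e' where "e x = 2 * f x" and "e' y = Suc (2 * f' y)" for x y
  define E where "E u v \<longleftrightarrow> (\<exists>a\<in>arcs G. u = e (tail G a) \<and> v = e (head G a)) \<or> (\<exists>a\<in>arcs H. u = e' (tail H a) \<and> v = e' (head H a))" for u v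
  have inj: "inj_on e (verts G)" "inj_on e' (verts H)" using f f' unfolding e_def e'_def inj_on_def by auto
  have dj: "e x \<noteq> e' y" for x y unfolding e_def e'_def by presburger
  have "sgraph E"
  proof
    show "E v u" if "E u v" for u v
      using that G.sym_arcs H.sym_arcs unfolding E_def symmetric_conv by metis
    show "\<not> E u u" for u
    proof
      assume "E u u"
      then consider a where "a \<in> arcs G" "e (tail G a) = e (head G a)" | a where "a \<in> arcs H" "e' (tail H a) = e' (head H a)"
        unfolding E_def by metis
      then show False
      proof cases
        case 1 then show False using inj_on_eq_iff[OF inj(1)] G.no_loops G.wellformed by metis
      next
        case 2 then show False using inj_on_eq_iff[OF inj(2)] H.no_loops H.wellformed by metis
      qed
    qed
  qed
  moreover have "E (e x) (e y) \<longleftrightarrow> (x, y) \<in> arcs_ends G" if "x \<in> verts G" "y \<in> verts G" for x y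
  proof -
    have "E (e x) (e y) \<longleftrightarrow> (\<exists>a\<in>arcs G. e x = e (tail G a) \<and> e y = e (head G a))"
      unfolding E_def using dj by simp
    also have "\<dots> \<longleftrightarrow> (\<exists>a\<in>arcs G. x = tail G a \<and> y = head G a)"
      using that inj_on_eq_iff[OF inj(1)] by (intro bex_cong) auto
    finally show ?thesis unfolding arcs_ends_conv by auto
  qed
  moreover have "E (e' x) (e' y) \<longleftrightarrow> (x, y) \<in> arcs_ends H" if "x \<in> verts H" "y \<in> verts H" for x y
  proof -
    have "E (e' x) (e' y) \<longleftrightarrow> (\<exists>a\<in>arcs H. e' x = e' (tail H a) \<and> e' y = e' (head H a))"
      unfolding E_def using dj[symmetric] by simp
    also have "\<dots> \<longleftrightarrow> (\<exists>a\<in>arcs H. x = tail H a \<and> y = head H a)"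
      using that inj_on_eq_iff[OF inj(2)] by (intro bex_cong) auto
    finally show ?thesis unfolding arcs_ends_conv by auto
  qed
  ultimately have "graph_encoding E e G" "graph_encoding E e' H"
    using assms inj unfolding graph_encoding_def graph_encoding_axioms_def by auto
  moreover have "e ` verts G \<inter> e' ` verts H = {}" using dj by blast
  ultimately show thesis using that by blast
qed

text \<open>The permutation relating the matrices is absorbed into the listing of the types of
  \<open>H\<close>, after which both listings share their indices.\<close>

lemma digraph_iso_if_same_N_matrix:
  fixes G :: "('a, 'b) pre_digraph" and H :: "('c, 'd) pre_digraph"
  assumes F: "ugraph_forest G" and ne: "arcs G \<noteq> {}" and H: "graph H" "arcs H \<noteq> {}" and N: "same_N_matrix H G"
  shows "digraph_iso H G"
proof -
  have gG: "graph G" using F unfolding ugraph_forest_def by blast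
  obtain E :: "nat \<Rightarrow> nat \<Rightarrow> bool" and e e' where enc: "graph_encoding E e G" "graph_encoding E e' H"
    "e ` verts G \<inter> e' ` verts H = {}" by (rule disjoint_encodings_exist[OF gG H(1)])
  interpret A: graph_encoding E e G by fact
  interpret B: graph_encoding E e' H by fact
  obtain LH LG n p where LH: "enumerates_types H LH" and LG: "enumerates_types G LG"
    and c: "count_matrix LH \<in> carrier_mat n n" "count_matrix LG \<in> carrier_mat n n" and p: "p permutes {..<n}"
    and eq: "\<forall>i<n. \<forall>j<n. count_matrix LG $$ (i, j) = count_matrix LH $$ (p i, p j)"
    using N unfolding same_N_matrix_def is_N_matrix_def perm_equal_def by blast
  have len: "length LH = n" "length LG = n" using c unfolding count_matrix_def by auto
  have pn: "p i < n" if "i < n" for i using permutes_in_image[OF p, of i] that by simp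
  have LGi: "induced_subgraph (LG ! i) G \<and> arcs (LG ! i) \<noteq> {}" if "i < n" for i
    using LG that len unfolding enumerates_types_def by auto
  have LHi: "induced_subgraph (LH ! i) H \<and> arcs (LH ! i) \<noteq> {}" if "i < n" for i
    using LH that len unfolding enumerates_types_def by auto
  have "A.sim (A.vs G) (B.vs H)"
  proof (rule A.reconstruction_from_copies[where m = n and L = "\<lambda>i. A.vs (LG ! i)" and M = "\<lambda>i. B.vs (LH ! p i)"])
    show "infinite (UNIV :: nat set)" by simp
    show "A.vs G \<inter> B.vs H = {}" using enc(3) unfolding A.vs_def B.vs_def .
    show "A.forest_on (A.vs G)" using A.forest_on_if_ugraph_forest[OF F] .
    show "finite (B.vs H)" using B.vs_finite[OF B.induced_self] .
    show "A.arc_count (A.vs G) \<noteq> 0" using A.vs_arc_count[OF A.induced_self] ne by blast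
    show "A.arc_count (B.vs H) \<noteq> 0" using B.vs_arc_count[OF B.induced_self] H(2) by blast
    show "A.vs (LG ! i) \<subseteq> A.vs G \<and> A.arc_count (A.vs (LG ! i)) \<noteq> 0" if "i < n" for i
      using LGi[OF that] A.vs_subset A.vs_arc_count by blast
    show "B.vs (LH ! p i) \<subseteq> B.vs H \<and> A.arc_count (B.vs (LH ! p i)) \<noteq> 0" if "i < n" for i
      using LHi[OF pn[OF that]] B.vs_subset B.vs_arc_count by blast
    show "\<exists>i<n. A.sim W (A.vs (LG ! i))" if W: "W \<subseteq> A.vs G" "A.arc_count W \<noteq> 0" for W
    proof -
      obtain K where K: "induced_subgraph K G" "A.vs K = W" using W(1) by (rule A.induced_of_subset)
      then have "arcs K \<noteq> {}" using A.vs_arc_count[OF K(1)] W(2) by simp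
      then obtain L where L: "L \<in> set LG" "digraph_iso K L" using LG K(1) unfolding enumerates_types_def by blast
      then obtain i where i: "i < n" "L = LG ! i" using len by (metis in_set_conv_nth)
      then show ?thesis using ends_iso_iff_sim[OF enc(1,1) K(1)] LGi[OF i(1)] L(2) K(2) by blast
    qed
    show "\<exists>i<n. A.sim W (B.vs (LH ! p i))" if W: "W \<subseteq> B.vs H" "A.arc_count W \<noteq> 0" for W
    proof -
      obtain K where K: "induced_subgraph K H" "B.vs K = W" using W(1) by (rule B.induced_of_subset)
      then have "arcs K \<noteq> {}" using B.vs_arc_count[OF K(1)] W(2) by simp
      then obtain L where L: "L \<in> set LH" "digraph_iso K L" using LH K(1) unfolding enumerates_types_def by blast
      then obtain k where k: "k < n" "L = LH ! k" using len by (metis in_set_conv_nth)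
      have "k \<in> p ` {..<n}" using permutes_image[OF p] k(1) by simp
      then obtain i where i: "i < n" "k = p i" by blast
      then show ?thesis using ends_iso_iff_sim[OF enc(2,2) K(1)] LHi[OF k(1)] L(2) K(2) k(2) by blast
    qed
    show "i = j" if ij: "i < n" "j < n" "A.sim (A.vs (LG ! i)) (A.vs (LG ! j))" for i j
    proof -
      have "digraph_iso (LG ! i) (LG ! j)"
        using ends_iso_iff_sim[OF enc(1,1), of "LG ! i" "LG ! j"] LGi[OF ij(1)] LGi[OF ij(2)] ij(3) by simp
      then show ?thesis using LG ij(1,2) unfolding enumerates_types_def len(2) by simp
    qed
    show "i = j" if ij: "i < n" "j < n" "A.sim (B.vs (LH ! p i)) (B.vs (LH ! p j))" for i j
    proof -
      have "digraph_iso (LH ! p i) (LH ! p j)" using ends_iso_iff_sim[OF enc(2,2)] LHi pn ij by blast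
      then have "p i = p j" using LH ij len pn unfolding enumerates_types_def by blast
      then show ?thesis using permutes_inj[OF p] by (simp add: inj_eq)
    qed
    show "A.copies (A.vs (LG ! i)) (A.vs (LG ! j)) = A.copies (B.vs (LH ! p i)) (B.vs (LH ! p j))"
      if ij: "i < n" "j < n" for i j
    proof -
      have "count_matrix LG $$ (i, j) = num_induced (LG ! i) (LG ! j)"
        using ij len unfolding count_matrix_def by simp
      moreover have "count_matrix LH $$ (p i, p j) = num_induced (LH ! p i) (LH ! p j)"
        using pn ij len unfolding count_matrix_def by simp
      ultimately show ?thesis
        using eq ij A.num_induced_copies LGi B.num_induced_copies LHi pn by metis
    qed
  qed
  then have "A.sim (B.vs H) (A.vs G)" by (rule A.sim_sym)
  then show ?thesis using ends_iso_iff_sim[OF enc(2,1) B.induced_self A.induced_self] by blast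
qed

theorem theorem2p14:
  fixes G :: "('a, 'b) pre_digraph"
  assumes "ugraph_tree G \<or> ugraph_forest G"
    and "arcs G \<noteq> {}"
  shows "N_matrix_reconstructible TYPE(('c, 'd) pre_digraph) G"
proof -
  have F: "ugraph_forest G" using assms(1) unfolding ugraph_tree_def by blast
  then have "graph G" unfolding ugraph_forest_def by blast
  then show ?thesis
    unfolding N_matrix_reconstructible_def using assms(2) digraph_iso_if_same_N_matrix[OF F assms(2)] by blast
qed

end
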